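(* Let $\alpha>-1$, set $$\sigma_\alpha=\min\{1,1+\alpha\},\qquad p_\alpha=1+\frac2{\sigma_\alpha},\qquad Q_\alpha=p_\alpha+1,$$ and let $\mu\in\mathbb R$. There is $\varepsilon_{\alpha,\mu}>0$ with the following property. If $u_0\in\ell^2(\mathbb N_0)$ and $\|u_0\|_{\ell^2}\le\varepsilon_{\alpha,\mu}$, then $$i\partial_tu=H_\alpha u+\mu|u|^{p_\alpha-1}u,\qquad u(0)=u_0,$$ has a unique global mild solution $u$ in $C(\mathbb R;\ell^2)\cap L^{Q_\alpha}(\mathbb R;\ell^{Q_\alpha})$. Moreover, there are $u_\pm\in\ell^2$ such that $$\|u(t)-e^{-itH_\alpha}u_\pm\|_{\ell^2}\to0\qquad(t\to\pm\infty).$$ For every $\mu_0\ge0$, there is an $\varepsilon(\mu_0)>0$, independent of $\alpha\ge0$ and of $\mu$ with $|\mu|\le\mu_0$, for which the same conclusion holds whenever $\|u_0\|_{\ell^2}\le\varepsilon(\mu_0)$.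
   Context: For $\alpha>-1$, the discrete Laguerre operator $H_\alpha$ is the self-adjoint Jacobi operator on $\ell^2(\mathbb N_0)$ (with its maximal domain) associated with $$(H_\alpha u)_n=\sqrt{n(n+\alpha)}\,u_{n-1}+(2n+1+\alpha)u_n+\sqrt{(n+1)(n+1+\alpha)}\,u_{n+1},\quad u_{-1}=0.$$ $\ell^r=\ell^r(\mathbb N_0)$ (complex sequences). The nonlinearity $|u|^{p-1}u$ acts componentwise. A mild solution is a solution of the Duhamel equation $$u(t)=e^{-itH_\alpha}u_0-i\mu\int_0^te^{-i(t-s)H_\alpha}|u(s)|^{p_\alpha-1}u(s)\,ds,\qquad t\in\mathbb R.$$ *)

theory Defs
  imports "HOL-Analysis.Analysis"
begin

section \<open>The Hilbert space of square-summable complex sequences\<close>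

definition l2_seq :: "(nat \<Rightarrow> complex) \<Rightarrow> bool" where
  "l2_seq f \<longleftrightarrow> summable (\<lambda>n. (cmod (f n))\<^sup>2)"

lemma l2_seq_zero: "l2_seq (\<lambda>_. 0)"
  by (simp add: l2_seq_def)

lemma l2_seq_add: "l2_seq f \<Longrightarrow> l2_seq g \<Longrightarrow> l2_seq (\<lambda>n. f n + g n)"
  unfolding l2_seq_def
proof (rule summable_comparison_test')
  assume f: "summable (\<lambda>n. (cmod (f n))\<^sup>2)" and g: "summable (\<lambda>n. (cmod (g n))\<^sup>2)"
  show "summable (\<lambda>n. 2 * (cmod (f n))\<^sup>2 + 2 * (cmod (g n))\<^sup>2)"
    by (intro summable_add summable_mult f g)
  fix n :: nat
  have "(cmod (f n + g n))\<^sup>2 \<le> (cmod (f n) + cmod (g n))\<^sup>2"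
    by (intro power_mono norm_triangle_ineq norm_ge_zero)
  also have "\<dots> \<le> 2 * (cmod (f n))\<^sup>2 + 2 * (cmod (g n))\<^sup>2"
    using sum_squares_ge_zero[of "cmod (f n) - cmod (g n)" 0]
    by (simp add: power2_eq_square algebra_simps)
  finally show "norm ((cmod (f n + g n))\<^sup>2) \<le> 2 * (cmod (f n))\<^sup>2 + 2 * (cmod (g n))\<^sup>2"
    by simp
qed

lemma l2_seq_cmult: "l2_seq f \<Longrightarrow> l2_seq (\<lambda>n. c * f n)"
  unfolding l2_seq_def by (simp add: norm_mult power_mult_distrib summable_mult)

lemma l2_seq_uminus: "l2_seq f \<Longrightarrow> l2_seq (\<lambda>n. - f n)"
  unfolding l2_seq_def by simp

lemma l2_seq_diff: "l2_seq f \<Longrightarrow> l2_seq g \<Longrightarrow> l2_seq (\<lambda>n. f n - g n)"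
  using l2_seq_add[of f "\<lambda>n. - g n"] l2_seq_uminus[of g] by simp

lemma l2_seq_scaleR: "l2_seq f \<Longrightarrow> l2_seq (\<lambda>n. r *\<^sub>R f n)"
  using l2_seq_cmult[of f "of_real r"] by (simp add: scaleR_conv_of_real)

lemma l2_seq_inner_summable:
  assumes "l2_seq f" "l2_seq g"
  shows "summable (\<lambda>n. inner (f n) (g n))"
proof (rule summable_comparison_test')
  show "summable (\<lambda>n. (cmod (f n))\<^sup>2 + (cmod (g n))\<^sup>2)"
    using assms by (intro summable_add) (simp_all add: l2_seq_def)
  fix n :: nat
  have "norm (inner (f n) (g n)) \<le> cmod (f n) * cmod (g n)"
    using Cauchy_Schwarz_ineq2 by simp
  also have "\<dots> \<le> (cmod (f n))\<^sup>2 + (cmod (g n))\<^sup>2"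
  proof -
    have "0 \<le> cmod (f n) * cmod (g n)" by simp
    moreover have "2 * (cmod (f n) * cmod (g n)) \<le> (cmod (f n))\<^sup>2 + (cmod (g n))\<^sup>2"
      using sum_squares_bound[of "cmod (f n)" "cmod (g n)"] by simp
    ultimately show ?thesis by linarith
  qed
  finally show "norm (inner (f n) (g n)) \<le> (cmod (f n))\<^sup>2 + (cmod (g n))\<^sup>2" .
qed

typedef ell2 = "{f. l2_seq f}"
  morphisms coord Abs_ell2
  using l2_seq_zero by blast

setup_lifting type_definition_ell2

lemma l2_seq_coord [simp]: "l2_seq (coord x)"
  using coord by simp

lemma ell2_eqI: "(\<And>n. coord x n = coord y n) \<Longrightarrow> x = y"
  by (metis coord_inject ext)

lemma coord_Abs_ell2: "l2_seq f \<Longrightarrow> coord (Abs_ell2 f) = f"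
  by (simp add: Abs_ell2_inverse)

text \<open>The class \<open>real_inner\<close> carries the real part of the Hilbert space inner product; it determines
  the \<open>\<ell>\<^sup>2\<close> norm.\<close>

instantiation ell2 :: real_inner
begin

lift_definition zero_ell2 :: ell2 is "\<lambda>_. 0" by (rule l2_seq_zero)
lift_definition plus_ell2 :: "ell2 \<Rightarrow> ell2 \<Rightarrow> ell2" is "\<lambda>f g n. f n + g n" by (rule l2_seq_add)
lift_definition minus_ell2 :: "ell2 \<Rightarrow> ell2 \<Rightarrow> ell2" is "\<lambda>f g n. f n - g n" by (rule l2_seq_diff)
lift_definition uminus_ell2 :: "ell2 \<Rightarrow> ell2" is "\<lambda>f n. - f n" by (rule l2_seq_uminus)
lift_definition scaleR_ell2 :: "real \<Rightarrow> ell2 \<Rightarrow> ell2" is "\<lambda>r f n. r *\<^sub>R f n" by (rule l2_seq_scaleR)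

definition inner_ell2 :: "ell2 \<Rightarrow> ell2 \<Rightarrow> real" where
  "inner_ell2 x y = (\<Sum>n. inner (coord x n) (coord y n))"
definition norm_ell2 :: "ell2 \<Rightarrow> real" where "norm_ell2 x = sqrt (inner x x)"
definition sgn_ell2 :: "ell2 \<Rightarrow> ell2" where "sgn_ell2 x = inverse (norm x) *\<^sub>R x"
definition dist_ell2 :: "ell2 \<Rightarrow> ell2 \<Rightarrow> real" where "dist_ell2 x y = norm (x - y)"
definition uniformity_ell2 :: "(ell2 \<times> ell2) filter" where
  "uniformity_ell2 = (INF e\<in>{0<..}. principal {(x, y). dist x y < e})"
definition open_ell2 :: "ell2 set \<Rightarrow> bool" where
  "open_ell2 S = (\<forall>x\<in>S. \<forall>\<^sub>F (x', y) in uniformity. x' = x \<longrightarrow> y \<in> S)"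

instance
proof
  fix x y z :: ell2 and r s :: real
  show "x + y + z = x + (y + z)" "x + y = y + x" "0 + x = x" "- x + x = 0" "x - y = x + - y"
    "r *\<^sub>R (x + y) = r *\<^sub>R x + r *\<^sub>R y" "(r + s) *\<^sub>R x = r *\<^sub>R x + s *\<^sub>R x"
    "r *\<^sub>R s *\<^sub>R x = (r * s) *\<^sub>R x" "1 *\<^sub>R x = x"
    by (transfer; simp add: algebra_simps)+
  have S: "summable (\<lambda>n. inner (coord a n) (coord b n))" for a b :: ell2
    by (rule l2_seq_inner_summable) auto
  show "inner x y = inner y x"
    by (simp add: inner_ell2_def inner_commute)
  show "inner (x + y) z = inner x z + inner y z"
    unfolding inner_ell2_def plus_ell2.rep_eq inner_add_left by (rule suminf_add[symmetric]; rule S)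
  show "inner (r *\<^sub>R x) y = r * inner x y"
    unfolding inner_ell2_def scaleR_ell2.rep_eq inner_scaleR_left by (rule suminf_mult; rule S)
  show "0 \<le> inner x x"
    unfolding inner_ell2_def by (rule suminf_nonneg[OF S]) simp
  show "inner x x = 0 \<longleftrightarrow> x = 0"
  proof -
    have "inner x x = 0 \<longleftrightarrow> (\<forall>n. inner (coord x n) (coord x n) = 0)"
      unfolding inner_ell2_def by (rule suminf_eq_zero_iff[OF S[of x x]]) simp
    also have "\<dots> \<longleftrightarrow> (\<forall>n. coord x n = coord 0 n)"
      by (simp add: zero_ell2.rep_eq)
    also have "\<dots> \<longleftrightarrow> x = 0" using ell2_eqI by blast
    finally show ?thesis .
  qed
  show "norm x = sqrt (inner x x)" by (rule norm_ell2_def)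
qed (rule sgn_ell2_def dist_ell2_def uniformity_ell2_def open_ell2_def)+

end

lemma norm_ell2_eq: "norm x = sqrt (\<Sum>n. (cmod (coord x n))\<^sup>2)"
  unfolding norm_ell2_def inner_ell2_def power2_norm_eq_inner ..

lemma norm_ell2_sq: "(norm x)\<^sup>2 = (\<Sum>n. (cmod (coord x n))\<^sup>2)"
  unfolding power2_norm_eq_inner inner_ell2_def ..

lemma summable_coord_sq: "summable (\<lambda>n. (cmod (coord x n))\<^sup>2)"
  using l2_seq_coord[of x] by (simp add: l2_seq_def)

lemma sum_coord_sq_le: "(\<Sum>n<N. (cmod (coord x n))\<^sup>2) \<le> (norm x)\<^sup>2"
  unfolding norm_ell2_sq by (rule sum_le_suminf[OF summable_coord_sq]) auto

lemma norm_coord_le: "cmod (coord x n) \<le> norm x"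
proof -
  have "(cmod (coord x n))\<^sup>2 \<le> (\<Sum>k<Suc n. (cmod (coord x k))\<^sup>2)"
    by (simp add: sum_nonneg)
  also have "\<dots> \<le> (norm x)\<^sup>2" by (rule sum_coord_sq_le)
  finally show ?thesis by (rule power2_le_imp_le) simp
qed

instance ell2 :: banach
proof
  fix X :: "nat \<Rightarrow> ell2"
  assume C: "Cauchy X"
  have "Cauchy (\<lambda>k. coord (X k) n)" for n
  proof (rule metric_CauchyI)
    fix e :: real assume "0 < e"
    then obtain M where M: "\<And>m k. m \<ge> M \<Longrightarrow> k \<ge> M \<Longrightarrow> dist (X m) (X k) < e"
      using metric_CauchyD[OF C] by blast
    have "dist (coord (X m) n) (coord (X k) n) \<le> dist (X m) (X k)" for m k
      using norm_coord_le[of "X m - X k" n] by (simp add: dist_norm minus_ell2.rep_eq)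
    with M show "\<exists>M. \<forall>m\<ge>M. \<forall>k\<ge>M. dist (coord (X m) n) (coord (X k) n) < e"
      by (meson le_less_trans)
  qed
  then have "\<exists>l. (\<lambda>k. coord (X k) n) \<longlonglongrightarrow> l" for n
    by (simp add: Cauchy_convergent_iff convergent_def)
  then obtain f where f: "\<And>n. (\<lambda>k. coord (X k) n) \<longlonglongrightarrow> f n" by metis
  have tail: "\<exists>M. \<forall>m\<ge>M. l2_seq (\<lambda>n. coord (X m) n - f n) \<and>
      (\<Sum>n. (cmod (coord (X m) n - f n))\<^sup>2) \<le> e\<^sup>2" if "0 < e" for e :: real
  proof -
    obtain M where M: "\<And>m k. m \<ge> M \<Longrightarrow> k \<ge> M \<Longrightarrow> dist (X m) (X k) < e"
      using metric_CauchyD[OF C \<open>0 < e\<close>] by blast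
    have B: "(\<Sum>n<N. (cmod (coord (X m) n - f n))\<^sup>2) \<le> e\<^sup>2" if "m \<ge> M" for m N
    proof (rule LIMSEQ_le_const2)
      show "(\<lambda>k. \<Sum>n<N. (cmod (coord (X m) n - coord (X k) n))\<^sup>2) \<longlonglongrightarrow>
          (\<Sum>n<N. (cmod (coord (X m) n - f n))\<^sup>2)"
        by (intro tendsto_intros f)
      have "(\<Sum>n<N. (cmod (coord (X m) n - coord (X k) n))\<^sup>2) \<le> e\<^sup>2" if "k \<ge> M" for k
      proof -
        have "(\<Sum>n<N. (cmod (coord (X m - X k) n))\<^sup>2) \<le> (norm (X m - X k))\<^sup>2"
          by (rule sum_coord_sq_le)
        also have "\<dots> \<le> e\<^sup>2"
          using M[OF \<open>m \<ge> M\<close> that] by (intro power_mono) (auto simp: dist_norm)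
        finally show ?thesis by (simp add: minus_ell2.rep_eq)
      qed
      then show "\<exists>K. \<forall>k\<ge>K. (\<Sum>n<N. (cmod (coord (X m) n - coord (X k) n))\<^sup>2) \<le> e\<^sup>2"
        by blast
    qed
    have S: "summable (\<lambda>n. (cmod (coord (X m) n - f n))\<^sup>2)" if "m \<ge> M" for m
      by (rule summableI_nonneg_bounded[OF _ B[OF that]]) simp
    show ?thesis
      unfolding l2_seq_def using suminf_le_const[OF S B] S by blast
  qed
  obtain m0 where "l2_seq (\<lambda>n. coord (X m0) n - f n)"
    using tail[of 1] by auto
  from l2_seq_diff[OF l2_seq_coord[of "X m0"] this] have lf: "l2_seq f" by simp
  have "X \<longlonglongrightarrow> Abs_ell2 f"
  proof (rule metric_LIMSEQ_I)
    fix e :: real assume "0 < e"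
    then obtain M where M: "\<And>m. m \<ge> M \<Longrightarrow> (\<Sum>n. (cmod (coord (X m) n - f n))\<^sup>2) \<le> (e/2)\<^sup>2"
      using tail[of "e/2"] by auto
    have "norm (X m - Abs_ell2 f) \<le> e/2" if "m \<ge> M" for m
    proof (rule power2_le_imp_le)
      show "(norm (X m - Abs_ell2 f))\<^sup>2 \<le> (e/2)\<^sup>2"
        unfolding norm_ell2_sq minus_ell2.rep_eq coord_Abs_ell2[OF lf] by (rule M[OF that])
    qed (use \<open>0 < e\<close> in simp)
    then have "dist (X m) (Abs_ell2 f) < e" if "m \<ge> M" for m
      unfolding dist_norm using that \<open>0 < e\<close> by fastforce
    then show "\<exists>M. \<forall>m\<ge>M. dist (X m) (Abs_ell2 f) < e"
      by blast
  qed
  then show "convergent X" by (auto simp: convergent_def)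
qed

lemma l2_seq_finite_support: "(\<And>n. n \<ge> N \<Longrightarrow> f n = 0) \<Longrightarrow> l2_seq f"
  unfolding l2_seq_def by (rule summable_finite[of "{..<N}"]) (auto simp: not_less)

lemma ell2_countable_dense:
  "\<exists>D :: ell2 set. countable D \<and> (\<forall>x e. 0 < e \<longrightarrow> (\<exists>d\<in>D. dist d x < e))"
proof -
  obtain C :: "complex set" where C: "countable C"
      and dense: "\<And>U. open U \<Longrightarrow> U \<noteq> {} \<Longrightarrow> \<exists>d\<in>C. d \<in> U"
    using countable_dense_setE by metis
  define h :: "complex list \<Rightarrow> ell2" where
    "h l = Abs_ell2 (\<lambda>n. if n < length l then l ! n else 0)" for l
  have h: "coord (h l) = (\<lambda>n. if n < length l then l ! n else 0)" for l
    unfolding h_def by (rule coord_Abs_ell2, rule l2_seq_finite_support[of "length l"]) simp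
  have "\<exists>d\<in>h ` lists C. dist d x < e" if "0 < e" for x :: ell2 and e :: real
  proof -
    have "\<exists>N. \<forall>n\<ge>N. norm (\<Sum>i. (cmod (coord x (i + n)))\<^sup>2) < e\<^sup>2 / 2"
      using that by (intro suminf_exist_split[OF _ summable_coord_sq]) simp
    then obtain N where N: "(\<Sum>i. (cmod (coord x (i + N)))\<^sup>2) < e\<^sup>2 / 2"
      by (metis abs_ge_self le_less_trans order_refl real_norm_def)
    define r where "r = e / sqrt (2 * (N + 1))"
    have "0 < r" using that by (simp add: r_def)
    have r2: "r\<^sup>2 = e\<^sup>2 / (2 * (N + 1))" by (simp add: r_def power_divide)
    have "\<exists>d\<in>C. d \<in> ball (coord x n) r" for n
      using \<open>0 < r\<close> by (intro dense) auto
    then obtain c where c: "\<And>n. c n \<in> C" "\<And>n. dist (coord x n) (c n) < r"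
      by (metis mem_ball)
    define l where "l = map c [0..<N]"
    have l: "l \<in> lists C" using c by (auto simp: l_def)
    let ?g = "\<lambda>n. (cmod (coord (h l - x) n))\<^sup>2"
    have "(\<Sum>n<N. ?g n) \<le> (\<Sum>n<N. r\<^sup>2)"
      using c(2) by (intro sum_mono power_mono)
        (auto simp: h minus_ell2.rep_eq l_def dist_norm norm_minus_commute less_imp_le)
    also have "\<dots> \<le> e\<^sup>2 / 2"
      unfolding r2 by (simp add: divide_simps) (simp add: algebra_simps)
    finally have 1: "(\<Sum>n<N. ?g n) \<le> e\<^sup>2 / 2" .
    have 2: "?g (i + N) = (cmod (coord x (i + N)))\<^sup>2" for i
      by (simp add: h minus_ell2.rep_eq l_def)
    have "(norm (h l - x))\<^sup>2 = (\<Sum>i. ?g (i + N)) + (\<Sum>n<N. ?g n)"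
      unfolding norm_ell2_sq by (rule suminf_split_initial_segment[OF summable_coord_sq])
    also have "\<dots> < e\<^sup>2" using 1 N unfolding 2 by simp
    finally have "norm (h l - x) < e"
      by (rule power2_less_imp_less) (use that in simp)
    with l show ?thesis by (auto simp: dist_norm)
  qed
  moreover have "countable (h ` lists C)" using C by (intro countable_image countable_lists)
  ultimately show ?thesis by blast
qed

instance ell2 :: second_countable_topology
proof
  obtain D :: "ell2 set" where D: "countable D" "\<And>x e. 0 < e \<Longrightarrow> \<exists>d\<in>D. dist d x < e"
    using ell2_countable_dense by blast
  define B where "B = (\<lambda>(d, q). ball d q) ` (D \<times> (\<rat> :: real set))"
  have "topological_basis B"
  proof (rule topological_basisI)
    show "open b" if "b \<in> B" for b using that by (auto simp: B_def)
    fix U and x :: ell2 assume "open U" "x \<in> U"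
    then obtain e where e: "0 < e" "ball x e \<subseteq> U" by (meson openE)
    obtain q where q: "q \<in> \<rat>" "0 < q" "q < e / 2"
      using Rats_dense_in_real[of 0 "e / 2"] e by auto
    obtain d where d: "d \<in> D" "dist d x < q" using D(2) q by blast
    have "ball d q \<subseteq> ball x e"
    proof
      fix y assume "y \<in> ball d q"
      then have "dist x y < q + q"
        using d(2) dist_triangle[of x y d] by (simp add: dist_commute)
      then show "y \<in> ball x e" using q by simp
    qed
    then show "\<exists>b\<in>B. x \<in> b \<and> b \<subseteq> U"
      using d q e by (intro bexI[of _ "ball d q"]) (auto simp: B_def)
  qed
  moreover have "countable B" using D(1) countable_rat by (auto simp: B_def)
  ultimately show "\<exists>B :: ell2 set set. countable B \<and> open = generate_topology B"
    using topological_basis_imp_subbasis by blast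
qed

lift_definition scaleC :: "complex \<Rightarrow> ell2 \<Rightarrow> ell2"  (infixr \<open>*\<^sub>C\<close> 75)
  is "\<lambda>c f n. c * f n" by (rule l2_seq_cmult)


section \<open>Unitary groups\<close>

definition unitary_op :: "(ell2 \<Rightarrow> ell2) \<Rightarrow> bool" where
  "unitary_op V \<longleftrightarrow>
     (\<forall>x y. V (x + y) = V x + V y) \<and> (\<forall>c x. V (c *\<^sub>C x) = c *\<^sub>C V x) \<and>
     (\<forall>x. norm (V x) = norm x) \<and> surj V"

definition unitary_group :: "(real \<Rightarrow> ell2 \<Rightarrow> ell2) \<Rightarrow> bool" where
  "unitary_group U \<longleftrightarrow>
     (\<forall>t. unitary_op (U t)) \<and> (\<forall>x. U 0 x = x) \<and> (\<forall>s t x. U (s + t) x = U s (U t x)) \<and>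
     (\<forall>x. continuous_on UNIV (\<lambda>t. U t x))"

text \<open>The generator of \<open>U\<close>, in the sense of Stone's theorem, is exactly \<open>-iA\<close> with domain \<open>D\<close>:
  the strong derivative at \<open>0\<close> exists precisely on \<open>D\<close>.\<close>

definition has_generator :: "(real \<Rightarrow> ell2 \<Rightarrow> ell2) \<Rightarrow> ell2 set \<Rightarrow> (ell2 \<Rightarrow> ell2) \<Rightarrow> bool" where
  "has_generator U D A \<longleftrightarrow>
     (\<forall>x y. ((\<lambda>t. (1 / t) *\<^sub>R (U t x - x)) \<longlongrightarrow> y) (at 0) \<longleftrightarrow> x \<in> D \<and> y = (- \<i>) *\<^sub>C A x)"

text \<open>\<open>exp_group D A t\<close> is \<open>e\<^sup>-\<^sup>i\<^sup>t\<^sup>A\<close> for a self-adjoint operator \<open>A\<close> with domain \<open>D\<close>; by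
  Stone's theorem there is then exactly one group as described.\<close>

definition exp_group :: "ell2 set \<Rightarrow> (ell2 \<Rightarrow> ell2) \<Rightarrow> real \<Rightarrow> ell2 \<Rightarrow> ell2" where
  "exp_group D A = (THE U. unitary_group U \<and> has_generator U D A)"


section \<open>The discrete Laguerre operator\<close>

definition laguerre_expr :: "real \<Rightarrow> (nat \<Rightarrow> complex) \<Rightarrow> nat \<Rightarrow> complex" where
  "laguerre_expr \<alpha> f n =
     complex_of_real (sqrt (real n * (real n + \<alpha>))) * (if n = 0 then 0 else f (n - 1))
     + complex_of_real (2 * real n + 1 + \<alpha>) * f n
     + complex_of_real (sqrt ((real n + 1) * (real n + 1 + \<alpha>))) * f (n + 1)"

definition laguerre_dom :: "real \<Rightarrow> ell2 set" where
  "laguerre_dom \<alpha> = {x. l2_seq (laguerre_expr \<alpha> (coord x))}"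

definition laguerre_op :: "real \<Rightarrow> ell2 \<Rightarrow> ell2" where
  "laguerre_op \<alpha> x = Abs_ell2 (laguerre_expr \<alpha> (coord x))"

definition laguerre_group :: "real \<Rightarrow> real \<Rightarrow> ell2 \<Rightarrow> ell2" where
  "laguerre_group \<alpha> = exp_group (laguerre_dom \<alpha>) (laguerre_op \<alpha>)"


section \<open>Mild solutions and mixed-norm spaces\<close>

definition power_nl :: "real \<Rightarrow> ell2 \<Rightarrow> ell2" where
  "power_nl p x = Abs_ell2 (\<lambda>n. complex_of_real (cmod (coord x n) powr (p - 1)) * coord x n)"

text \<open>For \<open>p \<ge> 1\<close> the componentwise nonlinearity does map \<open>\<ell>\<^sup>2\<close> to itself.\<close>

lemma coord_power_nl:
  assumes "1 \<le> p"
  shows "coord (power_nl p x) n = complex_of_real (cmod (coord x n) powr (p - 1)) * coord x n"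
proof -
  have "l2_seq (\<lambda>n. complex_of_real (cmod (coord x n) powr (p - 1)) * coord x n)"
    unfolding l2_seq_def
  proof (rule summable_comparison_test')
    show "summable (\<lambda>n. (norm x powr (p - 1))\<^sup>2 * (cmod (coord x n))\<^sup>2)"
      by (intro summable_mult summable_coord_sq)
    fix n :: nat
    have "(cmod (coord x n) powr (p - 1))\<^sup>2 \<le> (norm x powr (p - 1))\<^sup>2"
      using assms by (intro power_mono powr_mono2 norm_coord_le) auto
    then show "norm ((cmod (complex_of_real (cmod (coord x n) powr (p - 1)) * coord x n))\<^sup>2)
        \<le> (norm x powr (p - 1))\<^sup>2 * (cmod (coord x n))\<^sup>2"
      by (simp add: norm_mult power_mult_distrib mult_right_mono)
  qed
  then show ?thesis by (simp add: power_nl_def coord_Abs_ell2)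
qed

text \<open>For \<open>u \<in> C(\<real>; \<ell>\<^sup>2)\<close> the integrability clause below holds automatically; it only rules out
  that the Bochner integral is read as its default value \<open>0\<close>.\<close>

definition mild_solution :: "real \<Rightarrow> real \<Rightarrow> real \<Rightarrow> ell2 \<Rightarrow> (real \<Rightarrow> ell2) \<Rightarrow> bool" where
  "mild_solution \<alpha> \<mu> p u0 u \<longleftrightarrow>
     (\<forall>t. interval_lebesgue_integrable lborel (ereal 0) (ereal t)
            (\<lambda>s. laguerre_group \<alpha> (t - s) (power_nl p (u s))) \<and>
          u t = laguerre_group \<alpha> t u0 - (\<i> * complex_of_real \<mu>) *\<^sub>C
            (LBINT s=ereal 0..ereal t. laguerre_group \<alpha> (t - s) (power_nl p (u s))))"

definition lr_norm :: "real \<Rightarrow> (nat \<Rightarrow> complex) \<Rightarrow> real" where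
  "lr_norm r f = (\<Sum>n. cmod (f n) powr r) powr (1 / r)"

text \<open>The space \<open>L\<^sup>q(\<real>; \<ell>\<^sup>r)\<close> for \<open>1 \<le> q, r < \<infinity>\<close>. As \<open>\<ell>\<^sup>r\<close> is then separable, strong
  measurability amounts to measurability of every coordinate.\<close>

definition LqLr :: "real \<Rightarrow> real \<Rightarrow> (real \<Rightarrow> nat \<Rightarrow> complex) set" where
  "LqLr q r = {v.
     (\<forall>n. (\<lambda>t. v t n) \<in> borel_measurable lborel) \<and>
     (AE t in lborel. summable (\<lambda>n. cmod (v t n) powr r)) \<and>
     integrable lborel (\<lambda>t. lr_norm r (v t) powr q)}"


section \<open>Scattering at the critical exponent\<close>

definition sigma :: "real \<Rightarrow> real" where "sigma \<alpha> = min 1 (1 + \<alpha>)"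

definition p_crit :: "real \<Rightarrow> real" where "p_crit \<alpha> = 1 + 2 / sigma \<alpha>"

definition Q_crit :: "real \<Rightarrow> real" where "Q_crit \<alpha> = p_crit \<alpha> + 1"

definition global_solution :: "real \<Rightarrow> real \<Rightarrow> ell2 \<Rightarrow> (real \<Rightarrow> ell2) \<Rightarrow> bool" where
  "global_solution \<alpha> \<mu> u0 u \<longleftrightarrow>
     continuous_on UNIV u \<and> (\<lambda>t. coord (u t)) \<in> LqLr (Q_crit \<alpha>) (Q_crit \<alpha>) \<and>
     mild_solution \<alpha> \<mu> (p_crit \<alpha>) u0 u"

definition scatters :: "real \<Rightarrow> (real \<Rightarrow> ell2) \<Rightarrow> bool" where
  "scatters \<alpha> u \<longleftrightarrow>
     (\<exists>u_plus u_minus.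
        ((\<lambda>t. norm (u t - laguerre_group \<alpha> t u_plus)) \<longlongrightarrow> 0) at_top \<and>
        ((\<lambda>t. norm (u t - laguerre_group \<alpha> t u_minus)) \<longlongrightarrow> 0) at_bot)"

end

theory Submission
  imports Defs
begin

text \<open>
  The matrix elements of \<open>e\<^sup>-\<^sup>i\<^sup>t\<^sup>H\<close> are explicit: up to a unimodular factor they are
  \<open>(1 + t\<^sup>2)\<^bsup>-(1+\<alpha>)/2\<^esup>\<close> times a real function of \<open>x = ln t\<close> which, suitably weighted, solves \<open>y'' = V y\<close>.
  A Sonin function reduces the bound \<open>\<bar>y\<bar> \<le> 1\<close> to the outermost maximum, where the equation is compared with two
  integral identities that the ladder relations make telescope. This yields the decay \<open>\<bar>t\<bar>\<^bsup>-\<sigma>\<^esup>\<close> of the kernel, with constant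
  one for every \<open>\<alpha>\<close>.

  Interpolation with unitarity gives the decay \<open>\<bar>t\<bar>\<^bsup>-2/Q\<^esup>\<close> from \<open>\<ell>\<^sup>q\<close> to \<open>\<ell>\<^sup>Q\<close>, where \<open>q\<close> is conjugate to \<open>Q\<close>, and
  fractional integration in time turns it into Strichartz estimates in \<open>L\<^sup>Q(\<real>; \<ell>\<^sup>Q)\<close> whose constants depend on \<open>Q\<close>
  only. For small data these keep the Picard iterates in a fixed ball of \<open>L\<^sup>Q(\<real>; \<ell>\<^sup>Q)\<close> and of \<open>L\<^sup>\<infinity>(\<real>; \<ell>\<^sup>2)\<close>. Convergence and
  uniqueness need no smallness: the nonlinearity is Lipschitz on balls of \<open>\<ell>\<^sup>2\<close>, so a weight \<open>e\<^bsup>K\<bar>t\<bar>\<^esup>\<close> makes the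
  solution map contract. Scattering is the dual Strichartz estimate on \<open>[s, t]\<close> as \<open>s, t \<rightarrow> \<plusminus>\<infinity>\<close>.
\<close>

subsection \<open>Linear contractions of \<open>\<ell>\<^sup>2\<close>\<close>

text \<open>The exponents close up exactly. With \<open>Q = p + 1\<close> one has
  \<open>sigma = 2/(Q-2)\<close>, so interpolating \<open>|t|^(-sigma)\<close> with unitarity gives
  \<open>|t|^(-2/Q)\<close>. This is the scale-invariant kernel from \<open>L^q\<close> to
  \<open>L^Q\<close> in time; it is only weakly integrable to the power that Young's inequality
  would require, so fractional integration is unavoidable. Since \<open>(Q-1) q = Q\<close>, the
  nonlinearity maps \<open>L^Q\<close> into precisely the dual space, and the iteration is global in
  time. The obstacle is a pointwise bound uniform in both indices, through the oscillatory region
  and its turning points. The weight \<open>leta^(\<alpha>/2)\<close> that removes the first-order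
  term decays at plus infinity only for \<open>\<alpha> > 0\<close>. For
  \<open>\<alpha> \<le> 0\<close> the unweighted function is kept together with its first-order
  term, and a limit of modulus at most one replaces the decay; this forces a second Sonin function.
  Uniformity over \<open>\<alpha> \<ge> 0\<close> comes for free: all these \<alpha> share
  \<open>sigma = 1\<close>, hence \<open>Q = 4\<close>, and every constant after the dispersive
  estimate is a function of \<open>Q\<close> only.\<close>

definition basis :: "nat \<Rightarrow> ell2" where
  "basis m = Abs_ell2 (\<lambda>n. if n = m then 1 else 0)"

definition trunc :: "nat \<Rightarrow> ell2 \<Rightarrow> ell2" where
  "trunc N x = Abs_ell2 (\<lambda>n. if n < N then coord x n else 0)"

lemma coord_basis: "coord (basis m) n = (if n = m then 1 else 0)"
proof -
  have "l2_seq (\<lambda>n. if n = m then 1 else 0)"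
    by (rule l2_seq_finite_support[of "Suc m"]) auto
  then show ?thesis by (simp add: basis_def coord_Abs_ell2)
qed

lemma coord_trunc: "coord (trunc N x) n = (if n < N then coord x n else 0)"
proof -
  have "l2_seq (\<lambda>n. if n < N then coord x n else 0)"
    by (rule l2_seq_finite_support[of N]) auto
  then show ?thesis by (simp add: trunc_def coord_Abs_ell2)
qed

lemmas coord_simps = zero_ell2.rep_eq plus_ell2.rep_eq minus_ell2.rep_eq uminus_ell2.rep_eq
  scaleR_ell2.rep_eq scaleC.rep_eq

lemma coord_sum: "coord (sum f A) n = (\<Sum>i\<in>A. coord (f i) n)"
  by (induction A rule: infinite_finite_induct) (auto simp: coord_simps)

lemma trunc_eq_sum: "trunc N x = (\<Sum>m<N. coord x m *\<^sub>C basis m)"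
proof (rule ell2_eqI)
  fix n
  have "(\<Sum>m<N. coord x m * (if n = m then 1 else 0)) = (\<Sum>m<N. if n = m then coord x m else 0)"
    by (intro sum.cong) auto
  then show "coord (trunc N x) n = coord (\<Sum>m<N. coord x m *\<^sub>C basis m) n"
    by (simp add: coord_trunc coord_sum coord_simps coord_basis)
qed

lemma norm_scaleC: "norm (c *\<^sub>C x) = cmod c * norm x"
proof -
  have "(norm (c *\<^sub>C x))\<^sup>2 = (\<Sum>n. (cmod c)\<^sup>2 * (cmod (coord x n))\<^sup>2)"
    unfolding norm_ell2_sq by (simp add: coord_simps norm_mult power_mult_distrib)
  also have "\<dots> = (cmod c * norm x)\<^sup>2"
    by (simp add: suminf_mult summable_coord_sq norm_ell2_sq power_mult_distrib)
  finally show ?thesis by (simp add: power2_eq_iff_nonneg)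
qed

lemma scaleC_add: "c *\<^sub>C (x + y) = c *\<^sub>C x + c *\<^sub>C y"
  by (rule ell2_eqI) (simp add: coord_simps algebra_simps)

lemma bounded_linear_scaleC: "bounded_linear (scaleC c)"
proof (rule bounded_linear_intro[of _ "cmod c"])
  show "c *\<^sub>C (r *\<^sub>R x) = r *\<^sub>R (c *\<^sub>C x)" for r x
    by (rule ell2_eqI) (simp add: coord_simps)
qed (simp_all add: scaleC_add norm_scaleC mult.commute)

lemma norm_basis [simp]: "norm (basis m) = 1"
proof -
  have "(\<lambda>n. if n = m then (1::real) else 0) sums 1"
    using sums_single[of m "\<lambda>_. 1 :: real"] by simp
  moreover have "(\<lambda>n. (cmod (coord (basis m) n))\<^sup>2) = (\<lambda>n. if n = m then 1 else 0)"
    by (auto simp: coord_basis)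
  ultimately show ?thesis by (simp add: norm_ell2_eq sums_unique[symmetric])
qed

lemma norm_trunc_sq: "(norm (trunc N x))\<^sup>2 = (\<Sum>n<N. (cmod (coord x n))\<^sup>2)"
proof -
  have "(norm (trunc N x))\<^sup>2 = (\<Sum>n. if n \<in> {..<N} then (cmod (coord x n))\<^sup>2 else 0)"
    unfolding norm_ell2_sq by (intro suminf_cong) (auto simp: coord_trunc)
  also have "\<dots> = (\<Sum>n<N. (cmod (coord x n))\<^sup>2)"
    using sums_If_finite_set[of "{..<N}"] by (intro sums_unique[symmetric]) auto
  finally show ?thesis .
qed

lemma norm_trunc_le: "norm (trunc N x) \<le> norm x"
  using sum_coord_sq_le[where N = N and x = x] unfolding norm_trunc_sq[symmetric]
  by (rule power2_le_imp_le) simp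

lemma norm_diff_trunc_sq: "(norm (x - trunc N x))\<^sup>2 = (norm x)\<^sup>2 - (\<Sum>n<N. (cmod (coord x n))\<^sup>2)"
proof -
  have "(\<lambda>n. if n \<in> {..<N} then (cmod (coord x n))\<^sup>2 else 0) sums (\<Sum>n<N. (cmod (coord x n))\<^sup>2)"
    by (rule sums_If_finite_set) auto
  moreover have "(\<lambda>n. (cmod (coord x n))\<^sup>2) sums (norm x)\<^sup>2"
    unfolding norm_ell2_sq by (rule summable_sums[OF summable_coord_sq])
  ultimately have "(\<lambda>n. (cmod (coord x n))\<^sup>2 - (if n \<in> {..<N} then (cmod (coord x n))\<^sup>2 else 0)) sums
      ((norm x)\<^sup>2 - (\<Sum>n<N. (cmod (coord x n))\<^sup>2))" by (intro sums_diff)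
  moreover have "(\<lambda>n. (cmod (coord x n))\<^sup>2 - (if n \<in> {..<N} then (cmod (coord x n))\<^sup>2 else 0))
      = (\<lambda>n. (cmod (coord (x - trunc N x) n))\<^sup>2)"
    by (auto simp: coord_trunc coord_simps)
  ultimately show ?thesis unfolding norm_ell2_sq[of "x - trunc N x"] by (simp add: sums_iff)
qed

lemma trunc_tendsto: "(\<lambda>N. trunc N x) \<longlonglongrightarrow> x"
proof -
  have "(\<lambda>N. \<Sum>n<N. (cmod (coord x n))\<^sup>2) \<longlonglongrightarrow> (norm x)\<^sup>2"
    unfolding norm_ell2_sq by (rule summable_LIMSEQ[OF summable_coord_sq])
  then have "(\<lambda>N. sqrt ((norm x)\<^sup>2 - (\<Sum>n<N. (cmod (coord x n))\<^sup>2))) \<longlonglongrightarrow> sqrt ((norm x)\<^sup>2 - (norm x)\<^sup>2)"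
    by (intro tendsto_intros)
  then have "(\<lambda>N. norm (x - trunc N x)) \<longlonglongrightarrow> 0"
    unfolding norm_diff_trunc_sq[symmetric] by simp
  then have "(\<lambda>N. x - (x - trunc N x)) \<longlonglongrightarrow> x - 0"
    by (intro tendsto_diff tendsto_const) (rule tendsto_norm_zero_cancel)
  then show ?thesis by simp
qed

lemma sum_mult_coord_le:
  "summable (\<lambda>n. cmod (coord x n) * cmod (coord y n))"
  "(\<Sum>n. cmod (coord x n) * cmod (coord y n)) \<le> norm x * norm y"
proof -
  have *: "(\<Sum>n<N. cmod (coord x n) * cmod (coord y n)) \<le> norm x * norm y" for N
  proof -
    have "(\<Sum>n<N. cmod (coord x n) * cmod (coord y n))
        \<le> L2_set (\<lambda>n. cmod (coord x n)) {..<N} * L2_set (\<lambda>n. cmod (coord y n)) {..<N}"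
      using L2_set_mult_ineq[of "\<lambda>n. cmod (coord x n)" "\<lambda>n. cmod (coord y n)" "{..<N}"] by simp
    also have "\<dots> = norm (trunc N x) * norm (trunc N y)"
      unfolding L2_set_def norm_trunc_sq[symmetric] by simp
    also have "\<dots> \<le> norm x * norm y" by (intro mult_mono norm_trunc_le) auto
    finally show ?thesis .
  qed
  show "summable (\<lambda>n. cmod (coord x n) * cmod (coord y n))"
    by (rule summableI_nonneg_bounded[OF _ *]) simp
  then show "(\<Sum>n. cmod (coord x n) * cmod (coord y n)) \<le> norm x * norm y"
    by (rule suminf_le_const[OF _ *])
qed

text \<open>Bilinear, with no conjugation, and complex valued. The class \<open>inner\<close>
  carries only a real part, and the kernels below are symmetric rather than Hermitian, so moving one
  across \<open>pairing\<close> costs no conjugate.\<close>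

definition pairing :: "ell2 \<Rightarrow> ell2 \<Rightarrow> complex" where
  "pairing x y = (\<Sum>n. coord x n * coord y n)"

lemma summable_pairing: "summable (\<lambda>n. coord x n * coord y n)"
  by (rule summable_norm_cancel) (simp add: norm_mult sum_mult_coord_le)

lemma norm_pairing_le: "cmod (pairing x y) \<le> norm x * norm y"
proof -
  have "cmod (pairing x y) \<le> (\<Sum>n. cmod (coord x n * coord y n))"
    unfolding pairing_def by (rule summable_norm) (simp add: norm_mult sum_mult_coord_le)
  also have "\<dots> \<le> norm x * norm y" by (simp add: norm_mult sum_mult_coord_le)
  finally show ?thesis .
qed

lemma bounded_linear_pairing: "bounded_linear (\<lambda>x. pairing x y)"
proof (rule bounded_linear_intro[of _ "norm y"])
  show "pairing (x + x') y = pairing x y + pairing x' y" for x x'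
    unfolding pairing_def coord_simps distrib_right
    by (rule suminf_add[symmetric]; rule summable_pairing)
  show "pairing (r *\<^sub>R x) y = r *\<^sub>R pairing x y" for r x
    unfolding pairing_def coord_simps scaleR_conv_of_real mult.assoc
    by (rule suminf_mult; rule summable_pairing)
qed (rule norm_pairing_le)

lemma bounded_linear_coord: "bounded_linear (\<lambda>x. coord x n)"
  by (rule bounded_linear_intro[of _ 1]) (auto simp: coord_simps norm_coord_le)

text \<open>Only a norm bound is demanded, so the notion applies before an operator is known to be
  isometric or onto. Homogeneity over the complex numbers is what lets the images of the basis
  vectors determine the operator.\<close>

definition clinear_contraction :: "(ell2 \<Rightarrow> ell2) \<Rightarrow> bool" where
  "clinear_contraction F \<longleftrightarrow> (\<forall>x y. F (x + y) = F x + F y) \<and> (\<forall>c x. F (c *\<^sub>C x) = c *\<^sub>C F x) \<and>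
     (\<forall>x. norm (F x) \<le> norm x)"

lemma unitary_op_contraction: "unitary_op F \<Longrightarrow> clinear_contraction F"
  by (auto simp: unitary_op_def clinear_contraction_def)

lemma scaleC_of_real: "complex_of_real r *\<^sub>C x = r *\<^sub>R x"
  by (rule ell2_eqI) (simp add: coord_simps scaleR_conv_of_real)

lemma bounded_linear_contraction:
  assumes "clinear_contraction F" shows "bounded_linear F"
proof (rule bounded_linear_intro[of _ 1])
  show "F (r *\<^sub>R x) = r *\<^sub>R F x" for r x
    using assms unfolding scaleC_of_real[symmetric] by (simp add: clinear_contraction_def)
qed (use assms in \<open>auto simp: clinear_contraction_def\<close>)

lemma clinear_contraction_trunc:
  assumes "clinear_contraction F"
  shows "F (trunc N x) = (\<Sum>m<N. coord x m *\<^sub>C F (basis m))"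
  unfolding trunc_eq_sum linear_sum[OF bounded_linear.linear[OF bounded_linear_contraction[OF assms]]] using assms
  by (simp add: clinear_contraction_def)

lemma clinear_contraction_eqI:
  assumes "clinear_contraction F" "clinear_contraction G" "\<And>m. F (basis m) = G (basis m)"
  shows "F x = G x"
proof -
  have "(\<lambda>N. F (trunc N x)) \<longlonglongrightarrow> F x" "(\<lambda>N. G (trunc N x)) \<longlonglongrightarrow> G x"
    by (rule bounded_linear.tendsto[OF bounded_linear_contraction[OF assms(1)] trunc_tendsto],
        rule bounded_linear.tendsto[OF bounded_linear_contraction[OF assms(2)] trunc_tendsto])
  moreover have "(\<lambda>N. F (trunc N x)) = (\<lambda>N. G (trunc N x))"
    using assms by (simp add: clinear_contraction_trunc)
  ultimately show ?thesis using LIMSEQ_unique by metis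
qed

lemma clinear_contraction_comp:
  assumes "clinear_contraction F" "clinear_contraction G"
  shows "clinear_contraction (\<lambda>x. F (G x))"
proof -
  have "norm (F (G x)) \<le> norm x" for x
    using assms order_trans[of "norm (F (G x))" "norm (G x)"] by (simp add: clinear_contraction_def)
  with assms show ?thesis by (simp add: clinear_contraction_def)
qed


subsection \<open>A Jacobi operator generates the group given by its kernel\<close>

text \<open>For \<open>x \<in> D\<close> the curve \<open>U (t - \<tau>) (V \<tau> x)\<close> is
  constant in \<tau>: \<open>V\<close> preserves \<open>D\<close>, and the difference quotients of
  both groups at \<open>V \<tau> x\<close> have the same limit. Comparing \<tau> = 0 with \<tau> = t
  gives equality on \<open>D\<close>, and basis vectors in \<open>D\<close> carry it to the whole
  space.\<close>

lemma has_generator_unique: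
  assumes U: "unitary_group U" "has_generator U D A" and V: "unitary_group V" "has_generator V D A"
    and D: "\<And>m. basis m \<in> D"
  shows "U = V"
proof (intro ext)
  fix t :: real and x
  have uU: "unitary_op (U t)" and uV: "unitary_op (V t)" for t
    using U V by (auto simp: unitary_group_def)
  have cU: "clinear_contraction (U t)" and cV: "clinear_contraction (V t)" for t
    by (simp_all add: uU uV unitary_op_contraction)
  note lU = bounded_linear_contraction[OF cU] and lV = bounded_linear_contraction[OF cV]
  have U0: "U 0 x = x" "V 0 x = x" "U (s + t) x = U s (U t x)" "V (s + t) x = V s (V t x)" for s t x
    using U V by (auto simp: unitary_group_def)
  have gU: "((\<lambda>h. (1 / h) *\<^sub>R (U h z - z)) \<longlongrightarrow> y) (at 0) \<longleftrightarrow> z \<in> D \<and> y = (- \<i>) *\<^sub>C A z" for z y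
    using U(2) unfolding has_generator_def by blast
  have gV: "((\<lambda>h. (1 / h) *\<^sub>R (V h z - z)) \<longlongrightarrow> y) (at 0) \<longleftrightarrow> z \<in> D \<and> y = (- \<i>) *\<^sub>C A z" for z y
    using V(2) unfolding has_generator_def by blast
  have isoU: "norm (U t x) = norm x" for t x using uU by (simp add: unitary_op_def)
  have "U t x = V t x" if x: "x \<in> D" for x
  proof -
    \<comment> \<open>The generator clause makes differentiability at 0 equivalent to membership in
      \<open>D\<close>, so invariance follows by applying the bounded operator
      \<open>V \<tau>\<close> to the difference quotient of \<open>x\<close>.\<close>
    have VD: "V \<tau> x \<in> D" for \<tau>
    proof -
      let ?q = "\<lambda>h. (1 / h) *\<^sub>R (V h x - x)"
      have "(?q \<longlongrightarrow> (- \<i>) *\<^sub>C A x) (at 0)" unfolding gV using x by blast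
      then have "((\<lambda>h. V \<tau> (?q h)) \<longlongrightarrow> V \<tau> ((- \<i>) *\<^sub>C A x)) (at 0)"
        by (rule bounded_linear.tendsto[OF lV])
      moreover have "V \<tau> (?q h) = (1 / h) *\<^sub>R (V h (V \<tau> x) - V \<tau> x)" for h
        unfolding bounded_linear.linear[OF lV, THEN linear_scale] bounded_linear.linear[OF lV, THEN linear_diff]
          U0(4)[symmetric] by (simp add: add.commute)
      ultimately have "((\<lambda>h. (1 / h) *\<^sub>R (V h (V \<tau> x) - V \<tau> x)) \<longlongrightarrow> V \<tau> ((- \<i>) *\<^sub>C A x)) (at 0)"
        by simp
      then show ?thesis unfolding gV by blast
    qed
    define f where "f \<tau> = U (t - \<tau>) (V \<tau> x)" for \<tau>
    have "(f has_derivative (\<lambda>h. 0)) (at \<tau>)" for \<tau>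
    proof -
      let ?v = "V \<tau> x"
      have "((\<lambda>h. (1 / h) *\<^sub>R (V h ?v - ?v) - (1 / h) *\<^sub>R (U h ?v - ?v)) \<longlongrightarrow>
          (- \<i>) *\<^sub>C A ?v - (- \<i>) *\<^sub>C A ?v) (at 0)"
        by (intro tendsto_diff) (use VD[of \<tau>] gU gV in blast)+
      then have "((\<lambda>h. norm ((1 / h) *\<^sub>R (V h ?v - ?v) - (1 / h) *\<^sub>R (U h ?v - ?v))) \<longlongrightarrow> 0) (at 0)"
        by (intro tendsto_norm_zero) simp
      moreover have "norm ((1 / h) *\<^sub>R (V h ?v - ?v) - (1 / h) *\<^sub>R (U h ?v - ?v))
          = norm (f (\<tau> + h) - f \<tau> - 0) / norm h" for h
      proof -
        \<comment> \<open>Both terms are brought under the same isometry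
          \<open>U (t - \<tau> - h)\<close>, which the norm then removes.\<close>
        have "f (\<tau> + h) - f \<tau> = U (t - \<tau> - h) (V h ?v) - U (t - \<tau> - h) (U h ?v)"
          unfolding f_def U0(3)[symmetric] by (simp add: U0(4)[symmetric] add.commute diff_diff_eq)
        also have "\<dots> = U (t - \<tau> - h) (V h ?v - U h ?v)"
          by (simp add: bounded_linear.linear[OF lU, THEN linear_diff])
        finally have "norm (f (\<tau> + h) - f \<tau>) = norm (V h ?v - U h ?v)" by (simp add: isoU)
        moreover have "(1 / h) *\<^sub>R (V h ?v - ?v) - (1 / h) *\<^sub>R (U h ?v - ?v) = (1 / h) *\<^sub>R (V h ?v - U h ?v)"
          by (simp add: algebra_simps)
        ultimately show ?thesis by simp
      qed
      ultimately have "((\<lambda>h. norm (f (\<tau> + h) - f \<tau> - 0) / norm h) \<longlongrightarrow> 0) (at 0)" by simp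
      then show ?thesis by (simp add: has_derivative_at)
    qed
    then have "\<And>\<tau>. (f has_derivative (\<lambda>h. 0)) (at \<tau> within UNIV)" by simp
    from has_derivative_zero_unique[OF convex_UNIV this UNIV_I UNIV_I]
    have "f 0 = f t" .
    then show ?thesis by (simp add: f_def U0)
  qed
  then show "U t x = V t x"
    by (rule clinear_contraction_eqI[OF cU cV]) (simp add: D)
qed

text \<open>At \<open>n = 0\<close> the truncated \<open>n - 1\<close> reads \<open>f 0\<close>
  again; the term is harmless because the sequences used satisfy \<open>a 0 = 0\<close>.\<close>

definition jacobi_expr :: "(nat \<Rightarrow> real) \<Rightarrow> (nat \<Rightarrow> real) \<Rightarrow> (nat \<Rightarrow> complex) \<Rightarrow> nat \<Rightarrow> complex" where
  "jacobi_expr a b f n = of_real (a n) * f (n - 1) + of_real (b n) * f n + of_real (a (Suc n)) * f (Suc n)"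

text \<open>Discrete Green identity: the diagonal terms cancel and the off-diagonal ones telescope
  to a Wronskian at the cut-off, which at \<open>M = 0\<close> vanishes with
  \<open>a 0\<close>.\<close>

lemma jacobi_summation_by_parts:
  assumes "a 0 = 0"
  shows "(\<Sum>n<M. jacobi_expr a b f n * g n) - (\<Sum>n<M. f n * jacobi_expr a b g n)
    = of_real (a M) * (f M * g (M - 1) - f (M - 1) * g M)"
proof (induction M)
  case 0
  show ?case using assms by simp
next
  case (Suc M)
  have "(\<Sum>n<Suc M. jacobi_expr a b f n * g n) - (\<Sum>n<Suc M. f n * jacobi_expr a b g n)
      = ((\<Sum>n<M. jacobi_expr a b f n * g n) - (\<Sum>n<M. f n * jacobi_expr a b g n))
        + (jacobi_expr a b f M * g M - f M * jacobi_expr a b g M)"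
    by simp
  also have "\<dots> = of_real (a (Suc M)) * (f (Suc M) * g (Suc M - 1) - f (Suc M - 1) * g (Suc M))"
    unfolding Suc.IH by (simp add: jacobi_expr_def algebra_simps)
  finally show ?case .
qed

text \<open>\<open>K n m t\<close> plays the matrix element of the group to be built. The bound
  \<open>B\<close> beats the growth of \<open>a\<close> uniformly on bounded times and thereby kills
  every Wronskian at the cut-off; this does the work of a criterion for self-adjointness on the
  maximal domain.\<close>

locale jacobi_kernel =
  fixes a b :: "nat \<Rightarrow> real" and K :: "nat \<Rightarrow> nat \<Rightarrow> real \<Rightarrow> complex"
  assumes a0: "a 0 = 0"
    and K_0: "K n m 0 = (if n = m then 1 else 0)"
    and K_deriv: "((\<lambda>t. K n m t) has_vector_derivative - \<i> * jacobi_expr a b (\<lambda>k. K k m t) n) (at t)"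
    and K_sym: "K n m t = K m n t"
    and K_cnj: "cnj (K n m t) = K n m (- t)"
    and K_decay: "\<exists>B. summable (\<lambda>n. (1 + \<bar>a n\<bar> + \<bar>a (Suc n)\<bar>) * B n) \<and> (\<forall>n t. \<bar>t\<bar> \<le> T \<longrightarrow> cmod (K n m t) \<le> B n)"
begin

text \<open>The shifted product with \<open>B (n - 1)\<close> is recorded because the Wronskian at
  \<open>M\<close> pairs the indices \<open>M\<close> and \<open>M - 1\<close>.\<close>

lemma decay_bound:
  assumes "0 \<le> T"
  obtains B where "\<And>n. 0 \<le> B n" "summable B" "(\<lambda>n. \<bar>a n\<bar> * B n) \<longlonglongrightarrow> 0"
    "(\<lambda>n. \<bar>a n\<bar> * B (n - 1)) \<longlonglongrightarrow> 0" "\<And>n t. \<bar>t\<bar> \<le> T \<Longrightarrow> cmod (K n m t) \<le> B n"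
proof -
  from K_decay[of T m] obtain B where BB: "summable (\<lambda>n. (1 + \<bar>a n\<bar> + \<bar>a (Suc n)\<bar>) * B n) \<and>
      (\<forall>n t. \<bar>t\<bar> \<le> T \<longrightarrow> cmod (K n m t) \<le> B n)" ..
  then have B: "summable (\<lambda>n. (1 + \<bar>a n\<bar> + \<bar>a (Suc n)\<bar>) * B n)"
      and le: "\<And>n t. \<bar>t\<bar> \<le> T \<Longrightarrow> cmod (K n m t) \<le> B n" by simp_all
  have pos: "0 \<le> B n" for n using order_trans[OF norm_ge_zero le[of 0 n]] assms by simp
  have lim: "(\<lambda>n. (1 + \<bar>a n\<bar> + \<bar>a (Suc n)\<bar>) * B n) \<longlonglongrightarrow> 0" by (rule summable_LIMSEQ_zero[OF B])
  have "summable B"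
    by (rule summable_comparison_test'[OF B]) (use pos in \<open>simp add: algebra_simps\<close>)
  moreover have "(\<lambda>n. \<bar>a n\<bar> * B n) \<longlonglongrightarrow> 0"
    by (rule tendsto_sandwich[OF _ _ tendsto_const lim]) (use pos in \<open>simp_all add: algebra_simps\<close>)
  moreover have "(\<lambda>n. \<bar>a (Suc n)\<bar> * B n) \<longlonglongrightarrow> 0"
    by (rule tendsto_sandwich[OF _ _ tendsto_const lim]) (use pos in \<open>simp_all add: algebra_simps\<close>)
  then have "(\<lambda>n. \<bar>a (Suc n)\<bar> * B (Suc n - 1)) \<longlonglongrightarrow> 0" by simp
  then have "(\<lambda>n. \<bar>a n\<bar> * B (n - 1)) \<longlonglongrightarrow> 0" by (rule LIMSEQ_imp_Suc)
  ultimately show ?thesis using that[of B] pos le by simp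
qed

text \<open>The partial sums of \<open>K j n (t - \<tau>) * K n m (s + \<tau>)\<close> have a
  Wronskian as \<tau>-derivative, bounded by \<open>e M\<close>. As \<open>M\<close> grows, their
  values at \<tau> = 0 and \<tau> = t merge, which is the group law in matrix form.\<close>

lemma K_sums: "(\<lambda>n. K j n t * K n m s) sums K j m (t + s)"
proof -
  define T where "T = \<bar>t\<bar> + \<bar>s\<bar>"
  have T: "0 \<le> T" by (simp add: T_def)
  obtain B where B: "\<And>n. 0 \<le> B n" "summable B" "(\<lambda>n. \<bar>a n\<bar> * B n) \<longlonglongrightarrow> 0"
    "(\<lambda>n. \<bar>a n\<bar> * B (n - 1)) \<longlonglongrightarrow> 0" "\<And>n t. \<bar>t\<bar> \<le> T \<Longrightarrow> cmod (K n j t) \<le> B n"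
    using decay_bound[OF T] by blast
  obtain C where C: "\<And>n. 0 \<le> C n" "summable C" "(\<lambda>n. \<bar>a n\<bar> * C n) \<longlonglongrightarrow> 0"
    "(\<lambda>n. \<bar>a n\<bar> * C (n - 1)) \<longlonglongrightarrow> 0" "\<And>n t. \<bar>t\<bar> \<le> T \<Longrightarrow> cmod (K n m t) \<le> C n"
    using decay_bound[OF T] by blast
  have Cb: "C n \<le> suminf C" for n
    using sum_le_suminf[OF C(2), of "{n}"] C(1) by simp
  define e where "e M = suminf C * (\<bar>a M\<bar> * B M + \<bar>a M\<bar> * B (M - 1))" for M
  define f where "f M \<tau> = (\<Sum>n<M. K j n (t - \<tau>) * K n m (s + \<tau>))" for M \<tau>
  have f': "(f M has_vector_derivative
      \<i> * of_real (a M) * (K M j (t - \<tau>) * K (M - 1) m (s + \<tau>) - K (M - 1) j (t - \<tau>) * K M m (s + \<tau>)))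
      (at \<tau>)" for M \<tau>
  proof -
    let ?F = "\<lambda>n. K n j (t - \<tau>)" and ?G = "\<lambda>n. K n m (s + \<tau>)"
    have d1: "((\<lambda>\<tau>. K n j (t - \<tau>)) has_vector_derivative \<i> * jacobi_expr a b ?F n) (at \<tau>)" for n
    proof -
      have "((\<lambda>\<tau>. t - \<tau>) has_vector_derivative -1) (at \<tau>)"
        by (auto intro!: derivative_eq_intros)
      from vector_diff_chain_at[OF this K_deriv[of n j "t - \<tau>"]] show ?thesis by (simp add: o_def)
    qed
    have d2: "((\<lambda>\<tau>. K n m (s + \<tau>)) has_vector_derivative - \<i> * jacobi_expr a b ?G n) (at \<tau>)" for n
    proof -
      have "((\<lambda>\<tau>. s + \<tau>) has_vector_derivative 1) (at \<tau>)"
        by (auto intro!: derivative_eq_intros)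
      from vector_diff_chain_at[OF this K_deriv[of n m "s + \<tau>"]] show ?thesis by (simp add: o_def)
    qed
    have "(f M has_vector_derivative
        (\<Sum>n<M. ?F n * (- \<i> * jacobi_expr a b ?G n) + (\<i> * jacobi_expr a b ?F n) * ?G n)) (at \<tau>)"
      unfolding f_def K_sym[of j]
      by (rule has_vector_derivative_sum) (rule has_vector_derivative_mult[OF d1 d2])
    also have "(\<Sum>n<M. ?F n * (- \<i> * jacobi_expr a b ?G n) + (\<i> * jacobi_expr a b ?F n) * ?G n)
        = \<i> * ((\<Sum>n<M. jacobi_expr a b ?F n * ?G n) - (\<Sum>n<M. ?F n * jacobi_expr a b ?G n))"
      unfolding sum_subtractf[symmetric] sum_distrib_left by (intro sum.cong) (auto simp: algebra_simps)
    finally show ?thesis unfolding jacobi_summation_by_parts[where a = a, OF a0] by (simp add: mult.assoc)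
  qed
  have "norm (f M t - f M 0) \<le> e M * norm (t - 0)" for M
  proof (rule differentiable_bound[where f' = "\<lambda>\<tau> h. h *\<^sub>R (\<i> * of_real (a M) * (K M j (t - \<tau>) * K (M - 1) m (s + \<tau>)
      - K (M - 1) j (t - \<tau>) * K M m (s + \<tau>)))" and S = "closed_segment 0 t"])
    fix \<tau> assume \<tau>: "\<tau> \<in> closed_segment 0 t"
    show "(f M has_derivative (\<lambda>h. h *\<^sub>R (\<i> * of_real (a M) * (K M j (t - \<tau>) * K (M - 1) m (s + \<tau>)
      - K (M - 1) j (t - \<tau>) * K M m (s + \<tau>))))) (at \<tau> within closed_segment 0 t)"
      using f'[of M \<tau>] by (simp add: has_vector_derivative_def has_derivative_at_withinI)
    have "\<bar>t - \<tau>\<bar> \<le> T" "\<bar>s + \<tau>\<bar> \<le> T"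
      using \<tau> by (auto simp: T_def closed_segment_eq_real_ivl split: if_splits)
    then have "cmod (K M j (t - \<tau>) * K (M - 1) m (s + \<tau>) - K (M - 1) j (t - \<tau>) * K M m (s + \<tau>))
        \<le> B M * suminf C + B (M - 1) * suminf C"
      by (intro order_trans[OF norm_triangle_ineq4] add_mono)
        (auto simp: norm_mult intro!: mult_mono B C Cb order_trans[OF C(5) Cb])
    then have "\<bar>a M\<bar> * cmod (K M j (t - \<tau>) * K (M - 1) m (s + \<tau>) - K (M - 1) j (t - \<tau>) * K M m (s + \<tau>))
        \<le> \<bar>a M\<bar> * (B M * suminf C + B (M - 1) * suminf C)"
      by (intro mult_left_mono) auto
    also have "\<dots> = e M" by (simp add: e_def algebra_simps)
    finally show "onorm (\<lambda>h. h *\<^sub>R (\<i> * of_real (a M) * (K M j (t - \<tau>) * K (M - 1) m (s + \<tau>)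
      - K (M - 1) j (t - \<tau>) * K M m (s + \<tau>)))) \<le> e M"
      by (intro onorm_bound) (auto simp: norm_mult e_def intro!: mult_nonneg_nonneg add_nonneg_nonneg B C suminf_nonneg mult_left_mono, simp add: mult.commute mult_left_mono)
  qed auto
  moreover have "e \<longlonglongrightarrow> suminf C * (0 + 0)" unfolding e_def by (intro tendsto_intros B)
  then have "(\<lambda>M. e M * norm (t - 0)) \<longlonglongrightarrow> 0 * norm (t - 0)" by (intro tendsto_mult tendsto_const) simp
  then have "(\<lambda>M. e M * norm (t - 0)) \<longlonglongrightarrow> 0" by simp
  ultimately have lim: "(\<lambda>M. f M t - f M 0) \<longlonglongrightarrow> 0"
    by (metis (no_types, lifting) Lim_null_comparison always_eventually)
  \<comment> \<open>At \<tau> = t the first factor is the identity matrix, so a single summand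
    survives once \<open>M\<close> exceeds \<open>j\<close>.\<close>
  have "f M t = K j m (t + s)" if "M > j" for M
  proof -
    have "f M t = (\<Sum>n<M. if n = j then K j m (s + t) else 0)"
      unfolding f_def by (intro sum.cong) (auto simp: K_0)
    then show ?thesis using that by (simp add: add.commute)
  qed
  then have "\<forall>\<^sub>F M in sequentially. f M t = K j m (t + s)"
    by (rule eventually_mono[OF eventually_gt_at_top[of j]])
  then have "(\<lambda>M. f M t) \<longlonglongrightarrow> K j m (t + s)" by (rule tendsto_eventually)
  from tendsto_diff[OF this lim] show ?thesis by (simp add: sums_def f_def)
qed

text \<open>The group law at times \<open>- t\<close> and \<open>t\<close>: conjugation reverses
  time, and symmetry turns a row into a column.\<close>

lemma K_orthonormal: "(\<lambda>n. cnj (K n i t) * K n m t) sums (if i = m then 1 else 0)"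
  using K_sums[of i "- t" m t] by (simp add: K_cnj K_sym[of i] K_0)

lemma K_summable_mult: "summable (\<lambda>m. K n m t * coord x m)"
proof -
  obtain B where B: "\<And>n. 0 \<le> B n" "summable B" "\<And>m s. \<bar>s\<bar> \<le> \<bar>t\<bar> \<Longrightarrow> cmod (K m n s) \<le> B m"
    using decay_bound[of "\<bar>t\<bar>" n] by (metis abs_ge_zero)
  show ?thesis
  proof (rule summable_comparison_test')
    show "summable (\<lambda>m. B m * norm x)" by (intro summable_mult2 B)
    show "norm (K n m t * coord x m) \<le> B m * norm x" for m
      unfolding norm_mult by (intro mult_mono norm_coord_le) (auto simp: K_sym[of n] intro: B)
  qed
qed

text \<open>Orthonormality of the columns gives the norm exactly when only \<open>M\<close> input
  coordinates are kept, because finite sums may be interchanged with the series over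
  \<open>n\<close>. For fixed \<open>L\<close> the limit in \<open>M\<close> preserves the
  inequality.\<close>

lemma sum_kernel_sq_le: "(\<Sum>n<L. (cmod (\<Sum>m. K n m t * coord x m))\<^sup>2) \<le> (norm x)\<^sup>2"
proof (rule LIMSEQ_le_const2)
  show "(\<lambda>M. \<Sum>n<L. (cmod (\<Sum>m<M. K n m t * coord x m))\<^sup>2)
      \<longlonglongrightarrow> (\<Sum>n<L. (cmod (\<Sum>m. K n m t * coord x m))\<^sup>2)"
    by (intro tendsto_sum tendsto_power tendsto_norm summable_LIMSEQ K_summable_mult)
  have "(\<Sum>n<L. (cmod (\<Sum>m<M. K n m t * coord x m))\<^sup>2) \<le> (norm x)\<^sup>2" for M
  proof -
    let ?S = "\<lambda>n. \<Sum>m<M. K n m t * coord x m"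
    have "(\<lambda>n. \<Sum>i<M. \<Sum>m<M. (cnj (coord x i) * coord x m) * (cnj (K n i t) * K n m t)) sums
        (\<Sum>i<M. \<Sum>m<M. (cnj (coord x i) * coord x m) * (if i = m then 1 else 0))"
      by (intro sums_sum sums_mult K_orthonormal)
    moreover have "(\<Sum>i<M. \<Sum>m<M. (cnj (coord x i) * coord x m) * (cnj (K n i t) * K n m t)) = cnj (?S n) * ?S n" for n
      unfolding cnj_sum sum_product by (intro sum.cong) (auto simp: algebra_simps)
    moreover have "(\<Sum>i<M. \<Sum>m<M. (cnj (coord x i) * coord x m) * (if i = m then 1 else 0)) = (\<Sum>i<M. cnj (coord x i) * coord x i)"
      by (intro sum.cong refl) (simp add: if_distrib sum.delta' cong: if_cong)
    ultimately have "(\<lambda>n. cnj (?S n) * ?S n) sums (\<Sum>i<M. cnj (coord x i) * coord x i)" by simp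
    then have "(\<lambda>n. complex_of_real ((cmod (?S n))\<^sup>2)) sums complex_of_real (\<Sum>i<M. (cmod (coord x i))\<^sup>2)"
      unfolding of_real_sum complex_norm_square by (simp only: mult.commute[of _ "cnj _"])
    then have *: "(\<lambda>n. (cmod (?S n))\<^sup>2) sums (\<Sum>i<M. (cmod (coord x i))\<^sup>2)" using sums_of_real_iff by blast
    have "(\<Sum>n<L. (cmod (?S n))\<^sup>2) \<le> (\<Sum>n. (cmod (?S n))\<^sup>2)"
      by (rule sum_le_suminf) (use * in \<open>auto simp: sums_iff\<close>)
    also have "\<dots> = (\<Sum>i<M. (cmod (coord x i))\<^sup>2)" using * by (simp add: sums_iff)
    also have "\<dots> \<le> (norm x)\<^sup>2" by (rule sum_coord_sq_le)
    finally show ?thesis .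
  qed
  then show "\<exists>N. \<forall>M\<ge>N. (\<Sum>n<L. (cmod (\<Sum>m<M. K n m t * coord x m))\<^sup>2) \<le> (norm x)\<^sup>2" by blast
qed

definition kernel_op :: "real \<Rightarrow> ell2 \<Rightarrow> ell2" where
  "kernel_op t x = Abs_ell2 (\<lambda>n. \<Sum>m. K n m t * coord x m)"

lemma coord_kernel_op: "coord (kernel_op t x) n = (\<Sum>m. K n m t * coord x m)"
proof -
  have "l2_seq (\<lambda>n. \<Sum>m. K n m t * coord x m)"
    unfolding l2_seq_def by (rule summableI_nonneg_bounded[OF _ sum_kernel_sq_le]) simp
  then show ?thesis by (simp add: kernel_op_def coord_Abs_ell2)
qed

lemma kernel_op_contraction: "clinear_contraction (kernel_op t)"
proof -
  have "kernel_op t (x + y) = kernel_op t x + kernel_op t y" for x y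
    by (rule ell2_eqI) (simp add: coord_kernel_op coord_simps distrib_left suminf_add[OF K_summable_mult K_summable_mult])
  moreover have "kernel_op t (c *\<^sub>C x) = c *\<^sub>C kernel_op t x" for c x
    by (rule ell2_eqI)
      (simp add: coord_kernel_op coord_simps mult.left_commute[of _ c] suminf_mult[OF K_summable_mult])
  moreover have "norm (kernel_op t x) \<le> norm x" for x
  proof (rule power2_le_imp_le)
    show "(norm (kernel_op t x))\<^sup>2 \<le> (norm x)\<^sup>2"
      unfolding norm_ell2_sq[of "kernel_op t x"]
      by (rule suminf_le_const[OF summable_coord_sq]) (simp add: coord_kernel_op sum_kernel_sq_le)
  qed simp
  ultimately show ?thesis by (simp add: clinear_contraction_def)
qed

lemma coord_kernel_op_basis: "coord (kernel_op t (basis m)) n = K n m t"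
proof -
  have "(\<lambda>k. K n k t * coord (basis m) k) = (\<lambda>k. if k = m then K n k t else 0)"
    by (auto simp: coord_basis)
  then show ?thesis
    unfolding coord_kernel_op using sums_single[of m "\<lambda>k. K n k t"] by (simp add: sums_iff)
qed

lemma kernel_op_add: "kernel_op (s + t) x = kernel_op s (kernel_op t x)"
proof (rule clinear_contraction_eqI[where F = "kernel_op (s + t)" and G = "\<lambda>x. kernel_op s (kernel_op t x)"])
  show "kernel_op (s + t) (basis m) = kernel_op s (kernel_op t (basis m))" for m
    by (rule ell2_eqI)
      (simp add: coord_kernel_op_basis coord_kernel_op[of s "kernel_op t (basis m)"] sums_unique[OF K_sums])
qed (rule kernel_op_contraction, rule clinear_contraction_comp[OF kernel_op_contraction kernel_op_contraction])

lemma kernel_op_0: "kernel_op 0 x = x"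
proof (rule clinear_contraction_eqI[where F = "kernel_op 0" and G = "\<lambda>x. x"])
  show "kernel_op 0 (basis m) = basis m" for m
    by (rule ell2_eqI) (simp add: coord_kernel_op_basis K_0 coord_basis)
qed (rule kernel_op_contraction, simp add: clinear_contraction_def)

text \<open>\<open>kernel_op (- t)\<close> is a contraction inverting \<open>kernel_op t\<close>, so
  no norm can be lost.\<close>

lemma norm_kernel_op: "norm (kernel_op t x) = norm x"
proof (rule antisym)
  have c: "norm (kernel_op s y) \<le> norm y" for s y
    using kernel_op_contraction by (simp add: clinear_contraction_def)
  then show "norm (kernel_op t x) \<le> norm x" .
  show "norm x \<le> norm (kernel_op t x)"
    using c[of "- t" "kernel_op t x"] by (simp add: kernel_op_add[symmetric] kernel_op_0)
qed

lemma isCont_K: "isCont (K n m) t"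
  using K_deriv[of n m t] by (rule has_vector_derivative_continuous)


lemma kernel_op_diff: "kernel_op t (x - y) = kernel_op t x - kernel_op t y"
  by (rule linear_diff[OF bounded_linear.linear[OF bounded_linear_contraction[OF kernel_op_contraction]]])

lemma norm_kernel_op_diff: "norm (kernel_op t x - kernel_op s x) = norm (kernel_op (t - s) x - x)"
proof -
  have "kernel_op t x - kernel_op s x = kernel_op s (kernel_op (t - s) x - x)"
    by (simp add: kernel_op_diff kernel_op_add[symmetric])
  then show ?thesis by (simp add: norm_kernel_op)
qed

text \<open>The squared distance of the moved basis vector from its start is
  \<open>2 - 2 Re (K m m h)\<close>, so strong continuity reduces to continuity of a scalar.\<close>

lemma continuous_kernel_op_basis: "continuous_on UNIV (\<lambda>t. kernel_op t (basis m))"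
proof -
  have *: "norm (kernel_op h (basis m) - basis m) = sqrt (2 - 2 * Re (K m m h))" for h
  proof -
    have "(\<lambda>n. inner (coord (kernel_op h (basis m)) n) (coord (basis m) n)) = (\<lambda>n. if n = m then Re (K n m h) else 0)"
      by (auto simp: coord_kernel_op_basis coord_basis inner_complex_def)
    then have "inner (kernel_op h (basis m)) (basis m) = Re (K m m h)"
      unfolding inner_ell2_def using sums_single[of m "\<lambda>n. Re (K n m h)"] by (simp add: sums_iff)
    moreover have "(norm (x - y))\<^sup>2 = (norm x)\<^sup>2 + (norm y)\<^sup>2 - 2 * inner x y" for x y :: ell2
      by (simp add: power2_norm_eq_inner inner_diff_left inner_diff_right inner_commute)
    ultimately have "(norm (kernel_op h (basis m) - basis m))\<^sup>2 = 2 - 2 * Re (K m m h)"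
      by (simp add: norm_kernel_op)
    then show ?thesis by (metis norm_ge_zero real_sqrt_unique)
  qed
  have "isCont (\<lambda>t. kernel_op t (basis m)) t" for t
  proof -
    have "((\<lambda>h. sqrt (2 - 2 * Re (K m m (h - t)))) \<longlongrightarrow> sqrt (2 - 2 * Re (K m m (t - t)))) (at t)"
      by (intro tendsto_intros isCont_tendsto_compose[OF isCont_K])
    then have "((\<lambda>h. norm (kernel_op h (basis m) - kernel_op t (basis m))) \<longlongrightarrow> 0) (at t)"
      by (simp add: norm_kernel_op_diff * K_0)
    then have "((\<lambda>h. kernel_op h (basis m) - kernel_op t (basis m)) \<longlongrightarrow> 0) (at t)"
      by (rule tendsto_norm_zero_cancel)
    then show ?thesis unfolding isCont_def by (rule LIM_zero_cancel)
  qed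
  then show ?thesis by (simp add: continuous_at_imp_continuous_on)
qed

text \<open>Isometry makes the approximation by truncations uniform in \<open>t\<close>, and a
  uniform limit of continuous curves is continuous.\<close>

lemma continuous_kernel_op: "continuous_on UNIV (\<lambda>t. kernel_op t x)"
proof (rule uniform_limit_theorem)
  show "\<forall>\<^sub>F N in sequentially. continuous_on UNIV (\<lambda>t. kernel_op t (trunc N x))"
    unfolding clinear_contraction_trunc[OF kernel_op_contraction]
    by (intro always_eventually allI continuous_on_sum
        bounded_linear.continuous_on[OF bounded_linear_scaleC continuous_kernel_op_basis])
  show "uniform_limit UNIV (\<lambda>N t. kernel_op t (trunc N x)) (\<lambda>t. kernel_op t x) sequentially"
  proof (rule uniform_limitI)
    fix e :: real assume "0 < e"
    then have "\<forall>\<^sub>F N in sequentially. dist (trunc N x) x < e"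
      using trunc_tendsto[of x] by (simp add: tendsto_iff)
    then show "\<forall>\<^sub>F N in sequentially. \<forall>t\<in>UNIV. dist (kernel_op t (trunc N x)) (kernel_op t x) < e"
      by (rule eventually_mono) (simp add: dist_norm kernel_op_diff[symmetric] norm_kernel_op)
  qed
qed simp

lemma unitary_group_kernel_op: "unitary_group kernel_op"
proof -
  have "surj (kernel_op t)" for t
    by (rule surjI[of _ "kernel_op (- t)"]) (simp add: kernel_op_add[symmetric] kernel_op_0)
  then show ?thesis
    using kernel_op_contraction
    by (simp add: unitary_group_def unitary_op_def clinear_contraction_def norm_kernel_op kernel_op_0
        kernel_op_add continuous_kernel_op)
qed

text \<open>Differentiating the series termwise puts the Jacobi expression on the kernel; summation
  by parts moves it to \<open>x\<close>, where it is square summable by assumption. The error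
  consists of a tail and a Wronskian, both small uniformly for times in a ball around
  \<open>t\<close>.\<close>

lemma coord_kernel_op_deriv:
  assumes x: "l2_seq (jacobi_expr a b (coord x))" and y: "coord y = (\<lambda>n. - \<i> * jacobi_expr a b (coord x) n)"
  shows "((\<lambda>s. coord (kernel_op s x) n) has_vector_derivative coord (kernel_op t y) n) (at t)"
proof -
  define T where "T = \<bar>t\<bar> + 1"
  obtain B where B: "\<And>k. 0 \<le> B k" "summable B" "(\<lambda>k. \<bar>a k\<bar> * B k) \<longlonglongrightarrow> 0"
    "(\<lambda>k. \<bar>a k\<bar> * B (k - 1)) \<longlonglongrightarrow> 0" "\<And>k s. \<bar>s\<bar> \<le> T \<Longrightarrow> cmod (K k n s) \<le> B k"
    using decay_bound[of T n] by (auto simp: T_def)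
  define f where "f M s = (\<Sum>m<M. K m n s * coord x m)" for M s
  define f' where "f' M s = - \<i> * (\<Sum>m<M. jacobi_expr a b (\<lambda>k. K k n s) m * coord x m)" for M s
  \<comment> \<open>The first summand bounds the tail of the series for \<open>y\<close>, the second
    the Wronskian at the cut-off \<open>M\<close>.\<close>
  define r where "r M = (\<Sum>m. B (m + M)) * norm y + (\<bar>a M\<bar> * B M + \<bar>a M\<bar> * B (M - 1)) * norm x" for M
  have S: "convex (ball t 1)" by simp
  have bnd: "cmod (f' M s - coord (kernel_op s y) n) \<le> r M" if "s \<in> ball t 1" for M s
  proof -
    have s: "\<bar>s\<bar> \<le> T" using that by (auto simp: T_def dist_real_def)
    let ?g = "\<lambda>m. K m n s * coord y m"
    have sy: "summable ?g" using K_summable_mult[of n s y] by (simp add: K_sym[of n])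
    have fA: "f' M s = (\<Sum>m<M. ?g m) - \<i> * (of_real (a M) * (K M n s * coord x (M - 1) - K (M - 1) n s * coord x M))"
    proof -
      have "(\<Sum>m<M. ?g m) = - \<i> * (\<Sum>m<M. K m n s * jacobi_expr a b (coord x) m)"
        unfolding y sum_distrib_left by (intro sum.cong refl) (simp add: mult.left_commute)
      then show ?thesis
        unfolding f'_def jacobi_summation_by_parts[where a = a and b = b and f = "\<lambda>k. K k n s" and g = "coord x", OF a0, symmetric]
        by (simp add: right_diff_distrib)
    qed
    have fB: "coord (kernel_op s y) n = (\<Sum>m. ?g (m + M)) + (\<Sum>m<M. ?g m)"
      unfolding coord_kernel_op K_sym[of n] by (rule suminf_split_initial_segment[OF sy])
    have arith: "(S - Z) - (R + S) = - R - Z" for S Z R :: complex by simp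
    have "cmod (f' M s - coord (kernel_op s y) n) = cmod (- (\<Sum>m. ?g (m + M))
        - \<i> * (of_real (a M) * (K M n s * coord x (M - 1) - K (M - 1) n s * coord x M)))"
      unfolding fA fB arith ..
    also have "\<dots> \<le> cmod (\<Sum>m. ?g (m + M))
        + \<bar>a M\<bar> * cmod (K M n s * coord x (M - 1) - K (M - 1) n s * coord x M)"
      by (intro order_trans[OF norm_triangle_ineq4]) (simp add: norm_mult)
    also have "\<dots> \<le> (\<Sum>m. B (m + M)) * norm y + \<bar>a M\<bar> * (B M * norm x + B (M - 1) * norm x)"
    proof (intro add_mono mult_left_mono)
      have sB: "summable (\<lambda>m. B (m + M) * norm y)"
        by (intro summable_mult2 summable_ignore_initial_segment B)
      have le: "norm (?g m) \<le> B m * norm y" for m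
        unfolding norm_mult using s by (intro mult_mono norm_coord_le) (auto intro: B)
      have sn: "summable (\<lambda>m. norm (?g (m + M)))"
        by (rule summable_comparison_test'[OF sB]) (use le in simp)
      have "cmod (\<Sum>m. ?g (m + M)) \<le> (\<Sum>m. norm (?g (m + M)))" by (rule summable_norm[OF sn])
      also have "\<dots> \<le> (\<Sum>m. B (m + M) * norm y)" by (rule suminf_le[OF le sn sB])
      also have "\<dots> = (\<Sum>m. B (m + M)) * norm y"
        by (rule suminf_mult2[symmetric]) (intro summable_ignore_initial_segment B)
      finally show "cmod (\<Sum>m. ?g (m + M)) \<le> (\<Sum>m. B (m + M)) * norm y" .
      show "cmod (K M n s * coord x (M - 1) - K (M - 1) n s * coord x M) \<le> B M * norm x + B (M - 1) * norm x"
        using s by (intro order_trans[OF norm_triangle_ineq4] add_mono)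
          (auto simp: norm_mult intro!: mult_mono norm_coord_le B)
    qed simp
    also have "\<dots> = r M" by (simp add: r_def algebra_simps)
    finally show ?thesis .
  qed
  have r0: "r \<longlonglongrightarrow> 0"
  proof -
    have "(\<lambda>M. \<Sum>m. B (m + M)) \<longlonglongrightarrow> 0" by (rule suminf_exist_split2[OF B(2)])
    then have "r \<longlonglongrightarrow> 0 * norm y + (0 + 0) * norm x" unfolding r_def by (intro tendsto_intros B)
    then show ?thesis by simp
  qed
  have "\<exists>g. \<forall>s\<in>ball t 1. (\<lambda>M. f M s) \<longlonglongrightarrow> g s \<and>
      (g has_derivative (\<lambda>h. h *\<^sub>R coord (kernel_op s y) n)) (at s within ball t 1)"
  proof (rule has_derivative_sequence[OF S, where f' = "\<lambda>M s h. h *\<^sub>R f' M s"])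
    show "(f M has_derivative (\<lambda>h. h *\<^sub>R f' M s)) (at s within ball t 1)" if "s \<in> ball t 1" for M s
    proof -
      have "(f M has_vector_derivative (\<Sum>m<M. (- \<i> * jacobi_expr a b (\<lambda>k. K k n s) m) * coord x m)) (at s)"
        unfolding f_def by (rule has_vector_derivative_sum) (rule has_vector_derivative_mult_left[OF K_deriv])
      then show ?thesis
        by (simp add: f'_def has_vector_derivative_def sum_distrib_left mult.assoc sum_negf has_derivative_at_withinI)
    qed
    show "\<forall>\<^sub>F M in sequentially. \<forall>s\<in>ball t 1. \<forall>h. norm (h *\<^sub>R f' M s - h *\<^sub>R coord (kernel_op s y) n) \<le> e * norm h"
      if "0 < e" for e
    proof -
      have "\<forall>\<^sub>F M in sequentially. r M < e" using r0 that by (rule order_tendstoD)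
      then show ?thesis
      proof (rule eventually_mono, intro ballI allI)
        fix M s h assume "r M < e" "s \<in> ball t 1"
        with bnd[of s M] have "cmod (f' M s - coord (kernel_op s y) n) \<le> e" by linarith
        then show "norm (h *\<^sub>R f' M s - h *\<^sub>R coord (kernel_op s y) n) \<le> e * norm h"
          unfolding scaleR_diff_right[symmetric] norm_scaleR by (subst mult.commute) (simp add: mult_right_mono)
      qed
    qed
    show "t \<in> ball t 1" by simp
    show "(\<lambda>M. f M t) \<longlonglongrightarrow> coord (kernel_op t x) n"
      unfolding f_def coord_kernel_op K_sym[of n] by (rule summable_LIMSEQ) (use K_summable_mult[of n t x] in \<open>simp add: K_sym[of n]\<close>)
  qed
  then obtain g where gg: "\<forall>s\<in>ball t 1. (\<lambda>M. f M s) \<longlonglongrightarrow> g s \<and>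
      (g has_derivative (\<lambda>h. h *\<^sub>R coord (kernel_op s y) n)) (at s within ball t 1)" ..
  have g: "\<And>s. s \<in> ball t 1 \<Longrightarrow> (\<lambda>M. f M s) \<longlonglongrightarrow> g s"
      "\<And>s. s \<in> ball t 1 \<Longrightarrow> (g has_derivative (\<lambda>h. h *\<^sub>R coord (kernel_op s y) n)) (at s within ball t 1)"
    using gg by blast+
  have gs: "g s = coord (kernel_op s x) n" if "s \<in> ball t 1" for s
  proof (rule LIMSEQ_unique[OF g(1)[OF that]])
    show "(\<lambda>M. f M s) \<longlonglongrightarrow> coord (kernel_op s x) n"
      unfolding f_def coord_kernel_op K_sym[of n] by (rule summable_LIMSEQ) (use K_summable_mult[of n s x] in \<open>simp add: K_sym[of n]\<close>)
  qed
  have "(g has_derivative (\<lambda>h. h *\<^sub>R coord (kernel_op t y) n)) (at t)"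
    using g(2)[of t] by (simp add: at_within_open[OF _ open_ball])
  then have "((\<lambda>s. coord (kernel_op s x) n) has_derivative (\<lambda>h. h *\<^sub>R coord (kernel_op t y) n)) (at t)"
    by (rule has_derivative_transform_within_open[where s = "ball t 1"]) (auto simp: gs)
  then show ?thesis by (simp add: has_vector_derivative_def)
qed

text \<open>Differentiability is known only coordinate by coordinate. A bound in norm results from
  testing the remainder \<open>d\<close> against its own truncation: the mean value inequality
  applies to that scalar function, and one factor \<open>norm (trunc L d)\<close> cancels.\<close>

lemma kernel_op_difference_bound:
  assumes x: "l2_seq (jacobi_expr a b (coord x))" and y: "coord y = (\<lambda>n. - \<i> * jacobi_expr a b (coord x) n)"
    and e: "\<And>s. \<bar>s\<bar> \<le> \<bar>t\<bar> \<Longrightarrow> norm (kernel_op s y - y) \<le> e"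
  shows "norm (kernel_op t x - x - t *\<^sub>R y) \<le> e * \<bar>t\<bar>"
proof -
  define d where "d = kernel_op t x - x - t *\<^sub>R y"
  have e0: "0 \<le> e" using e[of 0] by (simp add: kernel_op_0)
  have "norm (trunc L d) \<le> e * \<bar>t\<bar>" for L
  proof -
    define f where "f s = (\<Sum>n<L. cnj (coord d n) * (coord (kernel_op s x) n - s *\<^sub>R coord y n))" for s
    define f' where "f' s = (\<Sum>n<L. cnj (coord d n) * (coord (kernel_op s y) n - coord y n))" for s
    have f': "(f has_vector_derivative f' s) (at s)" for s
      unfolding f_def f'_def
      by (rule has_vector_derivative_sum, rule has_vector_derivative_mult_right,
          rule has_vector_derivative_diff[OF coord_kernel_op_deriv[OF x y]])
        (auto intro!: derivative_eq_intros)
    have "norm (f t - f 0) \<le> (norm (trunc L d) * e) * norm (t - 0)"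
    proof (rule differentiable_bound[where f' = "\<lambda>s h. h *\<^sub>R f' s" and S = "closed_segment 0 t"])
      fix s assume s: "s \<in> closed_segment 0 t"
      then have s': "\<bar>s\<bar> \<le> \<bar>t\<bar>" by (auto simp: closed_segment_eq_real_ivl split: if_splits)
      show "(f has_derivative (\<lambda>h. h *\<^sub>R f' s)) (at s within closed_segment 0 t)"
        using f'[of s] by (simp add: has_vector_derivative_def has_derivative_at_withinI)
      have "cmod (f' s) \<le> (\<Sum>n<L. cmod (coord d n) * cmod (coord (kernel_op s y - y) n))"
        unfolding f'_def by (intro order_trans[OF norm_sum] sum_mono) (simp add: norm_mult coord_simps)
      also have "\<dots> = (\<Sum>n<L. cmod (coord (trunc L d) n) * cmod (coord (kernel_op s y - y) n))"
        by (intro sum.cong) (auto simp: coord_trunc)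
      also have "\<dots> \<le> (\<Sum>n. cmod (coord (trunc L d) n) * cmod (coord (kernel_op s y - y) n))"
        by (rule sum_le_suminf[OF sum_mult_coord_le(1)]) auto
      also have "\<dots> \<le> norm (trunc L d) * norm (kernel_op s y - y)" by (rule sum_mult_coord_le)
      also have "\<dots> \<le> norm (trunc L d) * e" by (intro mult_left_mono e s') auto
      finally have "cmod (f' s) \<le> norm (trunc L d) * e" .
      then have "norm (h *\<^sub>R f' s) \<le> (norm (trunc L d) * e) * norm h" for h
        by (simp add: mult.commute[of _ "\<bar>h\<bar>"] mult_left_mono)
      then show "onorm (\<lambda>h. h *\<^sub>R f' s) \<le> norm (trunc L d) * e"
        using e0 by (intro onorm_bound) auto
    qed auto
    moreover have "f t - f 0 = of_real ((norm (trunc L d))\<^sup>2)"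
    proof -
      have "f t - f 0 = (\<Sum>n<L. cnj (coord d n) * coord d n)"
        unfolding f_def sum_subtractf[symmetric]
        by (intro sum.cong refl) (simp add: d_def coord_simps kernel_op_0 algebra_simps)
      then show ?thesis
        unfolding norm_trunc_sq of_real_sum complex_norm_square by (simp only: mult.commute[of "cnj _"])
    qed
    ultimately have *: "(norm (trunc L d))\<^sup>2 \<le> norm (trunc L d) * (e * \<bar>t\<bar>)"
      by (simp del: of_real_power add: norm_of_real mult.assoc)
    show ?thesis
    proof (cases "norm (trunc L d) = 0")
      case True then show ?thesis using e0 by simp
    next
      case False
      then have "0 < norm (trunc L d)" by simp
      then show ?thesis using * by (simp add: power2_eq_square)
    qed
  qed
  moreover have "(\<lambda>L. norm (trunc L d)) \<longlonglongrightarrow> norm d" by (intro tendsto_norm trunc_tendsto)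
  ultimately show ?thesis unfolding d_def[symmetric] by (intro LIMSEQ_le_const2) auto
qed

lemma kernel_op_has_limit:
  assumes x: "l2_seq (jacobi_expr a b (coord x))"
  shows "((\<lambda>t. (1 / t) *\<^sub>R (kernel_op t x - x)) \<longlongrightarrow> (- \<i>) *\<^sub>C Abs_ell2 (jacobi_expr a b (coord x))) (at 0)"
proof -
  define y where "y = (- \<i>) *\<^sub>C Abs_ell2 (jacobi_expr a b (coord x))"
  have y: "coord y = (\<lambda>n. - \<i> * jacobi_expr a b (coord x) n)"
    by (simp add: y_def coord_simps coord_Abs_ell2[OF x])
  show ?thesis unfolding y_def[symmetric]
  proof (rule LIM_I)
    fix e :: real assume "0 < e"
    have "isCont (\<lambda>t. kernel_op t y) 0"
      using continuous_kernel_op by (simp add: continuous_on_eq_continuous_at)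
    then obtain \<delta> where "0 < \<delta>" and \<delta>: "\<And>s. \<bar>s\<bar> < \<delta> \<Longrightarrow> norm (kernel_op s y - y) < e / 2"
      unfolding continuous_at_eps_delta using \<open>0 < e\<close>
      by (metis half_gt_zero dist_norm diff_zero kernel_op_0 real_norm_def)
    have "norm ((1 / t) *\<^sub>R (kernel_op t x - x) - y) < e" if t: "t \<noteq> 0" "\<bar>t\<bar> < \<delta>" for t
    proof -
      have "norm (kernel_op t x - x - t *\<^sub>R y) \<le> e / 2 * \<bar>t\<bar>"
        by (rule kernel_op_difference_bound[OF x y]) (use \<delta> t in \<open>force intro: less_imp_le\<close>)
      moreover have "(1 / t) *\<^sub>R (kernel_op t x - x) - y = (1 / t) *\<^sub>R (kernel_op t x - x - t *\<^sub>R y)"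
        using t by (simp add: algebra_simps)
      ultimately have "norm ((1 / t) *\<^sub>R (kernel_op t x - x) - y) \<le> \<bar>1 / t\<bar> * (e / 2 * \<bar>t\<bar>)"
        by (simp only: norm_scaleR real_norm_def) (intro mult_left_mono, simp_all)
      also have "\<dots> = e / 2" using t by simp
      finally have "norm ((1 / t) *\<^sub>R (kernel_op t x - x) - y) \<le> e / 2" .
      then show ?thesis using \<open>0 < e\<close> by simp
    qed
    with \<open>0 < \<delta>\<close> show "\<exists>s>0. \<forall>t. t \<noteq> 0 \<and> norm (t - 0) < s \<longrightarrow> norm ((1 / t) *\<^sub>R (kernel_op t x - x) - y) < e"
      by auto
  qed
qed

lemma jacobi_expr_basis:
  "jacobi_expr a b (coord (basis j)) m = (if m = Suc j then of_real (a (Suc j)) else 0)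
     + (if m = j then of_real (b j) else 0) + (if Suc m = j then of_real (a j) else 0)"
  using a0 by (cases m) (auto simp: jacobi_expr_def coord_basis)

lemma l2_seq_jacobi_expr_basis: "l2_seq (jacobi_expr a b (coord (basis j)))"
  by (rule l2_seq_finite_support[of "j + 2"]) (auto simp: jacobi_expr_basis)

text \<open>The Jacobi matrix is symmetric, so its \<open>j\<close>-th column paired with
  \<open>x\<close> is its \<open>j\<close>-th row applied to \<open>x\<close>; this needs no domain
  condition on \<open>x\<close>.\<close>

lemma pairing_jacobi_expr_basis:
  "pairing (Abs_ell2 (jacobi_expr a b (coord (basis j)))) x = jacobi_expr a b (coord x) j"
proof -
  have 1: "(\<lambda>m. if m = Suc j then of_real (a (Suc j)) * coord x m else 0) sums (of_real (a (Suc j)) * coord x (Suc j))"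
    using sums_single[of "Suc j" "\<lambda>m. of_real (a (Suc j)) * coord x m"] by simp
  have 2: "(\<lambda>m. if m = j then of_real (b j) * coord x m else 0) sums (of_real (b j) * coord x j)"
    using sums_single[of j "\<lambda>m. of_real (b j) * coord x m"] by simp
  have 3: "(\<lambda>m. if Suc m = j then of_real (a j) * coord x m else 0) sums (of_real (a j) * coord x (j - 1))"
  proof (cases j)
    case 0
    then show ?thesis by (simp add: a0)
  next
    case (Suc k)
    then show ?thesis using sums_single[of k "\<lambda>m. of_real (a j) * coord x m"] by simp
  qed
  have "(\<lambda>m. jacobi_expr a b (coord (basis j)) m * coord x m) sums
      (of_real (a (Suc j)) * coord x (Suc j) + of_real (b j) * coord x j + of_real (a j) * coord x (j - 1))"
    using sums_add[OF sums_add[OF 1 2] 3]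
    by (rule sums_cong[THEN iffD1, rotated]) (auto simp: jacobi_expr_basis)
  then show ?thesis
    unfolding pairing_def coord_Abs_ell2[OF l2_seq_jacobi_expr_basis] by (simp add: sums_iff jacobi_expr_def)
qed

text \<open>The point is that the domain is not larger. If the strong derivative \<open>y\<close>
  exists at \<open>x\<close>, pairing with \<open>basis n\<close> transfers the group to
  \<open>basis n\<close>, where the derivative is known. All coordinates of \<open>y\<close> are
  identified in this way, and membership of \<open>y\<close> in \<open>ell2\<close> places
  \<open>x\<close> in the maximal domain.\<close>

lemma has_generator_kernel_op:
  "has_generator kernel_op {x. l2_seq (jacobi_expr a b (coord x))} (\<lambda>x. Abs_ell2 (jacobi_expr a b (coord x)))"
  unfolding has_generator_def
proof (intro allI iffI)
  fix x y
  assume lim: "((\<lambda>t. (1 / t) *\<^sub>R (kernel_op t x - x)) \<longlongrightarrow> y) (at 0)"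
  have y: "coord y n = - \<i> * jacobi_expr a b (coord x) n" for n
  proof -
    let ?v = "(- \<i>) *\<^sub>C Abs_ell2 (jacobi_expr a b (coord (basis n)))"
    have "((\<lambda>t. pairing ((1 / t) *\<^sub>R (kernel_op t (basis n) - basis n)) x) \<longlongrightarrow> pairing ?v x) (at 0)"
      by (rule bounded_linear.tendsto[OF bounded_linear_pairing kernel_op_has_limit[OF l2_seq_jacobi_expr_basis]])
    moreover have "pairing ((1 / t) *\<^sub>R (kernel_op t (basis n) - basis n)) x = coord ((1 / t) *\<^sub>R (kernel_op t x - x)) n" for t
    proof -
      have "pairing (kernel_op t (basis n)) x = coord (kernel_op t x) n"
        unfolding pairing_def coord_kernel_op_basis unfolding coord_kernel_op by (simp add: K_sym[of n])
      moreover have "pairing (basis n) x = coord x n"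
        unfolding pairing_def coord_basis using sums_single[of n "coord x"]
        by (simp add: sums_iff if_distribR if_distrib[of "\<lambda>c. c * _"] cong: if_cong)
      moreover have "pairing (c *\<^sub>R (v - w)) x = c *\<^sub>R (pairing v x - pairing w x)" for c v w
        by (simp add: linear_scale[OF bounded_linear.linear[OF bounded_linear_pairing]]
            linear_diff[OF bounded_linear.linear[OF bounded_linear_pairing]])
      ultimately show ?thesis by (simp add: coord_simps)
    qed
    moreover have "((\<lambda>t. coord ((1 / t) *\<^sub>R (kernel_op t x - x)) n) \<longlongrightarrow> coord y n) (at 0)"
      by (rule bounded_linear.tendsto[OF bounded_linear_coord lim])
    ultimately have "coord y n = pairing ?v x"
      using tendsto_unique[of "at (0::real)"] by auto
    also have "\<dots> = - \<i> * pairing (Abs_ell2 (jacobi_expr a b (coord (basis n)))) x"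
      unfolding pairing_def coord_simps mult.assoc by (rule suminf_mult) (rule summable_pairing)
    finally show ?thesis by (simp only: pairing_jacobi_expr_basis)
  qed
  then have "jacobi_expr a b (coord x) = (\<lambda>n. \<i> * coord y n)" by auto
  then have l2: "l2_seq (jacobi_expr a b (coord x))" using l2_seq_cmult[of "coord y" \<i>] by simp
  moreover have "y = (- \<i>) *\<^sub>C Abs_ell2 (jacobi_expr a b (coord x))"
    by (rule ell2_eqI) (simp add: coord_simps coord_Abs_ell2[OF l2] y)
  ultimately show "x \<in> {x. l2_seq (jacobi_expr a b (coord x))} \<and> y = (- \<i>) *\<^sub>C Abs_ell2 (jacobi_expr a b (coord x))"
    by simp
qed (use kernel_op_has_limit in auto)

lemma exp_group_eq_kernel_op:
  "exp_group {x. l2_seq (jacobi_expr a b (coord x))} (\<lambda>x. Abs_ell2 (jacobi_expr a b (coord x))) = kernel_op"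
  unfolding exp_group_def
proof (rule the_equality)
  show "unitary_group kernel_op \<and> has_generator kernel_op {x. l2_seq (jacobi_expr a b (coord x))}
      (\<lambda>x. Abs_ell2 (jacobi_expr a b (coord x)))"
    using unitary_group_kernel_op has_generator_kernel_op by simp
next
  fix V
  assume "unitary_group V \<and> has_generator V {x. l2_seq (jacobi_expr a b (coord x))}
      (\<lambda>x. Abs_ell2 (jacobi_expr a b (coord x)))"
  then show "V = kernel_op"
    using has_generator_unique[OF _ _ unitary_group_kernel_op has_generator_kernel_op]
      l2_seq_jacobi_expr_basis by simp
qed

end

subsection \<open>The kernel of the Laguerre group\<close>

text \<open>\<open>lag_poly s n m t\<close> is \<open>t\<^bsup>n+m\<^esup> / (n! m!)\<close> times the terminating hypergeometric series
  \<open>F(-n, -m; s; -1/t\<^sup>2)\<close>, cleared of negative powers of \<open>t\<close>.\<close>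

definition lag_coeff :: "real \<Rightarrow> nat \<Rightarrow> nat \<Rightarrow> nat \<Rightarrow> real" where
  "lag_coeff s n m k = (if k \<le> n \<and> k \<le> m
     then (- 1) ^ k / (pochhammer s k * fact k * fact (n - k) * fact (m - k)) else 0)"

definition lag_poly :: "real \<Rightarrow> nat \<Rightarrow> nat \<Rightarrow> real \<Rightarrow> real" where
  "lag_poly s n m t = (\<Sum>k\<le>n. lag_coeff s n m k * t ^ (n + m - 2 * k))"

definition lag_norm :: "real \<Rightarrow> nat \<Rightarrow> nat \<Rightarrow> real" where
  "lag_norm s n m = sqrt (pochhammer s n * pochhammer s m * fact n * fact m)"

definition lag_fun :: "real \<Rightarrow> nat \<Rightarrow> nat \<Rightarrow> real \<Rightarrow> real" where
  "lag_fun \<alpha> n m t = lag_norm (1 + \<alpha>) n m * lag_poly (1 + \<alpha>) n m t"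

text \<open>The operator is a parabolic element of su(1,1) acting in a lowest-weight representation,
  and these are the matrix elements of the group it generates. The complex power is smooth in
  \<open>t\<close> because its base has real part 1 and avoids the cut.\<close>

definition lag_kernel :: "real \<Rightarrow> nat \<Rightarrow> nat \<Rightarrow> real \<Rightarrow> complex" where
  "lag_kernel \<alpha> n m t = (- \<i>) ^ (n + m) * ((1 + \<i> * t) powr (- of_real (1 + \<alpha>)) / (1 + \<i> * t) ^ (n + m))
     * of_real (lag_fun \<alpha> n m t)"

definition lag_a :: "real \<Rightarrow> nat \<Rightarrow> real" where
  "lag_a \<alpha> n = sqrt (real n * (real n + \<alpha>))"

lemma lag_coeff_sym: "lag_coeff s n m k = lag_coeff s m n k"
  by (simp add: lag_coeff_def mult.commute mult.left_commute conj_commute)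

text \<open>Coefficients vanish beyond the smaller index; the same fact makes the truncated exponent
  \<open>n + m - 2 * k\<close> harmless.\<close>

lemma lag_poly_eq:
  assumes "n \<le> N \<or> m \<le> N"
  shows "lag_poly s n m t = (\<Sum>k\<le>N. lag_coeff s n m k * t ^ (n + m - 2 * k))"
proof -
  have "(\<Sum>k\<le>n. lag_coeff s n m k * t ^ (n + m - 2 * k)) = (\<Sum>k\<le>min n (min m N). lag_coeff s n m k * t ^ (n + m - 2 * k))"
    by (rule sum.mono_neutral_right) (use assms in \<open>auto simp: lag_coeff_def\<close>)
  also have "\<dots> = (\<Sum>k\<le>N. lag_coeff s n m k * t ^ (n + m - 2 * k))"
    by (rule sum.mono_neutral_left) (use assms in \<open>auto simp: lag_coeff_def\<close>)
  finally show ?thesis by (simp add: lag_poly_def)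
qed

lemma lag_poly_sym: "lag_poly s n m t = lag_poly s m n t"
  by (subst lag_poly_eq[of n m m]) (simp_all add: lag_poly_def lag_coeff_sym[of s n m] add.commute)

lemma lag_coeff_Suc: "(real (Suc n) - real k) * lag_coeff s (Suc n) m k = lag_coeff s n m k"
proof (cases "k \<le> n \<and> k \<le> m")
  case True
  then have "fact (Suc n - k) = (real (Suc n) - real k) * fact (n - k)"
    by (simp add: Suc_diff_le of_nat_diff)
  then show ?thesis using True by (simp add: lag_coeff_def)
next
  case False
  then show ?thesis by (cases "k = Suc n") (auto simp: lag_coeff_def)
qed

text \<open>Raising \<open>n\<close> and \<open>k\<close> together leaves \<open>n - k\<close>
  unchanged, so only the factors in \<open>k\<close> and in \<open>m - k\<close> enter the
  ratio.\<close>

lemma lag_coeff_Suc_Suc: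
  assumes "0 < s"
  shows "(s + real k) * (real k + 1) * lag_coeff s (Suc n) m (Suc k) = - (real m - real k) * lag_coeff s n m k"
proof (cases "k \<le> n \<and> k < m")
  case True
  then obtain j where j: "m - k = Suc j" "m - Suc k = j" by (metis Suc_diff_Suc)
  have "real m - real k = real (Suc j)" using True j by linarith
  moreover have "pochhammer s (Suc k) = pochhammer s k * (s + real k)" by (simp add: pochhammer_Suc)
  moreover have "s + real k \<noteq> 0" using assms by simp
  moreover have "A * B * (- x / (p * A * (B * f) * g * h)) = - C * (x / (p * f * g * (C * h)))"
    if "A \<noteq> 0" "B \<noteq> 0" "C \<noteq> 0" for A B C x p f g h :: real
    using that by simp
  from this[of "s + real k" "real k + 1" "real (Suc j)" "(- 1) ^ k" "pochhammer s k" "fact k" "fact (n - k)" "fact j"]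
  have "(s + real k) * (real k + 1) * (- ((- 1) ^ k) / (pochhammer s k * (s + real k) * ((real k + 1) * fact k) * fact (n - k) * fact j))
      = - real (Suc j) * ((- 1) ^ k / (pochhammer s k * fact k * fact (n - k) * (real (Suc j) * fact j)))"
    using assms by auto
  ultimately show ?thesis using True by (simp add: lag_coeff_def j add.commute)
qed (auto simp: lag_coeff_def)

definition lag_poly_lower :: "real \<Rightarrow> nat \<Rightarrow> nat \<Rightarrow> real \<Rightarrow> real" where
  "lag_poly_lower s n m t = (if n = 0 then 0 else lag_poly s (n - 1) m t)"

lemma lag_poly_lower_eq:
  "lag_poly_lower s n m t = (\<Sum>k\<le>n. (real n - real k) * lag_coeff s n m k * t ^ (n + m - 1 - 2 * k))"
proof (cases n)
  case (Suc n')
  have "lag_poly s n' m t = (\<Sum>k\<le>n. lag_coeff s n' m k * t ^ (n' + m - 2 * k))"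
    by (rule lag_poly_eq) (simp add: Suc)
  then show ?thesis by (simp add: lag_poly_lower_def Suc lag_coeff_Suc[of n', symmetric])
qed (simp add: lag_poly_lower_def)

lemma lag_poly_deriv:
  "((lag_poly s n m) has_real_derivative
     (\<Sum>k\<le>n. lag_coeff s n m k * (real (n + m - 2 * k) * t ^ (n + m - 1 - 2 * k)))) (at t)"
  unfolding lag_poly_def by (auto intro!: derivative_eq_intros sum.cong simp: diff_right_commute)

text \<open>The exponent is split as \<open>n + m - 2k = (m - n) + 2 (n - k)\<close>; a factor
  \<open>n - k\<close> is exactly what lowers \<open>n\<close> in the coefficients.\<close>

lemma lag_poly_deriv_1:
  assumes "((lag_poly s n m) has_real_derivative D) (at t)"
  shows "t * D = (real m - real n) * lag_poly s n m t + 2 * t * lag_poly_lower s n m t"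
proof -
  have D: "D = (\<Sum>k\<le>n. lag_coeff s n m k * (real (n + m - 2 * k) * t ^ (n + m - 1 - 2 * k)))"
    by (rule DERIV_unique[OF assms lag_poly_deriv])
  have "t * (lag_coeff s n m k * (real (n + m - 2 * k) * t ^ (n + m - 1 - 2 * k)))
      = (real m - real n) * (lag_coeff s n m k * t ^ (n + m - 2 * k))
        + 2 * t * ((real n - real k) * lag_coeff s n m k * t ^ (n + m - 1 - 2 * k))" if "k \<le> n" for k
  proof (cases "k \<le> m")
    case True
    show ?thesis
    proof (cases "n + m - 2 * k")
      case 0
      then have "n = k" "m = k" using True that by auto
      then show ?thesis by simp
    next
      case (Suc j)
      then have *: "n + m - 1 - 2 * k = j" by simp
      have eq: "real (Suc j) = real n + real m - 2 * real k" using Suc True that by linarith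
      show ?thesis unfolding Suc * eq power_Suc by (simp add: algebra_simps)
    qed
  qed (simp add: lag_coeff_def)
  then show ?thesis
    unfolding D lag_poly_lower_eq lag_poly_def sum_distrib_left sum.distrib[symmetric]
    by (intro sum.cong refl) simp
qed

text \<open>Here the exponent is split as \<open>(m - k) + (n - k)\<close>. The second part lowers
  \<open>n\<close> as before; in the first part a shift of the summation index brings in the
  polynomial at \<open>Suc n\<close>.\<close>

lemma lag_poly_deriv_2:
  assumes "0 < s" "((lag_poly s n m) has_real_derivative D) (at t)"
  shows "D = (1 - t\<^sup>2) * lag_poly_lower s n m t + (2 * real n + s) * t * lag_poly s n m t
    - (real n + 1) * (s + real n) * lag_poly s (Suc n) m t"
proof -
  have D: "D = (\<Sum>k\<le>n. lag_coeff s n m k * (real (n + m - 2 * k) * t ^ (n + m - 1 - 2 * k)))"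
    by (rule DERIV_unique[OF assms(2) lag_poly_deriv])
  \<comment> \<open>This combination satisfies \<open>c 0 = 0\<close>, and \<open>c (Suc k)\<close>
    is \<open>m - k\<close> times the old coefficient, so the index shift below loses no
    term.\<close>
  define c where "c k = (real n + real k + s) * lag_coeff s n m k
      - (real n + 1) * (s + real n) * lag_coeff s (Suc n) m k" for k
  have c: "c k = - real k * (real k + s - 1) * lag_coeff s (Suc n) m k" for k
    unfolding c_def lag_coeff_Suc[of n, symmetric] by (simp add: algebra_simps)
  have "(\<Sum>k\<le>n. (real m - real k) * lag_coeff s n m k * t ^ (n + m - 1 - 2 * k))
      = (\<Sum>k\<le>n. c (Suc k) * t ^ (n + m + 1 - 2 * Suc k))"
  proof (intro sum.cong refl)
    fix k
    have "c (Suc k) = (real m - real k) * lag_coeff s n m k"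
      unfolding c using lag_coeff_Suc_Suc[OF assms(1), of k n m] by (simp add: algebra_simps)
    then show "(real m - real k) * lag_coeff s n m k * t ^ (n + m - 1 - 2 * k) = c (Suc k) * t ^ (n + m + 1 - 2 * Suc k)"
      by simp
  qed
  also have "\<dots> = (\<Sum>k\<le>Suc n. c k * t ^ (n + m + 1 - 2 * k))"
    by (subst sum.atMost_Suc_shift) (simp add: c)
  also have "\<dots> = (\<Sum>k\<le>Suc n. (real n + real k + s) * lag_coeff s n m k * t ^ (n + m + 1 - 2 * k))
      - (real n + 1) * (s + real n) * lag_poly s (Suc n) m t"
    unfolding c_def lag_poly_def by (simp add: sum_subtractf sum_distrib_left algebra_simps)
  also have "(\<Sum>k\<le>Suc n. (real n + real k + s) * lag_coeff s n m k * t ^ (n + m + 1 - 2 * k))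
      = (\<Sum>k\<le>n. (real n + real k + s) * lag_coeff s n m k * t ^ (n + m + 1 - 2 * k))"
    by (simp add: lag_coeff_def)
  also have "\<dots> = (2 * real n + s) * t * lag_poly s n m t - t\<^sup>2 * lag_poly_lower s n m t"
  proof -
    have "(real n + real k + s) * lag_coeff s n m k * t ^ (n + m + 1 - 2 * k)
        = (2 * real n + s) * t * (lag_coeff s n m k * t ^ (n + m - 2 * k))
          - t\<^sup>2 * ((real n - real k) * lag_coeff s n m k * t ^ (n + m - 1 - 2 * k))" if "k \<le> n" for k
    proof (cases "k \<le> m")
      case True
      show ?thesis
      proof (cases "n + m - 2 * k")
        case 0
        then have "n = k" "m = k" using True that by auto
        then show ?thesis by simp
      next
        case (Suc j)
        then have *: "n + m - 1 - 2 * k = j" "n + m + 1 - 2 * k = Suc (Suc j)" by simp_all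
        show ?thesis unfolding Suc * by (simp add: algebra_simps power2_eq_square)
      qed
    qed (simp add: lag_coeff_def)
    then show ?thesis
      unfolding lag_poly_lower_eq lag_poly_def sum_distrib_left sum_subtractf[symmetric]
      by (intro sum.cong refl) simp
  qed
  finally have 1: "(\<Sum>k\<le>n. (real m - real k) * lag_coeff s n m k * t ^ (n + m - 1 - 2 * k))
      = (2 * real n + s) * t * lag_poly s n m t - t\<^sup>2 * lag_poly_lower s n m t
        - (real n + 1) * (s + real n) * lag_poly s (Suc n) m t" .
  have "D = (\<Sum>k\<le>n. (real m - real k) * lag_coeff s n m k * t ^ (n + m - 1 - 2 * k)) + lag_poly_lower s n m t"
    unfolding D lag_poly_lower_eq sum.distrib[symmetric]
  proof (intro sum.cong refl)
    fix k assume "k \<in> {..n}"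
    show "lag_coeff s n m k * (real (n + m - 2 * k) * t ^ (n + m - 1 - 2 * k))
        = (real m - real k) * lag_coeff s n m k * t ^ (n + m - 1 - 2 * k)
          + (real n - real k) * lag_coeff s n m k * t ^ (n + m - 1 - 2 * k)"
    proof (cases "k \<le> m")
      case True
      with \<open>k \<in> {..n}\<close> have "real (n + m - 2 * k) = (real m - real k) + (real n - real k)"
        by (simp add: of_nat_diff)
      then show ?thesis by (simp add: algebra_simps)
    qed (simp add: lag_coeff_def)
  qed
  with 1 show ?thesis by (simp add: algebra_simps)
qed

lemma lag_norm_sym: "lag_norm s n m = lag_norm s m n"
  by (simp add: lag_norm_def mult.commute mult.left_commute)

lemma lag_fun_sym: "lag_fun \<alpha> n m t = lag_fun \<alpha> m n t"
  by (simp add: lag_fun_def lag_poly_sym[of _ n m] lag_norm_sym[of _ n m])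

lemma lag_norm_Suc:
  assumes "-1 < \<alpha>"
  shows "lag_norm (1 + \<alpha>) (Suc n) m = lag_a \<alpha> (Suc n) * lag_norm (1 + \<alpha>) n m"
  unfolding lag_norm_def lag_a_def real_sqrt_mult[symmetric] pochhammer_Suc
  by (simp add: algebra_simps)

lemma lag_a_Suc_sq: "-1 < \<alpha> \<Longrightarrow> lag_a \<alpha> (Suc n) * lag_a \<alpha> (Suc n) = (real n + 1) * (1 + \<alpha> + real n)"
proof -
  assume "-1 < \<alpha>"
  then have "0 \<le> real (Suc n) * (real (Suc n) + \<alpha>)" by (intro mult_nonneg_nonneg) auto
  then have "lag_a \<alpha> (Suc n) * lag_a \<alpha> (Suc n) = real (Suc n) * (real (Suc n) + \<alpha>)"
    unfolding lag_a_def by (simp only: real_sqrt_mult_self abs_of_nonneg)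
  then show ?thesis by (simp add: algebra_simps)
qed

lemma lag_fun_lower:
  assumes "-1 < \<alpha>"
  shows "lag_a \<alpha> n * lag_fun \<alpha> (n - 1) m t = lag_norm (1 + \<alpha>) n m * lag_poly_lower (1 + \<alpha>) n m t"
  using lag_norm_Suc[OF assms, of "n - 1" m]
  by (cases n) (simp_all add: lag_fun_def lag_poly_lower_def lag_a_def)

lemma lag_fun_upper:
  assumes "-1 < \<alpha>"
  shows "lag_a \<alpha> (Suc n) * lag_fun \<alpha> (Suc n) m t
    = lag_norm (1 + \<alpha>) n m * ((real n + 1) * (1 + \<alpha> + real n) * lag_poly (1 + \<alpha>) (Suc n) m t)"
  using lag_a_Suc_sq[OF assms, of n] unfolding lag_fun_def lag_norm_Suc[OF assms] by (simp add: ac_simps)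

definition lag_fun' :: "real \<Rightarrow> nat \<Rightarrow> nat \<Rightarrow> real \<Rightarrow> real" where
  "lag_fun' \<alpha> n m t = lag_norm (1 + \<alpha>) n m * (\<Sum>k\<le>n. lag_coeff (1 + \<alpha>) n m k *
     (real (n + m - 2 * k) * t ^ (n + m - 1 - 2 * k)))"

lemma lag_fun_deriv: "(lag_fun \<alpha> n m has_real_derivative lag_fun' \<alpha> n m t) (at t)"
  unfolding lag_fun_def lag_fun'_def by (intro DERIV_cmult lag_poly_deriv)

lemma lag_fun_deriv_1:
  assumes "-1 < \<alpha>"
  shows "t * lag_fun' \<alpha> n m t = (real m - real n) * lag_fun \<alpha> n m t + 2 * t * (lag_a \<alpha> n * lag_fun \<alpha> (n - 1) m t)"
  unfolding lag_fun_lower[OF assms] unfolding lag_fun_def lag_fun'_def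
  using arg_cong[OF lag_poly_deriv_1[OF lag_poly_deriv[of "1 + \<alpha>" n m t]], of "\<lambda>x. lag_norm (1 + \<alpha>) n m * x"]
  by (simp only: distrib_left mult_ac)

lemma lag_fun_deriv_2:
  assumes "-1 < \<alpha>"
  shows "lag_fun' \<alpha> n m t = (1 - t\<^sup>2) * (lag_a \<alpha> n * lag_fun \<alpha> (n - 1) m t)
    + (2 * real n + 1 + \<alpha>) * t * lag_fun \<alpha> n m t - lag_a \<alpha> (Suc n) * lag_fun \<alpha> (Suc n) m t"
proof -
  have "0 < 1 + \<alpha>" using assms by simp
  note arg_cong[OF lag_poly_deriv_2[OF this lag_poly_deriv[of "1 + \<alpha>" n m t]], of "\<lambda>x. lag_norm (1 + \<alpha>) n m * x"]
  then show ?thesis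
    unfolding lag_fun_lower[OF assms] lag_fun_upper[OF assms] unfolding lag_fun_def lag_fun'_def
    by (simp add: algebra_simps)
qed

lemma not_nonpos_Real: "1 + \<i> * complex_of_real t \<notin> \<real>\<^sub>\<le>\<^sub>0"
  by (simp add: complex_nonpos_Reals_iff)

text \<open>Once the common factor \<open>(- \<i>) ^ N * (P / z)\<close> is removed, the evolution
  equation becomes one complex identity between real functions. Its real part is
  \<open>lag_fun_deriv_2\<close>, its imaginary part \<open>lag_fun_deriv_1\<close>.\<close>

lemma lag_kernel_deriv:
  assumes "-1 < \<alpha>"
  shows "((\<lambda>t. lag_kernel \<alpha> n m t) has_vector_derivative
    - \<i> * jacobi_expr (lag_a \<alpha>) (\<lambda>n. 2 * real n + 1 + \<alpha>) (\<lambda>k. lag_kernel \<alpha> k m t) n) (at t)"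
proof -
  define s where "s = complex_of_real (1 + \<alpha>)"
  define z where "z = 1 + \<i> * complex_of_real t"
  define N where "N = n + m"
  define P where "P = z powr (- s) / z ^ N"
  have z0: "z \<noteq> 0" using not_nonpos_Real[of t] by (auto simp: z_def)
  let ?R = "complex_of_real (lag_fun \<alpha> n m t)" and ?R' = "complex_of_real (lag_fun' \<alpha> n m t)"
  let ?A = "complex_of_real (lag_a \<alpha> n * lag_fun \<alpha> (n - 1) m t)"
  let ?C = "complex_of_real (lag_a \<alpha> (Suc n) * lag_fun \<alpha> (Suc n) m t)"
  have "((\<lambda>x. (1 + \<i> * x) powr (- s) / (1 + \<i> * x) ^ N) has_field_derivative - \<i> * (s + of_nat N) * (P / z)) (at (complex_of_real t))"
  proof -
    have "((\<lambda>x. (1 + \<i> * x) powr (- s)) has_field_derivative (- s * z powr (- s - 1)) * \<i>) (at (complex_of_real t))"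
      unfolding z_def
      by (rule DERIV_chain2[where f = "\<lambda>z. z powr (- s)" and g = "\<lambda>x. 1 + \<i> * x"],
          rule has_field_derivative_powr[OF not_nonpos_Real]) (auto intro!: derivative_eq_intros)
    then have "((\<lambda>x. (1 + \<i> * x) powr (- s) / (1 + \<i> * x) ^ N) has_field_derivative
      ((- s * z powr (- s - 1)) * \<i> * z ^ N - z powr (- s) * (of_nat N * z ^ (N - 1) * \<i>)) / (z ^ N * z ^ N)) (at (complex_of_real t))"
      unfolding z_def by (rule DERIV_divide) (use z0 in \<open>auto simp: z_def intro!: derivative_eq_intros\<close>)
    also have "((- s * z powr (- s - 1)) * \<i> * z ^ N - z powr (- s) * (of_nat N * z ^ (N - 1) * \<i>)) / (z ^ N * z ^ N)
        = - \<i> * (s + of_nat N) * (P / z)"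
    proof -
      have e1: "z powr (- s - 1) = z powr (- s) / z" using z0 by (simp add: powr_diff)
      have e2: "of_nat N * z ^ (N - 1) = of_nat N * z ^ N / z" using z0 by (cases N) auto
      show ?thesis unfolding e1 e2 P_def using z0 by (simp add: field_simps)
    qed
    finally show ?thesis .
  qed
  then have dP: "((\<lambda>x. (1 + \<i> * complex_of_real x) powr (- s) / (1 + \<i> * complex_of_real x) ^ N) has_vector_derivative
      - \<i> * (s + of_nat N) * (P / z)) (at t)"
    by (rule has_vector_derivative_real_field)
  have dR: "((\<lambda>x. complex_of_real (lag_fun \<alpha> n m x)) has_vector_derivative ?R') (at t)"
    using lag_fun_deriv[of \<alpha> n m t]
    by (intro has_vector_derivative_of_real) (simp add: has_real_derivative_iff_has_vector_derivative)
  have "((\<lambda>x. (- \<i>) ^ N * ((1 + \<i> * complex_of_real x) powr (- s) / (1 + \<i> * complex_of_real x) ^ N)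
        * complex_of_real (lag_fun \<alpha> n m x)) has_vector_derivative
      (- \<i>) ^ N * P * ?R' + (- \<i>) ^ N * (- \<i> * (s + of_nat N) * (P / z)) * ?R) (at t)"
    using has_vector_derivative_mult[OF has_vector_derivative_mult_right[OF dP, of "(- \<i>) ^ N"] dR]
    by (simp add: P_def z_def)
  moreover have "(- \<i>) ^ N * P * ?R' + (- \<i>) ^ N * (- \<i> * (s + of_nat N) * (P / z)) * ?R
      = (- \<i>) ^ N * (P / z) * (z * ?R' - \<i> * (s + of_nat N) * ?R)"
    using z0 by (simp add: field_simps)
  moreover have "- \<i> * jacobi_expr (lag_a \<alpha>) (\<lambda>n. 2 * real n + 1 + \<alpha>) (\<lambda>k. lag_kernel \<alpha> k m t) n
      = (- \<i>) ^ N * (P / z) * (z\<^sup>2 * ?A - \<i> * (2 * of_nat n + s) * z * ?R - ?C)"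
  proof -
    \<comment> \<open>Passing to \<open>n - 1\<close> changes the phase by \<i> and the denominator
      by one power of \<open>z\<close>; at \<open>n = 0\<close> both sides vanish with
      \<open>lag_a \<alpha> 0\<close>.\<close>
    have 1: "lag_a \<alpha> n * lag_kernel \<alpha> (n - 1) m t = \<i> * ((- \<i>) ^ N * (P * z) * ?A)"
    proof (cases n)
      case 0
      then show ?thesis by (simp add: lag_a_def)
    next
      case (Suc k)
      have "(- \<i>) ^ N * \<i> = (- \<i>) ^ (k + m)"
        unfolding N_def Suc add_Suc power_Suc by (simp only: mult.commute[of _ \<i>] mult.assoc[symmetric]) simp
      moreover have "P * z = z powr (- s) / z ^ (k + m)" using z0 by (simp add: P_def N_def Suc)
      moreover have "\<i> * ((- \<i>) ^ N * (P * z) * ?A) = ((- \<i>) ^ N * \<i>) * (P * z) * ?A" by simp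
      ultimately have "\<i> * ((- \<i>) ^ N * (P * z) * ?A) = (- \<i>) ^ (k + m) * (z powr (- s) / z ^ (k + m)) * ?A"
        by (simp only:)
      then show ?thesis by (simp add: Suc lag_kernel_def z_def[symmetric] s_def)
    qed
    have 2: "(2 * real n + 1 + \<alpha>) * lag_kernel \<alpha> n m t = (- \<i>) ^ N * P * ((2 * of_nat n + s) * ?R)"
      by (simp add: lag_kernel_def N_def P_def z_def[symmetric] s_def)
    have 3: "lag_a \<alpha> (Suc n) * lag_kernel \<alpha> (Suc n) m t = - \<i> * ((- \<i>) ^ N * (P / z) * ?C)"
      using z0 by (simp add: lag_kernel_def N_def P_def z_def[symmetric] s_def mult_ac)
    show ?thesis unfolding jacobi_expr_def 1 2 3 using z0
      by (simp add: field_simps power2_eq_square)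
  qed
  moreover have "z * ?R' - \<i> * (s + of_nat N) * ?R = z\<^sup>2 * ?A - \<i> * (2 * of_nat n + s) * z * ?R - ?C"
  proof (rule complex_eqI)
    show "Re (z * ?R' - \<i> * (s + of_nat N) * ?R) = Re (z\<^sup>2 * ?A - \<i> * (2 * of_nat n + s) * z * ?R - ?C)"
      using lag_fun_deriv_2[OF assms, of n m t]
      by (simp add: z_def s_def N_def power2_eq_square algebra_simps)
    show "Im (z * ?R' - \<i> * (s + of_nat N) * ?R) = Im (z\<^sup>2 * ?A - \<i> * (2 * of_nat n + s) * z * ?R - ?C)"
      using lag_fun_deriv_1[OF assms, of t n m]
      by (simp add: z_def s_def N_def power2_eq_square algebra_simps)
  qed
  ultimately show ?thesis unfolding lag_kernel_def s_def N_def by simp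
qed

section \<open>Decay of the kernel in the index at bounded times\<close>

lemma summable_poly_geometric:
  fixes x :: real
  assumes "0 \<le> x" "x < 1"
  shows "summable (\<lambda>n. (real n + 1) ^ p * x ^ n)"
  using assms
proof (induction p arbitrary: x)
  case 0
  then show ?case by (simp add: summable_geometric)
next
  case (Suc p)
  \<comment> \<open>Half of the geometric decay pays for one power of \<open>n + 1\<close>: the
    number \<open>(n + 1) y^n\<close> is at most the whole geometric series of
    \<open>y\<close>.\<close>
  define y where "y = sqrt x"
  have y: "0 \<le> y" "y < 1" "x = y * y" using Suc.prems by (auto simp: y_def)
  have 1: "(real n + 1) * y ^ n \<le> 1 / (1 - y)" for n
  proof -
    have "(real n + 1) * y ^ n = (\<Sum>k\<le>n. y ^ n)" by simp
    also have "\<dots> \<le> (\<Sum>k\<le>n. y ^ k)" using y by (intro sum_mono power_decreasing) auto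
    also have "\<dots> \<le> (\<Sum>k. y ^ k)" using y by (intro sum_le_suminf summable_geometric) auto
    finally show ?thesis using y by (simp add: suminf_geometric)
  qed
  show ?case
  proof (rule summable_comparison_test')
    show "summable (\<lambda>n. (real n + 1) ^ p * y ^ n * (1 / (1 - y)))" using y by (intro summable_mult2 Suc.IH)
    fix n
    have "(real n + 1) ^ Suc p * x ^ n = ((real n + 1) ^ p * y ^ n) * ((real n + 1) * y ^ n)"
      by (simp add: y(3) power_mult_distrib)
    also have "\<dots> \<le> ((real n + 1) ^ p * y ^ n) * (1 / (1 - y))"
      by (rule mult_left_mono[OF 1]) (use y in simp)
    finally show "norm ((real n + 1) ^ Suc p * x ^ n) \<le> (real n + 1) ^ p * y ^ n * (1 / (1 - y))"
      using y by (simp add: abs_mult)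
  qed
qed

text \<open>Bernoulli's inequality replaces the factor \<open>s + n\<close> by
  \<open>(n + 1) (1 + 1/(n + 1))^S\<close>, and the product of the second factors telescopes to a
  power of \<open>n + 1\<close>.\<close>

lemma pochhammer_le:
  assumes "0 < s" "s \<le> real S"
  shows "pochhammer s n \<le> (real n + 1) ^ S * fact n"
proof (induction n)
  case (Suc n)
  have "s + real n \<le> (real n + 1) * (1 + real S * (1 / (real n + 1)))"
    using assms mult_right_mono[of s "real S" "real n"] by (simp add: field_simps)
  also have "\<dots> \<le> (real n + 1) * (1 + 1 / (real n + 1)) ^ S"
  proof (rule mult_left_mono)
    have "-1 \<le> 1 / (real n + 1)" by (rule order_trans[of _ 0]) simp_all
    then show "1 + real S * (1 / (real n + 1)) \<le> (1 + 1 / (real n + 1)) ^ S" by (rule Bernoulli_inequality)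
  qed simp
  finally have 1: "s + real n \<le> (real n + 1) * (1 + 1 / (real n + 1)) ^ S" .
  have "pochhammer s (Suc n) \<le> ((real n + 1) ^ S * fact n) * ((real n + 1) * (1 + 1 / (real n + 1)) ^ S)"
    unfolding pochhammer_Suc using assms by (intro mult_mono Suc.IH 1) auto
  also have "\<dots> = ((real n + 1) * (1 + 1 / (real n + 1))) ^ S * fact (Suc n)"
    unfolding power_mult_distrib fact_Suc by (simp only: of_nat_Suc mult_ac add_ac)
  also have "(real n + 1) * (1 + 1 / (real n + 1)) = real (Suc n) + 1" by (simp add: field_simps)
  finally show ?case .
qed simp

lemma norm_one_plus_i: "cmod (1 + \<i> * complex_of_real t) = sqrt (1 + t\<^sup>2)"
  by (simp add: cmod_def)

lemma norm_lag_kernel: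
  "cmod (lag_kernel \<alpha> n m t) = sqrt (1 + t\<^sup>2) powr (- (1 + \<alpha>)) / sqrt (1 + t\<^sup>2) ^ (n + m) * \<bar>lag_fun \<alpha> n m t\<bar>"
proof -
  have "cmod ((1 + \<i> * complex_of_real t) powr (- complex_of_real (1 + \<alpha>))) = sqrt (1 + t\<^sup>2) powr (- (1 + \<alpha>))"
    using norm_powr_real_powr'[of "- complex_of_real (1 + \<alpha>)" "1 + \<i> * complex_of_real t"]
    by (simp only: norm_one_plus_i) simp
  then show ?thesis unfolding lag_kernel_def norm_mult norm_divide norm_power norm_one_plus_i by simp
qed

lemma abs_lag_coeff_le:
  assumes "0 < s"
  shows "fact n * \<bar>lag_coeff s n m k\<bar> \<le> (real n + 1) ^ m / (pochhammer s k * fact k * fact (m - k))"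
proof (cases "k \<le> n \<and> k \<le> m")
  case True
  have p: "0 < pochhammer s k" using assms by (rule pochhammer_pos)
  have "fact n / fact (n - k) \<le> real (n ^ k)"
  proof -
    have "fact n \<le> n ^ k * (fact (n - k) :: nat)"
      using fact_div_fact_le_pow[of k n] True fact_dvd[of "n - k" n]
      by (metis diff_le_self dvd_div_mult_self mult_le_mono1)
    then have "real (fact n) \<le> real (n ^ k * fact (n - k))" by (rule of_nat_mono)
    then show ?thesis by (simp add: divide_le_eq)
  qed
  also have "\<dots> \<le> (real n + 1) ^ k" by (simp add: power_mono)
  also have "\<dots> \<le> (real n + 1) ^ m" using True by (intro power_increasing) auto
  finally have "fact n / fact (n - k) * (1 / (pochhammer s k * fact k * fact (m - k)))
      \<le> (real n + 1) ^ m * (1 / (pochhammer s k * fact k * fact (m - k)))"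
    using p by (intro mult_right_mono) auto
  moreover have "fact n * \<bar>lag_coeff s n m k\<bar> = fact n / fact (n - k) * (1 / (pochhammer s k * fact k * fact (m - k)))"
    using True p by (simp add: lag_coeff_def abs_mult)
  ultimately show ?thesis by simp
next
  case False
  then have "lag_coeff s n m k = 0" by (auto simp: lag_coeff_def)
  then show ?thesis using pochhammer_pos[OF assms, of k] by simp
qed

text \<open>On bounded times \<open>|t| / sqrt (1 + t^2)\<close> stays below some
  \<open>\<rho> < 1\<close>. For fixed \<open>m\<close> only the terms \<open>k \<le> m\<close>
  occur, each losing at most \<open>\<rho>^(-m)\<close>, while normalisation and coefficients
  together grow polynomially in \<open>n\<close>.\<close>

lemma lag_kernel_decay:
  assumes \<alpha>: "-1 < \<alpha>"
  shows "\<exists>C p \<rho>. 0 \<le> \<rho> \<and> \<rho> < 1 \<and> (\<forall>n t. \<bar>t\<bar> \<le> T \<longrightarrow> cmod (lag_kernel \<alpha> n m t) \<le> C * (real n + 1) ^ p * \<rho> ^ n)"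
proof -
  define s where "s = 1 + \<alpha>"
  have s: "0 < s" using \<alpha> by (simp add: s_def)
  obtain S where S: "s \<le> real S" using real_arch_simple by blast
  \<comment> \<open>Enlarging \<open>T\<close> to at least 1 keeps \<rho> positive, as the division
    by \<open>\<rho> ^ m\<close> requires.\<close>
  define T1 where "T1 = max T 1"
  define \<rho> where "\<rho> = T1 / sqrt (1 + T1\<^sup>2)"
  have T1: "1 \<le> T1" "T \<le> T1" by (auto simp: T1_def)
  have "sqrt (T1\<^sup>2) < sqrt (1 + T1\<^sup>2)" by (intro real_sqrt_less_mono) simp
  moreover have "0 < sqrt (1 + T1\<^sup>2)" by (simp add: add_pos_nonneg)
  ultimately have \<rho>: "0 < \<rho>" "\<rho> < 1" using T1 by (simp_all add: \<rho>_def)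
  define D where "D = (\<Sum>k\<le>m. 1 / (pochhammer s k * fact k * fact (m - k)))"
  have D0: "0 \<le> D" unfolding D_def by (intro sum_nonneg) (use pochhammer_pos[OF s] in \<open>auto intro: less_imp_le\<close>)
  define E where "E = sqrt (pochhammer s m * fact m)"
  have E0: "0 \<le> E" using pochhammer_pos[OF s, of m] by (simp add: E_def)
  have "cmod (lag_kernel \<alpha> n m t) \<le> (E * D / \<rho> ^ m) * (real n + 1) ^ (S + m) * \<rho> ^ n" if t: "\<bar>t\<bar> \<le> T" for n t
  proof -
    define c where "c = sqrt (1 + t\<^sup>2)"
    have c1: "1 \<le> c" by (simp add: c_def)
    have tc: "\<bar>t\<bar> / c \<le> \<rho>"
    proof -
      have "(\<bar>t\<bar> * sqrt (1 + T1\<^sup>2))\<^sup>2 \<le> (T1 * c)\<^sup>2"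
      proof -
        have "t\<^sup>2 \<le> T1\<^sup>2" using t T1 by (intro abs_le_square_iff[THEN iffD1]) auto
        then show ?thesis by (simp add: c_def power_mult_distrib algebra_simps)
      qed
      then have "\<bar>t\<bar> * sqrt (1 + T1\<^sup>2) \<le> T1 * c" by (rule power2_le_imp_le) (use T1 c1 in simp)
      moreover have "0 < sqrt (1 + T1\<^sup>2)" by (simp add: add_pos_nonneg)
      ultimately show ?thesis unfolding \<rho>_def using c1 by (simp add: field_simps)
    qed
    have 1: "\<bar>lag_poly s n m t\<bar> / c ^ (n + m) \<le> (\<Sum>k\<le>m. \<bar>lag_coeff s n m k\<bar> * (\<rho> ^ n / \<rho> ^ m))"
    proof -
      have "\<bar>lag_poly s n m t\<bar> / c ^ (n + m) \<le> (\<Sum>k\<le>m. \<bar>lag_coeff s n m k * t ^ (n + m - 2 * k)\<bar>) / c ^ (n + m)"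
        using c1 by (subst lag_poly_eq[of n m m]) (auto intro!: divide_right_mono sum_abs)
      also have "\<dots> \<le> (\<Sum>k\<le>m. \<bar>lag_coeff s n m k\<bar> * (\<rho> ^ n / \<rho> ^ m))"
        unfolding sum_divide_distrib
      proof (intro sum_mono)
        fix k assume k: "k \<in> {..m}"
        show "\<bar>lag_coeff s n m k * t ^ (n + m - 2 * k)\<bar> / c ^ (n + m) \<le> \<bar>lag_coeff s n m k\<bar> * (\<rho> ^ n / \<rho> ^ m)"
        proof (cases "k \<le> n")
          case True
          let ?e = "n + m - 2 * k"
          have "\<bar>t\<bar> ^ ?e / c ^ (n + m) \<le> \<bar>t\<bar> ^ ?e / c ^ ?e"
            using c1 by (intro divide_left_mono power_increasing) auto
          also have "\<dots> = (\<bar>t\<bar> / c) ^ ?e" by (simp add: power_divide)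
          also have "\<dots> \<le> \<rho> ^ ?e" using tc c1 by (intro power_mono) auto
          also have "\<dots> \<le> \<rho> ^ n / \<rho> ^ m"
          proof -
            have "\<rho> ^ ?e * \<rho> ^ m = \<rho> ^ (?e + m)" by (simp add: power_add)
            also have "\<dots> \<le> \<rho> ^ n" using \<rho> k True by (intro power_decreasing) auto
            finally show ?thesis using \<rho> by (simp add: le_divide_eq)
          qed
          finally have "\<bar>t\<bar> ^ ?e / c ^ (n + m) \<le> \<rho> ^ n / \<rho> ^ m" .
          then have "\<bar>lag_coeff s n m k\<bar> * (\<bar>t\<bar> ^ ?e / c ^ (n + m)) \<le> \<bar>lag_coeff s n m k\<bar> * (\<rho> ^ n / \<rho> ^ m)"
            by (rule mult_left_mono) simp
          then show ?thesis by (simp add: abs_mult power_abs)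
        qed (use \<rho> in \<open>simp add: lag_coeff_def\<close>)
      qed
      finally show ?thesis .
    qed
    have 2: "lag_norm s n m \<le> E * ((real n + 1) ^ S * fact n)"
    proof -
      have "pochhammer s n * fact n \<le> ((real n + 1) ^ S * fact n) * fact n"
        by (intro mult_right_mono pochhammer_le s S) simp
      also have "\<dots> \<le> ((real n + 1) ^ S * fact n) * ((real n + 1) ^ S * fact n)"
        by (intro mult_left_mono) (simp_all add: mult_le_cancel_right1)
      finally have "sqrt (pochhammer s n * fact n) \<le> (real n + 1) ^ S * fact n"
        by (intro real_le_lsqrt) (auto simp: power2_eq_square)
      then have "E * sqrt (pochhammer s n * fact n) \<le> E * ((real n + 1) ^ S * fact n)"
        using E0 by (rule mult_left_mono)
      moreover have "lag_norm s n m = E * sqrt (pochhammer s n * fact n)"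
        unfolding lag_norm_def E_def real_sqrt_mult[symmetric] by (simp add: mult_ac)
      ultimately show ?thesis by simp
    qed
    have "c powr (- s) \<le> 1" using c1 s by (simp add: powr_minus inverse_le_1_iff ge_one_powr_ge_zero)
    have "cmod (lag_kernel \<alpha> n m t) = c powr (- s) * (lag_norm s n m * (\<bar>lag_poly s n m t\<bar> / c ^ (n + m)))"
      using pochhammer_pos[OF s, of n] pochhammer_pos[OF s, of m]
      unfolding norm_lag_kernel lag_fun_def c_def[symmetric] s_def[symmetric]
      by (simp add: abs_mult lag_norm_def abs_of_nonneg)
    also have "\<dots> \<le> 1 * ((E * ((real n + 1) ^ S * fact n)) * (\<Sum>k\<le>m. \<bar>lag_coeff s n m k\<bar> * (\<rho> ^ n / \<rho> ^ m)))"
      using E0 c1 \<open>c powr (- s) \<le> 1\<close> pochhammer_pos[OF s, of n] pochhammer_pos[OF s, of m]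
      by (intro mult_mono 1 2) (auto simp: lag_norm_def)
    also have "\<dots> = E * (real n + 1) ^ S * ((\<Sum>k\<le>m. fact n * \<bar>lag_coeff s n m k\<bar>) * (\<rho> ^ n / \<rho> ^ m))"
      by (simp add: sum_distrib_left sum_distrib_right mult_ac)
    also have "\<dots> \<le> E * (real n + 1) ^ S * (((real n + 1) ^ m * D) * (\<rho> ^ n / \<rho> ^ m))"
    proof (intro mult_left_mono mult_right_mono)
      have "(\<Sum>k\<le>m. fact n * \<bar>lag_coeff s n m k\<bar>) \<le> (\<Sum>k\<le>m. (real n + 1) ^ m / (pochhammer s k * fact k * fact (m - k)))"
        by (intro sum_mono abs_lag_coeff_le s)
      also have "\<dots> = (real n + 1) ^ m * D" by (simp add: D_def sum_distrib_left)
      finally show "(\<Sum>k\<le>m. fact n * \<bar>lag_coeff s n m k\<bar>) \<le> (real n + 1) ^ m * D" .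
    qed (use E0 \<rho> in auto)
    also have "\<dots> = (E * D / \<rho> ^ m) * (real n + 1) ^ (S + m) * \<rho> ^ n" by (simp add: power_add)
    finally show ?thesis .
  qed
  then show ?thesis using \<rho> by (intro exI[of _ "E * D / \<rho> ^ m"] exI[of _ "S + m"] exI[of _ \<rho>]) auto
qed

lemma lag_a_le:
  assumes "-1 < \<alpha>"
  shows "\<bar>lag_a \<alpha> n\<bar> \<le> (1 + \<bar>\<alpha>\<bar>) * (real n + 1)"
proof -
  have "real n * (real n + \<alpha>) \<le> (real n + \<bar>\<alpha>\<bar>) * (real n + \<bar>\<alpha>\<bar>)"
  proof -
    have "real n * (real n + \<alpha>) \<le> real n * (real n + \<bar>\<alpha>\<bar>)" by (intro mult_left_mono) auto
    also have "\<dots> \<le> (real n + \<bar>\<alpha>\<bar>) * (real n + \<bar>\<alpha>\<bar>)" by (intro mult_right_mono) auto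
    finally show ?thesis .
  qed
  then have "lag_a \<alpha> n \<le> real n + \<bar>\<alpha>\<bar>" unfolding lag_a_def by (intro real_le_lsqrt) (auto simp: power2_eq_square)
  moreover have "0 \<le> lag_a \<alpha> n"
    using assms unfolding lag_a_def by (cases n) auto
  moreover have "0 \<le> \<bar>\<alpha>\<bar> * real n" by simp
  moreover have "(1 + \<bar>\<alpha>\<bar>) * (real n + 1) = 1 + \<bar>\<alpha>\<bar> + real n + \<bar>\<alpha>\<bar> * real n" by (simp add: algebra_simps)
  ultimately show ?thesis by linarith
qed

lemma lag_kernel_jacobi:
  assumes \<alpha>: "-1 < \<alpha>"
  shows "jacobi_kernel (lag_a \<alpha>) (\<lambda>n. 2 * real n + 1 + \<alpha>) (lag_kernel \<alpha>)"
proof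
  show "lag_a \<alpha> 0 = 0" by (simp add: lag_a_def)
  have s: "0 < 1 + \<alpha>" using \<alpha> by simp
  show "lag_kernel \<alpha> n m t = lag_kernel \<alpha> m n t" for n m t
    by (simp add: lag_kernel_def lag_fun_sym[of _ n m] add.commute)
  show "lag_kernel \<alpha> n m 0 = (if n = m then 1 else 0)" for n m
  proof -
    have "lag_fun \<alpha> n m 0 = (if n = m then (- 1) ^ n else 0)"
    proof (cases "n = m")
      case True
      have p: "pochhammer (1 + \<alpha>) n > 0" using s by (rule pochhammer_pos)
      have "lag_poly (1 + \<alpha>) n n 0 = (\<Sum>k\<le>n. if k = n then lag_coeff (1 + \<alpha>) n n n else 0)"
        unfolding lag_poly_def by (intro sum.cong) auto
      then have "lag_fun \<alpha> n n 0 = sqrt ((pochhammer (1 + \<alpha>) n * fact n) * (pochhammer (1 + \<alpha>) n * fact n))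
          * ((- 1) ^ n / (pochhammer (1 + \<alpha>) n * fact n))"
        by (simp add: lag_fun_def lag_norm_def lag_coeff_def mult_ac)
      also have "\<dots> = (- 1) ^ n" using p by (simp only: real_sqrt_abs2) simp
      finally show ?thesis using True by simp
    next
      case False
      then have "lag_poly (1 + \<alpha>) n m 0 = 0"
        unfolding lag_poly_def by (intro sum.neutral) (auto simp: lag_coeff_def)
      then show ?thesis using False by (simp add: lag_fun_def)
    qed
    moreover have "(- \<i>) ^ (n + n) * (- 1) ^ n = (1 :: complex)" for n
      by (simp add: power_add power_mult_distrib[symmetric])
    ultimately show ?thesis by (auto simp: lag_kernel_def)
  qed
  show "cnj (lag_kernel \<alpha> n m t) = lag_kernel \<alpha> n m (- t)" for n m t
  proof -
    have "lag_fun \<alpha> n m (- t) = (- 1) ^ (n + m) * lag_fun \<alpha> n m t"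
    proof -
      have *: "lag_coeff (1 + \<alpha>) n m k * (- t) ^ (n + m - 2 * k)
          = (- 1) ^ (n + m) * (lag_coeff (1 + \<alpha>) n m k * t ^ (n + m - 2 * k))" for k
      proof (cases "k \<le> n \<and> k \<le> m")
        case True
        then have "even (n + m - 2 * k) = even (n + m)" by auto
        then show ?thesis by (cases "even (n + m)") auto
      qed (auto simp: lag_coeff_def)
      then have "lag_poly (1 + \<alpha>) n m (- t) = (- 1) ^ (n + m) * lag_poly (1 + \<alpha>) n m t"
        unfolding lag_poly_def sum_distrib_left by (intro sum.cong refl) (rule *)
      then show ?thesis by (simp add: lag_fun_def)
    qed
    moreover have "cnj ((1 + \<i> * complex_of_real t) powr - complex_of_real (1 + \<alpha>))
        = (1 + \<i> * complex_of_real (- t)) powr - complex_of_real (1 + \<alpha>)"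
      by (subst cnj_powr) (use not_nonpos_Real[of t] complex_nonpos_Reals_iff in auto)
    moreover have "\<i> ^ (n + m) = (- \<i>) ^ (n + m) * (- 1) ^ (n + m)"
      by (simp add: power_mult_distrib[symmetric])
    ultimately show ?thesis by (simp add: lag_kernel_def)
  qed
  show "((\<lambda>t. lag_kernel \<alpha> n m t) has_vector_derivative
      - \<i> * jacobi_expr (lag_a \<alpha>) (\<lambda>n. 2 * real n + 1 + \<alpha>) (\<lambda>k. lag_kernel \<alpha> k m t) n) (at t)" for n m t
    by (rule lag_kernel_deriv[OF \<alpha>])
  show "\<exists>B. summable (\<lambda>n. (1 + \<bar>lag_a \<alpha> n\<bar> + \<bar>lag_a \<alpha> (Suc n)\<bar>) * B n) \<and>
      (\<forall>n t. \<bar>t\<bar> \<le> T \<longrightarrow> cmod (lag_kernel \<alpha> n m t) \<le> B n)" for T m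
  proof -
    obtain C p \<rho> where \<rho>: "0 \<le> \<rho>" "\<rho> < 1"
      and le: "\<And>n t. \<bar>t\<bar> \<le> T \<Longrightarrow> cmod (lag_kernel \<alpha> n m t) \<le> C * (real n + 1) ^ p * \<rho> ^ n"
      using lag_kernel_decay[OF \<alpha>, of T m] by auto
    define A where "A = 1 + \<bar>\<alpha>\<bar>"
    have "summable (\<lambda>n. (1 + \<bar>lag_a \<alpha> n\<bar> + \<bar>lag_a \<alpha> (Suc n)\<bar>) * (\<bar>C\<bar> * (real n + 1) ^ p * \<rho> ^ n))"
    proof (rule summable_comparison_test')
      show "summable (\<lambda>n. (4 * A * \<bar>C\<bar>) * ((real n + 1) ^ Suc p * \<rho> ^ n))"
        by (intro summable_mult summable_poly_geometric \<rho>)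
      fix n
      have A1: "1 \<le> A * (real n + 1)" by (auto simp: A_def algebra_simps)
      have "1 + \<bar>lag_a \<alpha> n\<bar> + \<bar>lag_a \<alpha> (Suc n)\<bar> \<le> 4 * (A * (real n + 1))"
      proof -
        have "A * (real (Suc n) + 1) \<le> A * (2 * (real n + 1))" by (intro mult_left_mono) (auto simp: A_def)
        with lag_a_le[OF \<alpha>, of n] lag_a_le[OF \<alpha>, of "Suc n"] A1 show ?thesis
          unfolding A_def[symmetric] by linarith
      qed
      then have "(1 + \<bar>lag_a \<alpha> n\<bar> + \<bar>lag_a \<alpha> (Suc n)\<bar>) * (\<bar>C\<bar> * (real n + 1) ^ p * \<rho> ^ n)
          \<le> 4 * (A * (real n + 1)) * (\<bar>C\<bar> * (real n + 1) ^ p * \<rho> ^ n)"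
        using \<rho> by (intro mult_right_mono) auto
      then show "norm ((1 + \<bar>lag_a \<alpha> n\<bar> + \<bar>lag_a \<alpha> (Suc n)\<bar>) * (\<bar>C\<bar> * (real n + 1) ^ p * \<rho> ^ n))
          \<le> (4 * A * \<bar>C\<bar>) * ((real n + 1) ^ Suc p * \<rho> ^ n)"
      proof -
        have "4 * (A * (real n + 1)) * (\<bar>C\<bar> * (real n + 1) ^ p * \<rho> ^ n) = (4 * A * \<bar>C\<bar>) * ((real n + 1) ^ Suc p * \<rho> ^ n)"
          by simp
        moreover have "0 \<le> (1 + \<bar>lag_a \<alpha> n\<bar> + \<bar>lag_a \<alpha> (Suc n)\<bar>) * (\<bar>C\<bar> * (real n + 1) ^ p * \<rho> ^ n)"
          using \<rho> by (intro mult_nonneg_nonneg) auto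
        moreover note \<open>_ \<le> 4 * (A * (real n + 1)) * (\<bar>C\<bar> * (real n + 1) ^ p * \<rho> ^ n)\<close>
        ultimately show ?thesis by (simp only: real_norm_def abs_of_nonneg)
      qed
    qed
    moreover have "cmod (lag_kernel \<alpha> n m t) \<le> \<bar>C\<bar> * (real n + 1) ^ p * \<rho> ^ n" if "\<bar>t\<bar> \<le> T" for n t
      using \<rho> by (intro order_trans[OF le[OF that]] mult_right_mono) auto
    ultimately show ?thesis
      by (intro exI[of _ "\<lambda>n. \<bar>C\<bar> * (real n + 1) ^ p * \<rho> ^ n"]) simp
  qed
qed

lemma laguerre_expr_eq: "laguerre_expr \<alpha> f = jacobi_expr (lag_a \<alpha>) (\<lambda>n. 2 * real n + 1 + \<alpha>) f"
  by (auto simp: laguerre_expr_def jacobi_expr_def lag_a_def fun_eq_iff add.commute)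

theorem laguerre_group_kernel:
  assumes \<alpha>: "-1 < \<alpha>"
  shows "unitary_group (laguerre_group \<alpha>)"
    and "coord (laguerre_group \<alpha> t (basis m)) n = lag_kernel \<alpha> n m t"
proof -
  interpret jacobi_kernel "lag_a \<alpha>" "\<lambda>n. 2 * real n + 1 + \<alpha>" "lag_kernel \<alpha>"
    by (rule lag_kernel_jacobi[OF \<alpha>])
  have *: "laguerre_group \<alpha> = kernel_op"
    unfolding laguerre_group_def laguerre_dom_def laguerre_op_def laguerre_expr_eq exp_group_eq_kernel_op[symmetric] ..
  show "unitary_group (laguerre_group \<alpha>)" unfolding * by (rule unitary_group_kernel_op)
  show "coord (laguerre_group \<alpha> t (basis m)) n = lag_kernel \<alpha> n m t" unfolding * by (rule coord_kernel_op_basis)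
qed

subsection \<open>The dispersive estimate\<close>

text \<open>With \<open>t = e\<^sup>x\<close>, \<open>lxi x = t\<^sup>2 / (1 + t\<^sup>2)\<close> and \<open>leta x = 1 / (1 + t\<^sup>2)\<close>.\<close>

definition lxi :: "real \<Rightarrow> real" where "lxi x = exp (2 * x) / (1 + exp (2 * x))"
definition leta :: "real \<Rightarrow> real" where "leta x = 1 / (1 + exp (2 * x))"

lemma one_plus_exp_pos: "0 < 1 + exp (c :: real)" "1 + exp (c :: real) \<noteq> 0"
  using exp_gt_zero[of c] by linarith+

lemma lxi_pos: "0 < lxi x" and leta_pos: "0 < leta x" and lxi_leta: "lxi x + leta x = 1"
  using one_plus_exp_pos[of "2 * x"] by (simp_all add: lxi_def leta_def add_divide_distrib[symmetric] add.commute)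

lemma leta_eq: "leta x = 1 - lxi x" using lxi_leta[of x] by linarith
lemma lxi_lt_1: "lxi x < 1" and leta_lt_1: "leta x < 1"
  using lxi_leta[of x] lxi_pos[of x] leta_pos[of x] by linarith+

lemma lxi_minus: "lxi (- x) = leta x" and leta_minus: "leta (- x) = lxi x"
  using one_plus_exp_pos[of "2 * x"] by (simp_all add: lxi_def leta_def exp_minus field_simps)

lemma DERIV_lxi: "(lxi has_real_derivative 2 * lxi x * leta x) (at x)"
  unfolding lxi_def[abs_def] leta_def using one_plus_exp_pos[of "2 * x"]
  by (auto intro!: derivative_eq_intros simp: field_simps)

lemma DERIV_leta: "(leta has_real_derivative - 2 * lxi x * leta x) (at x)"
  unfolding lxi_def leta_def[abs_def] using one_plus_exp_pos[of "2 * x"]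
  by (auto intro!: derivative_eq_intros simp: field_simps)

lemmas [derivative_intros] = DERIV_lxi[THEN DERIV_chain2] DERIV_leta[THEN DERIV_chain2]

lemma lxi_at_bot: "(lxi \<longlongrightarrow> 0) at_bot"
proof -
  have "filterlim (\<lambda>x::real. 2 * x) at_bot at_bot"
    by (rule filterlim_tendsto_pos_mult_at_bot[OF tendsto_const _ filterlim_ident]) simp
  then have "((\<lambda>x::real. exp (2 * x)) \<longlongrightarrow> 0) at_bot" by (rule filterlim_compose[OF exp_at_bot])
  then have "((\<lambda>x::real. exp (2 * x) / (1 + exp (2 * x))) \<longlongrightarrow> 0 / (1 + 0)) at_bot"
    by (intro tendsto_intros) auto
  then show ?thesis by (simp add: lxi_def[abs_def])
qed

lemma leta_at_top: "(leta \<longlongrightarrow> 0) at_top"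
  using lxi_at_bot unfolding filterlim_at_bot_mirror by (simp add: lxi_minus)

lemma lxi_at_top: "(lxi \<longlongrightarrow> 1) at_top"
  using tendsto_diff[OF tendsto_const leta_at_top, of 1] by (simp add: leta_eq[abs_def])

lemma leta_at_bot: "(leta \<longlongrightarrow> 1) at_bot"
  using tendsto_diff[OF tendsto_const lxi_at_bot, of 1] by (simp add: leta_eq[abs_def])

lemma lxi_mono: "x \<le> y \<Longrightarrow> lxi x \<le> lxi y"
  by (rule DERIV_nonneg_imp_nondecreasing[of x y lxi])
    (auto intro!: exI[of _ "2 * lxi _ * leta _"] DERIV_lxi mult_nonneg_nonneg less_imp_le[OF lxi_pos] less_imp_le[OF leta_pos])

lemma leta_mono: "x \<le> y \<Longrightarrow> leta y \<le> leta x"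
  using lxi_mono[of x y] by (simp add: leta_eq)

section \<open>Monotonicity, limits and maxima on the real line\<close>

lemma nondecreasing_onI:
  fixes f :: "real \<Rightarrow> real"
  assumes "\<And>x. u \<le> x \<Longrightarrow> x \<le> v \<Longrightarrow> (f has_real_derivative f' x) (at x)"
    and "\<And>x. u \<le> x \<Longrightarrow> x \<le> v \<Longrightarrow> 0 \<le> f' x" and "u \<le> v"
  shows "f u \<le> f v"
  using DERIV_nonneg_imp_nondecreasing[OF \<open>u \<le> v\<close>, of f] assms by blast

lemma nonincreasing_onI:
  fixes f :: "real \<Rightarrow> real"
  assumes "\<And>x. u \<le> x \<Longrightarrow> x \<le> v \<Longrightarrow> (f has_real_derivative f' x) (at x)"
    and "\<And>x. u \<le> x \<Longrightarrow> x \<le> v \<Longrightarrow> f' x \<le> 0" and "u \<le> v"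
  shows "f v \<le> f u"
  using DERIV_nonpos_imp_nonincreasing[OF \<open>u \<le> v\<close>, of f] assms by blast

lemma at_bot_limit_le:
  fixes f :: "real \<Rightarrow> real"
  assumes "(f \<longlongrightarrow> l) at_bot" "\<And>u. u \<le> x \<Longrightarrow> f u \<le> c"
  shows "l \<le> c"
  by (rule tendsto_upperbound[OF assms(1) eventually_mono[OF eventually_le_at_bot[of x]]]) (use assms(2) in auto)

lemma at_bot_limit_ge:
  fixes f :: "real \<Rightarrow> real"
  assumes "(f \<longlongrightarrow> l) at_bot" "\<And>u. u \<le> x \<Longrightarrow> c \<le> f u"
  shows "c \<le> l"
  by (rule tendsto_lowerbound[OF assms(1) eventually_mono[OF eventually_le_at_bot[of x]]]) (use assms(2) in auto)

lemma at_top_limit_le: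
  fixes f :: "real \<Rightarrow> real"
  assumes "(f \<longlongrightarrow> l) at_top" "\<And>u. x \<le> u \<Longrightarrow> f u \<le> c"
  shows "l \<le> c"
  by (rule tendsto_upperbound[OF assms(1) eventually_mono[OF eventually_ge_at_top[of x]]]) (use assms(2) in auto)

lemma at_top_limit_ge:
  fixes f :: "real \<Rightarrow> real"
  assumes "(f \<longlongrightarrow> l) at_top" "\<And>u. x \<le> u \<Longrightarrow> c \<le> f u"
  shows "c \<le> l"
  by (rule tendsto_lowerbound[OF assms(1) eventually_mono[OF eventually_ge_at_top[of x]]]) (use assms(2) in auto)

lemma attains_max_at_top:
  fixes f :: "real \<Rightarrow> real"
  assumes "continuous_on UNIV f" "(f \<longlongrightarrow> l) at_top" "l < f u" "z \<le> u"
  obtains s where "z \<le> s" "\<And>v. z \<le> v \<Longrightarrow> f v \<le> f s"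
proof -
  have "\<forall>\<^sub>F x in at_top. f x < f u" using assms(2,3) by (rule order_tendstoD)
  then obtain B where B: "\<And>x. B \<le> x \<Longrightarrow> f x < f u" by (auto simp: eventually_at_top_linorder)
  let ?I = "{z..max B u}"
  have "\<exists>s\<in>?I. \<forall>v\<in>?I. f v \<le> f s"
    by (rule continuous_attains_sup) (use assms in \<open>auto intro: continuous_on_subset\<close>)
  then obtain s where s: "s \<in> ?I" "\<And>v. v \<in> ?I \<Longrightarrow> f v \<le> f s" by blast
  have "f v \<le> f s" if "z \<le> v" for v
  proof (cases "v \<le> max B u")
    case True then show ?thesis using s that by auto
  next
    case False
    then have "f v < f u" by (intro B) auto
    also have "f u \<le> f s" using s assms(4) by auto
    finally show ?thesis by simp
  qed
  then show ?thesis using that[of s] s by auto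
qed

lemma attains_max_at_bot:
  fixes f :: "real \<Rightarrow> real"
  assumes "continuous_on UNIV f" "(f \<longlongrightarrow> l) at_bot" "l < f u" "u \<le> z"
  obtains s where "s \<le> z" "\<And>v. v \<le> z \<Longrightarrow> f v \<le> f s"
proof -
  have c: "continuous_on UNIV (\<lambda>x. f (- x))"
    by (rule continuous_on_compose2[OF assms(1)]) (auto intro: continuous_intros)
  have l: "((\<lambda>x. f (- x)) \<longlongrightarrow> l) at_top"
    using assms(2) by (simp add: filterlim_at_bot_mirror)
  obtain s where "- z \<le> s" "\<And>v. - z \<le> v \<Longrightarrow> f (- v) \<le> f (- s)"
    using attains_max_at_top[OF c l, of "- u" "- z"] assms(3,4) by auto
  then show ?thesis using that[of "- s"] by (metis minus_le_iff minus_minus neg_le_iff_le)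
qed

lemma attains_global_max:
  fixes f :: "real \<Rightarrow> real"
  assumes "continuous_on UNIV f" "(f \<longlongrightarrow> k) at_bot" "(f \<longlongrightarrow> l) at_top" "k < f u" "l < f u"
  obtains s where "\<And>v. f v \<le> f s"
proof -
  obtain s1 where s1: "s1 \<le> u" "\<And>v. v \<le> u \<Longrightarrow> f v \<le> f s1"
    using attains_max_at_bot[OF assms(1,2,4), of u] by auto
  obtain s2 where s2: "u \<le> s2" "\<And>v. u \<le> v \<Longrightarrow> f v \<le> f s2"
    using attains_max_at_top[OF assms(1,3,5), of u] by auto
  have "f v \<le> f (if f s1 \<le> f s2 then s2 else s1)" for v
    using s1(2)[of v] s2(2)[of v] by (cases "v \<le> u") auto
  then show ?thesis using that by blast
qed

lemma DERIV_max_sq: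
  fixes y :: "real \<Rightarrow> real"
  assumes d: "(y has_real_derivative D) (at s)" and e: "0 < e" "\<And>v. \<bar>s - v\<bar> < e \<Longrightarrow> (y v)\<^sup>2 \<le> (y s)\<^sup>2"
    and "y s \<noteq> 0"
  shows "D = 0"
proof -
  have "((\<lambda>x. (y x)\<^sup>2) has_real_derivative 2 * y s * D) (at s)"
    by (auto intro!: derivative_eq_intros d)
  then have "2 * y s * D = 0" by (rule DERIV_local_max[OF _ e(1)]) (use e(2) in auto)
  with \<open>y s \<noteq> 0\<close> show ?thesis by simp
qed

lemma last_zero:
  fixes y :: "real \<Rightarrow> real"
  assumes c: "continuous_on UNIV y" and ev: "\<forall>\<^sub>F x in at_top. y x \<noteq> 0" and "s \<le> u" "y u = 0"
  obtains z where "s \<le> z" "y z = 0" "\<And>v. z < v \<Longrightarrow> y v \<noteq> 0"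
proof -
  obtain B where B: "\<And>x. B \<le> x \<Longrightarrow> y x \<noteq> 0" using ev by (auto simp: eventually_at_top_linorder)
  define Z where "Z = {x \<in> {s..B}. y x = 0}"
  have "closed Z" unfolding Z_def
    by (intro continuous_closed_preimage_constant) (auto intro: continuous_on_subset[OF c])
  moreover have "bounded Z" unfolding Z_def by (rule bounded_subset[of "{s..B}"]) auto
  ultimately have "compact Z" by (simp add: compact_eq_bounded_closed)
  moreover have "u \<le> B" using B[of u] assms(4) by (meson linear)
  then have "u \<in> Z" using assms(3,4) by (simp add: Z_def)
  ultimately obtain z where z: "z \<in> Z" "\<And>v. v \<in> Z \<Longrightarrow> v \<le> z"
    using compact_attains_sup[of Z] by auto
  have "y v \<noteq> 0" if "z < v" for v
  proof
    assume "y v = 0"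
    moreover have "s \<le> v" using z(1) that by (auto simp: Z_def)
    moreover have "v \<le> B" using B[of v] \<open>y v = 0\<close> by (meson linear)
    ultimately have "v \<in> Z" by (auto simp: Z_def)
    with z(2)[of v] that show False by simp
  qed
  then show ?thesis using that[of z] z(1) by (auto simp: Z_def)
qed

text \<open>\<open>V\<close> is a convex function of \<open>lxi x\<close>. Beyond its minimum the Sonin function \<open>y\<^sup>2 - y'\<^sup>2 / V\<close> increases
  on the oscillatory region, so the maxima of \<open>y\<^sup>2\<close> are dominated by the last one.\<close>

lemma sonin_last_maximum:
  fixes y y' V :: "real \<Rightarrow> real" and a b c :: real
  assumes V: "\<And>x. V x = a\<^sup>2 * lxi x + b\<^sup>2 * leta x - c * lxi x * leta x" and c: "0 < c"
    and dy: "\<And>x. (y has_real_derivative y' x) (at x)"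
    and dy': "\<And>x. (y' has_real_derivative V x * y x) (at x)"
    and top: "(y \<longlongrightarrow> 0) at_top" "\<forall>\<^sub>F x in at_top. y x \<noteq> 0"
    and tail: "\<And>x. (\<And>u. x \<le> u \<Longrightarrow> y u \<noteq> 0) \<Longrightarrow> (y x)\<^sup>2 \<le> 1"
    and s: "0 \<le> a\<^sup>2 - b\<^sup>2 - c + 2 * c * lxi s"
  shows "(y s)\<^sup>2 \<le> 1"
proof (cases "\<exists>u\<ge>s. y u = 0")
  case False
  then show ?thesis by (intro tail) auto
next
  case True
  have cont: "continuous_on UNIV y"
    using dy by (intro continuous_at_imp_continuous_on) (auto intro: DERIV_isCont)
  then obtain z where z: "s \<le> z" "y z = 0" "\<And>v. z < v \<Longrightarrow> y v \<noteq> 0"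
    using last_zero[OF cont top(2)] True by metis
  have lim2: "((\<lambda>x. (y x)\<^sup>2) \<longlongrightarrow> 0) at_top" using tendsto_power[OF top(1), of 2] by simp
  have "0 < (y (z + 1))\<^sup>2" using z(3)[of "z + 1"] by simp
  moreover have "continuous_on UNIV (\<lambda>x. (y x)\<^sup>2)" by (intro continuous_intros cont)
  ultimately obtain w where w: "z \<le> w" "\<And>v. z \<le> v \<Longrightarrow> (y v)\<^sup>2 \<le> (y w)\<^sup>2"
    using attains_max_at_top[OF _ lim2, of "z + 1" z] by auto
  have yw: "y w \<noteq> 0" using w(2)[of "z + 1"] \<open>0 < (y (z + 1))\<^sup>2\<close> by auto
  then have zw: "z < w" using w(1) z(2) by (cases "z = w") auto
  have y'w: "y' w = 0"
    by (rule DERIV_max_sq[OF dy, where e = "w - z"]) (use zw yw w(2) in \<open>auto simp: abs_less_iff\<close>)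
  have w1: "(y w)\<^sup>2 \<le> 1" by (rule tail) (use z(3) zw in auto)
  have dV: "(V has_real_derivative 2 * lxi x * leta x * (a\<^sup>2 - b\<^sup>2 - c + 2 * c * lxi x)) (at x)" for x
    unfolding V[abs_def] by (auto intro!: derivative_eq_intros simp: leta_eq algebra_simps power2_eq_square)
  have V'0: "0 \<le> 2 * lxi x * leta x * (a\<^sup>2 - b\<^sup>2 - c + 2 * c * lxi x)" if "s \<le> x" for x
  proof -
    have "c * lxi s \<le> c * lxi x" using c lxi_mono[OF that] by simp
    then have "0 \<le> a\<^sup>2 - b\<^sup>2 - c + 2 * c * lxi x" using s by linarith
    then show ?thesis using lxi_pos[of x] leta_pos[of x] by simp
  qed
  have Vmono: "V u \<le> V v" if "s \<le> u" "u \<le> v" for u v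
    by (rule nondecreasing_onI[OF dV V'0]) (use that in auto)
  \<comment> \<open>If \<open>V\<close> were nonnegative from \<open>w\<close> on,
    \<open>y * y'\<close> would be nondecreasing from its value 0 at \<open>w\<close>, and the
    square of \<open>y\<close> could not fall from a positive value to 0.\<close>
  have "V w < 0"
  proof (rule ccontr)
    assume "\<not> V w < 0"
    then have Vpos: "0 \<le> V x" if "w \<le> x" for x using Vmono[of w x] that z(1) zw by simp
    have d: "((\<lambda>x. y x * y' x) has_real_derivative (y' x)\<^sup>2 + V x * (y x)\<^sup>2) (at x)" for x
      by (auto intro!: derivative_eq_intros dy dy' simp: power2_eq_square)
    have "0 \<le> y x * y' x" if "w \<le> x" for x
      using nondecreasing_onI[of w x "\<lambda>x. y x * y' x", OF d _ that] Vpos y'w by simp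
    then have mono: "(y w)\<^sup>2 \<le> (y x)\<^sup>2" if "w \<le> x" for x
      by (intro nondecreasing_onI[of w x "\<lambda>x. (y x)\<^sup>2" "\<lambda>x. 2 * (y x * y' x)", OF _ _ that])
        (auto intro!: derivative_eq_intros dy)
    have "(y w)\<^sup>2 \<le> 0" by (rule at_top_limit_ge[OF lim2 mono])
    with yw show False by simp
  qed
  then have Vneg: "V x < 0" if "s \<le> x" "x \<le> w" for x using Vmono[OF that] by simp
  \<comment> \<open>By the equation the mixed terms cancel, and the Sonin function has derivative
    \<open>y'^2 V' / V^2\<close>, of the sign of \<open>V'\<close>.\<close>
  have "(y s)\<^sup>2 - (y' s)\<^sup>2 / V s \<le> (y w)\<^sup>2 - (y' w)\<^sup>2 / V w"
  proof (rule nondecreasing_onI[where f = "\<lambda>x. (y x)\<^sup>2 - (y' x)\<^sup>2 / V x"])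
    fix x assume x: "s \<le> x" "x \<le> w"
    let ?D = "2 * lxi x * leta x * (a\<^sup>2 - b\<^sup>2 - c + 2 * c * lxi x)"
    show "((\<lambda>x. (y x)\<^sup>2 - (y' x)\<^sup>2 / V x) has_real_derivative (y' x)\<^sup>2 * ?D / (V x)\<^sup>2) (at x)"
      using Vneg[OF x] by (auto intro!: derivative_eq_intros dy dy' dV simp: field_simps power2_eq_square)
    show "0 \<le> (y' x)\<^sup>2 * ?D / (V x)\<^sup>2" 
      by (rule divide_nonneg_nonneg[OF mult_nonneg_nonneg[OF zero_le_power2 V'0[OF x(1)]] zero_le_power2])
  qed (use z(1) zw in simp)
  moreover have "(y' s)\<^sup>2 / V s \<le> 0" using Vneg[of s] z(1) zw by (simp add: divide_nonneg_neg)
  ultimately show ?thesis using w1 y'w by simp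
qed

lemma DERIV_reflect:
  fixes f :: "real \<Rightarrow> real"
  assumes "\<And>x. (f has_real_derivative f' x) (at x)"
  shows "((\<lambda>x. f (- x)) has_real_derivative - f' (- x)) (at x)"
proof -
  have "((\<lambda>x. - x) has_real_derivative - 1) (at x)" by (auto intro!: derivative_eq_intros)
  from DERIV_chain2[where f = f and g = "\<lambda>x. - x", OF assms this] show ?thesis by simp
qed

lemma powr_half_sq: "0 < x \<Longrightarrow> (x powr (p / 2))\<^sup>2 = x powr p" for x :: real
  by (simp add: power2_eq_square powr_add[symmetric])

text \<open>A maximum of the square above 1 would sit on one side of the minimum of
  \<open>V\<close>. On the right the last maximum dominates it; on the left the reflection
  \<open>x \<mapsto> - x\<close>, which exchanges \<open>a\<close> and \<open>b\<close>, reduces to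
  the same case. For \<open>b = 0\<close> nothing decays at the left end, and the Sonin function is
  compared with its limit 1 there.\<close>

lemma sonin_bound:
  fixes y y' V :: "real \<Rightarrow> real" and a b c :: real
  assumes V: "\<And>x. V x = a\<^sup>2 * lxi x + b\<^sup>2 * leta x - c * lxi x * leta x" and c: "0 < c"
    and dy: "\<And>x. (y has_real_derivative y' x) (at x)"
    and dy': "\<And>x. (y' has_real_derivative V x * y x) (at x)"
    and top: "(y \<longlongrightarrow> 0) at_top" "\<forall>\<^sub>F x in at_top. y x \<noteq> 0"
    and tail: "\<And>x. (\<And>u. x \<le> u \<Longrightarrow> y u \<noteq> 0) \<Longrightarrow> (y x)\<^sup>2 \<le> 1"
    and bot: "b \<noteq> 0 \<Longrightarrow> (y \<longlongrightarrow> 0) at_bot" "\<forall>\<^sub>F x in at_bot. y x \<noteq> 0"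
    and head: "\<And>x. b \<noteq> 0 \<Longrightarrow> (\<And>u. u \<le> x \<Longrightarrow> y u \<noteq> 0) \<Longrightarrow> (y x)\<^sup>2 \<le> 1"
    and bot0: "b = 0 \<Longrightarrow> ((\<lambda>x. (y x)\<^sup>2) \<longlongrightarrow> 1) at_bot" "b = 0 \<Longrightarrow> ((\<lambda>x. (y' x)\<^sup>2 / V x) \<longlongrightarrow> 0) at_bot"
  shows "(y x)\<^sup>2 \<le> 1"
proof (rule ccontr)
  assume "\<not> (y x)\<^sup>2 \<le> 1"
  then have x: "1 < (y x)\<^sup>2" by simp
  have cont: "continuous_on UNIV (\<lambda>x. (y x)\<^sup>2)"
    by (intro continuous_intros continuous_at_imp_continuous_on) (use dy DERIV_isCont in blast)
  have t0: "((\<lambda>x. (y x)\<^sup>2) \<longlongrightarrow> 0) at_top" using tendsto_power[OF top(1), of 2] by simp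
  obtain k where k: "((\<lambda>x. (y x)\<^sup>2) \<longlongrightarrow> k) at_bot" "k \<le> 1"
  proof (cases "b = 0")
    case True then show ?thesis using that bot0 by blast
  next
    case False
    then have "((\<lambda>x. (y x)\<^sup>2) \<longlongrightarrow> 0) at_bot" using tendsto_power[OF bot(1), of 2] by simp
    then show ?thesis using that[of 0] by simp
  qed
  obtain s where s: "\<And>v. (y v)\<^sup>2 \<le> (y s)\<^sup>2"
  proof -
    have "k < (y x)\<^sup>2" "0 < (y x)\<^sup>2" using k(2) x by linarith+
    then show ?thesis by (rule attains_global_max[OF cont k(1) t0]) (rule that)
  qed
  have s1: "1 < (y s)\<^sup>2" using s[of x] x by simp
  show False
  proof (cases "0 \<le> a\<^sup>2 - b\<^sup>2 - c + 2 * c * lxi s")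
    case True
    have "(y s)\<^sup>2 \<le> 1"
      by (rule sonin_last_maximum[OF V c dy dy' top tail True])
    with s1 show False by simp
  next
    case neg: False
    show False
    proof (cases "b = 0")
      case False
      have dz: "((\<lambda>x. y (- x)) has_real_derivative (\<lambda>x. - y' (- x)) x) (at x)" for x
        by (rule DERIV_reflect[OF dy])
      have dz': "((\<lambda>x. - y' (- x)) has_real_derivative V (- x) * y (- x)) (at x)" for x
        using DERIV_minus[OF DERIV_reflect[OF dy', of x]] by simp
      have V': "V (- x) = b\<^sup>2 * lxi x + a\<^sup>2 * leta x - c * lxi x * leta x" for x
        by (simp add: V lxi_minus leta_minus)
      have "(y (- (- s)))\<^sup>2 \<le> 1"
      proof (rule sonin_last_maximum[where y = "\<lambda>x. y (- x)" and a = b and b = a and c = c and s = "- s", OF V' c dz dz'])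
        show "((\<lambda>x. y (- x)) \<longlongrightarrow> 0) at_top" using bot(1)[OF False] by (simp add: filterlim_at_bot_mirror)
        show "\<forall>\<^sub>F x in at_top. y (- x) \<noteq> 0" using bot(2) by (simp add: at_bot_mirror eventually_filtermap)
        show "(y (- x))\<^sup>2 \<le> 1" if "\<And>u. x \<le> u \<Longrightarrow> y (- u) \<noteq> 0" for x
          by (rule head[OF False]) (use that[of "- _"] in \<open>force simp: minus_le_iff\<close>)
        show "0 \<le> b\<^sup>2 - a\<^sup>2 - c + 2 * c * lxi (- s)"
          using neg by (simp add: lxi_minus leta_eq algebra_simps)
      qed
      with s1 show False by simp
    next
      case True
      have dV: "(V has_real_derivative 2 * lxi x * leta x * (a\<^sup>2 - b\<^sup>2 - c + 2 * c * lxi x)) (at x)" for x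
        unfolding V[abs_def] by (auto intro!: derivative_eq_intros simp: leta_eq algebra_simps power2_eq_square)
      have neg': "a\<^sup>2 - b\<^sup>2 - c + 2 * c * lxi x < 0" if "x \<le> s" for x
      proof -
        have "c * lxi x \<le> c * lxi s" using c lxi_mono[OF that] by simp
        with neg show ?thesis by linarith
      qed
      \<comment> \<open>With \<open>b = 0\<close> the potential is \<open>lxi x\<close> times
        \<open>a^2 - c + c lxi x\<close>, and the second factor lies below the negative number
        \<open>a^2 - c + 2 c lxi x\<close>.\<close>
      have Vneg: "V x < 0" if "x \<le> s" for x
      proof -
        have "V x = lxi x * (a\<^sup>2 - c + c * lxi x)" using True by (simp add: V leta_eq algebra_simps)
        moreover have "a\<^sup>2 - c + c * lxi x < 0"
          using neg'[OF that] mult_pos_pos[OF c lxi_pos[of x]] True by simp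
        ultimately show ?thesis using lxi_pos[of x] by (simp add: mult_less_0_iff)
      qed
      have m: "(y s)\<^sup>2 - (y' s)\<^sup>2 / V s \<le> (y u)\<^sup>2 - (y' u)\<^sup>2 / V u" if "u \<le> s" for u
      proof (rule nonincreasing_onI[where f = "\<lambda>x. (y x)\<^sup>2 - (y' x)\<^sup>2 / V x", OF _ _ that])
        fix x assume x: "u \<le> x" "x \<le> s"
        let ?D = "2 * lxi x * leta x * (a\<^sup>2 - b\<^sup>2 - c + 2 * c * lxi x)"
        show "((\<lambda>x. (y x)\<^sup>2 - (y' x)\<^sup>2 / V x) has_real_derivative (y' x)\<^sup>2 * ?D / (V x)\<^sup>2) (at x)"
          using Vneg[OF x(2)] by (auto intro!: derivative_eq_intros dy dy' dV simp: field_simps power2_eq_square)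
        have Dle: "?D \<le> 0" using neg'[OF x(2)] lxi_pos[of x] leta_pos[of x] by (simp add: mult_nonneg_nonpos)
        show "(y' x)\<^sup>2 * ?D / (V x)\<^sup>2 \<le> 0"
          by (rule divide_nonpos_nonneg[OF mult_nonneg_nonpos[OF zero_le_power2 Dle] zero_le_power2])
      qed
      have "((\<lambda>x. (y x)\<^sup>2 - (y' x)\<^sup>2 / V x) \<longlongrightarrow> 1 - 0) at_bot"
        by (intro tendsto_diff bot0 True)
      from at_bot_limit_ge[OF this m] have "(y s)\<^sup>2 - (y' s)\<^sup>2 / V s \<le> 1 - 0" .
      moreover have "(y' s)\<^sup>2 / V s \<le> 0" using Vneg[of s] by (simp add: divide_nonneg_neg)
      ultimately show False using s1 by simp
    qed
  qed
qed

lemma const_sign_on: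
  fixes y :: "real \<Rightarrow> real"
  assumes "continuous_on UNIV y" "connected S" "\<And>u. u \<in> S \<Longrightarrow> y u \<noteq> 0" "x \<in> S" "0 < y x" "u \<in> S"
  shows "0 < y u"
proof (rule ccontr)
  assume "\<not> 0 < y u"
  then have "y u \<le> 0" by simp
  have "connected (y ` S)"
    by (rule connected_continuous_image[OF continuous_on_subset[OF assms(1)] assms(2)]) auto
  then have "0 \<in> y ` S"
    by (rule connectedD_interval[of _ "y u" "y x"]) (use \<open>y u \<le> 0\<close> assms in auto)
  with assms(3) show False by auto
qed

text \<open>Riccati comparison: before its first zero a solution that vanishes at \<open>-\<infinity>\<close> satisfies
  \<open>y' \<le> (b leta - a lxi) y\<close>, because the ground state \<open>lxi\<^bsup>b/2\<^esup> leta\<^bsup>a/2\<^esup>\<close> solves the corresponding first-order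
  equation and \<open>c\<close> exceeds its eigenvalue \<open>(a + b) (a + b + 2)\<close>.\<close>

lemma DERIV_ground_state:
  "((\<lambda>x. lxi x powr p * leta x powr q) has_real_derivative
     2 * (p * leta x - q * lxi x) * (lxi x powr p * leta x powr q)) (at x)"
proof -
  have "((\<lambda>x. lxi x powr p) has_real_derivative 2 * p * leta x * lxi x powr p) (at x)"
    using DERIV_fun_powr[OF DERIV_lxi lxi_pos, of p x] lxi_pos[of x] by (simp add: powr_diff mult_ac)
  moreover have "((\<lambda>x. leta x powr q) has_real_derivative - 2 * q * lxi x * leta x powr q) (at x)"
    using DERIV_fun_powr[OF DERIV_leta leta_pos, of q x] leta_pos[of x] by (simp add: powr_diff mult_ac)
  ultimately show ?thesis by (rule DERIV_mult[THEN DERIV_cong]) (simp add: algebra_simps)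
qed

text \<open>The monotone quantity is the Wronskian of \<open>y\<close> with the ground state. Both
  satisfy an equation of the same form, and the potentials differ only in the coefficient of
  \<open>lxi x * leta x\<close>, so the Wronskian has a derivative of fixed sign wherever
  \<open>y\<close> is positive.\<close>

lemma riccati_monotone:
  fixes y y' V :: "real \<Rightarrow> real" and a b c :: real
  assumes V: "\<And>x. V x = a\<^sup>2 * lxi x + b\<^sup>2 * leta x - c * lxi x * leta x" and c: "(a + b) * (a + b + 2) \<le> c"
    and dy: "\<And>x. (y has_real_derivative y' x) (at x)"
    and dy': "\<And>x. (y' has_real_derivative V x * y x) (at x)"
    and pos: "\<And>x. u \<le> x \<Longrightarrow> x \<le> v \<Longrightarrow> 0 < y x" and "u \<le> v"
  shows "(y' v - (b * leta v - a * lxi v) * y v) * (lxi v powr (b/2) * leta v powr (a/2))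
    \<le> (y' u - (b * leta u - a * lxi u) * y u) * (lxi u powr (b/2) * leta u powr (a/2))"
proof (rule nonincreasing_onI[where f = "\<lambda>x. (y' x - (b * leta x - a * lxi x) * y x) * (lxi x powr (b/2) * leta x powr (a/2))",
      OF _ _ \<open>u \<le> v\<close>])
  fix x assume x: "u \<le> x" "x \<le> v"
  let ?g = "lxi x powr (b/2) * leta x powr (a/2)"
  let ?r = "b * leta x - a * lxi x"
  have "((\<lambda>x. (y' x - (b * leta x - a * lxi x) * y x) * (lxi x powr (b/2) * leta x powr (a/2))) has_real_derivative
      (V x * y x - ((- 2 * (a + b) * lxi x * leta x) * y x + ?r * y' x)) * ?g
        + (y' x - ?r * y x) * (?r * ?g)) (at x)"
    by (rule DERIV_mult'[THEN DERIV_cong], (rule derivative_eq_intros dy dy' refl DERIV_ground_state)+)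
      (simp add: algebra_simps)
  moreover have "(V x * y x - ((- 2 * (a + b) * lxi x * leta x) * y x + ?r * y' x)) * ?g
        + (y' x - ?r * y x) * (?r * ?g) = - (c - (a + b) * (a + b + 2)) * lxi x * leta x * y x * ?g"
  proof -
    have "V x + 2 * (a + b) * lxi x * leta x - ?r * ?r = - (c - (a + b) * (a + b + 2)) * lxi x * leta x"
      unfolding V leta_eq by (simp add: algebra_simps power2_eq_square)
    moreover have "(V x * y x - ((- 2 * (a + b) * lxi x * leta x) * y x + ?r * y' x)) * ?g
        + (y' x - ?r * y x) * (?r * ?g) = (V x + 2 * (a + b) * lxi x * leta x - ?r * ?r) * y x * ?g"
      by (simp add: algebra_simps)
    ultimately show ?thesis by simp
  qed
  ultimately show "((\<lambda>x. (y' x - (b * leta x - a * lxi x) * y x) * (lxi x powr (b/2) * leta x powr (a/2))) has_real_derivative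
      - (c - (a + b) * (a + b + 2)) * lxi x * leta x * y x * ?g) (at x)" by simp
  show "- (c - (a + b) * (a + b + 2)) * lxi x * leta x * y x * ?g \<le> 0"
  proof -
    have "0 \<le> (c - (a + b) * (a + b + 2)) * (lxi x * leta x * y x * ?g)"
      using c pos[OF x] lxi_pos[of x] leta_pos[of x] by (intro mult_nonneg_nonneg) auto
    then show ?thesis by (simp only: minus_mult_left[symmetric] mult.assoc neg_le_0_iff_le)
  qed
qed

lemma quotient_ground_state_deriv:
  assumes "(y has_real_derivative y') (at x)"
  shows "((\<lambda>x. y x / (lxi x powr (b/2) * leta x powr (a/2))) has_real_derivative
    (y' - (b * leta x - a * lxi x) * y x) / (lxi x powr (b/2) * leta x powr (a/2))) (at x)"
proof -
  have "lxi x powr (b/2) * leta x powr (a/2) \<noteq> 0" using lxi_pos[of x] leta_pos[of x] by simp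
  then show ?thesis
    by (intro DERIV_divide[OF assms DERIV_ground_state[of "b/2" "a/2"], THEN DERIV_cong]) (simp_all add: field_simps)
qed

text \<open>Up to the first zero the quotient of \<open>y\<close> by the ground state is
  nonincreasing, so \<open>y\<close> is at least \<open>C\<close> times the ground state to the left
  of \<open>x\<close>. The mass that this forces on the left half-line,
  \<open>C^2 A lxi^b / 2\<close>, cannot exceed the total mass 1/2.\<close>

lemma head_bound_pos:
  fixes y y' V \<Theta> :: "real \<Rightarrow> real" and a b c A :: real
  assumes V: "\<And>x. V x = a\<^sup>2 * lxi x + b\<^sup>2 * leta x - c * lxi x * leta x" and c: "(a + b) * (a + b + 2) \<le> c"
    and b: "0 < b" and dy: "\<And>x. (y has_real_derivative y' x) (at x)"
    and dy': "\<And>x. (y' has_real_derivative V x * y x) (at x)"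
    and bot: "((\<lambda>x. (y' x - (b * leta x - a * lxi x) * y x) * (lxi x powr (b/2) * leta x powr (a/2))) \<longlongrightarrow> 0) at_bot"
    and d\<Theta>: "\<And>x. (\<Theta> has_real_derivative b * leta x * (y x)\<^sup>2) (at x)"
    and \<Theta>: "(\<Theta> \<longlongrightarrow> l) at_bot" "(\<Theta> \<longlongrightarrow> l + 1/2) at_top"
    and A: "0 \<le> A" "\<And>u. u \<le> x \<Longrightarrow> A \<le> leta u powr a"
    and pos: "\<And>u. u \<le> x \<Longrightarrow> 0 < y u"
  shows "A * (y x)\<^sup>2 \<le> leta x powr a"
proof -
  let ?g = "\<lambda>x. lxi x powr (b/2) * leta x powr (a/2)"
  have g0: "0 < ?g x" for x using lxi_pos[of x] leta_pos[of x] by simp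
  have h: "(y' v - (b * leta v - a * lxi v) * y v) \<le> 0" if v: "v \<le> x" for v
  proof -
    have "(y' v - (b * leta v - a * lxi v) * y v) * ?g v \<le> 0"
      by (rule at_bot_limit_ge[OF bot, of v], rule riccati_monotone[OF V c dy dy']) (use pos v in auto)
    then show ?thesis using g0[of v] by (meson mult_pos_pos not_le)
  qed
  \<comment> \<open>The constant makes the multiple of the ground state touch \<open>y\<close> at
    \<open>x\<close>, so the bound on \<open>C\<close> is a bound on \<open>y x\<close>.\<close>
  define C where "C = y x / ?g x"
  have C: "C * ?g u \<le> y u" if "u \<le> x" for u
  proof -
    have "C \<le> y u / ?g u"
      unfolding C_def
      by (rule nonincreasing_onI[OF quotient_ground_state_deriv[OF dy], of u x])
        (use h g0 that in \<open>auto intro!: divide_nonpos_pos\<close>)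
    then show ?thesis using g0[of u] by (simp add: le_divide_eq)
  qed
  have C0: "0 \<le> C" unfolding C_def using pos[of x] g0[of x] by simp
  have g2: "(?g u)\<^sup>2 = lxi u powr b * leta u powr a" for u
    by (simp add: power_mult_distrib powr_half_sq lxi_pos leta_pos)
  have m: "\<Theta> u - C\<^sup>2 * A * lxi u powr b / 2 \<le> \<Theta> x - C\<^sup>2 * A * lxi x powr b / 2" if ux: "u \<le> x" for u
  proof (rule nondecreasing_onI[where f = "\<lambda>x. \<Theta> x - C\<^sup>2 * A * lxi x powr b / 2", OF _ _ ux])
    fix w assume w: "u \<le> w" "w \<le> x"
    have "((\<lambda>x. lxi x powr b) has_real_derivative 2 * b * leta w * lxi w powr b) (at w)"
      using DERIV_fun_powr[OF DERIV_lxi lxi_pos, of b w] lxi_pos[of w] by (simp add: powr_diff mult_ac)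
    then show "((\<lambda>x. \<Theta> x - C\<^sup>2 * A * lxi x powr b / 2) has_real_derivative
        b * leta w * (y w)\<^sup>2 - C\<^sup>2 * A * (b * leta w * lxi w powr b)) (at w)"
      by (rule DERIV_diff[OF d\<Theta> DERIV_cdivide[OF DERIV_cmult], THEN DERIV_cong]) simp
    have "C\<^sup>2 * A * lxi w powr b \<le> C\<^sup>2 * (leta w powr a) * lxi w powr b"
      using A(2)[OF w(2)] by (intro mult_right_mono mult_left_mono) auto
    also have "\<dots> = (C * ?g w)\<^sup>2" unfolding power_mult_distrib[of C] g2 by (simp only: mult_ac)
    also have "\<dots> \<le> (y w)\<^sup>2" using C[OF w(2)] C0 g0[of w] by (intro power_mono) auto
    finally have "b * leta w * (C\<^sup>2 * A * lxi w powr b) \<le> b * leta w * (y w)\<^sup>2"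
      using b leta_pos[of w] by (intro mult_left_mono) auto
    then show "0 \<le> b * leta w * (y w)\<^sup>2 - C\<^sup>2 * A * (b * leta w * lxi w powr b)" by (simp add: mult_ac)
  qed
  have "((\<lambda>u. \<Theta> u - C\<^sup>2 * A * lxi u powr b / 2) \<longlongrightarrow> l - C\<^sup>2 * A * 0 / 2) at_bot"
    by (intro tendsto_intros \<Theta>(1)) (use tendsto_powr2[OF lxi_at_bot tendsto_const, of b] b lxi_pos in \<open>auto intro: always_eventually less_imp_le\<close>)
  from at_bot_limit_le[OF this m] have "l - C\<^sup>2 * A * 0 / 2 \<le> \<Theta> x - C\<^sup>2 * A * lxi x powr b / 2" .
  moreover have "\<Theta> x \<le> l + 1/2"
    by (rule at_top_limit_ge[OF \<Theta>(2), of x], rule nondecreasing_onI[OF d\<Theta>])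
      (use b leta_pos in \<open>auto intro!: mult_nonneg_nonneg intro: less_imp_le\<close>)
  ultimately have C1: "C\<^sup>2 * A * lxi x powr b \<le> 1" by simp
  have "C\<^sup>2 * (?g x)\<^sup>2 = (y x)\<^sup>2"
    using lxi_pos[of x] leta_pos[of x] by (simp add: C_def power_mult_distrib[symmetric])
  then have y2: "(y x)\<^sup>2 = C\<^sup>2 * (lxi x powr b * leta x powr a)" unfolding g2 by simp
  have "A * (y x)\<^sup>2 = (C\<^sup>2 * A * lxi x powr b) * leta x powr a" unfolding y2 by simp
  also have "\<dots> \<le> 1 * leta x powr a" by (intro mult_right_mono C1) simp
  finally show ?thesis by simp
qed

text \<open>The mirror argument after the last zero, with total mass \<open>1 / (2 a)\<close>. The
  power of \<open>lxi\<close> in the ground state is increasing and may be dropped, so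
  \<open>leta^(a/2)\<close> alone is the comparison function and the bound comes out as exactly
  1.\<close>

lemma tail_bound_pos:
  fixes y y' V \<Phi> :: "real \<Rightarrow> real" and a b c :: real
  assumes V: "\<And>x. V x = a\<^sup>2 * lxi x + b\<^sup>2 * leta x - c * lxi x * leta x" and c: "(a + b) * (a + b + 2) \<le> c"
    and a: "0 < a" and b: "0 \<le> b" and dy: "\<And>x. (y has_real_derivative y' x) (at x)"
    and dy': "\<And>x. (y' has_real_derivative V x * y x) (at x)"
    and top: "((\<lambda>x. (y' x - (b * leta x - a * lxi x) * y x) * (lxi x powr (b/2) * leta x powr (a/2))) \<longlongrightarrow> 0) at_top"
    and d\<Phi>: "\<And>x. (\<Phi> has_real_derivative lxi x * (y x)\<^sup>2) (at x)"
    and \<Phi>: "(\<Phi> \<longlongrightarrow> - 1 / (2 * a)) at_bot" "(\<Phi> \<longlongrightarrow> 0) at_top"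
    and pos: "\<And>u. x \<le> u \<Longrightarrow> 0 < y u"
  shows "(y x)\<^sup>2 \<le> 1"
proof -
  let ?g = "\<lambda>x. lxi x powr (b/2) * leta x powr (a/2)"
  have g0: "0 < ?g x" for x using lxi_pos[of x] leta_pos[of x] by simp
  have h: "0 \<le> (y' v - (b * leta v - a * lxi v) * y v)" if v: "x \<le> v" for v
  proof -
    have "0 \<le> (y' v - (b * leta v - a * lxi v) * y v) * ?g v"
      by (rule at_top_limit_le[OF top, of v], rule riccati_monotone[OF V c dy dy']) (use pos v in auto)
    then show ?thesis using g0[of v] by (meson mult_neg_pos not_le)
  qed
  define C where "C = y x / leta x powr (a/2)"
  have C0: "0 \<le> C" unfolding C_def using pos[of x] leta_pos[of x] by simp
  have C: "C * leta u powr (a/2) \<le> y u" if "x \<le> u" for u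
  proof -
    have "y x / ?g x \<le> y u / ?g u"
      by (rule nondecreasing_onI[OF quotient_ground_state_deriv[OF dy], of x u])
        (use h g0 that in \<open>auto intro!: divide_nonneg_pos\<close>)
    then have "y x / ?g x * ?g u \<le> y u" using g0[of u] by (simp add: le_divide_eq)
    moreover have "y x / ?g x * ?g u = C * leta u powr (a/2) * (lxi u powr (b/2) / lxi x powr (b/2))"
      by (simp add: C_def mult.commute mult.left_commute)
    moreover have "1 \<le> lxi u powr (b/2) / lxi x powr (b/2)"
      using lxi_pos[of x] lxi_mono[OF that] b by (simp add: powr_mono2)
    then have "C * leta u powr (a/2) * 1 \<le> C * leta u powr (a/2) * (lxi u powr (b/2) / lxi x powr (b/2))"
      using C0 by (intro mult_left_mono) auto
    ultimately show ?thesis by linarith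
  qed
  have e2: "(leta u powr (a/2))\<^sup>2 = leta u powr a" for u by (simp add: powr_half_sq leta_pos)
  have m: "\<Phi> x + C\<^sup>2 * leta x powr a / (2 * a) \<le> \<Phi> u + C\<^sup>2 * leta u powr a / (2 * a)" if xu: "x \<le> u" for u
  proof (rule nondecreasing_onI[where f = "\<lambda>x. \<Phi> x + C\<^sup>2 * leta x powr a / (2 * a)", OF _ _ xu])
    fix w assume w: "x \<le> w" "w \<le> u"
    have "((\<lambda>x. leta x powr a) has_real_derivative - 2 * a * lxi w * leta w powr a) (at w)"
      using DERIV_fun_powr[OF DERIV_leta leta_pos, of a w] leta_pos[of w] by (simp add: powr_diff mult_ac)
    then show "((\<lambda>x. \<Phi> x + C\<^sup>2 * leta x powr a / (2 * a)) has_real_derivative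
        lxi w * (y w)\<^sup>2 - lxi w * (C\<^sup>2 * leta w powr a)) (at w)"
      by (rule DERIV_add[OF d\<Phi> DERIV_cdivide[OF DERIV_cmult], THEN DERIV_cong]) (use a in simp)
    have "C\<^sup>2 * leta w powr a = (C * leta w powr (a/2))\<^sup>2" by (simp add: power_mult_distrib e2)
    also have "\<dots> \<le> (y w)\<^sup>2" using C[OF w(1)] C0 by (intro power_mono) auto
    finally show "0 \<le> lxi w * (y w)\<^sup>2 - lxi w * (C\<^sup>2 * leta w powr a)"
      using lxi_pos[of w] by simp
  qed
  have "((\<lambda>u. \<Phi> u + C\<^sup>2 * leta u powr a / (2 * a)) \<longlongrightarrow> 0 + C\<^sup>2 * 0 / (2 * a)) at_top"
    using a by (intro tendsto_intros \<Phi>(2)) (use tendsto_powr2[OF leta_at_top tendsto_const, of a] leta_pos in \<open>auto intro: always_eventually less_imp_le\<close>)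
  from at_top_limit_ge[OF this m] have "\<Phi> x + C\<^sup>2 * leta x powr a / (2 * a) \<le> 0 + C\<^sup>2 * 0 / (2 * a)" .
  moreover have "C\<^sup>2 * leta x powr a = (y x)\<^sup>2"
    unfolding e2[symmetric] power_mult_distrib[symmetric] using leta_pos[of x] by (simp add: C_def)
  moreover have "- 1 / (2 * a) \<le> \<Phi> x"
    by (rule at_bot_limit_le[OF \<Phi>(1), of x], rule nondecreasing_onI[OF d\<Phi>])
      (use lxi_pos in \<open>auto intro!: mult_nonneg_nonneg intro: less_imp_le\<close>)
  ultimately have "- 1 / (2 * a) + (y x)\<^sup>2 / (2 * a) \<le> 0" by simp
  then have "((y x)\<^sup>2 - 1) / (2 * a) \<le> 0" by (simp add: diff_divide_distrib)
  then show ?thesis using a by (simp add: divide_le_0_iff)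
qed

text \<open>The first-order term stays in the equation, and \<open>T\<close> is the Sonin function
  adapted to it. Where \<open>U > 0\<close>, its derivative has the sign of \<open>B\<close>, which
  increases with \<open>x\<close>. A maximum with \<open>B \<ge> 0\<close> is compared with the
  limit \<open>w \<le> 1\<close> at the right end. One with \<open>B < 0\<close> is compared with
  the highest point before the first zero, or, if \<open>b = 0\<close>, with the limit 1 at the left
  end.\<close>

lemma sonin_bound_nonpos:
  fixes z z' U :: "real \<Rightarrow> real" and a b L w :: real
  assumes U: "\<And>x. U x = L * lxi x - b\<^sup>2" and L: "0 < L" "b\<^sup>2 < L" and a: "-1 < a"
    and dz: "\<And>x. (z has_real_derivative z' x) (at x)"
    and dz': "\<And>x. (z' has_real_derivative 2 * a * lxi x * z' x - leta x * U x * z x) (at x)"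
    and top: "((\<lambda>x. (z x)\<^sup>2) \<longlongrightarrow> w) at_top" "w \<le> 1" "((\<lambda>x. (z' x)\<^sup>2 / leta x) \<longlongrightarrow> 0) at_top"
    and bot: "b \<noteq> 0 \<Longrightarrow> (z \<longlongrightarrow> 0) at_bot" "\<forall>\<^sub>F x in at_bot. z x \<noteq> 0"
    and head: "\<And>x. b \<noteq> 0 \<Longrightarrow> (\<And>u. u \<le> x \<Longrightarrow> z u \<noteq> 0) \<Longrightarrow> (z x)\<^sup>2 \<le> 1"
    and bot0: "b = 0 \<Longrightarrow> ((\<lambda>x. (z x)\<^sup>2) \<longlongrightarrow> 1) at_bot" "b = 0 \<Longrightarrow> ((\<lambda>x. (z' x)\<^sup>2 / lxi x) \<longlongrightarrow> 0) at_bot"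
  shows "(z x)\<^sup>2 \<le> 1"
proof (rule ccontr)
  assume "\<not> (z x)\<^sup>2 \<le> 1"
  then have x: "1 < (z x)\<^sup>2" by simp
  have cont1: "continuous_on UNIV z"
    using dz by (intro continuous_at_imp_continuous_on) (auto intro: DERIV_isCont)
  then have cont: "continuous_on UNIV (\<lambda>x. (z x)\<^sup>2)" by (intro continuous_intros)
  obtain k where k: "((\<lambda>x. (z x)\<^sup>2) \<longlongrightarrow> k) at_bot" "k \<le> 1"
  proof (cases "b = 0")
    case True then show ?thesis using that bot0 by blast
  next
    case False
    then have "((\<lambda>x. (z x)\<^sup>2) \<longlongrightarrow> 0) at_bot" using tendsto_power[OF bot(1), of 2] by simp
    then show ?thesis using that[of 0] by simp
  qed
  obtain s where s: "\<And>v. (z v)\<^sup>2 \<le> (z s)\<^sup>2"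
  proof -
    have "k < (z x)\<^sup>2" "w < (z x)\<^sup>2" using k(2) top(2) x by linarith+
    then show ?thesis by (rule attains_global_max[OF cont k(1) top(1)]) (rule that)
  qed
  have s1: "1 < (z s)\<^sup>2" using s[of x] x by simp
  have dU: "(U has_real_derivative L * (2 * lxi x * leta x)) (at x)" for x
    unfolding U[abs_def] by (auto intro!: derivative_eq_intros)
  have Umono: "U u \<le> U v" if "u \<le> v" for u v
    unfolding U using lxi_mono[OF that] L(1) by simp
  define B where "B x = (2 * a + 1) * U x - L * leta x" for x
  have B: "B x = (2 * a + 2) * L * lxi x - (2 * a + 1) * b\<^sup>2 - L" for x
    unfolding B_def U leta_eq by (simp add: algebra_simps)
  have Bmono: "B u \<le> B v" if "u \<le> v" for u v
    unfolding B using lxi_mono[OF that] L(1) a by (simp add: mult_left_mono)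
  define T where "T x = (z x)\<^sup>2 + (z' x)\<^sup>2 / (leta x * U x)" for x
  have dT: "(T has_real_derivative (z' x)\<^sup>2 * (2 * lxi x * leta x * B x) / (leta x * U x)\<^sup>2) (at x)" if "0 < U x" for x
  proof -
    have D0: "leta x * U x \<noteq> 0" using that leta_pos[of x] by simp
    have dD: "((\<lambda>x. leta x * U x) has_real_derivative 2 * lxi x * leta x * (L * leta x - U x)) (at x)"
      by (auto intro!: derivative_eq_intros dU simp: algebra_simps)
    have "(T has_real_derivative 2 * z x * z' x + (2 * z' x * (2 * a * lxi x * z' x - leta x * U x * z x) * (leta x * U x)
        - (z' x)\<^sup>2 * (2 * lxi x * leta x * (L * leta x - U x))) / ((leta x * U x) * (leta x * U x))) (at x)"
      unfolding T_def[abs_def]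
      by (rule DERIV_add, (auto intro!: derivative_eq_intros dz)[1], rule DERIV_divide[OF _ dD D0])
        (auto intro!: derivative_eq_intros dz')
    moreover have "2 * z x * z' x + (2 * z' x * (2 * a * lxi x * z' x - leta x * U x * z x) * (leta x * U x)
        - (z' x)\<^sup>2 * (2 * lxi x * leta x * (L * leta x - U x))) / ((leta x * U x) * (leta x * U x))
        = (z' x)\<^sup>2 * (2 * lxi x * leta x * B x) / (leta x * U x)\<^sup>2"
      using D0 unfolding B_def by (simp add: field_simps power2_eq_square)
    ultimately show ?thesis by simp
  qed
  have Tge: "(z s)\<^sup>2 \<le> T s" if "0 < U s"
    using that leta_pos[of s] by (simp add: T_def)
  show False
  proof (cases "0 \<le> B s")
    case True
    \<comment> \<open>Otherwise \<open>B s\<close> would lie strictly below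
      \<open>(2 a + 1) (L - b^2)\<close>, which is then not positive.\<close>
    have "0 < 2 * a + 1"
    proof (rule ccontr)
      assume "\<not> 0 < 2 * a + 1"
      then have "(2 * a + 1) * L \<le> (2 * a + 1) * b\<^sup>2" using L(2) by (intro mult_left_mono_neg) auto
      moreover have "B s < (2 * a + 2) * L * 1 - (2 * a + 1) * b\<^sup>2 - L"
        unfolding B using lxi_lt_1[of s] L(1) a by simp
      ultimately show False using True by (simp add: algebra_simps)
    qed
    then have Upos: "0 < U x" if "s \<le> x" for x
    proof -
      have "0 < L * leta s" using L(1) leta_pos[of s] by simp
      then have "0 < (2 * a + 1) * U s" using True unfolding B_def by linarith
      then have "0 < U s" using \<open>0 < 2 * a + 1\<close> by (simp add: zero_less_mult_iff)
      then show ?thesis using Umono[OF that] by simp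
    qed
    have m: "T s \<le> T u" if su: "s \<le> u" for u
    proof (rule nondecreasing_onI[OF dT _ su])
      fix v assume v: "s \<le> v" "v \<le> u"
      then show "0 < U v" using Upos by simp
      have "0 \<le> B v" using Bmono[OF v(1)] True by simp
      then show "0 \<le> (z' v)\<^sup>2 * (2 * lxi v * leta v * B v) / (leta v * U v)\<^sup>2"
        using lxi_pos[of v] leta_pos[of v] by (intro divide_nonneg_nonneg mult_nonneg_nonneg) auto
    qed
    have "(T \<longlongrightarrow> w + 0 / (L * 1 - b\<^sup>2)) at_top"
      unfolding T_def[abs_def] divide_divide_eq_left[symmetric] U
      by (intro tendsto_intros top lxi_at_top) (use L(2) in auto)
    from at_top_limit_ge[OF this m] have "T s \<le> w" by simp
    with Tge[OF Upos[of s]] s1 top(2) show False by simp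
  next
    case neg: False
    have Tmono: "T s \<le> T u" if u: "u \<le> s" "0 < U u" for u
    proof (rule nonincreasing_onI[OF dT _ u(1)])
      fix v assume v: "u \<le> v" "v \<le> s"
      then show "0 < U v" using Umono[OF v(1)] u by simp
      have "B v \<le> 0" using Bmono[OF v(2)] neg by simp
      then have le: "2 * lxi v * leta v * B v \<le> 0"
        using lxi_pos[of v] leta_pos[of v] by (simp add: mult_nonneg_nonpos)
      show "(z' v)\<^sup>2 * (2 * lxi v * leta v * B v) / (leta v * U v)\<^sup>2 \<le> 0"
        by (rule divide_nonpos_nonneg[OF mult_nonneg_nonpos[OF zero_le_power2 le] zero_le_power2])
    qed
    show False
    proof (cases "b = 0")
      case True
      then have Upos: "0 < U u" for u using L(1) lxi_pos[of u] by (simp add: U)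
      have m: "T s \<le> T u" if "u \<le> s" for u using Tmono that Upos by blast
      have "((\<lambda>x. (z x)\<^sup>2 + (z' x)\<^sup>2 / lxi x / (leta x * L)) \<longlongrightarrow> 1 + 0 / (1 * L)) at_bot"
        by (intro tendsto_intros bot0 True leta_at_bot) (use L in auto)
      then have "(T \<longlongrightarrow> 1) at_bot" unfolding T_def[abs_def] U using True by (simp add: mult_ac)
      from at_bot_limit_ge[OF this m] Tge[OF Upos] s1 show False by simp
    next
      case False
      have "\<exists>u\<le>s. z u = 0"
      proof (rule ccontr)
        assume "\<not> (\<exists>u\<le>s. z u = 0)"
        then have "(z s)\<^sup>2 \<le> 1" by (intro head False) auto
        with s1 show False by simp
      qed
      then obtain u where u: "u \<le> s" "z u = 0" by blast
      \<comment> \<open>Reflection turns the search for the first zero into an application of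
        \<open>last_zero\<close>.\<close>
      have contm: "continuous_on UNIV (\<lambda>x. z (- x))"
        by (rule continuous_on_compose2[OF cont1]) (auto intro: continuous_intros)
      have evm: "\<forall>\<^sub>F x in at_top. z (- x) \<noteq> 0" using bot(2) by (simp add: at_bot_mirror eventually_filtermap)
      obtain m where m: "- s \<le> m" "z (- m) = 0" "\<And>v. m < v \<Longrightarrow> z (- v) \<noteq> 0"
        using last_zero[OF contm evm, of "- s" "- u"] u by auto
      define \<zeta> where "\<zeta> = - m"
      have \<zeta>: "\<zeta> \<le> s" "z \<zeta> = 0" "\<And>v. v < \<zeta> \<Longrightarrow> z v \<noteq> 0"
        using m(1,2) m(3)[of "- _"] by (auto simp: \<zeta>_def)
      have lim2: "((\<lambda>x. (z x)\<^sup>2) \<longlongrightarrow> 0) at_bot" using tendsto_power[OF bot(1)[OF False], of 2] by simp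
      have p: "0 < (z (\<zeta> - 1))\<^sup>2" using \<zeta>(3)[of "\<zeta> - 1"] by simp
      obtain q where q: "q \<le> \<zeta>" "\<And>v. v \<le> \<zeta> \<Longrightarrow> (z v)\<^sup>2 \<le> (z q)\<^sup>2"
        by (rule attains_max_at_bot[OF cont lim2 p, of \<zeta>]) auto
      have zq: "z q \<noteq> 0" using q(2)[of "\<zeta> - 1"] p by auto
      then have q\<zeta>: "q < \<zeta>" using q(1) \<zeta>(2) by (cases "q = \<zeta>") auto
      have z'q: "z' q = 0"
        by (rule DERIV_max_sq[OF dz, where e = "\<zeta> - q"]) (use q\<zeta> zq q(2) in \<open>auto simp: abs_less_iff\<close>)
      have q1: "(z q)\<^sup>2 \<le> 1" by (rule head[OF False]) (use \<zeta>(3) q\<zeta> in auto)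
      \<comment> \<open>The power \<open>leta x powr a\<close> is the integrating factor of the
        first-order term. If \<open>U\<close> were nonpositive up to \<open>q\<close>, then
        \<open>?P\<close> would increase to its value 0 at \<open>q\<close>, the square of
        \<open>z\<close> would decrease up to \<open>q\<close>, and its limit 0 at the left end
        would force \<open>z q = 0\<close>.\<close>
      have "0 < U q"
      proof (rule ccontr)
        assume "\<not> 0 < U q"
        then have Uneg: "U x \<le> 0" if "x \<le> q" for x using Umono[OF that] by simp
        let ?P = "\<lambda>x. leta x powr a * (z x * z' x)"
        have dP: "(?P has_real_derivative leta x powr a * ((z' x)\<^sup>2 - leta x * U x * (z x)\<^sup>2)) (at x)" for x
        proof -
          have "((\<lambda>x. leta x powr a) has_real_derivative - 2 * a * lxi x * leta x powr a) (at x)"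
            using DERIV_fun_powr[OF DERIV_leta leta_pos, of a x] leta_pos[of x] by (simp add: powr_diff mult_ac)
          from DERIV_mult[OF this DERIV_mult[OF dz dz']]
          show ?thesis by (rule DERIV_cong) (simp add: algebra_simps power2_eq_square)
        qed
        have "?P x \<le> ?P q" if "x \<le> q" for x
        proof (rule nondecreasing_onI[OF dP _ that])
          fix v assume v: "x \<le> v" "v \<le> q"
          have "leta v * U v * (z v)\<^sup>2 \<le> 0"
            using Uneg[OF v(2)] leta_pos[of v] by (intro mult_nonpos_nonneg mult_nonneg_nonpos) auto
          then show "0 \<le> leta v powr a * ((z' v)\<^sup>2 - leta v * U v * (z v)\<^sup>2)"
            by (intro mult_nonneg_nonneg) (auto intro: order_trans[OF _ zero_le_power2])
        qed
        then have zz: "z x * z' x \<le> 0" if "x \<le> q" for x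
          using that z'q leta_pos[of x] by (force simp: mult_le_0_iff)
        have m2: "(z q)\<^sup>2 \<le> (z x)\<^sup>2" if "x \<le> q" for x
          by (rule nonincreasing_onI[where f = "\<lambda>x. (z x)\<^sup>2" and f' = "\<lambda>x. 2 * (z x * z' x)", OF _ _ that])
            (use zz in \<open>auto intro!: derivative_eq_intros dz\<close>)
        from at_bot_limit_ge[OF lim2 m2] zq show False by simp
      qed
      then have "T s \<le> T q" using Tmono[of q] q\<zeta> \<zeta>(1) by simp
      moreover have "T q \<le> 1" using q1 z'q by (simp add: T_def)
      moreover have "0 < U s" using \<open>0 < U q\<close> Umono[of q s] q\<zeta> \<zeta>(1) by simp
      ultimately show False using Tge s1 by simp
    qed
  qed
qed

section \<open>The kernel as a function of \<open>x = ln t\<close>\<close>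

definition lrho :: "real \<Rightarrow> real" where "lrho x = sqrt (lxi x)"

lemma lrho_pos: "0 < lrho x" and lrho_sq: "lrho x * lrho x = lxi x"
  using lxi_pos[of x] by (simp_all add: lrho_def)

lemma lxi_eq_exp: "lxi x = (exp x)\<^sup>2 * leta x"
  by (simp add: lxi_def leta_def power2_eq_square exp_double)

lemma exp_sqrt_leta: "exp x * sqrt (leta x) = lrho x"
  by (simp add: lrho_def lxi_eq_exp real_sqrt_mult)

lemma DERIV_lrho: "(lrho has_real_derivative leta x * lrho x) (at x)"
proof -
  have "((\<lambda>x. sqrt (lxi x)) has_real_derivative (2 * lxi x * leta x) * (inverse (sqrt (lxi x)) / 2)) (at x)"
    using lxi_pos[of x] by (auto intro!: derivative_eq_intros)
  moreover have "(2 * lxi x * leta x) * (inverse (sqrt (lxi x)) / 2) = leta x * sqrt (lxi x)"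
    using lxi_pos[of x] by (simp add: field_simps)
  ultimately show ?thesis unfolding lrho_def[abs_def] by (simp only:)
qed

lemma DERIV_sqrt_leta: "((\<lambda>x. sqrt (leta x)) has_real_derivative - lxi x * sqrt (leta x)) (at x)"
proof -
  have "((\<lambda>x. sqrt (leta x)) has_real_derivative (- 2 * lxi x * leta x) * (inverse (sqrt (leta x)) / 2)) (at x)"
    using leta_pos[of x] by (auto intro!: derivative_eq_intros)
  moreover have "(- 2 * lxi x * leta x) * (inverse (sqrt (leta x)) / 2) = - lxi x * sqrt (leta x)"
    using leta_pos[of x] by (simp add: field_simps)
  ultimately show ?thesis by (simp only:)
qed

lemma DERIV_leta_powr: "((\<lambda>x. leta x powr q) has_real_derivative - 2 * q * lxi x * leta x powr q) (at x)"
  using DERIV_fun_powr[OF DERIV_leta leta_pos, of q x] leta_pos[of x] by (simp add: powr_diff mult_ac)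

lemma lrho_at_bot: "(lrho \<longlongrightarrow> 0) at_bot" and lrho_at_top: "(lrho \<longlongrightarrow> 1) at_top"
  unfolding lrho_def[abs_def] using tendsto_real_sqrt[OF lxi_at_bot] tendsto_real_sqrt[OF lxi_at_top] by simp_all

definition lz :: "real \<Rightarrow> nat \<Rightarrow> nat \<Rightarrow> real \<Rightarrow> real" where
  "lz \<alpha> n m x = sqrt (leta x) ^ (n + m) * lag_fun \<alpha> n m (exp x)"

text \<open>The derivative in its lowering form. Differentiating it once more by the raising
  relation produces a second-order equation for \<open>lz\<close> alone.\<close>

definition lz' :: "real \<Rightarrow> nat \<Rightarrow> nat \<Rightarrow> real \<Rightarrow> real" where
  "lz' \<alpha> n m x = (real m - real n - real (n + m) * lxi x) * lz \<alpha> n m x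
     + 2 * lag_a \<alpha> n * lrho x * lz \<alpha> (n - 1) m x"

lemma lz_sym: "lz \<alpha> n m x = lz \<alpha> m n x"
  by (simp add: lz_def lag_fun_sym[of _ n m] add.commute)

lemma DERIV_lz_aux: "(lz \<alpha> n m has_real_derivative
    - real (n + m) * lxi x * lz \<alpha> n m x + sqrt (leta x) ^ (n + m) * (exp x * lag_fun' \<alpha> n m (exp x))) (at x)"
proof -
  have "((\<lambda>x. sqrt (leta x) ^ (n + m)) has_real_derivative - real (n + m) * lxi x * sqrt (leta x) ^ (n + m)) (at x)"
    by (rule DERIV_power[OF DERIV_sqrt_leta, THEN DERIV_cong]) (cases "n + m", simp_all add: algebra_simps)
  moreover have "((\<lambda>x. lag_fun \<alpha> n m (exp x)) has_real_derivative lag_fun' \<alpha> n m (exp x) * exp x) (at x)"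
    by (rule DERIV_chain2[OF lag_fun_deriv DERIV_exp])
  ultimately show ?thesis
    unfolding lz_def[abs_def] by (rule DERIV_mult[THEN DERIV_cong]) (simp add: mult_ac)
qed

lemma DERIV_lz:
  assumes "-1 < \<alpha>"
  shows "(lz \<alpha> n m has_real_derivative lz' \<alpha> n m x) (at x)"
proof -
  have "sqrt (leta x) ^ (n + m) * (2 * exp x * (lag_a \<alpha> n * lag_fun \<alpha> (n - 1) m (exp x)))
      = 2 * lag_a \<alpha> n * lrho x * lz \<alpha> (n - 1) m x"
    by (cases n) (simp_all add: lag_a_def[of _ 0] lz_def exp_sqrt_leta[symmetric])
  then show ?thesis
    by (intro DERIV_lz_aux[THEN DERIV_cong]) (simp add: lag_fun_deriv_1[OF assms] lz'_def lz_def[of _ n m] algebra_simps)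
qed

text \<open>The lowered function is eliminated between the two derivative formulas; the factor
  \<open>1 + t^2\<close> arises in that elimination.\<close>

lemma lag_fun_raise:
  assumes "-1 < \<alpha>"
  shows "(1 + t\<^sup>2) * (t * lag_fun' \<alpha> n m t) = (- (real m - real n) * (1 - t\<^sup>2) + 2 * (2 * real n + 1 + \<alpha>) * t\<^sup>2) * lag_fun \<alpha> n m t
    - 2 * t * (lag_a \<alpha> (Suc n) * lag_fun \<alpha> (Suc n) m t)"
proof -
  let ?A = "lag_a \<alpha> n * lag_fun \<alpha> (n - 1) m t"
  have 1: "2 * (t * ?A) = t * lag_fun' \<alpha> n m t - (real m - real n) * lag_fun \<alpha> n m t"
    using lag_fun_deriv_1[OF assms, of t n m] by simp
  have "2 * (t * lag_fun' \<alpha> n m t) = (1 - t\<^sup>2) * (2 * (t * ?A)) + 2 * (2 * real n + 1 + \<alpha>) * t\<^sup>2 * lag_fun \<alpha> n m t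
      - 2 * t * (lag_a \<alpha> (Suc n) * lag_fun \<alpha> (Suc n) m t)"
    by (subst lag_fun_deriv_2[OF assms]) (simp add: algebra_simps power2_eq_square)
  then show ?thesis unfolding 1 by (simp add: algebra_simps)
qed

lemma DERIV_lz_raise:
  assumes "-1 < \<alpha>"
  shows "(lz \<alpha> n m has_real_derivative
    ((real (n + m) + 2 + 2 * \<alpha>) * lxi x - (real m - real n)) * lz \<alpha> n m x - 2 * lag_a \<alpha> (Suc n) * lrho x * lz \<alpha> (Suc n) m x) (at x)"
proof (rule DERIV_lz_aux[THEN DERIV_cong])
  let ?t = "exp x" and ?f = "lag_fun \<alpha> n m (exp x)" and ?g = "lag_a \<alpha> (Suc n) * lag_fun \<alpha> (Suc n) m (exp x)"
  have "leta x * (1 + ?t\<^sup>2) = 1" using lxi_leta[of x] by (simp add: lxi_eq_exp algebra_simps)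
  then have "?t * lag_fun' \<alpha> n m ?t = leta x * ((1 + ?t\<^sup>2) * (?t * lag_fun' \<alpha> n m ?t))" by (simp add: mult.assoc[symmetric])
  also have "\<dots> = (- (real m - real n) * (leta x - ?t\<^sup>2 * leta x) + 2 * (2 * real n + 1 + \<alpha>) * (?t\<^sup>2 * leta x)) * ?f
      - 2 * (?t * leta x) * ?g"
    unfolding lag_fun_raise[OF assms] by (simp add: algebra_simps)
  also have "\<dots> = (- (real m - real n) * (1 - 2 * lxi x) + 2 * (2 * real n + 1 + \<alpha>) * lxi x) * ?f - 2 * (?t * leta x) * ?g"
  proof -
    have "leta x - ?t\<^sup>2 * leta x = 1 - 2 * lxi x" using lxi_leta[of x] lxi_eq_exp[of x] by linarith
    then show ?thesis by (simp only: lxi_eq_exp[symmetric])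
  qed
  finally have 1: "?t * lag_fun' \<alpha> n m ?t = (- (real m - real n) * (1 - 2 * lxi x) + 2 * (2 * real n + 1 + \<alpha>) * lxi x) * ?f
      - 2 * (?t * leta x) * ?g" .
  have "?t * leta x = lrho x * sqrt (leta x)"
    using leta_pos[of x] by (simp add: exp_sqrt_leta[symmetric] mult.assoc)
  then have 2: "sqrt (leta x) ^ (n + m) * (2 * (?t * leta x) * ?g) = 2 * lag_a \<alpha> (Suc n) * lrho x * lz \<alpha> (Suc n) m x"
    by (simp add: lz_def)
  show "- real (n + m) * lxi x * lz \<alpha> n m x + sqrt (leta x) ^ (n + m) * (?t * lag_fun' \<alpha> n m ?t)
      = ((real (n + m) + 2 + 2 * \<alpha>) * lxi x - (real m - real n)) * lz \<alpha> n m x - 2 * lag_a \<alpha> (Suc n) * lrho x * lz \<alpha> (Suc n) m x"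
    unfolding 2[symmetric] unfolding 1 by (simp add: lz_def algebra_simps)
qed

text \<open>Lowering and then raising returns to the index \<open>n\<close> with the factor
  \<open>lag_a \<alpha> n\<close> squared, that is \<open>n (n + \<alpha>)\<close>. The remaining
  occurrence of the lowered function is expressed through \<open>lz'\<close> itself.\<close>

lemma DERIV_lz':
  assumes "-1 < \<alpha>"
  shows "(lz' \<alpha> n m has_real_derivative 2 * \<alpha> * lxi x * lz' \<alpha> n m x
    - leta x * (real (n + m) * (real (n + m) + 2 * \<alpha> + 2) * lxi x - (real m - real n)\<^sup>2) * lz \<alpha> n m x) (at x)"
proof -
  define b where "b = real m - real n"
  define N where "N = real (n + m)"
  have Nb: "N = 2 * real n + b" by (simp add: N_def b_def)
  let ?z = "lz \<alpha> n m x" and ?z' = "lz' \<alpha> n m x" and ?w = "lz \<alpha> (n - 1) m x"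
  have dz: "((\<lambda>x. (b - N * lxi x) * lz \<alpha> n m x) has_real_derivative
      (- 2 * N * lxi x * leta x) * ?z + (b - N * lxi x) * ?z') (at x)"
    by (auto intro!: derivative_eq_intros DERIV_lz[OF assms])
  have z': "lz' \<alpha> n m x = (b - N * lxi x) * lz \<alpha> n m x + 2 * lag_a \<alpha> n * lrho x * lz \<alpha> (n - 1) m x" for x
    by (simp add: lz'_def b_def N_def)
  have "((\<lambda>x. 2 * lag_a \<alpha> n * lrho x * lz \<alpha> (n - 1) m x) has_real_derivative
      ((N + 2 * \<alpha>) * lxi x - b) * (2 * lag_a \<alpha> n * lrho x * ?w) - 4 * (real n * (real n + \<alpha>)) * lxi x * ?z) (at x)"
  proof (cases n)
    case 0
    then show ?thesis by (simp add: lag_a_def)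
  next
    case (Suc k)
    have "((\<lambda>x. lrho x * lz \<alpha> k m x) has_real_derivative leta x * lrho x * lz \<alpha> k m x
        + (((real (k + m) + 2 + 2 * \<alpha>) * lxi x - (real m - real k)) * lz \<alpha> k m x - 2 * lag_a \<alpha> (Suc k) * lrho x * lz \<alpha> (Suc k) m x) * lrho x) (at x)"
      by (rule DERIV_mult[OF DERIV_lrho DERIV_lz_raise[OF assms]])
    from DERIV_cmult[OF this, of "2 * lag_a \<alpha> n"]
    have main: "((\<lambda>x. 2 * lag_a \<alpha> n * (lrho x * lz \<alpha> k m x)) has_real_derivative
        2 * lag_a \<alpha> n * ((leta x + (real (k + m) + 2 + 2 * \<alpha>) * lxi x - (real m - real k)) * (lrho x * lz \<alpha> k m x))
        - 4 * (lag_a \<alpha> n * lag_a \<alpha> n) * (lrho x * lrho x) * ?z) (at x)"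
      by (rule DERIV_cong) (simp add: Suc algebra_simps)
    have e1: "leta x + (real (k + m) + 2 + 2 * \<alpha>) * lxi x - (real m - real k) = (N + 2 * \<alpha>) * lxi x - b"
      by (simp add: leta_eq N_def b_def Suc algebra_simps)
    have e2: "lag_a \<alpha> n * lag_a \<alpha> n = real n * (real n + \<alpha>)"
      using lag_a_Suc_sq[OF assms, of k] by (simp add: Suc algebra_simps)
    show ?thesis using main unfolding e1 e2 lrho_sq by (simp add: Suc mult_ac)
  qed
  from DERIV_add[OF dz this]
  have "(lz' \<alpha> n m has_real_derivative (- 2 * N * lxi x * leta x) * ?z + (b - N * lxi x) * ?z'
      + (((N + 2 * \<alpha>) * lxi x - b) * (?z' - (b - N * lxi x) * ?z) - 4 * (real n * (real n + \<alpha>)) * lxi x * ?z)) (at x)"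
    by (simp add: z'[abs_def])
  then show ?thesis
    unfolding b_def[symmetric] N_def[symmetric]
    by (rule DERIV_cong) (simp add: Nb leta_eq algebra_simps power2_eq_square)
qed

section \<open>Behaviour at both ends\<close>

definition lzeta :: "real \<Rightarrow> nat \<Rightarrow> nat \<Rightarrow> real" where
  "lzeta \<alpha> n m = lag_norm (1 + \<alpha>) n m / (fact n * fact m)"

text \<open>What remains of the sum for \<open>lz\<close> after the term \<open>k = 0\<close>, with
  one factor \<open>leta x\<close> divided out. Having a finite limit at plus infinity, it measures
  the rate at which \<open>lz\<close> approaches \<open>lzeta\<close>.\<close>

definition lrem :: "real \<Rightarrow> nat \<Rightarrow> nat \<Rightarrow> real \<Rightarrow> real" where
  "lrem \<alpha> n m x = lag_norm (1 + \<alpha>) n m *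
     (\<Sum>k<n. lag_coeff (1 + \<alpha>) n m (Suc k) * lrho x ^ (n + m - 2 * Suc k) * leta x ^ k)"

lemma lz_eq_sum:
  "lz \<alpha> n m x = lag_norm (1 + \<alpha>) n m * (\<Sum>k\<le>n. lag_coeff (1 + \<alpha>) n m k * lrho x ^ (n + m - 2 * k) * leta x ^ k)"
proof -
  have *: "sqrt (leta x) ^ (n + m) * (lag_coeff (1 + \<alpha>) n m k * exp x ^ (n + m - 2 * k))
      = lag_coeff (1 + \<alpha>) n m k * lrho x ^ (n + m - 2 * k) * leta x ^ k" for k
  proof (cases "k \<le> n \<and> k \<le> m")
    case True
    then have "n + m = (n + m - 2 * k) + 2 * k" by simp
    then have "sqrt (leta x) ^ (n + m) = sqrt (leta x) ^ (n + m - 2 * k) * (sqrt (leta x) ^ 2) ^ k"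
      by (metis power_add power_mult)
    then show ?thesis
      using leta_pos[of x] by (simp add: exp_sqrt_leta[symmetric] power_mult_distrib)
  qed (auto simp: lag_coeff_def)
  have "sqrt (leta x) ^ (n + m) * (\<Sum>k\<le>n. lag_coeff (1 + \<alpha>) n m k * exp x ^ (n + m - 2 * k))
      = (\<Sum>k\<le>n. lag_coeff (1 + \<alpha>) n m k * lrho x ^ (n + m - 2 * k) * leta x ^ k)"
    unfolding sum_distrib_left by (intro sum.cong refl *)
  then show ?thesis
    unfolding lz_def lag_fun_def lag_poly_def by (simp only: mult.left_commute)
qed

lemma lz_expansion: "lz \<alpha> n m x = lzeta \<alpha> n m * lrho x ^ (n + m) + leta x * lrem \<alpha> n m x"
proof -
  have "(\<Sum>k\<le>n. lag_coeff (1 + \<alpha>) n m k * lrho x ^ (n + m - 2 * k) * leta x ^ k)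
      = lag_coeff (1 + \<alpha>) n m 0 * lrho x ^ (n + m)
        + leta x * (\<Sum>k<n. lag_coeff (1 + \<alpha>) n m (Suc k) * lrho x ^ (n + m - 2 * Suc k) * leta x ^ k)"
    by (subst sum.atMost_shift) (simp add: sum_distrib_left mult_ac)
  then show ?thesis
    unfolding lz_eq_sum by (simp add: lzeta_def lrem_def lag_coeff_def algebra_simps)
qed

lemma lrem_at_top: "\<exists>l. (lrem \<alpha> n m \<longlongrightarrow> l) at_top"
  unfolding lrem_def[abs_def] by (rule exI, (rule tendsto_intros lrho_at_top leta_at_top)+)

lemma lz_at_top: "(lz \<alpha> n m \<longlongrightarrow> lzeta \<alpha> n m) at_top"
proof -
  obtain l where l: "(lrem \<alpha> n m \<longlongrightarrow> l) at_top" using lrem_at_top by blast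
  have "((\<lambda>x. lzeta \<alpha> n m * lrho x ^ (n + m) + leta x * lrem \<alpha> n m x) \<longlongrightarrow> lzeta \<alpha> n m * 1 ^ (n + m) + 0 * l) at_top"
    by (intro tendsto_intros l lrho_at_top leta_at_top)
  then show ?thesis by (simp add: lz_expansion[abs_def])
qed

lemma lzeta_pos: "-1 < \<alpha> \<Longrightarrow> 0 < lzeta \<alpha> n m"
  unfolding lzeta_def lag_norm_def by (intro divide_pos_pos) (auto intro!: mult_pos_pos pochhammer_pos)

lemma lzeta_Suc: "-1 < \<alpha> \<Longrightarrow> (real n + 1) * lzeta \<alpha> (Suc n) m = lag_a \<alpha> (Suc n) * lzeta \<alpha> n m"
  unfolding lzeta_def by (simp add: lag_norm_Suc divide_simps)

text \<open>For nonpositive \<alpha> the Pochhammer symbol is dominated factor by factor: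
  \<open>1 + \<alpha> + k \<le> k + 1\<close>.\<close>

lemma lzeta_le_1:
  assumes "-1 < \<alpha>" "\<alpha> \<le> 0"
  shows "(lzeta \<alpha> n m)\<^sup>2 \<le> 1"
proof -
  have p: "pochhammer (1 + \<alpha>) k \<le> fact k" "0 < pochhammer (1 + \<alpha>) k" for k
  proof -
    show "pochhammer (1 + \<alpha>) k \<le> fact k"
    proof (induction k)
      case (Suc k)
      have "pochhammer (1 + \<alpha>) k * (1 + \<alpha> + real k) \<le> fact k * (real k + 1)"
        by (intro mult_mono Suc.IH) (use assms in auto)
      then show ?case by (simp add: pochhammer_Suc algebra_simps)
    qed simp
    show "0 < pochhammer (1 + \<alpha>) k" by (rule pochhammer_pos) (use assms in simp)
  qed
  have "pochhammer (1 + \<alpha>) n * pochhammer (1 + \<alpha>) m * fact n * fact m \<le> fact n * fact m * fact n * fact m"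
    by (intro mult_right_mono mult_mono p) (use p(2) in \<open>auto intro: less_imp_le\<close>)
  then have "(lag_norm (1 + \<alpha>) n m)\<^sup>2 \<le> (fact n * fact m)\<^sup>2"
    using p(2)[of n] p(2)[of m] by (simp add: lag_norm_def power2_eq_square mult_ac)
  then show ?thesis by (simp add: lzeta_def power_divide divide_le_eq)
qed

lemma lag_fun_0:
  assumes "-1 < \<alpha>"
  shows "lag_fun \<alpha> n m 0 = (if n = m then (- 1) ^ n else 0)"
proof -
  interpret jacobi_kernel "lag_a \<alpha>" "\<lambda>n. 2 * real n + 1 + \<alpha>" "lag_kernel \<alpha>"
    by (rule lag_kernel_jacobi[OF assms])
  have "(- \<i>) ^ (n + m) * complex_of_real (lag_fun \<alpha> n m 0) = (if n = m then 1 else 0)"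
    using K_0[of n m] by (simp add: lag_kernel_def)
  then have "(\<i> ^ (n + m) * (- \<i>) ^ (n + m)) * complex_of_real (lag_fun \<alpha> n m 0) = (if n = m then \<i> ^ (n + m) else 0)"
    by (simp add: mult.assoc)
  moreover have "\<i> ^ (n + m) * (- \<i>) ^ (n + m) = 1" by (simp add: power_mult_distrib[symmetric])
  moreover have "\<i> ^ (n + n) = complex_of_real ((- 1) ^ n)" by (simp add: power_add power_mult_distrib[symmetric])
  ultimately have "complex_of_real (lag_fun \<alpha> n m 0) = complex_of_real (if n = m then (- 1) ^ n else 0)"
    by (cases "n = m") (simp_all only: simp_thms if_True if_False mult_1 of_real_0)
  then show ?thesis by (simp only: of_real_eq_iff)
qed

lemma lz_at_bot:
  assumes "-1 < \<alpha>"
  shows "(lz \<alpha> n m \<longlongrightarrow> (if n = m then (- 1) ^ n else 0)) at_bot"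
proof -
  have "((\<lambda>x. lag_norm (1 + \<alpha>) n m * (\<Sum>k\<le>n. lag_coeff (1 + \<alpha>) n m k * lrho x ^ (n + m - 2 * k) * leta x ^ k))
      \<longlongrightarrow> lag_norm (1 + \<alpha>) n m * (\<Sum>k\<le>n. lag_coeff (1 + \<alpha>) n m k * 0 ^ (n + m - 2 * k) * 1 ^ k)) at_bot"
    by (intro tendsto_intros lrho_at_bot leta_at_bot)
  moreover have "lag_norm (1 + \<alpha>) n m * (\<Sum>k\<le>n. lag_coeff (1 + \<alpha>) n m k * 0 ^ (n + m - 2 * k) * 1 ^ k) = lag_fun \<alpha> n m 0"
    by (simp add: lag_fun_def lag_poly_def)
  ultimately show ?thesis by (simp add: lz_eq_sum[abs_def] lag_fun_0[OF assms])
qed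

text \<open>Every term carries the factor \<open>lrho ^ (m - n)\<close>. After its removal only the
  term \<open>k = n\<close> survives in the limit, and its coefficient is not zero.\<close>

lemma lz_nonzero_at_bot:
  assumes "-1 < \<alpha>" "n \<le> m"
  shows "\<forall>\<^sub>F x in at_bot. lz \<alpha> n m x \<noteq> 0"
proof -
  define f where "f x = (\<Sum>k\<le>n. lag_coeff (1 + \<alpha>) n m k * lrho x ^ (2 * (n - k)) * leta x ^ k)" for x
  have p: "0 < lag_norm (1 + \<alpha>) n m"
    unfolding lag_norm_def using assms by (auto intro!: mult_pos_pos pochhammer_pos)
  have "(f \<longlongrightarrow> (\<Sum>k\<le>n. lag_coeff (1 + \<alpha>) n m k * 0 ^ (2 * (n - k)) * 1 ^ k)) at_bot"
    unfolding f_def by (intro tendsto_intros lrho_at_bot leta_at_bot)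
  also have "(\<Sum>k\<le>n. lag_coeff (1 + \<alpha>) n m k * 0 ^ (2 * (n - k)) * 1 ^ k) = (\<Sum>k\<le>n. if k = n then lag_coeff (1 + \<alpha>) n m n else 0)"
    by (intro sum.cong) auto
  also have "\<dots> = lag_coeff (1 + \<alpha>) n m n" by simp
  finally have "(f \<longlongrightarrow> lag_coeff (1 + \<alpha>) n m n) at_bot" .
  moreover have "lag_coeff (1 + \<alpha>) n m n \<noteq> 0"
    using pochhammer_pos[of "1 + \<alpha>" n] assms by (simp add: lag_coeff_def)
  ultimately have "\<forall>\<^sub>F x in at_bot. f x \<noteq> 0" by (rule tendsto_imp_eventually_ne)
  then show ?thesis
  proof (rule eventually_mono)
    fix x assume "f x \<noteq> 0"
    have "lz \<alpha> n m x = lag_norm (1 + \<alpha>) n m * (lrho x ^ (m - n) * f x)"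
      unfolding lz_eq_sum f_def sum_distrib_left[of "lrho x ^ (m - n)"]
    proof (intro arg_cong[where f = "\<lambda>c. lag_norm (1 + \<alpha>) n m * c"] sum.cong refl)
      fix k assume "k \<in> {..n}"
      then have "n + m - 2 * k = (m - n) + 2 * (n - k)" using assms(2) by auto
      then show "lag_coeff (1 + \<alpha>) n m k * lrho x ^ (n + m - 2 * k) * leta x ^ k
          = lrho x ^ (m - n) * (lag_coeff (1 + \<alpha>) n m k * lrho x ^ (2 * (n - k)) * leta x ^ k)"
        by (simp add: power_add)
    qed
    with \<open>f x \<noteq> 0\<close> p lrho_pos[of x] show "lz \<alpha> n m x \<noteq> 0" by simp
  qed
qed

text \<open>The leading constants of the two terms of \<open>lz'\<close> are tied by
  \<open>lzeta_Suc\<close>, and their sum is a multiple of \<open>leta x\<close>. Without this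
  cancellation \<open>lz'\<close> would only be bounded, which does not suffice for its square
  divided by \<open>leta\<close> to vanish.\<close>

lemma lz'_expansion:
  assumes "-1 < \<alpha>"
  shows "\<exists>W l. (W \<longlongrightarrow> l) at_top \<and> (\<forall>x. lz' \<alpha> n m x = leta x * W x)"
proof -
  obtain l where l: "(lrem \<alpha> n m \<longlongrightarrow> l) at_top" using lrem_at_top by blast
  obtain l' where l': "(lrem \<alpha> (n - 1) m \<longlongrightarrow> l') at_top" using lrem_at_top by blast
  define W where "W x = real (n + m) * lzeta \<alpha> n m * lrho x ^ (n + m)
    + (real m - real n - real (n + m) * lxi x) * lrem \<alpha> n m x + 2 * lag_a \<alpha> n * lrho x * lrem \<alpha> (n - 1) m x" for x
  have "lz' \<alpha> n m x = leta x * W x" for x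
  proof -
    have "2 * lag_a \<alpha> n * lrho x * (lzeta \<alpha> (n - 1) m * lrho x ^ (n - 1 + m)) = 2 * real n * lzeta \<alpha> n m * lrho x ^ (n + m)"
    proof (cases n)
      case 0 then show ?thesis by (simp add: lag_a_def)
    next
      case (Suc k)
      have "2 * lag_a \<alpha> n * lrho x * (lzeta \<alpha> (n - 1) m * lrho x ^ (n - 1 + m))
          = 2 * (lag_a \<alpha> (Suc k) * lzeta \<alpha> k m) * lrho x ^ (n + m)" by (simp add: Suc)
      then show ?thesis unfolding lzeta_Suc[OF assms, symmetric] by (simp add: Suc algebra_simps)
    qed
    then have "lz' \<alpha> n m x = (real m - real n - real (n + m) * lxi x + 2 * real n) * (lzeta \<alpha> n m * lrho x ^ (n + m))
        + leta x * ((real m - real n - real (n + m) * lxi x) * lrem \<alpha> n m x + 2 * lag_a \<alpha> n * lrho x * lrem \<alpha> (n - 1) m x)"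
      unfolding lz'_def lz_expansion by (simp add: algebra_simps)
    moreover have "real m - real n - real (n + m) * lxi x + 2 * real n = leta x * real (n + m)"
      by (simp add: leta_eq algebra_simps)
    ultimately have "lz' \<alpha> n m x = (leta x * real (n + m)) * (lzeta \<alpha> n m * lrho x ^ (n + m))
        + leta x * ((real m - real n - real (n + m) * lxi x) * lrem \<alpha> n m x + 2 * lag_a \<alpha> n * lrho x * lrem \<alpha> (n - 1) m x)"
      by (simp only:)
    then show ?thesis by (simp add: W_def algebra_simps)
  qed
  moreover have "(W \<longlongrightarrow> real (n + m) * lzeta \<alpha> n m * 1 ^ (n + m) + (real m - real n - real (n + m) * 1) * l + 2 * lag_a \<alpha> n * 1 * l') at_top"
    unfolding W_def by (intro tendsto_intros l l' lrho_at_top lxi_at_top)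
  ultimately show ?thesis by blast
qed

lemma lz'_at_top:
  assumes "-1 < \<alpha>"
  shows "(lz' \<alpha> n m \<longlongrightarrow> 0) at_top" "((\<lambda>x. (lz' \<alpha> n m x)\<^sup>2 / leta x) \<longlongrightarrow> 0) at_top"
proof -
  obtain W l where W: "(W \<longlongrightarrow> l) at_top" "\<And>x. lz' \<alpha> n m x = leta x * W x"
    using lz'_expansion[OF assms, of n m] by blast
  have "((\<lambda>x. leta x * W x) \<longlongrightarrow> 0 * l) at_top" by (intro tendsto_intros W leta_at_top)
  then show "(lz' \<alpha> n m \<longlongrightarrow> 0) at_top" by (simp add: W(2)[abs_def])
  have "((\<lambda>x. leta x * (W x)\<^sup>2) \<longlongrightarrow> 0 * l\<^sup>2) at_top" by (intro tendsto_intros W leta_at_top)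
  moreover have "(lz' \<alpha> n m x)\<^sup>2 / leta x = leta x * (W x)\<^sup>2" for x
    using leta_pos[of x] by (simp add: W(2) power2_eq_square)
  ultimately show "((\<lambda>x. (lz' \<alpha> n m x)\<^sup>2 / leta x) \<longlongrightarrow> 0) at_top" by simp
qed

lemma lz'_at_bot:
  assumes "-1 < \<alpha>"
  shows "(lz' \<alpha> n m \<longlongrightarrow> (real m - real n) * (if n = m then (- 1) ^ n else 0)) at_bot"
proof -
  have "((\<lambda>x. (real m - real n - real (n + m) * lxi x) * lz \<alpha> n m x + 2 * lag_a \<alpha> n * lrho x * lz \<alpha> (n - 1) m x)
      \<longlongrightarrow> (real m - real n - real (n + m) * 0) * (if n = m then (- 1) ^ n else 0)
        + 2 * lag_a \<alpha> n * 0 * (if n - 1 = m then (- 1) ^ (n - 1) else 0)) at_bot"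
    by (intro tendsto_intros lz_at_bot[OF assms] lxi_at_bot lrho_at_bot)
  then show ?thesis by (simp add: lz'_def[abs_def])
qed

text \<open>On the diagonal the drift \<open>m - n\<close> disappears and a factor
  \<open>lrho\<close> comes out. This controls the Sonin quotient at the end where the function has
  modulus tending to 1.\<close>

lemma lz'_diag_at_bot:
  assumes "-1 < \<alpha>"
  shows "((\<lambda>x. (lz' \<alpha> n n x)\<^sup>2 / lxi x) \<longlongrightarrow> 0) at_bot" "((\<lambda>x. lz' \<alpha> n n x / lrho x) \<longlongrightarrow> 0) at_bot"
proof -
  have a: "((\<lambda>x. 2 * lag_a \<alpha> n * lz \<alpha> (n - 1) n x) \<longlongrightarrow> 0) at_bot"
  proof (cases n)
    case 0 then show ?thesis by (simp add: lag_a_def)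
  next
    case (Suc k)
    have "((\<lambda>x. 2 * lag_a \<alpha> n * lz \<alpha> (n - 1) n x) \<longlongrightarrow> 2 * lag_a \<alpha> n * (if n - 1 = n then (- 1) ^ (n - 1) else 0)) at_bot"
      by (intro tendsto_intros lz_at_bot[OF assms])
    then show ?thesis by (simp add: Suc)
  qed
  have "((\<lambda>x. - real (n + n) * lrho x * lz \<alpha> n n x + 2 * lag_a \<alpha> n * lz \<alpha> (n - 1) n x)
      \<longlongrightarrow> - real (n + n) * 0 * (if n = n then (- 1) ^ n else 0) + 0) at_bot"
    by (intro tendsto_add a tendsto_mult tendsto_const lz_at_bot[OF assms] lrho_at_bot)
  moreover have "lz' \<alpha> n n x / lrho x = - real (n + n) * lrho x * lz \<alpha> n n x + 2 * lag_a \<alpha> n * lz \<alpha> (n - 1) n x" for x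
    using lrho_pos[of x] unfolding lz'_def lrho_sq[symmetric] by (simp add: field_simps)
  ultimately show d: "((\<lambda>x. lz' \<alpha> n n x / lrho x) \<longlongrightarrow> 0) at_bot" by simp
  have "(lz' \<alpha> n n x)\<^sup>2 / lxi x = (lz' \<alpha> n n x / lrho x)\<^sup>2" for x
    by (simp add: power_divide lrho_sq[symmetric] power2_eq_square)
  then show "((\<lambda>x. (lz' \<alpha> n n x)\<^sup>2 / lxi x) \<longlongrightarrow> 0) at_bot" using tendsto_power[OF d, of 2] by simp
qed

text \<open>The two masses \<open>2 \<alpha> \<integral> lxi y\<^sup>2\<close> and \<open>2 (m - n) \<integral> leta y\<^sup>2\<close>, with \<open>y = leta\<^bsup>\<alpha>/2\<^esup> lz\<close>, telescope in \<open>n\<close>: the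
  ladder relations turn the difference of consecutive integrands into an exact derivative.\<close>

lemma DERIV_lz_Suc:
  assumes "-1 < \<alpha>"
  shows "(lz \<alpha> (Suc n) m has_real_derivative
    (real m - real n - 1 - (real (n + m) + 1) * lxi x) * lz \<alpha> (Suc n) m x + 2 * lag_a \<alpha> (Suc n) * lrho x * lz \<alpha> n m x) (at x)"
  by (rule DERIV_lz[OF assms, THEN DERIV_cong]) (simp add: lz'_def algebra_simps)

text \<open>The coefficients of the mixed product cancel: the weight gives
  \<open>-2 \<alpha> lxi + leta\<close>, the two ladder relations give
  \<open>-1 + lxi + 2 \<alpha> lxi\<close>. Only the difference of the squares is left.\<close>

lemma DERIV_ladder_product:
  assumes "-1 < \<alpha>"
  shows "((\<lambda>x. leta x powr \<alpha> * (lrho x * (lz \<alpha> (Suc n) m x * lz \<alpha> n m x))) has_real_derivative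
    2 * lag_a \<alpha> (Suc n) * lxi x * leta x powr \<alpha> * ((lz \<alpha> n m x)\<^sup>2 - (lz \<alpha> (Suc n) m x)\<^sup>2)) (at x)"
  by (rule DERIV_mult[OF DERIV_leta_powr DERIV_mult[OF DERIV_lrho DERIV_mult[OF DERIV_lz_Suc[OF assms] DERIV_lz_raise[OF assms]]], THEN DERIV_cong])
    (simp add: lrho_sq[symmetric] leta_eq algebra_simps power2_eq_square)

lemma leta_powr_at_top: "0 < a \<Longrightarrow> ((\<lambda>x. leta x powr a) \<longlongrightarrow> 0) at_top"
  using tendsto_powr2[OF leta_at_top tendsto_const, of a] leta_pos by (auto intro: always_eventually less_imp_le)

lemma leta_powr_at_bot: "((\<lambda>x. leta x powr a) \<longlongrightarrow> 1) at_bot"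
  using tendsto_powr[OF leta_at_bot tendsto_const, of a] by simp

text \<open>The correcting term vanishes at both ends: on the left through \<open>lrho\<close>, on
  the right through the weight, which is where positivity of \<alpha> enters.\<close>

lemma lxi_mass_step:
  assumes \<alpha>: "0 < \<alpha>"
    and IH: "\<exists>\<Phi>. (\<forall>x. (\<Phi> has_real_derivative lxi x * (leta x powr \<alpha> * (lz \<alpha> n m x)\<^sup>2)) (at x)) \<and>
      (\<Phi> \<longlongrightarrow> - 1 / (2 * \<alpha>)) at_bot \<and> (\<Phi> \<longlongrightarrow> 0) at_top"
  shows "\<exists>\<Phi>. (\<forall>x. (\<Phi> has_real_derivative lxi x * (leta x powr \<alpha> * (lz \<alpha> (Suc n) m x)\<^sup>2)) (at x)) \<and>
      (\<Phi> \<longlongrightarrow> - 1 / (2 * \<alpha>)) at_bot \<and> (\<Phi> \<longlongrightarrow> 0) at_top"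
proof -
  have \<alpha>': "-1 < \<alpha>" using \<alpha> by simp
  obtain \<Phi> where \<Phi>: "\<And>x. (\<Phi> has_real_derivative lxi x * (leta x powr \<alpha> * (lz \<alpha> n m x)\<^sup>2)) (at x)"
      "(\<Phi> \<longlongrightarrow> - 1 / (2 * \<alpha>)) at_bot" "(\<Phi> \<longlongrightarrow> 0) at_top" using IH by blast
  define k where "k = 2 * lag_a \<alpha> (Suc n)"
  have k0: "k \<noteq> 0" unfolding k_def lag_a_def using \<alpha> by simp
  let ?F = "\<lambda>x. leta x powr \<alpha> * (lrho x * (lz \<alpha> (Suc n) m x * lz \<alpha> n m x))"
  have "((\<lambda>x. \<Phi> x - ?F x / k) has_real_derivative lxi x * (leta x powr \<alpha> * (lz \<alpha> (Suc n) m x)\<^sup>2)) (at x)" for x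
    by (rule DERIV_diff[OF \<Phi>(1) DERIV_cdivide[OF DERIV_ladder_product[OF \<alpha>']], THEN DERIV_cong])
      (simp only: k_def[symmetric] mult.assoc nonzero_mult_div_cancel_left[OF k0], simp add: algebra_simps)
  moreover have "((\<lambda>x. \<Phi> x - ?F x / k) \<longlongrightarrow> - 1 / (2 * \<alpha>) - (1 * (0 * ((if Suc n = m then (- 1) ^ Suc n else 0) * (if n = m then (- 1) ^ n else 0)))) / k) at_bot"
    by (intro tendsto_diff \<Phi> tendsto_divide tendsto_mult tendsto_const leta_powr_at_bot lrho_at_bot lz_at_bot[OF \<alpha>'] k0)
  moreover have "((\<lambda>x. \<Phi> x - ?F x / k) \<longlongrightarrow> 0 - (0 * (1 * (lzeta \<alpha> (Suc n) m * lzeta \<alpha> n m))) / k) at_top"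
    by (intro tendsto_diff \<Phi> tendsto_divide tendsto_mult tendsto_const leta_powr_at_top[OF \<alpha>] lrho_at_top lz_at_top k0)
  ultimately show ?thesis by (intro exI[of _ "\<lambda>x. \<Phi> x - ?F x / k"]) simp
qed

lemma lz_0_0: "lz \<alpha> 0 0 x = 1"
  by (simp add: lz_def lag_fun_def lag_norm_def lag_poly_def lag_coeff_def)

text \<open>At \<open>(0, 0)\<close> the function is 1 and the primitive explicit. The first index
  is raised to \<open>m\<close>, symmetry exchanges the two indices, and the first one is raised
  again to \<open>n\<close>.\<close>

lemma lxi_mass:
  assumes \<alpha>: "0 < \<alpha>"
  shows "\<exists>\<Phi>. (\<forall>x. (\<Phi> has_real_derivative lxi x * (leta x powr \<alpha> * (lz \<alpha> n m x)\<^sup>2)) (at x)) \<and>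
      (\<Phi> \<longlongrightarrow> - 1 / (2 * \<alpha>)) at_bot \<and> (\<Phi> \<longlongrightarrow> 0) at_top"
proof -
  let ?P = "\<lambda>n m. \<exists>\<Phi>. (\<forall>x. (\<Phi> has_real_derivative lxi x * (leta x powr \<alpha> * (lz \<alpha> n m x)\<^sup>2)) (at x)) \<and>
      (\<Phi> \<longlongrightarrow> - 1 / (2 * \<alpha>)) at_bot \<and> (\<Phi> \<longlongrightarrow> 0) at_top"
  have "?P 0 0"
  proof (intro exI[of _ "\<lambda>x. - (leta x powr \<alpha>) / (2 * \<alpha>)"] conjI allI)
    show "((\<lambda>x. - (leta x powr \<alpha>) / (2 * \<alpha>)) has_real_derivative lxi x * (leta x powr \<alpha> * (lz \<alpha> 0 0 x)\<^sup>2)) (at x)" for x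
      by (rule DERIV_cdivide[OF DERIV_minus[OF DERIV_leta_powr], THEN DERIV_cong]) (use \<alpha> in \<open>simp add: lz_0_0\<close>)
    show "((\<lambda>x. - (leta x powr \<alpha>) / (2 * \<alpha>)) \<longlongrightarrow> - 1 / (2 * \<alpha>)) at_bot"
      by (intro tendsto_intros leta_powr_at_bot) (use \<alpha> in simp)
    have "((\<lambda>x. - (leta x powr \<alpha>) / (2 * \<alpha>)) \<longlongrightarrow> - 0 / (2 * \<alpha>)) at_top"
      by (intro tendsto_intros leta_powr_at_top) (use \<alpha> in simp_all)
    then show "((\<lambda>x. - (leta x powr \<alpha>) / (2 * \<alpha>)) \<longlongrightarrow> 0) at_top" by simp
  qed
  then have "?P m 0"
  proof (induction m)
    case (Suc m)
    show ?case by (rule lxi_mass_step[OF \<alpha> Suc.IH[OF Suc.prems]])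
  qed
  then have "?P 0 m" by (simp add: lz_sym[of _ m 0])
  then show ?thesis
  proof (induction n)
    case (Suc n)
    show ?case by (rule lxi_mass_step[OF \<alpha> Suc.IH[OF Suc.prems]])
  qed
qed

text \<open>The coefficient of the ladder product is chosen so that in the derivative the
  coefficients of both squares acquire the common factor \<open>leta\<close>; half the sum of
  squares alone would leave terms in \<open>lxi\<close>.\<close>

definition leta_flux :: "real \<Rightarrow> nat \<Rightarrow> nat \<Rightarrow> real \<Rightarrow> real" where
  "leta_flux \<alpha> n m x = leta x powr \<alpha> * (((lz \<alpha> (Suc n) m x)\<^sup>2 + (lz \<alpha> n m x)\<^sup>2) / 2)
     - ((2 * real n + 2 + \<alpha>) / (2 * lag_a \<alpha> (Suc n))) * (leta x powr \<alpha> * (lrho x * (lz \<alpha> (Suc n) m x * lz \<alpha> n m x)))"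

lemma lag_a_Suc_pos: "-1 < \<alpha> \<Longrightarrow> 0 < lag_a \<alpha> (Suc n)"
  by (simp add: lag_a_def)

lemma DERIV_leta_flux:
  assumes "-1 < \<alpha>"
  shows "(leta_flux \<alpha> n m has_real_derivative leta x * (leta x powr \<alpha> *
    ((real m - real (Suc n)) * (lz \<alpha> (Suc n) m x)\<^sup>2 - (real m - real n) * (lz \<alpha> n m x)\<^sup>2))) (at x)"
proof -
  let ?u = "lz \<alpha> (Suc n) m" and ?v = "lz \<alpha> n m" and ?k = "2 * lag_a \<alpha> (Suc n)"
  define u' where "u' = (real m - real n - 1 - (real (n + m) + 1) * lxi x) * ?u x + ?k * lrho x * ?v x"
  define v' where "v' = ((real (n + m) + 2 + 2 * \<alpha>) * lxi x - (real m - real n)) * ?v x - ?k * lrho x * ?u x"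
  have du: "(?u has_real_derivative u') (at x)" and dv: "(?v has_real_derivative v') (at x)"
    unfolding u'_def v'_def by (rule DERIV_lz_Suc[OF assms], rule DERIV_lz_raise[OF assms])
  have "((\<lambda>x. ((?u x)\<^sup>2 + (?v x)\<^sup>2) / 2) has_real_derivative ?u x * u' + ?v x * v') (at x)"
    by (auto intro!: derivative_eq_intros du dv)
  moreover have "?u x * u' + ?v x * v' = (real m - real n - 1 - (real (n + m) + 1) * lxi x) * (?u x)\<^sup>2
      + ((real (n + m) + 2 + 2 * \<alpha>) * lxi x - (real m - real n)) * (?v x)\<^sup>2"
    unfolding u'_def v'_def by (simp add: algebra_simps power2_eq_square)
  ultimately have d1: "((\<lambda>x. ((?u x)\<^sup>2 + (?v x)\<^sup>2) / 2) has_real_derivative (real m - real n - 1 - (real (n + m) + 1) * lxi x) * (?u x)\<^sup>2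
      + ((real (n + m) + 2 + 2 * \<alpha>) * lxi x - (real m - real n)) * (?v x)\<^sup>2) (at x)" by simp
  have c: "((2 * real n + 2 + \<alpha>) / ?k) * (?k * lxi x * leta x powr \<alpha> * ((?v x)\<^sup>2 - (?u x)\<^sup>2))
      = (2 * real n + 2 + \<alpha>) * lxi x * leta x powr \<alpha> * ((?v x)\<^sup>2 - (?u x)\<^sup>2)"
    using lag_a_Suc_pos[OF assms, of n] by simp
  show ?thesis
    unfolding leta_flux_def[abs_def]
    by (rule DERIV_diff[OF DERIV_mult[OF DERIV_leta_powr d1] DERIV_cmult[OF DERIV_ladder_product[OF assms]], THEN DERIV_cong],
        unfold c) (simp add: leta_eq algebra_simps power2_eq_square add_divide_distrib diff_divide_distrib)
qed

lemma leta_flux_at_bot: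
  assumes "-1 < \<alpha>"
  shows "(leta_flux \<alpha> n m \<longlongrightarrow> (if Suc n = m \<or> n = m then 1/2 else 0)) at_bot"
proof -
  have "(leta_flux \<alpha> n m \<longlongrightarrow> 1 * (((if Suc n = m then (- 1) ^ Suc n else 0)\<^sup>2 + (if n = m then (- 1) ^ n else 0)\<^sup>2) / 2)
     - ((2 * real n + 2 + \<alpha>) / (2 * lag_a \<alpha> (Suc n))) * (1 * (0 * ((if Suc n = m then (- 1) ^ Suc n else 0) * (if n = m then (- 1) ^ n else 0))))) at_bot"
    unfolding leta_flux_def[abs_def]
    by (intro tendsto_diff tendsto_mult tendsto_const leta_powr_at_bot lrho_at_bot lz_at_bot[OF assms] tendsto_add tendsto_power tendsto_divide) simp
  then show ?thesis by (auto simp: power_mult[symmetric] mult.commute split: if_splits)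
qed

text \<open>For \<open>\<alpha> \<le> 0\<close> the weight does not decay, so the bracket itself has
  to vanish at plus infinity. Its leading terms balance, which yields one more factor
  \<open>leta\<close> and the decaying power \<open>\<alpha> + 1\<close>.\<close>

lemma leta_flux_at_top:
  assumes "-1 < \<alpha>"
  shows "(leta_flux \<alpha> n m \<longlongrightarrow> 0) at_top"
proof -
  define a where "a = lag_a \<alpha> (Suc n)"
  define N where "N = n + m"
  define c where "c = (2 * real n + 2 + \<alpha>) / (2 * a)"
  define \<zeta>1 where "\<zeta>1 = lzeta \<alpha> (Suc n) m"
  define \<zeta>0 where "\<zeta>0 = lzeta \<alpha> n m"
  let ?r1 = "lrem \<alpha> (Suc n) m" and ?r0 = "lrem \<alpha> n m"
  have a: "0 < a" "a * a = (real n + 1) * (1 + \<alpha> + real n)"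
    unfolding a_def using lag_a_Suc_pos[OF assms] lag_a_Suc_sq[OF assms] by auto
  have \<zeta>: "(real n + 1) * \<zeta>1 = a * \<zeta>0" unfolding \<zeta>1_def \<zeta>0_def a_def by (rule lzeta_Suc[OF assms])
  \<comment> \<open>The ratio of \<open>\<zeta>1\<close> to \<open>\<zeta>0\<close> is
    \<open>a / (n + 1)\<close> by the recursion, and
    \<open>a * a = (n + 1) (n + 1 + \<alpha>)\<close>; with these \<open>c\<close> is exactly the
    balancing weight.\<close>
  have bal: "c * (\<zeta>1 * \<zeta>0) = (\<zeta>1\<^sup>2 + \<zeta>0\<^sup>2) / 2"
  proof -
    have z1: "\<zeta>1 = a * \<zeta>0 / (real n + 1)" using \<zeta> by (simp add: field_simps)
    have "c * (\<zeta>1 * \<zeta>0) = (2 * real n + 2 + \<alpha>) * \<zeta>0\<^sup>2 / (2 * (real n + 1))"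
    proof -
      have "(q / (2 * a)) * (a * z / d * z) = q * z\<^sup>2 / (2 * d)" for q z d :: real
        using a(1) by (simp add: field_simps power2_eq_square)
      then show ?thesis unfolding c_def z1 .
    qed
    moreover have "\<zeta>1\<^sup>2 = (a * a) * \<zeta>0\<^sup>2 / (real n + 1)\<^sup>2"
      unfolding z1 by (simp add: power_divide power_mult_distrib power2_eq_square)
    then have "\<zeta>1\<^sup>2 = (1 + \<alpha> + real n) * \<zeta>0\<^sup>2 / (real n + 1)"
      unfolding a(2) by (simp add: power2_eq_square)
    moreover have "\<zeta>0\<^sup>2 = (real n + 1) * \<zeta>0\<^sup>2 / (real n + 1)" by simp
    ultimately have "(\<zeta>1\<^sup>2 + \<zeta>0\<^sup>2) / 2 = ((1 + \<alpha> + real n) * \<zeta>0\<^sup>2 / (real n + 1) + (real n + 1) * \<zeta>0\<^sup>2 / (real n + 1)) / 2" by simp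
    also have "\<dots> = (2 * real n + 2 + \<alpha>) * \<zeta>0\<^sup>2 / (2 * (real n + 1))"
      by (simp add: add_divide_distrib[symmetric] algebra_simps)
    finally show ?thesis using \<open>c * (\<zeta>1 * \<zeta>0) = _\<close> by (simp only:)
  qed
  \<comment> \<open>The bracket divided by \<open>leta x\<close>: the first term is what the balance
    leaves of the leading parts, and the others contain a remainder \<open>lrem\<close>.\<close>
  define E where "E x = \<zeta>0\<^sup>2 * lrho x ^ (2 * N) / 2
     + (\<zeta>1 * lrho x ^ (N + 1) * ?r1 x + leta x * (?r1 x)\<^sup>2 / 2 + \<zeta>0 * lrho x ^ N * ?r0 x + leta x * (?r0 x)\<^sup>2 / 2
       - c * lrho x * (\<zeta>1 * lrho x ^ (N + 1) * ?r0 x + \<zeta>0 * lrho x ^ N * ?r1 x + leta x * (?r1 x * ?r0 x)))" for x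
  have flux: "leta_flux \<alpha> n m x = leta x powr (\<alpha> + 1) * E x" for x
  proof -
    define P where "P = lrho x ^ N"
    have P2: "lrho x ^ (2 * N) = P * P" unfolding P_def by (simp add: power_add[symmetric] mult_2)
    have u: "lz \<alpha> (Suc n) m x = \<zeta>1 * (lrho x * P) + leta x * ?r1 x"
      by (simp add: lz_expansion \<zeta>1_def P_def N_def)
    have v: "lz \<alpha> n m x = \<zeta>0 * P + leta x * ?r0 x"
      by (simp add: lz_expansion \<zeta>0_def P_def N_def)
    have E': "E x = \<zeta>0\<^sup>2 * (P * P) / 2
     + (\<zeta>1 * (lrho x * P) * ?r1 x + leta x * (?r1 x)\<^sup>2 / 2 + \<zeta>0 * P * ?r0 x + leta x * (?r0 x)\<^sup>2 / 2
       - c * lrho x * (\<zeta>1 * (lrho x * P) * ?r0 x + \<zeta>0 * P * ?r1 x + leta x * (?r1 x * ?r0 x)))"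
      unfolding E_def P2 by (simp add: P_def mult_ac)
    have "((lz \<alpha> (Suc n) m x)\<^sup>2 + (lz \<alpha> n m x)\<^sup>2) / 2 - c * (lrho x * (lz \<alpha> (Suc n) m x * lz \<alpha> n m x))
        = (\<zeta>1\<^sup>2 * (lrho x * lrho x) + \<zeta>0\<^sup>2) / 2 * (P * P) - (c * (\<zeta>1 * \<zeta>0)) * (lrho x * lrho x) * (P * P)
          + leta x * (E x - \<zeta>0\<^sup>2 * (P * P) / 2)"
      unfolding u v E' by (simp add: field_simps power2_eq_square)
    also have "\<dots> = leta x * E x"
      unfolding bal lrho_sq unfolding leta_eq by (simp add: field_simps)
    finally have *: "((lz \<alpha> (Suc n) m x)\<^sup>2 + (lz \<alpha> n m x)\<^sup>2) / 2 - c * (lrho x * (lz \<alpha> (Suc n) m x * lz \<alpha> n m x)) = leta x * E x" .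
    have "leta_flux \<alpha> n m x = leta x powr \<alpha> * (((lz \<alpha> (Suc n) m x)\<^sup>2 + (lz \<alpha> n m x)\<^sup>2) / 2 - c * (lrho x * (lz \<alpha> (Suc n) m x * lz \<alpha> n m x)))"
      unfolding leta_flux_def c_def a_def right_diff_distrib by (simp only: mult.left_commute)
    then show ?thesis unfolding * using leta_pos[of x] by (simp add: powr_add mult_ac)
  qed
  obtain l1 where l1: "(?r1 \<longlongrightarrow> l1) at_top" using lrem_at_top by blast
  obtain l0 where l0: "(?r0 \<longlongrightarrow> l0) at_top" using lrem_at_top by blast
  have "\<exists>l. (E \<longlongrightarrow> l) at_top" unfolding E_def[abs_def]
    by (rule exI, (rule tendsto_intros lrho_at_top leta_at_top l1 l0 | simp)+)
  then obtain l where "(E \<longlongrightarrow> l) at_top" by blast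
  then have "((\<lambda>x. leta x powr (\<alpha> + 1) * E x) \<longlongrightarrow> 0 * l) at_top"
    by (intro tendsto_mult leta_powr_at_top) (use assms in simp_all)
  moreover have "leta_flux \<alpha> n m = (\<lambda>x. leta x powr (\<alpha> + 1) * E x)" by (rule ext) (rule flux)
  ultimately show ?thesis by simp
qed

text \<open>Half the sign of \<open>m - n\<close>. It changes only in the steps where
  \<open>n\<close> or \<open>Suc n\<close> equals \<open>m\<close>, and those are the steps where
  the flux has the limit 1/2 at minus infinity.\<close>

definition mass_sign :: "nat \<Rightarrow> nat \<Rightarrow> real" where
  "mass_sign n m = (if n < m then 1/2 else if n = m then 0 else - 1/2)"

lemma leta_mass_step:
  assumes \<alpha>: "-1 < \<alpha>"
    and IH: "\<exists>\<Theta> l. (\<forall>x. (\<Theta> has_real_derivative (real m - real n) * leta x * (leta x powr \<alpha> * (lz \<alpha> n m x)\<^sup>2)) (at x)) \<and>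
      (\<Theta> \<longlongrightarrow> l) at_bot \<and> (\<Theta> \<longlongrightarrow> l + mass_sign n m) at_top"
  shows "\<exists>\<Theta> l. (\<forall>x. (\<Theta> has_real_derivative (real m - real (Suc n)) * leta x * (leta x powr \<alpha> * (lz \<alpha> (Suc n) m x)\<^sup>2)) (at x)) \<and>
      (\<Theta> \<longlongrightarrow> l) at_bot \<and> (\<Theta> \<longlongrightarrow> l + mass_sign (Suc n) m) at_top"
proof -
  obtain \<Theta> l where \<Theta>: "\<And>x. (\<Theta> has_real_derivative (real m - real n) * leta x * (leta x powr \<alpha> * (lz \<alpha> n m x)\<^sup>2)) (at x)"
      "(\<Theta> \<longlongrightarrow> l) at_bot" "(\<Theta> \<longlongrightarrow> l + mass_sign n m) at_top" using IH by blast
  let ?l = "l + (if Suc n = m \<or> n = m then 1/2 else 0)"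
  have eq: "l + mass_sign n m + 0 = ?l + mass_sign (Suc n) m" by (auto simp: mass_sign_def)
  show ?thesis
  proof (intro exI[of _ "\<lambda>x. \<Theta> x + leta_flux \<alpha> n m x"] exI[of _ ?l] conjI allI)
    show "((\<lambda>x. \<Theta> x + leta_flux \<alpha> n m x) has_real_derivative (real m - real (Suc n)) * leta x * (leta x powr \<alpha> * (lz \<alpha> (Suc n) m x)\<^sup>2)) (at x)" for x
      by (rule DERIV_add[OF \<Theta>(1) DERIV_leta_flux[OF \<alpha>], THEN DERIV_cong]) (simp add: algebra_simps)
    show "((\<lambda>x. \<Theta> x + leta_flux \<alpha> n m x) \<longlongrightarrow> ?l) at_bot"
      by (intro tendsto_add \<Theta> leta_flux_at_bot[OF \<alpha>])
    show "((\<lambda>x. \<Theta> x + leta_flux \<alpha> n m x) \<longlongrightarrow> ?l + mass_sign (Suc n) m) at_top"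
      unfolding eq[symmetric] by (intro tendsto_add \<Theta> leta_flux_at_top[OF \<alpha>])
  qed
qed

lemma leta_mass:
  assumes \<alpha>: "-1 < \<alpha>"
  shows "\<exists>\<Theta> l. (\<forall>x. (\<Theta> has_real_derivative (real m - real n) * leta x * (leta x powr \<alpha> * (lz \<alpha> n m x)\<^sup>2)) (at x)) \<and>
      (\<Theta> \<longlongrightarrow> l) at_bot \<and> (\<Theta> \<longlongrightarrow> l + mass_sign n m) at_top"
proof -
  let ?P = "\<lambda>n m. \<exists>\<Theta> l. (\<forall>x. (\<Theta> has_real_derivative (real m - real n) * leta x * (leta x powr \<alpha> * (lz \<alpha> n m x)\<^sup>2)) (at x)) \<and>
      (\<Theta> \<longlongrightarrow> l) at_bot \<and> (\<Theta> \<longlongrightarrow> l + mass_sign n m) at_top"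
  have "?P 0 0" by (intro exI[of _ "\<lambda>_. 0"] exI[of _ 0]) (simp add: mass_sign_def)
  then have "?P m 0" by (induction m) (simp, rule leta_mass_step[OF \<alpha>], simp)
  then obtain \<Theta> l where \<Theta>: "\<And>x. (\<Theta> has_real_derivative (real 0 - real m) * leta x * (leta x powr \<alpha> * (lz \<alpha> m 0 x)\<^sup>2)) (at x)"
      "(\<Theta> \<longlongrightarrow> l) at_bot" "(\<Theta> \<longlongrightarrow> l + mass_sign m 0) at_top" by blast
  have "?P 0 m"
  proof (intro exI[of _ "\<lambda>x. - \<Theta> x"] exI[of _ "- l"] conjI allI)
    show "((\<lambda>x. - \<Theta> x) has_real_derivative (real m - real 0) * leta x * (leta x powr \<alpha> * (lz \<alpha> 0 m x)\<^sup>2)) (at x)" for x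
      by (rule DERIV_minus[OF \<Theta>(1), THEN DERIV_cong]) (simp add: lz_sym[of _ m 0])
    show "((\<lambda>x. - \<Theta> x) \<longlongrightarrow> - l) at_bot" by (intro tendsto_minus \<Theta>)
    have "((\<lambda>x. - \<Theta> x) \<longlongrightarrow> - (l + mass_sign m 0)) at_top" by (intro tendsto_minus \<Theta>)
    then show "((\<lambda>x. - \<Theta> x) \<longlongrightarrow> - l + mass_sign 0 m) at_top" by (simp add: mass_sign_def split: if_splits)
  qed
  then show ?thesis by (induction n) (simp, rule leta_mass_step[OF \<alpha>], simp)
qed

section \<open>The bound by one, for both signs of \<alpha>\<close>

lemma lag_index_ineqs:
  fixes n m :: nat and \<alpha> :: real
  defines "b \<equiv> real m - real n" and "N \<equiv> real (n + m)"
  assumes \<alpha>: "-1 < \<alpha>" and nm: "n \<le> m"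
  shows "(\<alpha> + b) * (\<alpha> + b + 2) \<le> (N + \<alpha>) * (N + \<alpha> + 2)"
    and "0 < N \<Longrightarrow> b\<^sup>2 < N * (N + 2 * \<alpha> + 2)" and "0 < N \<Longrightarrow> 0 < N * (N + 2 * \<alpha> + 2)"
proof -
  have b: "0 \<le> b" "b \<le> N" using nm by (auto simp: b_def N_def)
  have "(\<alpha> + b + 1)\<^sup>2 \<le> (N + \<alpha> + 1)\<^sup>2" using b \<alpha> by (intro power_mono) auto
  then show "(\<alpha> + b) * (\<alpha> + b + 2) \<le> (N + \<alpha>) * (N + \<alpha> + 2)" by (simp add: power2_eq_square algebra_simps)
  show "b\<^sup>2 < N * (N + 2 * \<alpha> + 2)" if "0 < N"
  proof -
    have "b\<^sup>2 \<le> N\<^sup>2" using b by (intro power_mono)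
    moreover have "0 < N * (2 * \<alpha> + 2)" using that \<alpha> by simp
    ultimately show ?thesis by (simp add: power2_eq_square algebra_simps)
  qed
  then show "0 < N * (N + 2 * \<alpha> + 2)" if "0 < N" using that \<alpha> by simp
qed

text \<open>Liouville's substitution: the logarithmic derivative \<open>- \<alpha> lxi\<close> of
  the weight absorbs the first-order term \<open>2 \<alpha> lxi\<close> of the equation for
  \<open>lz\<close>.\<close>

definition ly :: "real \<Rightarrow> nat \<Rightarrow> nat \<Rightarrow> real \<Rightarrow> real" where
  "ly \<alpha> n m x = leta x powr (\<alpha>/2) * lz \<alpha> n m x"

definition ly' :: "real \<Rightarrow> nat \<Rightarrow> nat \<Rightarrow> real \<Rightarrow> real" where
  "ly' \<alpha> n m x = leta x powr (\<alpha>/2) * (lz' \<alpha> n m x - \<alpha> * lxi x * lz \<alpha> n m x)"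

definition lV :: "real \<Rightarrow> nat \<Rightarrow> nat \<Rightarrow> real \<Rightarrow> real" where
  "lV \<alpha> n m x = \<alpha>\<^sup>2 * lxi x + (real m - real n)\<^sup>2 * leta x
     - (real (n + m) + \<alpha>) * (real (n + m) + \<alpha> + 2) * lxi x * leta x"

lemma DERIV_ly:
  assumes "-1 < \<alpha>"
  shows "(ly \<alpha> n m has_real_derivative ly' \<alpha> n m x) (at x)"
  unfolding ly_def[abs_def] ly'_def
  by (rule DERIV_mult[OF DERIV_leta_powr DERIV_lz[OF assms], THEN DERIV_cong]) (simp add: algebra_simps)

lemma DERIV_ly':
  assumes "-1 < \<alpha>"
  shows "(ly' \<alpha> n m has_real_derivative lV \<alpha> n m x * ly \<alpha> n m x) (at x)"
proof -
  have "((\<lambda>x. lz' \<alpha> n m x - \<alpha> * lxi x * lz \<alpha> n m x) has_real_derivative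
      (2 * \<alpha> * lxi x * lz' \<alpha> n m x - leta x * (real (n + m) * (real (n + m) + 2 * \<alpha> + 2) * lxi x - (real m - real n)\<^sup>2) * lz \<alpha> n m x)
      - (\<alpha> * (2 * lxi x * leta x) * lz \<alpha> n m x + lz' \<alpha> n m x * (\<alpha> * lxi x))) (at x)"
    by (rule DERIV_diff[OF DERIV_lz'[OF assms] DERIV_mult[OF DERIV_cmult[OF DERIV_lxi] DERIV_lz[OF assms]]])
  from DERIV_mult[OF DERIV_leta_powr this]
  show ?thesis unfolding ly'_def[abs_def]
    by (rule DERIV_cong) (simp add: ly_def lV_def leta_eq[of x] algebra_simps power2_eq_square del: of_nat_add)
qed

lemma ly_sq: "(ly \<alpha> n m x)\<^sup>2 = leta x powr \<alpha> * (lz \<alpha> n m x)\<^sup>2"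
  by (simp add: ly_def power_mult_distrib powr_half_sq leta_pos)

lemma ly_nonzero_iff: "ly \<alpha> n m x = 0 \<longleftrightarrow> lz \<alpha> n m x = 0"
  using leta_pos[of x] by (simp add: ly_def)

text \<open>The lower bound \<open>A\<close> is left open because the two signs of \<alpha> supply
  different ones: the weight at \<open>x\<close> itself for positive \<alpha>, and 1
  otherwise.\<close>

lemma lz_head_bound:
  assumes \<alpha>: "-1 < \<alpha>" and nm: "n < m" and nz: "\<And>u. u \<le> x \<Longrightarrow> lz \<alpha> n m u \<noteq> 0"
    and A: "0 \<le> A" "\<And>u. u \<le> x \<Longrightarrow> A \<le> leta u powr \<alpha>"
  shows "A * (ly \<alpha> n m x)\<^sup>2 \<le> leta x powr \<alpha>"
proof -
  obtain \<Theta> l where \<Theta>: "\<And>x. (\<Theta> has_real_derivative (real m - real n) * leta x * (leta x powr \<alpha> * (lz \<alpha> n m x)\<^sup>2)) (at x)"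
      "(\<Theta> \<longlongrightarrow> l) at_bot" "(\<Theta> \<longlongrightarrow> l + mass_sign n m) at_top"
    using leta_mass[OF \<alpha>, of m n] by blast
  \<comment> \<open>Multiplication by the sign at \<open>x\<close> makes the solution positive up to
    \<open>x\<close>, where it has no zero; the comparison lemma asks for positivity.\<close>
  define \<sigma> where "\<sigma> = (if 0 < ly \<alpha> n m x then 1 else - 1 :: real)"
  have \<sigma>: "\<sigma> * \<sigma> = 1" by (simp add: \<sigma>_def)
  let ?y = "\<lambda>x. \<sigma> * ly \<alpha> n m x" and ?y' = "\<lambda>x. \<sigma> * ly' \<alpha> n m x"
  have dy: "(?y has_real_derivative ?y' x) (at x)" for x
    by (rule DERIV_cmult[OF DERIV_ly[OF \<alpha>]])
  have dy': "(?y' has_real_derivative lV \<alpha> n m x * ?y x) (at x)" for x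
    by (rule DERIV_cmult[OF DERIV_ly'[OF \<alpha>], THEN DERIV_cong]) simp
  have y2: "(?y x)\<^sup>2 = leta x powr \<alpha> * (lz \<alpha> n m x)\<^sup>2" for x
    unfolding power_mult_distrib ly_sq using \<sigma> by (simp add: power2_eq_square)
  have cont: "continuous_on UNIV ?y"
    using dy by (intro continuous_at_imp_continuous_on) (auto intro: DERIV_isCont)
  have "0 < ?y x" using nz[of x] by (auto simp: \<sigma>_def ly_nonzero_iff not_less order.order_iff_strict)
  have "A * (?y x)\<^sup>2 \<le> leta x powr \<alpha>"
  proof (rule head_bound_pos[where y = ?y and y' = ?y' and b = "real m - real n" and \<Theta> = \<Theta> and l = l, OF lV_def _ _ dy dy'])
    show "(\<alpha> + (real m - real n)) * (\<alpha> + (real m - real n) + 2) \<le> (real (n + m) + \<alpha>) * (real (n + m) + \<alpha> + 2)"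
      by (rule lag_index_ineqs[OF \<alpha>]) (use nm in simp)
    show "0 < real m - real n" using nm by simp
    show "((\<lambda>x. (?y' x - ((real m - real n) * leta x - \<alpha> * lxi x) * ?y x) * (lxi x powr ((real m - real n) / 2) * leta x powr (\<alpha> / 2))) \<longlongrightarrow> 0) at_bot"
    proof -
      have "((\<lambda>x. \<sigma> * leta x powr (\<alpha>/2) * (lz' \<alpha> n m x - (real m - real n) * leta x * lz \<alpha> n m x)
          * (lxi x powr ((real m - real n) / 2) * leta x powr (\<alpha> / 2))) \<longlongrightarrow>
          \<sigma> * 1 * (0 - (real m - real n) * 1 * 0) * (0 * 1)) at_bot"
        using lz'_at_bot[OF \<alpha>, of n m] lz_at_bot[OF \<alpha>, of n m] nm
          tendsto_powr2[OF lxi_at_bot tendsto_const, of "(real m - real n) / 2"] lxi_pos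
        by (intro tendsto_intros leta_powr_at_bot leta_at_bot) (auto intro: always_eventually less_imp_le)
      then show ?thesis by (simp add: ly_def ly'_def algebra_simps)
    qed
    show "(\<Theta> has_real_derivative (real m - real n) * leta x * (?y x)\<^sup>2) (at x)" for x
      unfolding y2 by (rule \<Theta>(1))
    show "(\<Theta> \<longlongrightarrow> l) at_bot" by (rule \<Theta>)
    show "(\<Theta> \<longlongrightarrow> l + 1 / 2) at_top" using \<Theta>(3) nm by (simp add: mass_sign_def)
    show "0 < ?y u" if "u \<le> x" for u
      by (rule const_sign_on[OF cont connected_Iic[of x], where x = x])
        (use that nz \<open>0 < ?y x\<close> \<sigma> in \<open>auto simp: ly_nonzero_iff\<close>)
  qed (use A in auto)
  then show ?thesis unfolding y2 ly_sq .
qed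

lemma ly_tail_bound:
  assumes \<alpha>: "0 < \<alpha>" and nm: "n \<le> m" and nz: "\<And>u. x \<le> u \<Longrightarrow> ly \<alpha> n m u \<noteq> 0"
  shows "(ly \<alpha> n m x)\<^sup>2 \<le> 1"
proof -
  have \<alpha>': "-1 < \<alpha>" using \<alpha> by simp
  obtain \<Phi> where \<Phi>: "\<And>x. (\<Phi> has_real_derivative lxi x * (leta x powr \<alpha> * (lz \<alpha> n m x)\<^sup>2)) (at x)"
      "(\<Phi> \<longlongrightarrow> - 1 / (2 * \<alpha>)) at_bot" "(\<Phi> \<longlongrightarrow> 0) at_top"
    using lxi_mass[OF \<alpha>, of n m] by blast
  define \<sigma> where "\<sigma> = (if 0 < ly \<alpha> n m x then 1 else - 1 :: real)"
  have \<sigma>: "\<sigma> * \<sigma> = 1" by (simp add: \<sigma>_def)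
  let ?y = "\<lambda>x. \<sigma> * ly \<alpha> n m x" and ?y' = "\<lambda>x. \<sigma> * ly' \<alpha> n m x"
  have dy: "(?y has_real_derivative ?y' x) (at x)" for x
    by (rule DERIV_cmult[OF DERIV_ly[OF \<alpha>']])
  have dy': "(?y' has_real_derivative lV \<alpha> n m x * ?y x) (at x)" for x
    by (rule DERIV_cmult[OF DERIV_ly'[OF \<alpha>'], THEN DERIV_cong]) simp
  have y2: "(?y x)\<^sup>2 = leta x powr \<alpha> * (lz \<alpha> n m x)\<^sup>2" for x
    unfolding power_mult_distrib ly_sq using \<sigma> by (simp add: power2_eq_square)
  have cont: "continuous_on UNIV ?y"
    using dy by (intro continuous_at_imp_continuous_on) (auto intro: DERIV_isCont)
  have "0 < ?y x" using nz[of x] by (auto simp: \<sigma>_def not_less order.order_iff_strict)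
  have "(?y x)\<^sup>2 \<le> 1"
  proof (rule tail_bound_pos[where y = ?y and y' = ?y' and b = "real m - real n" and \<Phi> = \<Phi>, OF lV_def _ \<alpha> _ dy dy'])
    show "(\<alpha> + (real m - real n)) * (\<alpha> + (real m - real n) + 2) \<le> (real (n + m) + \<alpha>) * (real (n + m) + \<alpha> + 2)"
      by (rule lag_index_ineqs[OF \<alpha>' nm])
    show "0 \<le> real m - real n" using nm by simp
    show "((\<lambda>x. (?y' x - ((real m - real n) * leta x - \<alpha> * lxi x) * ?y x) * (lxi x powr ((real m - real n) / 2) * leta x powr (\<alpha> / 2))) \<longlongrightarrow> 0) at_top"
    proof -
      have "((\<lambda>x. lxi x powr ((real m - real n) / 2)) \<longlongrightarrow> 1 powr ((real m - real n) / 2)) at_top"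
        by (intro tendsto_powr lxi_at_top tendsto_const) simp
      then have "((\<lambda>x. \<sigma> * leta x powr (\<alpha>/2) * (lz' \<alpha> n m x - (real m - real n) * leta x * lz \<alpha> n m x)
          * (lxi x powr ((real m - real n) / 2) * leta x powr (\<alpha> / 2))) \<longlongrightarrow>
          \<sigma> * 0 * (0 - (real m - real n) * 0 * lzeta \<alpha> n m) * (1 powr ((real m - real n) / 2) * 0)) at_top"
        using \<alpha> by (intro tendsto_intros leta_powr_at_top leta_at_top lxi_at_top lz'_at_top[OF \<alpha>'] lz_at_top) auto
      then show ?thesis by (simp add: ly_def ly'_def algebra_simps)
    qed
    show "(\<Phi> has_real_derivative lxi x * (?y x)\<^sup>2) (at x)" for x
      unfolding y2 by (rule \<Phi>(1))
    show "0 < ?y u" if "x \<le> u" for u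
      by (rule const_sign_on[OF cont connected_Ici[of x], where x = x])
        (use that nz \<open>0 < ?y x\<close> \<sigma> in auto)
  qed (fact \<Phi>)+
  then show ?thesis unfolding y2 ly_sq .
qed

lemma lz_nonzero_at_top:
  assumes "-1 < \<alpha>" shows "\<forall>\<^sub>F x in at_top. lz \<alpha> n m x \<noteq> 0"
  by (rule tendsto_imp_eventually_ne[OF lz_at_top]) (use lzeta_pos[OF assms, of n m] in simp)

theorem ly_bound:
  assumes \<alpha>: "0 < \<alpha>" and nm: "n \<le> m"
  shows "(ly \<alpha> n m x)\<^sup>2 \<le> 1"
proof -
  have \<alpha>': "-1 < \<alpha>" using \<alpha> by simp
  define c where "c = (real (n + m) + \<alpha>) * (real (n + m) + \<alpha> + 2)"
  show ?thesis
  proof (rule sonin_bound[where y = "ly \<alpha> n m" and y' = "ly' \<alpha> n m" and c = c and b = "real m - real n",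
        OF lV_def[of \<alpha> n m, folded c_def] _ DERIV_ly[OF \<alpha>'] DERIV_ly'[OF \<alpha>']])
    show "0 < c" using \<alpha> unfolding c_def by (intro mult_pos_pos add_nonneg_pos add_pos_pos) auto
    have "((\<lambda>x. leta x powr (\<alpha>/2) * lz \<alpha> n m x) \<longlongrightarrow> 0 * lzeta \<alpha> n m) at_top"
      using \<alpha> by (intro tendsto_mult leta_powr_at_top lz_at_top) simp
    then show "(ly \<alpha> n m \<longlongrightarrow> 0) at_top" by (simp add: ly_def[abs_def])
    show "\<forall>\<^sub>F x in at_top. ly \<alpha> n m x \<noteq> 0" unfolding ly_nonzero_iff by (rule lz_nonzero_at_top[OF \<alpha>'])
    show "\<forall>\<^sub>F x in at_bot. ly \<alpha> n m x \<noteq> 0" unfolding ly_nonzero_iff by (rule lz_nonzero_at_bot[OF \<alpha>' nm])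
    show "(ly \<alpha> n m x)\<^sup>2 \<le> 1" if "\<And>u. x \<le> u \<Longrightarrow> ly \<alpha> n m u \<noteq> 0" for x
      by (rule ly_tail_bound[OF \<alpha> nm that])
    have bot: "(ly \<alpha> n m \<longlongrightarrow> (if n = m then (- 1) ^ n else 0)) at_bot"
      using tendsto_mult[OF leta_powr_at_bot lz_at_bot[OF \<alpha>'], of "\<alpha>/2" n m] by (simp add: ly_def[abs_def])
    show "(ly \<alpha> n m \<longlongrightarrow> 0) at_bot" if "real m - real n \<noteq> 0" using bot that by auto
    show "(ly \<alpha> n m x)\<^sup>2 \<le> 1" if "real m - real n \<noteq> 0" "\<And>u. u \<le> x \<Longrightarrow> ly \<alpha> n m u \<noteq> 0" for x
    proof -
      \<comment> \<open>For positive \<alpha> the weight decreases in its argument, so its value at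
        \<open>x\<close> bounds it from below on the left.\<close>
      have "leta x powr \<alpha> * (ly \<alpha> n m x)\<^sup>2 \<le> leta x powr \<alpha>"
        by (rule lz_head_bound[OF \<alpha>'])
          (use that nm \<alpha> leta_pos in \<open>auto simp: ly_nonzero_iff intro!: powr_mono2 leta_mono intro: less_imp_le\<close>)
      then show ?thesis using leta_pos[of x] by simp
    qed
    show "((\<lambda>x. (ly \<alpha> n m x)\<^sup>2) \<longlongrightarrow> 1) at_bot" if "real m - real n = 0"
      using tendsto_power[OF bot, of 2] that by (simp add: power_mult[symmetric] mult.commute)
    show "((\<lambda>x. (ly' \<alpha> n m x)\<^sup>2 / lV \<alpha> n m x) \<longlongrightarrow> 0) at_bot" if "real m - real n = 0"
    proof -
      \<comment> \<open>On the diagonal the square of \<open>lrho\<close> cancels between numerator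
        and denominator of the quotient. The remaining denominator tends to
        \<open>\<alpha>^2 - c\<close>, which is not zero since \<open>c\<close> exceeds the square
        of \<alpha>.\<close>
      have [simp]: "m = n" using that by simp
      have 1: "((\<lambda>x. (leta x powr (\<alpha>/2) * (lz' \<alpha> n n x / lrho x - \<alpha> * lrho x * lz \<alpha> n n x))\<^sup>2) \<longlongrightarrow>
          (1 * (0 - \<alpha> * 0 * (if n = n then (- 1) ^ n else 0)))\<^sup>2) at_bot"
        by (intro tendsto_power tendsto_mult tendsto_diff tendsto_const leta_powr_at_bot lz'_diag_at_bot[OF \<alpha>'] lrho_at_bot lz_at_bot[OF \<alpha>'])
      have "\<alpha>\<^sup>2 < c"
      proof -
        have "\<alpha> * \<alpha> < (real (n + m) + \<alpha>) * (real (n + m) + \<alpha> + 2)" using \<alpha> by (intro mult_le_less_imp_less) auto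
        then show ?thesis by (simp add: c_def power2_eq_square)
      qed
      then have 2: "((\<lambda>x. (leta x powr (\<alpha>/2) * (lz' \<alpha> n n x / lrho x - \<alpha> * lrho x * lz \<alpha> n n x))\<^sup>2 / (\<alpha>\<^sup>2 - c * leta x)) \<longlongrightarrow>
          (1 * (0 - \<alpha> * 0 * (if n = n then (- 1) ^ n else 0)))\<^sup>2 / (\<alpha>\<^sup>2 - c * 1)) at_bot"
        by (intro tendsto_divide 1 tendsto_diff tendsto_mult tendsto_const leta_at_bot) simp
      moreover have "(ly' \<alpha> n m x)\<^sup>2 / lV \<alpha> n m x
          = (leta x powr (\<alpha>/2) * (lz' \<alpha> n n x / lrho x - \<alpha> * lrho x * lz \<alpha> n n x))\<^sup>2 / (\<alpha>\<^sup>2 - c * leta x)" for x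
      proof -
        have "ly' \<alpha> n m x = lrho x * (leta x powr (\<alpha>/2) * (lz' \<alpha> n n x / lrho x - \<alpha> * lrho x * lz \<alpha> n n x))"
          using lrho_pos[of x] by (simp add: ly'_def lrho_sq[symmetric] field_simps)
        moreover have "lV \<alpha> n m x = (lrho x)\<^sup>2 * (\<alpha>\<^sup>2 - c * leta x)"
          by (simp add: lV_def c_def lrho_sq power2_eq_square[of "lrho x"] algebra_simps)
        ultimately show ?thesis using lrho_pos[of x] by (simp add: power_mult_distrib)
      qed
      ultimately show ?thesis by simp
    qed
  qed
qed

theorem lz_bound:
  assumes \<alpha>: "-1 < \<alpha>" "\<alpha> \<le> 0" and nm: "n \<le> m"
  shows "(lz \<alpha> n m x)\<^sup>2 \<le> 1"
proof (cases "n + m = 0")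
  case True
  then show ?thesis by (simp add: lz_0_0)
next
  case False
  then have "0 < n + m" by simp
  then have N: "0 < real (n + m)" by (simp only: of_nat_0_less_iff)
  define L where "L = real (n + m) * (real (n + m) + 2 * \<alpha> + 2)"
  show ?thesis
  proof (rule sonin_bound_nonpos[where z = "lz \<alpha> n m" and z' = "lz' \<alpha> n m" and b = "real m - real n" and L = L
        and U = "\<lambda>x. L * lxi x - (real m - real n)\<^sup>2" and a = \<alpha> and w = "(lzeta \<alpha> n m)\<^sup>2"])
    show "0 < L" "(real m - real n)\<^sup>2 < L" unfolding L_def by (rule lag_index_ineqs(3)[OF \<alpha>(1) nm N], rule lag_index_ineqs(2)[OF \<alpha>(1) nm N])
    show "(lz \<alpha> n m has_real_derivative lz' \<alpha> n m x) (at x)" for x by (rule DERIV_lz[OF \<alpha>(1)])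
    show "(lz' \<alpha> n m has_real_derivative 2 * \<alpha> * lxi x * lz' \<alpha> n m x - leta x * (L * lxi x - (real m - real n)\<^sup>2) * lz \<alpha> n m x) (at x)" for x
      unfolding L_def by (rule DERIV_lz'[OF \<alpha>(1)])
    show "((\<lambda>x. (lz \<alpha> n m x)\<^sup>2) \<longlongrightarrow> (lzeta \<alpha> n m)\<^sup>2) at_top" by (intro tendsto_power lz_at_top)
    show "(lzeta \<alpha> n m)\<^sup>2 \<le> 1" by (rule lzeta_le_1[OF \<alpha>])
    show "((\<lambda>x. (lz' \<alpha> n m x)\<^sup>2 / leta x) \<longlongrightarrow> 0) at_top" by (rule lz'_at_top[OF \<alpha>(1)])
    show "(lz \<alpha> n m \<longlongrightarrow> 0) at_bot" if "real m - real n \<noteq> 0" using lz_at_bot[OF \<alpha>(1), of n m] that by auto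
    show "\<forall>\<^sub>F x in at_bot. lz \<alpha> n m x \<noteq> 0" by (rule lz_nonzero_at_bot[OF \<alpha>(1) nm])
    show "(lz \<alpha> n m x)\<^sup>2 \<le> 1" if "real m - real n \<noteq> 0" "\<And>u. u \<le> x \<Longrightarrow> lz \<alpha> n m u \<noteq> 0" for x
    proof -
      \<comment> \<open>A nonpositive power of a number below 1 is at least 1.\<close>
      have "1 \<le> leta u powr \<alpha>" for u
      proof -
        have "leta u powr 0 \<le> leta u powr \<alpha>"
          using powr_mono'[of \<alpha> 0 "leta u"] \<alpha> leta_pos[of u] leta_lt_1[of u] by simp
        then show ?thesis using leta_pos[of u] by simp
      qed
      then have "1 * (ly \<alpha> n m x)\<^sup>2 \<le> leta x powr \<alpha>"
        using that nm by (intro lz_head_bound[OF \<alpha>(1)]) auto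
      then show ?thesis using leta_pos[of x] by (simp add: ly_sq)
    qed
    show "((\<lambda>x. (lz \<alpha> n m x)\<^sup>2) \<longlongrightarrow> 1) at_bot" if "real m - real n = 0"
      using tendsto_power[OF lz_at_bot[OF \<alpha>(1), of n m], of 2] that by (simp add: power_mult[symmetric] mult.commute)
    show "((\<lambda>x. (lz' \<alpha> n m x)\<^sup>2 / lxi x) \<longlongrightarrow> 0) at_bot" if "real m - real n = 0"
      using lz'_diag_at_bot(1)[OF \<alpha>(1), of n] that by simp
  qed (use \<alpha> in auto)
qed

lemma lag_kernel_minus: 
  assumes "-1 < \<alpha>" shows "cmod (lag_kernel \<alpha> n m (- t)) = cmod (lag_kernel \<alpha> n m t)"
proof -
  interpret jacobi_kernel "lag_a \<alpha>" "\<lambda>n. 2 * real n + 1 + \<alpha>" "lag_kernel \<alpha>"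
    by (rule lag_kernel_jacobi[OF assms])
  show ?thesis using arg_cong[OF K_cnj[of n m t], of cmod] by simp
qed

text \<open>With \<open>r = sqrt (1 + t^2)\<close> the modulus is \<open>r^(-1-\<alpha>)\<close>
  times \<open>lz\<close>. For positive \<alpha> the part \<open>r^(-\<alpha>)\<close> is the weight
  inside \<open>ly\<close>, which leaves the decay \<open>1 / r\<close>; otherwise \<open>lz\<close>
  itself is bounded and the whole power remains. Both cases are the power
  \<open>- sigma \<alpha>\<close>, and \<open>r \<ge> |t|\<close>. The case \<open>m < n\<close>
  follows by symmetry and negative \<open>t\<close> by conjugation.\<close>

theorem lag_kernel_dispersive:
  assumes \<alpha>: "-1 < \<alpha>" and t: "t \<noteq> 0"
  shows "cmod (lag_kernel \<alpha> n m t) \<le> \<bar>t\<bar> powr (- sigma \<alpha>)"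
proof -
  have pos: "cmod (lag_kernel \<alpha> n m t) \<le> t powr (- sigma \<alpha>)" if nm: "n \<le> m" and t: "0 < t" for n m t
  proof -
    define x where "x = ln t"
    define r where "r = sqrt (1 + t\<^sup>2)"
    have tx: "t = exp x" using t by (simp add: x_def)
    have r: "0 < r" "t \<le> r" unfolding r_def by (auto simp: add_pos_nonneg intro: real_le_rsqrt)
    have "leta x = 1 / r\<^sup>2" by (simp add: leta_def r_def tx exp_double)
    then have le: "sqrt (leta x) = 1 / r" using r by (simp add: real_sqrt_divide)
    have K: "cmod (lag_kernel \<alpha> n m t) = r powr (- (1 + \<alpha>)) * \<bar>lz \<alpha> n m x\<bar>"
      unfolding norm_lag_kernel r_def[symmetric] lz_def le tx[symmetric] using r
      by (simp add: abs_mult power_one_over divide_inverse power_inverse)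
    have dec: "r powr (- p) \<le> t powr (- p)" if "0 \<le> p" for p
      using powr_mono2'[of "- p" t r] t r that by simp
    show ?thesis
    proof (cases "0 < \<alpha>")
      case False
      then have "(lz \<alpha> n m x)\<^sup>2 \<le> 1" using \<alpha> nm by (intro lz_bound) auto
      then have "\<bar>lz \<alpha> n m x\<bar> \<le> 1" by (simp add: abs_square_le_1)
      then have "cmod (lag_kernel \<alpha> n m t) \<le> r powr (- (1 + \<alpha>))"
        unfolding K by (simp add: mult_left_le)
      also have "\<dots> \<le> t powr (- (1 + \<alpha>))" by (rule dec) (use \<alpha> in simp)
      finally show ?thesis using False by (simp add: sigma_def)
    next
      case True
      then have "(ly \<alpha> n m x)\<^sup>2 \<le> 1" using nm by (intro ly_bound) auto
      then have 1: "\<bar>ly \<alpha> n m x\<bar> \<le> 1" by (simp add: abs_square_le_1)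
      have "leta x powr (\<alpha>/2) = r powr (- \<alpha>)"
      proof -
        have "leta x = r powr (- 2)" using r \<open>leta x = 1 / r\<^sup>2\<close> by (simp add: powr_minus_divide)
        then show ?thesis by (simp add: powr_powr)
      qed
      moreover have "r powr (- (1 + \<alpha>)) = r powr (- 1) * r powr (- \<alpha>)" unfolding powr_add[symmetric] by simp
      ultimately have "cmod (lag_kernel \<alpha> n m t) = r powr (- 1) * \<bar>ly \<alpha> n m x\<bar>"
        unfolding K ly_def by (simp only: abs_mult abs_of_nonneg[OF powr_ge_zero] mult.assoc)
      also have "\<dots> \<le> r powr (- 1)" 
        by (rule order_trans[OF mult_left_mono[OF 1 powr_ge_zero]]) simp
      also have "\<dots> \<le> t powr (- 1)" by (rule dec) simp
      finally show ?thesis using True by (simp add: sigma_def)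
    qed
  qed
  have sym: "cmod (lag_kernel \<alpha> n m t) \<le> t powr (- sigma \<alpha>)" if t: "0 < t" for t
  proof (cases "n \<le> m")
    case False
    then have "m \<le> n" by simp
    from pos[OF this t] show ?thesis
      by (simp add: lag_kernel_def lag_fun_sym[of _ n m] add.commute)
  qed (rule pos[OF _ t])
  show ?thesis
  proof (cases "0 < t")
    case False
    then have "0 < - t" using t by simp
    from sym[OF this] \<open>0 < - t\<close> show ?thesis by (simp add: lag_kernel_minus[OF \<alpha>])
  qed (use sym in simp)
qed

subsection \<open>Fractional integration in time\<close>

text \<open>A crude form of Young's inequality with unit constants: either \<open>b\<close> is at
  most \<open>a powr (Q - 1)\<close> and the first term suffices, or inverting the power bounds
  \<open>a\<close> and the second one does.\<close>

lemma mult_le_powr_sum: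
  fixes a b Q :: real
  assumes "1 < Q" "0 \<le> a" "0 \<le> b"
  shows "a * b \<le> a powr Q + b powr (Q / (Q - 1))"
proof (cases "b \<le> a powr (Q - 1)")
  case True
  have "a * b \<le> a powr 1 * a powr (Q - 1)" using True assms by (cases "a = 0") (auto intro: mult_left_mono)
  also have "\<dots> = a powr Q" unfolding powr_add[symmetric] by simp
  finally show ?thesis by (simp add: add_increasing2)
next
  case False
  then have b: "0 < b" "a powr (Q - 1) \<le> b" using assms powr_ge_zero[of a "Q - 1"] by linarith+
  have "(a powr (Q - 1)) powr (1 / (Q - 1)) \<le> b powr (1 / (Q - 1))"
    using assms b by (intro powr_mono2) auto
  then have "a \<le> b powr (1 / (Q - 1))" using assms by (simp add: powr_powr)
  then have "a * b \<le> b powr (1 / (Q - 1)) * b powr 1" using b by (intro mult_mono) auto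
  also have "\<dots> = b powr (Q / (Q - 1))"
    unfolding powr_add[symmetric] using assms by (intro arg_cong[where f = "\<lambda>c. b powr c"]) (simp add: field_simps)
  finally show ?thesis by (simp add: add_increasing)
qed

lemma nn_integral_abs_le:
  fixes f :: "real \<Rightarrow> ennreal"
  assumes [measurable]: "f \<in> borel_measurable borel"
  shows "(\<integral>\<^sup>+r. f \<bar>r\<bar> \<partial>lborel) \<le> 2 * (\<integral>\<^sup>+r. f r * indicator {0..} r \<partial>lborel)"
proof -
  have "(\<integral>\<^sup>+r. f \<bar>r\<bar> \<partial>lborel) \<le> (\<integral>\<^sup>+r. f r * indicator {0..} r + f (- r) * indicator {0..} (- r) \<partial>lborel)"
    by (intro nn_integral_mono) (auto simp: indicator_def abs_if)
  also have "\<dots> = (\<integral>\<^sup>+r. f r * indicator {0..} r \<partial>lborel) + (\<integral>\<^sup>+r. f (- r) * indicator {0..} (- r) \<partial>lborel)"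
    by (rule nn_integral_add) measurable
  also have "(\<integral>\<^sup>+r. f (- r) * indicator {0..} (- r) \<partial>lborel) = (\<integral>\<^sup>+r. f r * indicator {0..} r \<partial>lborel)"
    using nn_integral_real_affine[of "\<lambda>r. f r * indicator {0..} r" "- 1" 0] by simp
  finally show ?thesis by (simp add: mult_2)
qed

lemma nn_integral_powr_near:
  assumes "0 \<le> p" "p < 1" "0 \<le> R"
  shows "(\<integral>\<^sup>+r. ennreal (\<bar>r\<bar> powr (- p)) * indicator {r. \<bar>r\<bar> \<le> R} r \<partial>lborel) \<le> ennreal (2 * R powr (1 - p) / (1 - p))"
proof -
  have "(\<integral>\<^sup>+r. ennreal (\<bar>r\<bar> powr (- p)) * indicator {r. \<bar>r\<bar> \<le> R} r \<partial>lborel)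
      \<le> 2 * (\<integral>\<^sup>+r. (ennreal (r powr (- p)) * indicator {..R} r) * indicator {0..} r \<partial>lborel)"
    using nn_integral_abs_le[of "\<lambda>r. ennreal (r powr (- p)) * indicator {..R} r"] by (simp add: indicator_def)
  also have "(\<integral>\<^sup>+r. (ennreal (r powr (- p)) * indicator {..R} r) * indicator {0..} r \<partial>lborel)
      = (\<integral>\<^sup>+r. ennreal (r powr (- p)) * indicator {0..R} r \<partial>lborel)"
    by (intro nn_integral_cong) (auto simp: indicator_def)
  also have "\<dots> = ennreal (R powr (- p + 1) / (- p + 1))"
    by (rule nn_integral_has_integral_lebesgue'[OF _ has_integral_powr_from_0]) (use assms in auto)
  also have "2 * \<dots> = ennreal (2 * R powr (1 - p) / (1 - p))"
    using assms by (subst ennreal_numeral[symmetric], subst ennreal_mult[symmetric]) auto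
  finally show ?thesis .
qed

lemma nn_integral_powr_far:
  assumes "1 < p" "0 < R"
  shows "(\<integral>\<^sup>+r. ennreal (\<bar>r\<bar> powr (- p)) * indicator {r. R < \<bar>r\<bar>} r \<partial>lborel) \<le> ennreal (2 * R powr (1 - p) / (p - 1))"
proof -
  have "(\<integral>\<^sup>+r. ennreal (\<bar>r\<bar> powr (- p)) * indicator {r. R < \<bar>r\<bar>} r \<partial>lborel)
      \<le> 2 * (\<integral>\<^sup>+r. (ennreal (r powr (- p)) * indicator {R<..} r) * indicator {0..} r \<partial>lborel)"
    using nn_integral_abs_le[of "\<lambda>r. ennreal (r powr (- p)) * indicator {R<..} r"] by (simp add: indicator_def)
  also have "(\<integral>\<^sup>+r. (ennreal (r powr (- p)) * indicator {R<..} r) * indicator {0..} r \<partial>lborel)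
      \<le> (\<integral>\<^sup>+r. ennreal (r powr (- p)) * indicator {R..} r \<partial>lborel)"
    by (intro nn_integral_mono) (auto simp: indicator_def)
  also have "\<dots> = ennreal (- (R powr (- p + 1)) / (- p + 1))"
    by (rule nn_integral_has_integral_lebesgue'[OF _ has_integral_powr_to_inf]) (use assms in auto)
  also have "- (R powr (- p + 1)) / (- p + 1) = R powr (1 - p) / (p - 1)"
    using assms by (simp add: field_simps)
  also have "2 * ennreal (R powr (1 - p) / (p - 1)) = ennreal (2 * R powr (1 - p) / (p - 1))"
    using assms by (subst ennreal_numeral[symmetric], subst ennreal_mult[symmetric]) auto
  finally show ?thesis by (simp add: mult_left_mono)
qed

lemma nn_integral_translate:
  fixes f :: "real \<Rightarrow> ennreal"
  assumes [measurable]: "f \<in> borel_measurable borel"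
  shows "(\<integral>\<^sup>+t. f (t - s) \<partial>lborel) = (\<integral>\<^sup>+r. f r \<partial>lborel)"
  using nn_integral_real_affine[of f 1 "- s"] by simp

lemma nn_integral_translate':
  fixes f :: "real \<Rightarrow> ennreal"
  assumes [measurable]: "f \<in> borel_measurable borel"
  shows "(\<integral>\<^sup>+s. f (t - s) \<partial>lborel) = (\<integral>\<^sup>+r. f r \<partial>lborel)"
  using nn_integral_real_affine[of f "- 1" t] by simp

text \<open>The Riesz potential of order \<open>1 - 2/Q\<close>, valued in the extended half-line so
  that it exists for every measurable \<open>G\<close>. The value \<open>0 powr _ = 0\<close> at
  \<open>s = t\<close> concerns a null set.\<close>

definition frac_int :: "real \<Rightarrow> (real \<Rightarrow> real) \<Rightarrow> real \<Rightarrow> ennreal" where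
  "frac_int Q G t = (\<integral>\<^sup>+s. ennreal (\<bar>t - s\<bar> powr (- (2 / Q)) * G s) \<partial>lborel)"

lemma frac_int_measurable [measurable]:
  assumes [measurable]: "G \<in> borel_measurable borel"
  shows "frac_int Q G \<in> borel_measurable borel"
  unfolding frac_int_def[abs_def] by measurable

text \<open>Pointwise form of the Hardy-Littlewood-Sobolev estimate: at a point where the fractional integral equals
  \<open>v\<close>, the contributions of \<open>\<bar>t - s\<bar> > R\<close> and of \<open>G \<le> \<theta>\<close>, with \<open>R \<sim> v\<^bsup>-Q\<^esup>\<close> and \<open>\<theta> \<sim> v\<^bsup>Q-1\<^esup>\<close>, are at most \<open>v/2\<close>.
  On the remaining set \<open>v\<^bsup>Q-1\<^esup>\<close> is bounded by a multiple of \<open>min (G s) (\<bar>t - s\<bar>\<^bsup>-1/q\<^esup>)\<close>.\<close>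

lemma frac_int_pointwise:
  assumes Q: "2 < Q"
  shows "\<exists>c>0. \<forall>G t. G \<in> borel_measurable borel \<longrightarrow> (\<forall>s. 0 \<le> G s) \<longrightarrow> (\<integral>\<^sup>+s. ennreal (G s powr (Q / (Q - 1))) \<partial>lborel) \<le> 1 \<longrightarrow>
       frac_int Q G t < \<infinity> \<longrightarrow>
       ennreal (enn2real (frac_int Q G t) powr Q) \<le> ennreal c * (\<integral>\<^sup>+s. ennreal (\<bar>t - s\<bar> powr (- (2 / Q)) * G s
          * min (G s) (\<bar>t - s\<bar> powr (- ((Q - 1) / Q)))) \<partial>lborel)"
proof -
  define l where "l = 2 / Q"
  define q where "q = Q / (Q - 1)"
  have l: "0 < l" "l < 1" "l * Q = 2" using Q by (auto simp: l_def)
  have q: "1 < q" using Q by (simp add: q_def field_simps)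
  \<comment> \<open>\<open>K\<close> is chosen so that the kernel term of the far estimate equals
    \<open>v / 8\<close>, and \<open>d\<close> so that the low part is at most
    \<open>v / 4\<close>.\<close>
  define K where "K = 2 * 8 powr Q"
  define d where "d = (1 - l) / (8 * K powr (1 - l))"
  define c1 where "c1 = max (1 / d) (K powr ((Q - 1) / Q))"
  have K: "0 < K" by (simp add: K_def)
  have d: "0 < d" using l K by (simp add: d_def)
  have c1: "0 < c1" using d by (simp add: c1_def less_max_iff_disj)
  show ?thesis
  proof (intro exI[of _ "2 * c1"] conjI allI impI)
    fix G :: "real \<Rightarrow> real" and t :: real
    assume Gm [measurable]: "G \<in> borel_measurable borel" and G0': "\<forall>s. 0 \<le> G s"
      and A: "(\<integral>\<^sup>+s. ennreal (G s powr (Q / (Q - 1))) \<partial>lborel) \<le> 1" and fin: "frac_int Q G t < \<infinity>"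
    have G0: "0 \<le> G s" for s by (rule spec[OF G0'])
    define v where "v = enn2real (frac_int Q G t)"
    let ?I = "\<integral>\<^sup>+s. ennreal (\<bar>t - s\<bar> powr (- (2 / Q)) * G s * min (G s) (\<bar>t - s\<bar> powr (- ((Q - 1) / Q)))) \<partial>lborel"
    have v0: "0 \<le> v" by (simp add: v_def)
    have fv: "frac_int Q G t = ennreal v" using fin by (simp add: v_def)
    show "ennreal (v powr Q) \<le> ennreal (2 * c1) * ?I"
    proof (cases "v = 0")
      case True then show ?thesis using Q by simp
    next
      case False
      then have v: "0 < v" using v0 by simp
      define R where "R = K * v powr (- Q)"
      define \<theta> where "\<theta> = d * v powr (Q - 1)"
      \<comment> \<open>The free parameter in Young's inequality, fixed by
        \<open>e powr (- q) = v / 8\<close>; with total mass at most 1 the second term then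
        contributes at most \<open>v / 8\<close>.\<close>
      define e where "e = (8 / v) powr (1 / q)"
      have R: "0 < R" and \<theta>: "0 < \<theta>" and e: "0 < e" using v K d by (auto simp: R_def \<theta>_def e_def)
      let ?k = "\<lambda>s. \<bar>t - s\<bar> powr (- l)"
      have eq: "e powr (- q) = v / 8"
        using v q by (simp add: e_def powr_powr powr_minus_divide)
      have eQ: "e powr Q * (2 / R) = v / 8"
      proof -
        have "e powr Q = (8 / v) powr (Q / q)" by (simp add: e_def powr_powr)
        also have "Q / q = Q - 1" using Q by (simp add: q_def)
        finally have "e powr Q = (8 / v) powr (Q - 1)" .
        moreover have "R = 2 * (8 / v) powr Q" using v by (simp add: R_def K_def powr_divide powr_minus_divide)
        moreover have "(8 / v) powr Q = (8 / v) powr (Q - 1) * (8 / v)"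
          using v powr_add[of "8 / v" "Q - 1" 1] by simp
        moreover have "(8 / v) powr (Q - 1) \<noteq> 0" using v by simp
        ultimately show ?thesis using v by simp
      qed
      have far: "(\<integral>\<^sup>+s. ennreal (?k s * G s) * indicator {s. R < \<bar>t - s\<bar>} s \<partial>lborel) \<le> ennreal (v / 4)"
      proof -
        have "(\<integral>\<^sup>+s. ennreal (?k s * G s) * indicator {s. R < \<bar>t - s\<bar>} s \<partial>lborel)
            \<le> (\<integral>\<^sup>+s. ennreal (e powr Q) * (ennreal (\<bar>t - s\<bar> powr (- 2)) * indicator {r. R < \<bar>r\<bar>} (t - s))
                + ennreal (e powr (- q)) * ennreal (G s powr q) \<partial>lborel)"
        proof (intro nn_integral_mono)
          fix s
          have "?k s * G s = (e * ?k s) * (G s / e)" using e by simp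
          also have "\<dots> \<le> (e * ?k s) powr Q + (G s / e) powr q"
            unfolding q_def by (rule mult_le_powr_sum) (use Q e G0 in auto)
          also have "(e * ?k s) powr Q = e powr Q * \<bar>t - s\<bar> powr (- 2)"
            using e l(3) by (simp add: powr_mult powr_powr)
          also have "(G s / e) powr q = e powr (- q) * G s powr q"
            using e G0[of s] by (simp add: powr_divide powr_minus_divide)
          finally have *: "?k s * G s \<le> e powr Q * \<bar>t - s\<bar> powr (- 2) + e powr (- q) * G s powr q" .
          show "ennreal (?k s * G s) * indicator {s. R < \<bar>t - s\<bar>} s
              \<le> ennreal (e powr Q) * (ennreal (\<bar>t - s\<bar> powr (- 2)) * indicator {r. R < \<bar>r\<bar>} (t - s))
                + ennreal (e powr (- q)) * ennreal (G s powr q)"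
          proof (cases "R < \<bar>t - s\<bar>")
            case True
            then show ?thesis
              using ennreal_leI[OF *] by (simp add: ennreal_mult[symmetric] ennreal_plus[symmetric] del: ennreal_plus)
          qed simp
        qed
        also have "\<dots> = ennreal (e powr Q) * (\<integral>\<^sup>+s. ennreal (\<bar>t - s\<bar> powr (- 2)) * indicator {r. R < \<bar>r\<bar>} (t - s) \<partial>lborel)
            + ennreal (e powr (- q)) * (\<integral>\<^sup>+s. ennreal (G s powr q) \<partial>lborel)"
          by (subst nn_integral_add) (simp_all add: nn_integral_cmult)
        also have "(\<integral>\<^sup>+s. ennreal (\<bar>t - s\<bar> powr (- 2)) * indicator {r. R < \<bar>r\<bar>} (t - s) \<partial>lborel)
            = (\<integral>\<^sup>+r. ennreal (\<bar>r\<bar> powr (- 2)) * indicator {r. R < \<bar>r\<bar>} r \<partial>lborel)"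
          by (rule nn_integral_translate'[of "\<lambda>r. ennreal (\<bar>r\<bar> powr (- 2)) * indicator {r. R < \<bar>r\<bar>} r"]) measurable
        also have "ennreal (e powr Q) * \<dots> + ennreal (e powr (- q)) * (\<integral>\<^sup>+s. ennreal (G s powr q) \<partial>lborel)
            \<le> ennreal (e powr Q) * ennreal (2 * R powr (1 - 2) / (2 - 1)) + ennreal (e powr (- q)) * 1"
          using A by (intro add_mono mult_left_mono nn_integral_powr_far R) (auto simp: q_def)
        also have "\<dots> = ennreal (e powr Q * (2 / R) + e powr (- q))"
          using R by (simp add: ennreal_mult[symmetric] ennreal_plus[symmetric] powr_minus_divide del: ennreal_plus)
        also have "\<dots> = ennreal (v / 4)" unfolding eq eQ by simp
        finally show ?thesis .
      qed
      have low: "(\<integral>\<^sup>+s. ennreal (?k s * G s) * indicator {s. \<bar>t - s\<bar> \<le> R \<and> G s \<le> \<theta>} s \<partial>lborel) \<le> ennreal (v / 4)"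
      proof -
        have "(\<integral>\<^sup>+s. ennreal (?k s * G s) * indicator {s. \<bar>t - s\<bar> \<le> R \<and> G s \<le> \<theta>} s \<partial>lborel)
            \<le> (\<integral>\<^sup>+s. ennreal \<theta> * (ennreal (\<bar>t - s\<bar> powr (- l)) * indicator {r. \<bar>r\<bar> \<le> R} (t - s)) \<partial>lborel)"
        proof (intro nn_integral_mono)
          fix s
          show "ennreal (?k s * G s) * indicator {s. \<bar>t - s\<bar> \<le> R \<and> G s \<le> \<theta>} s
              \<le> ennreal \<theta> * (ennreal (\<bar>t - s\<bar> powr (- l)) * indicator {r. \<bar>r\<bar> \<le> R} (t - s))"
            using \<theta> by (auto simp: indicator_def ennreal_mult[symmetric] mult.commute intro!: ennreal_leI mult_right_mono)
        qed
        also have "\<dots> = ennreal \<theta> * (\<integral>\<^sup>+s. ennreal (\<bar>t - s\<bar> powr (- l)) * indicator {r. \<bar>r\<bar> \<le> R} (t - s) \<partial>lborel)"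
          by (rule nn_integral_cmult) measurable
        also have "(\<integral>\<^sup>+s. ennreal (\<bar>t - s\<bar> powr (- l)) * indicator {r. \<bar>r\<bar> \<le> R} (t - s) \<partial>lborel)
            = (\<integral>\<^sup>+r. ennreal (\<bar>r\<bar> powr (- l)) * indicator {r. \<bar>r\<bar> \<le> R} r \<partial>lborel)"
          by (rule nn_integral_translate'[of "\<lambda>r. ennreal (\<bar>r\<bar> powr (- l)) * indicator {r. \<bar>r\<bar> \<le> R} r"]) measurable
        also have "ennreal \<theta> * \<dots> \<le> ennreal \<theta> * ennreal (2 * R powr (1 - l) / (1 - l))"
          using l R by (intro mult_left_mono nn_integral_powr_near) auto
        also have "\<dots> = ennreal (v / 4)"
        proof -
          have "R powr (1 - l) = K powr (1 - l) * v powr (- (Q - 2))"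
            using K v l(3) by (simp add: R_def powr_mult powr_powr algebra_simps)
          have "e / (8 * k) * w * (2 * (k * x) / e) = w * x / 4" if "e \<noteq> 0" "k \<noteq> 0" for e k w x :: real
            using that by (simp add: field_simps)
          from this[of "1 - l" "K powr (1 - l)" "v powr (Q - 1)" "v powr (- (Q - 2))"]
          have "\<theta> * (2 * R powr (1 - l) / (1 - l)) = (v powr (Q - 1) * v powr (- (Q - 2))) / 4"
            unfolding \<theta>_def d_def \<open>R powr (1 - l) = _\<close> using l(2) K by fastforce
          also have "v powr (Q - 1) * v powr (- (Q - 2)) = v" unfolding powr_add[symmetric] using v by simp
          finally have "\<theta> * (2 * R powr (1 - l) / (1 - l)) = v / 4" .
          moreover have "ennreal \<theta> * ennreal (2 * R powr (1 - l) / (1 - l)) = ennreal (\<theta> * (2 * R powr (1 - l) / (1 - l)))"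
            using \<theta> l by (intro ennreal_mult[symmetric]) auto
          ultimately show ?thesis by (simp only:)
        qed
        finally show ?thesis .
      qed
      let ?S = "{s. \<bar>t - s\<bar> \<le> R \<and> \<theta> < G s}"
      let ?J = "\<integral>\<^sup>+s. ennreal (?k s * G s) * indicator ?S s \<partial>lborel"
      have "ennreal v = (\<integral>\<^sup>+s. ennreal (?k s * G s) \<partial>lborel)" by (simp add: fv[symmetric] frac_int_def l_def)
      also have "\<dots> = (\<integral>\<^sup>+s. (ennreal (?k s * G s) * indicator {s. R < \<bar>t - s\<bar>} s
          + ennreal (?k s * G s) * indicator {s. \<bar>t - s\<bar> \<le> R \<and> G s \<le> \<theta>} s) + ennreal (?k s * G s) * indicator ?S s \<partial>lborel)"
        by (intro nn_integral_cong) (auto simp: indicator_def)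
      also have "\<dots> = ((\<integral>\<^sup>+s. ennreal (?k s * G s) * indicator {s. R < \<bar>t - s\<bar>} s \<partial>lborel)
          + (\<integral>\<^sup>+s. ennreal (?k s * G s) * indicator {s. \<bar>t - s\<bar> \<le> R \<and> G s \<le> \<theta>} s \<partial>lborel)) + ?J"
        by (simp add: nn_integral_add)
      also have "\<dots> \<le> (ennreal (v / 4) + ennreal (v / 4)) + ?J" by (intro add_mono far low order_refl)
      finally have "ennreal v \<le> ennreal (v / 2) + ?J" using v by (simp add: ennreal_plus[symmetric] del: ennreal_plus)
      then have J: "ennreal (v / 2) \<le> ?J"
      proof (cases ?J)
        case (real j)
        with \<open>ennreal v \<le> ennreal (v / 2) + ?J\<close> have "v \<le> v / 2 + j"
          using v by (simp add: ennreal_plus[symmetric] del: ennreal_plus)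
        then show ?thesis using real by (auto intro: ennreal_leI)
      qed auto
      have vQ: "v powr Q = v * v powr (Q - 1)" using v powr_add[of v 1 "Q - 1"] by simp
      have "ennreal (v powr Q) = ennreal (2 * v powr (Q - 1)) * ennreal (v / 2)"
        unfolding vQ using v by (simp add: ennreal_mult[symmetric])
      also have "\<dots> \<le> ennreal (2 * v powr (Q - 1)) * ?J" by (intro mult_left_mono J) simp
      also have "\<dots> = (\<integral>\<^sup>+s. ennreal (2 * v powr (Q - 1)) * (ennreal (?k s * G s) * indicator ?S s) \<partial>lborel)"
        by (rule nn_integral_cmult[symmetric]) measurable
      also have "\<dots> \<le> (\<integral>\<^sup>+s. ennreal (2 * c1) * ennreal (\<bar>t - s\<bar> powr (- (2 / Q)) * G s * min (G s) (\<bar>t - s\<bar> powr (- ((Q - 1) / Q)))) \<partial>lborel)"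
      proof (intro nn_integral_mono)
        fix s
        show "ennreal (2 * v powr (Q - 1)) * (ennreal (?k s * G s) * indicator ?S s)
            \<le> ennreal (2 * c1) * ennreal (\<bar>t - s\<bar> powr (- (2 / Q)) * G s * min (G s) (\<bar>t - s\<bar> powr (- ((Q - 1) / Q))))"
        proof (cases "s \<in> ?S \<and> s \<noteq> t")
          case False
          then show ?thesis by (auto simp: indicator_def)
        next
          case True
          then have s: "\<bar>t - s\<bar> \<le> R" "\<theta> < G s" "0 < \<bar>t - s\<bar>" by auto
          \<comment> \<open>On the remaining set the condition on \<open>G\<close> gives one half of
            the minimum, and the condition on the distance, raised to the power
            \<open>(Q - 1) / Q\<close>, gives the other.\<close>
          have "v powr (Q - 1) \<le> (1 / d) * G s" using s(2) d by (simp add: \<theta>_def field_simps)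
          also have "\<dots> \<le> c1 * G s" using G0[of s] by (intro mult_right_mono) (simp_all add: c1_def)
          finally have 1: "v powr (Q - 1) \<le> c1 * G s" .
          have "v powr Q \<le> K / \<bar>t - s\<bar>" using s(1,3) v by (simp add: R_def powr_minus_divide field_simps)
          then have "(v powr Q) powr ((Q - 1) / Q) \<le> (K / \<bar>t - s\<bar>) powr ((Q - 1) / Q)" using Q by (intro powr_mono2) auto
          then have "v powr (Q - 1) \<le> K powr ((Q - 1) / Q) * \<bar>t - s\<bar> powr (- ((Q - 1) / Q))"
            using Q K by (simp add: powr_powr powr_divide powr_minus_divide)
          also have "\<dots> \<le> c1 * \<bar>t - s\<bar> powr (- ((Q - 1) / Q))" by (intro mult_right_mono) (simp_all add: c1_def)
          finally have "v powr (Q - 1) \<le> c1 * min (G s) (\<bar>t - s\<bar> powr (- ((Q - 1) / Q)))" using 1 by (simp add: min_def)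
          then have "2 * v powr (Q - 1) * (?k s * G s) \<le> 2 * (c1 * min (G s) (\<bar>t - s\<bar> powr (- ((Q - 1) / Q)))) * (?k s * G s)"
            using G0[of s] by (intro mult_right_mono mult_left_mono) auto
          then have "ennreal (2 * v powr (Q - 1) * (?k s * G s))
              \<le> ennreal ((2 * c1) * (\<bar>t - s\<bar> powr (- (2 / Q)) * G s * min (G s) (\<bar>t - s\<bar> powr (- ((Q - 1) / Q)))))"
            by (intro ennreal_leI) (simp add: l_def mult_ac)
          then show ?thesis using True G0[of s] c1 by (simp add: ennreal_mult)
        qed
      qed
      also have "\<dots> = ennreal (2 * c1) * ?I" by (rule nn_integral_cmult) measurable
      finally show ?thesis .
    qed
  qed (use c1 in simp)
qed

text \<open>The two entries of the minimum cross at \<open>r0\<close>. Below it the kernel exponent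
  is under 1, above it the combined exponent \<open>1 + 1/Q\<close> exceeds 1, so both pieces
  converge, and they scale alike in \<open>g\<close>.\<close>

lemma nn_integral_min_powr:
  assumes Q: "2 < Q" and g: "0 < g"
  shows "(\<integral>\<^sup>+r. ennreal (\<bar>r\<bar> powr (- (2 / Q)) * min g (\<bar>r\<bar> powr (- ((Q - 1) / Q)))) \<partial>lborel)
    \<le> ennreal ((2 * Q / (Q - 2) + 2 * Q) * g powr (1 / (Q - 1)))"
proof -
  define r0 where "r0 = g powr (- (Q / (Q - 1)))"
  have r0: "0 < r0" using g by (simp add: r0_def)
  define p where "p = 2 / Q + (Q - 1) / Q"
  have p: "p = 1 + 1 / Q" using Q by (simp add: p_def field_simps)
  have "(\<integral>\<^sup>+r. ennreal (\<bar>r\<bar> powr (- (2 / Q)) * min g (\<bar>r\<bar> powr (- ((Q - 1) / Q)))) \<partial>lborel)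
      \<le> (\<integral>\<^sup>+r. ennreal g * (ennreal (\<bar>r\<bar> powr (- (2 / Q))) * indicator {r. \<bar>r\<bar> \<le> r0} r)
          + ennreal (\<bar>r\<bar> powr (- p)) * indicator {r. r0 < \<bar>r\<bar>} r \<partial>lborel)"
  proof (intro nn_integral_mono)
    fix r :: real
    show "ennreal (\<bar>r\<bar> powr (- (2 / Q)) * min g (\<bar>r\<bar> powr (- ((Q - 1) / Q))))
        \<le> ennreal g * (ennreal (\<bar>r\<bar> powr (- (2 / Q))) * indicator {r. \<bar>r\<bar> \<le> r0} r)
          + ennreal (\<bar>r\<bar> powr (- p)) * indicator {r. r0 < \<bar>r\<bar>} r"
    proof (cases "\<bar>r\<bar> \<le> r0")
      case True
      then show ?thesis
        using g by (simp add: ennreal_mult[symmetric] mult.commute[of g] mult_left_mono)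
    next
      case False
      have "\<bar>r\<bar> powr (- (2 / Q)) * min g (\<bar>r\<bar> powr (- ((Q - 1) / Q))) \<le> \<bar>r\<bar> powr (- (2 / Q)) * \<bar>r\<bar> powr (- ((Q - 1) / Q))"
        by (intro mult_left_mono) auto
      also have "\<dots> = \<bar>r\<bar> powr (- p)" unfolding powr_add[symmetric] by (simp add: p_def)
      finally show ?thesis using False by (simp add: ennreal_leI)
    qed
  qed
  also have "\<dots> = ennreal g * (\<integral>\<^sup>+r. ennreal (\<bar>r\<bar> powr (- (2 / Q))) * indicator {r. \<bar>r\<bar> \<le> r0} r \<partial>lborel)
      + (\<integral>\<^sup>+r. ennreal (\<bar>r\<bar> powr (- p)) * indicator {r. r0 < \<bar>r\<bar>} r \<partial>lborel)"
    by (simp add: nn_integral_add nn_integral_cmult)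
  also have "\<dots> \<le> ennreal g * ennreal (2 * r0 powr (1 - 2 / Q) / (1 - 2 / Q)) + ennreal (2 * r0 powr (1 - p) / (p - 1))"
    using Q r0 p by (intro add_mono mult_left_mono nn_integral_powr_near nn_integral_powr_far) auto
  also have "\<dots> = ennreal (g * (2 * r0 powr (1 - 2 / Q) / (1 - 2 / Q)) + 2 * r0 powr (1 - p) / (p - 1))"
    using g Q p by (simp add: ennreal_mult[symmetric] ennreal_plus[symmetric] del: ennreal_plus)
  also have "g * (2 * r0 powr (1 - 2 / Q) / (1 - 2 / Q)) + 2 * r0 powr (1 - p) / (p - 1)
      = (2 * Q / (Q - 2) + 2 * Q) * g powr (1 / (Q - 1))"
  proof -
    have "r0 powr (1 - 2 / Q) = g powr (- ((Q - 2) / (Q - 1)))"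
      unfolding r0_def powr_powr using Q by (intro arg_cong[where f = "\<lambda>c. g powr c"]) (simp add: field_simps)
    moreover have "g * g powr (- ((Q - 2) / (Q - 1))) = g powr (1 / (Q - 1))"
    proof -
      have "g * g powr (- ((Q - 2) / (Q - 1))) = g powr (1 + - ((Q - 2) / (Q - 1)))" unfolding powr_add using g by simp
      also have "1 + - ((Q - 2) / (Q - 1)) = 1 / (Q - 1)" using Q by (simp add: field_simps)
      finally show ?thesis .
    qed
    ultimately have 1: "g * (2 * r0 powr (1 - 2 / Q) / (1 - 2 / Q)) = 2 / (1 - 2 / Q) * g powr (1 / (Q - 1))" by simp
    have "r0 powr (1 - p) = g powr (1 / (Q - 1))"
      unfolding r0_def powr_powr p using Q by (intro arg_cong[where f = "\<lambda>c. g powr c"]) (simp add: field_simps)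
    then have 2: "2 * r0 powr (1 - p) / (p - 1) = 2 * Q * g powr (1 / (Q - 1))" by (simp add: p)
    have "2 / (1 - 2 / Q) = 2 * Q / (Q - 2)" using Q by (simp add: field_simps)
    then show ?thesis unfolding 1 2 by (simp add: distrib_right)
  qed
  finally show ?thesis .
qed

text \<open>Integrating the pointwise bound in \<open>t\<close> and exchanging integrals leaves, for
  each \<open>s\<close>, \<open>G s\<close> times an integral of order
  \<open>G s powr (1 / (Q - 1))\<close>. The product is the conjugate power, whose total is at most
  1.\<close>

lemma hls_normalized:
  assumes Q: "2 < Q"
  shows "\<exists>c>0. \<forall>G. G \<in> borel_measurable borel \<longrightarrow> (\<forall>s. 0 \<le> G s) \<longrightarrow> (\<integral>\<^sup>+s. ennreal (G s powr (Q / (Q - 1))) \<partial>lborel) \<le> 1 \<longrightarrow>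
       (\<forall>t. frac_int Q G t < \<infinity>) \<longrightarrow> (\<integral>\<^sup>+t. ennreal (enn2real (frac_int Q G t) powr Q) \<partial>lborel) \<le> ennreal c"
proof -
  obtain c where c: "0 < c" and pt: "\<forall>G t. G \<in> borel_measurable borel \<longrightarrow> (\<forall>s. 0 \<le> G s) \<longrightarrow>
       (\<integral>\<^sup>+s. ennreal (G s powr (Q / (Q - 1))) \<partial>lborel) \<le> 1 \<longrightarrow> frac_int Q G t < \<infinity> \<longrightarrow>
       ennreal (enn2real (frac_int Q G t) powr Q) \<le> ennreal c * (\<integral>\<^sup>+s. ennreal (\<bar>t - s\<bar> powr (- (2 / Q)) * G s
          * min (G s) (\<bar>t - s\<bar> powr (- ((Q - 1) / Q)))) \<partial>lborel)"
    using frac_int_pointwise[OF Q] by (elim exE conjE)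
  define B where "B = 2 * Q / (Q - 2) + 2 * Q"
  have B: "0 < B" using Q by (simp add: B_def add_pos_pos)
  show ?thesis
  proof (intro exI[of _ "c * B"] conjI allI impI)
    fix G :: "real \<Rightarrow> real"
    assume Gm [measurable]: "G \<in> borel_measurable borel" and G0: "\<forall>s. 0 \<le> G s"
      and A: "(\<integral>\<^sup>+s. ennreal (G s powr (Q / (Q - 1))) \<partial>lborel) \<le> 1" and fin: "\<forall>t. frac_int Q G t < \<infinity>"
    let ?h = "\<lambda>g r. \<bar>r\<bar> powr (- (2 / Q)) * min g (\<bar>r\<bar> powr (- ((Q - 1) / Q)))"
    have "(\<integral>\<^sup>+t. ennreal (enn2real (frac_int Q G t) powr Q) \<partial>lborel)
        \<le> (\<integral>\<^sup>+t. ennreal c * (\<integral>\<^sup>+s. ennreal (G s) * ennreal (?h (G s) (t - s)) \<partial>lborel) \<partial>lborel)"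
    proof (intro nn_integral_mono)
      fix t
      have "(\<integral>\<^sup>+s. ennreal (\<bar>t - s\<bar> powr (- (2 / Q)) * G s * min (G s) (\<bar>t - s\<bar> powr (- ((Q - 1) / Q)))) \<partial>lborel)
          = (\<integral>\<^sup>+s. ennreal (G s) * ennreal (?h (G s) (t - s)) \<partial>lborel)"
        using G0 by (intro nn_integral_cong) (simp add: ennreal_mult[symmetric] mult_ac)
      with pt[rule_format, OF Gm spec[OF G0] A spec[OF fin], of t]
      show "ennreal (enn2real (frac_int Q G t) powr Q) \<le> ennreal c * (\<integral>\<^sup>+s. ennreal (G s) * ennreal (?h (G s) (t - s)) \<partial>lborel)"
        by simp
    qed
    also have "\<dots> = ennreal c * (\<integral>\<^sup>+t. (\<integral>\<^sup>+s. ennreal (G s) * ennreal (?h (G s) (t - s)) \<partial>lborel) \<partial>lborel)"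
      by (rule nn_integral_cmult) measurable
    also have "(\<integral>\<^sup>+t. (\<integral>\<^sup>+s. ennreal (G s) * ennreal (?h (G s) (t - s)) \<partial>lborel) \<partial>lborel)
        = (\<integral>\<^sup>+s. (\<integral>\<^sup>+t. ennreal (G s) * ennreal (?h (G s) (t - s)) \<partial>lborel) \<partial>lborel)"
      by (rule lborel_pair.Fubini') measurable
    also have "\<dots> \<le> (\<integral>\<^sup>+s. ennreal B * ennreal (G s powr (Q / (Q - 1))) \<partial>lborel)"
    proof (intro nn_integral_mono)
      fix s
      have "(\<integral>\<^sup>+t. ennreal (G s) * ennreal (?h (G s) (t - s)) \<partial>lborel) = ennreal (G s) * (\<integral>\<^sup>+t. ennreal (?h (G s) (t - s)) \<partial>lborel)"
        by (rule nn_integral_cmult) measurable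
      also have "(\<integral>\<^sup>+t. ennreal (?h (G s) (t - s)) \<partial>lborel) = (\<integral>\<^sup>+r. ennreal (?h (G s) r) \<partial>lborel)"
        by (rule nn_integral_translate[of "\<lambda>r. ennreal (?h (G s) r)"]) measurable
      also have "ennreal (G s) * \<dots> \<le> ennreal B * ennreal (G s powr (Q / (Q - 1)))"
      proof (cases "G s = 0")
        case False
        then have g: "0 < G s" using spec[OF G0, of s] by simp
        have "ennreal (G s) * (\<integral>\<^sup>+r. ennreal (?h (G s) r) \<partial>lborel) \<le> ennreal (G s) * ennreal (B * G s powr (1 / (Q - 1)))"
          unfolding B_def by (intro mult_left_mono nn_integral_min_powr Q g) simp
        also have "\<dots> = ennreal (B * (G s powr 1 * G s powr (1 / (Q - 1))))"
          using g B by (simp add: ennreal_mult[symmetric] mult_ac)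
        also have "G s powr 1 * G s powr (1 / (Q - 1)) = G s powr (Q / (Q - 1))"
          unfolding powr_add[symmetric] using Q by (intro arg_cong[where f = "\<lambda>c. G s powr c"]) (simp add: field_simps)
        finally show ?thesis using B by (simp add: ennreal_mult)
      qed simp
      finally show "(\<integral>\<^sup>+t. ennreal (G s) * ennreal (?h (G s) (t - s)) \<partial>lborel) \<le> ennreal B * ennreal (G s powr (Q / (Q - 1)))" .
    qed
    also have "\<dots> = ennreal B * (\<integral>\<^sup>+s. ennreal (G s powr (Q / (Q - 1))) \<partial>lborel)"
      by (rule nn_integral_cmult) measurable
    also have "ennreal c * (ennreal B * (\<integral>\<^sup>+s. ennreal (G s powr (Q / (Q - 1))) \<partial>lborel)) \<le> ennreal c * (ennreal B * 1)"
      by (intro mult_left_mono A) auto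
    finally show "(\<integral>\<^sup>+t. ennreal (enn2real (frac_int Q G t) powr Q) \<partial>lborel) \<le> ennreal (c * B)"
      using c B by (simp add: ennreal_mult mult_left_mono)
  qed (use c B in simp)
qed

subsection \<open>Decay between conjugate exponents\<close>

definition pmass :: "real \<Rightarrow> ell2 \<Rightarrow> real" where
  "pmass Q x = (\<Sum>n. cmod (coord x n) powr Q)"

lemma powr_coord_le:
  assumes "2 \<le> Q" shows "cmod (coord x n) powr Q \<le> norm x powr (Q - 2) * (cmod (coord x n))\<^sup>2"
proof -
  have "cmod (coord x n) powr Q = cmod (coord x n) powr (Q - 2) * (cmod (coord x n))\<^sup>2"
  proof (cases "coord x n = 0")
    case False
    then show ?thesis using powr_add[of "cmod (coord x n)" "Q - 2" 2] by simp
  qed simp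
  also have "\<dots> \<le> norm x powr (Q - 2) * (cmod (coord x n))\<^sup>2"
    using assms by (intro mult_right_mono powr_mono2 norm_coord_le) auto
  finally show ?thesis .
qed

lemma summable_pmass:
  assumes "2 \<le> Q" shows "summable (\<lambda>n. cmod (coord x n) powr Q)"
  by (rule summable_comparison_test'[OF summable_mult[OF summable_coord_sq, of "norm x powr (Q - 2)" x]])
     (use powr_coord_le[OF assms] in simp)

lemma pmass_nonneg [simp]: "2 \<le> Q \<Longrightarrow> 0 \<le> pmass Q x"
  unfolding pmass_def by (intro suminf_nonneg summable_pmass) auto

lemma pmass_le:
  assumes "2 \<le> Q" shows "pmass Q x \<le> norm x powr Q"
proof -
  have "pmass Q x \<le> (\<Sum>n. norm x powr (Q - 2) * (cmod (coord x n))\<^sup>2)"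
    unfolding pmass_def
    by (intro suminf_le powr_coord_le summable_pmass assms summable_mult summable_coord_sq)
  also have "\<dots> = norm x powr (Q - 2) * (norm x)\<^sup>2"
    unfolding norm_ell2_sq by (rule suminf_mult[OF summable_coord_sq])
  also have "\<dots> = norm x powr Q"
  proof (cases "x = 0")
    case False
    then show ?thesis using powr_add[of "norm x" "Q - 2" 2] by simp
  qed simp
  finally show ?thesis .
qed

lemma sum_powr_le_pmass:
  assumes "2 \<le> Q" "finite S" shows "(\<Sum>n\<in>S. cmod (coord x n) powr Q) \<le> pmass Q x"
  unfolding pmass_def by (rule sum_le_suminf[OF summable_pmass]) (use assms in auto)

lemma pmass_eq_0:
  assumes "2 \<le> Q" "pmass Q x = 0" shows "x = 0"
proof (rule ell2_eqI)
  fix n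
  have "cmod (coord x n) powr Q \<le> 0"
    using sum_powr_le_pmass[of Q "{n}" x] assms by simp
  then show "coord x n = coord 0 n" by (simp add: coord_simps)
qed

lemma pmass_leI:
  assumes "2 \<le> Q" "\<And>L. (\<Sum>n<L. cmod (coord x n) powr Q) \<le> B" shows "pmass Q x \<le> B"
  unfolding pmass_def by (rule suminf_le_const[OF summable_pmass[OF assms(1)] assms(2)])

lemma pmass_trunc:
  assumes "0 < Q" shows "pmass Q (trunc L x) = (\<Sum>n<L. cmod (coord x n) powr Q)"
proof -
  have "pmass Q (trunc L x) = (\<Sum>n. if n \<in> {..<L} then cmod (coord x n) powr Q else 0)"
    unfolding pmass_def using assms by (intro suminf_cong) (auto simp: coord_trunc)
  also have "\<dots> = (\<Sum>n<L. cmod (coord x n) powr Q)"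
    by (rule sums_unique[symmetric, OF sums_If_finite_set]) simp
  finally show ?thesis .
qed

lemma coord_measurable [measurable]: "(\<lambda>x. coord x n) \<in> borel_measurable borel"
  by (intro borel_measurable_continuous_onI linear_continuous_on bounded_linear_coord)

lemma pmass_measurable [measurable]: "pmass Q \<in> borel_measurable borel"
  unfolding pmass_def[abs_def] by measurable

lemma coord_nl:
  "2 \<le> Q \<Longrightarrow> coord (power_nl (Q - 1) x) n = complex_of_real (cmod (coord x n) powr (Q - 2)) * coord x n"
  by (simp add: coord_power_nl)

lemma norm_coord_nl:
  assumes "2 \<le> Q" shows "cmod (coord (power_nl (Q - 1) x) n) = cmod (coord x n) powr (Q - 1)"
proof (cases "coord x n = 0")
  case False
  then show ?thesis using powr_add[of "cmod (coord x n)" "Q - 2" 1] assms by (simp add: coord_nl norm_mult)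
qed (use assms in \<open>simp add: coord_nl\<close>)

text \<open>\<open>power_nl\<close> of a truncation is the extremal functional for the
  \<open>Q\<close>-norm. This is what lets every Strichartz bound be obtained by duality, with
  finitely many coordinates at a time.\<close>

lemma inner_nl_trunc:
  assumes "2 \<le> Q" shows "inner (power_nl (Q - 1) (trunc L x)) x = pmass Q (trunc L x)"
proof -
  have "inner (coord (power_nl (Q - 1) (trunc L x)) n) (coord x n) = cmod (coord (trunc L x) n) powr Q" for n
  proof (cases "coord x n = 0 \<or> L \<le> n")
    case False
    then show ?thesis
      using powr_add[of "cmod (coord x n)" "Q - 2" 2] assms
      by (simp add: coord_nl coord_trunc scaleR_conv_of_real[symmetric] power2_norm_eq_inner[symmetric])
  qed (use assms in \<open>auto simp: coord_nl coord_trunc\<close>)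
  then show ?thesis by (simp add: inner_ell2_def pmass_def)
qed

lemma nl_zero: "2 \<le> Q \<Longrightarrow> power_nl (Q - 1) 0 = 0"
  by (rule ell2_eqI) (simp add: coord_nl coord_simps)

text \<open>Functions in the conjugate space \<open>\<ell>\<^sup>q\<close>, \<open>q = Q/(Q-1)\<close>, are always written as \<open>power_nl (Q - 1) x\<close>: their \<open>q\<close>-th power
  mass is \<open>pmass Q x\<close>, and no summability assumption is needed.\<close>

lemma abs_inner_nl_le:
  assumes Q: "2 \<le> Q"
  shows "\<bar>inner (power_nl (Q - 1) x) y\<bar> \<le> 2 * pmass Q x powr ((Q - 1) / Q) * pmass Q y powr (1 / Q)"
proof (cases "pmass Q x = 0 \<or> pmass Q y = 0")
  case True
  then have "x = 0 \<or> y = 0" using pmass_eq_0[OF Q] by blast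
  then have "inner (power_nl (Q - 1) x) y = 0" using nl_zero[OF Q] by auto
  then show ?thesis using Q by simp
next
  case False
  then have X: "0 < pmass Q x" and Y: "0 < pmass Q y"
    using Q by (simp_all add: less_le)
  define a b where "a = pmass Q x powr ((Q - 1) / Q)" and "b = pmass Q y powr (1 / Q)"
  have a: "0 < a" and b: "0 < b" using X Y by (auto simp: a_def b_def)
  have aq: "a powr (Q / (Q - 1)) = pmass Q x" and bQ: "b powr Q = pmass Q y"
    using X Y Q by (auto simp: a_def b_def powr_powr)
  have le: "\<bar>inner (coord (power_nl (Q - 1) x) n) (coord y n)\<bar>
      \<le> a * b * (cmod (coord y n) powr Q / pmass Q y + cmod (coord x n) powr Q / pmass Q x)" (is "_ \<le> ?r n") for n
  proof -
    have "\<bar>inner (coord (power_nl (Q - 1) x) n) (coord y n)\<bar> \<le> cmod (coord x n) powr (Q - 1) * cmod (coord y n)"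
      using Cauchy_Schwarz_ineq2[of "coord (power_nl (Q - 1) x) n" "coord y n"] Q by (simp add: norm_coord_nl)
    also have "\<dots> = a * b * ((cmod (coord y n) / b) * (cmod (coord x n) powr (Q - 1) / a))"
      using a b by simp
    \<comment> \<open>Both factors are divided by their norms, so each of the two Young terms sums
      to 1; this is the origin of the factor 2.\<close>
    also have "\<dots> \<le> a * b * ((cmod (coord y n) / b) powr Q + (cmod (coord x n) powr (Q - 1) / a) powr (Q / (Q - 1)))"
      using a b Q by (intro mult_left_mono mult_le_powr_sum) auto
    also have "(cmod (coord y n) / b) powr Q = cmod (coord y n) powr Q / pmass Q y"
      using b by (simp add: powr_divide bQ)
    also have "(cmod (coord x n) powr (Q - 1) / a) powr (Q / (Q - 1)) = cmod (coord x n) powr Q / pmass Q x"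
      using a Q by (simp add: powr_divide aq powr_powr)
    finally show ?thesis .
  qed
  have s: "?r sums (a * b * (pmass Q y / pmass Q y + pmass Q x / pmass Q x))"
    by (intro sums_mult sums_add sums_divide) (simp_all add: pmass_def summable_sums summable_pmass[OF Q])
  have sm: "summable (\<lambda>n. \<bar>inner (coord (power_nl (Q - 1) x) n) (coord y n)\<bar>)"
    by (rule summable_comparison_test'[OF sums_summable[OF s]]) (use le in simp)
  have "\<bar>inner (power_nl (Q - 1) x) y\<bar> \<le> (\<Sum>n. \<bar>inner (coord (power_nl (Q - 1) x) n) (coord y n)\<bar>)"
    unfolding inner_ell2_def by (rule summable_rabs[OF sm])
  also have "\<dots> \<le> (\<Sum>n. ?r n)" by (rule suminf_le[OF le sm sums_summable[OF s]])
  also have "\<dots> = a * b * 2" unfolding sums_unique[OF s, symmetric] using X Y by simp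
  finally show ?thesis by (simp add: a_def b_def mult_ac)
qed

definition restr :: "nat set \<Rightarrow> ell2 \<Rightarrow> ell2" where
  "restr S x = Abs_ell2 (\<lambda>n. if n \<in> S then coord x n else 0)"

lemma coord_restr: "coord (restr S x) n = (if n \<in> S then coord x n else 0)"
proof -
  have "l2_seq (\<lambda>n. if n \<in> S then coord x n else 0)"
    unfolding l2_seq_def by (rule summable_comparison_test'[OF summable_coord_sq[of x]]) auto
  then show ?thesis by (simp add: restr_def coord_Abs_ell2)
qed

lemma norm_coord_contraction_restr:
  assumes V: "clinear_contraction V" and M: "\<And>m n. cmod (coord (V (basis m)) n) \<le> M" and S: "finite S"
  shows "cmod (coord (V (restr S g)) n) \<le> M * (\<Sum>m\<in>S. cmod (coord g m))"
proof -
  obtain N where N: "S \<subseteq> {..<N}" using finite_nat_bounded[OF S] by blast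
  have "restr S g = trunc N (restr S g)" using N by (intro ell2_eqI) (auto simp: coord_restr coord_trunc)
  then have "coord (V (restr S g)) n = (\<Sum>m<N. coord (restr S g) m * coord (V (basis m)) n)"
    using clinear_contraction_trunc[OF V, of N "restr S g"] by (simp add: coord_sum coord_simps)
  also have "cmod \<dots> \<le> (\<Sum>m<N. cmod (coord (restr S g) m) * M)"
    by (intro sum_norm_le) (simp add: norm_mult mult_left_mono M)
  also have "\<dots> = (\<Sum>m\<in>S. cmod (coord g m) * M)"
    using N by (intro sum.mono_neutral_cong_right) (auto simp: coord_restr)
  finally show ?thesis unfolding sum_distrib_right[symmetric] by (simp only: mult.commute)
qed

text \<open>At level \<open>l\<close> the input is split where \<open>\<bar>z\<^sub>m\<bar> = M A / l\<close>, with \<open>A = pmass Q z\<close>. The image of the large part is at most \<open>l\<close> by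
  the kernel bound, so the contraction property applied to the small part controls the level set at \<open>2 l\<close>.\<close>

lemma pmass_contraction:
  assumes Q: "2 < Q" and V: "clinear_contraction V" and M: "\<And>m n. cmod (coord (V (basis m)) n) \<le> M" and M0: "0 < M"
  shows "pmass Q (V (power_nl (Q - 1) z)) \<le> 2 powr Q * (Q / (Q - 2)) * M powr (Q - 2) * pmass Q z powr (Q - 1)"
proof (cases "pmass Q z = 0")
  case True
  have "z = 0" using pmass_eq_0[OF _ True] Q by simp
  moreover have "V 0 = 0" using linear_0[OF bounded_linear.linear[OF bounded_linear_contraction[OF V]]] .
  ultimately show ?thesis using Q nl_zero[of Q] by (simp add: pmass_def coord_simps)
next
  case False
  have Q2: "2 \<le> Q" using Q by simp
  define A where "A = pmass Q z"
  have A: "0 < A" using False pmass_nonneg[OF Q2, of z] by (simp add: A_def)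
  define g where "g = power_nl (Q - 1) z"
  have g: "cmod (coord g n) = cmod (coord z n) powr (Q - 1)" for n unfolding g_def by (rule norm_coord_nl[OF Q2])
  define v where "v n = cmod (coord (V g) n)" for n
  \<comment> \<open>The highest level at which coordinate \<open>m\<close> still belongs to the
    small part. For a vanishing coordinate the quotient is 0 by convention, and the corresponding
    coordinate of \<open>g\<close> vanishes too.\<close>
  define lm where "lm m = M * A / cmod (coord z m)" for m
  have level: "(\<Sum>n<L. l\<^sup>2 * indicator {..v n / 2} l) \<le> (\<Sum>m. (cmod (coord g m))\<^sup>2 * indicator {m. cmod (coord z m) \<le> M * A / l} m)"
    and level_sm: "summable (\<lambda>m. (cmod (coord g m))\<^sup>2 * indicator {m. cmod (coord z m) \<le> M * A / l} m)"
    if l: "0 < l" for l :: real and L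
  proof -
    define h where "h = M * A / l"
    have h: "0 < h" using M0 A l by (simp add: h_def)
    \<comment> \<open>The coordinates tend to zero, so only finitely many exceed the positive
      threshold \<open>h\<close>, and the kernel bound applies to them.\<close>
    define S where "S = {m. h < cmod (coord z m)}"
    have "(\<lambda>n. (cmod (coord z n))\<^sup>2) \<longlonglongrightarrow> 0" by (rule summable_LIMSEQ_zero[OF summable_coord_sq])
    then have "\<forall>\<^sub>F n in sequentially. (cmod (coord z n))\<^sup>2 < h\<^sup>2" by (rule order_tendstoD(2)) (use h in simp)
    then obtain N where N: "\<And>n. N \<le> n \<Longrightarrow> (cmod (coord z n))\<^sup>2 < h\<^sup>2" unfolding eventually_sequentially by blast
    have "m < N" if "m \<in> S" for m
    proof (rule ccontr)
      assume "\<not> m < N"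
      then have "(cmod (coord z m))\<^sup>2 < h\<^sup>2" by (intro N) simp
      then have "cmod (coord z m) < h" using h by (simp add: power2_less_imp_less)
      with that show False by (simp add: S_def)
    qed
    then have S: "finite S" by (intro finite_subset[of S "{..<N}"]) auto
    \<comment> \<open>On the large part one factor \<open>h\<close> is traded for a coordinate,
      which bounds the sum of the \<open>cmod (coord g m)\<close> by \<open>A / h\<close>; the
      threshold is chosen so that \<open>M A / h\<close> is the level \<open>l\<close>.\<close>
    have "M * (\<Sum>m\<in>S. cmod (coord g m)) \<le> M * (\<Sum>m\<in>S. (1 / h) * cmod (coord z m) powr Q)"
    proof (intro mult_left_mono sum_mono)
      fix m assume "m \<in> S"
      then have m: "h < cmod (coord z m)" by (simp add: S_def)
      then have "cmod (coord z m) powr Q = cmod (coord z m) * cmod (coord z m) powr (Q - 1)"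
        using h powr_add[of "cmod (coord z m)" 1 "Q - 1"] by simp
      moreover have "h * cmod (coord z m) powr (Q - 1) \<le> cmod (coord z m) * cmod (coord z m) powr (Q - 1)"
        using m by (intro mult_right_mono) auto
      ultimately show "cmod (coord g m) \<le> (1 / h) * cmod (coord z m) powr Q"
        unfolding g using h by (simp add: pos_le_divide_eq mult.commute)
    qed (use M0 in simp)
    also have "\<dots> \<le> M * ((1 / h) * A)"
      unfolding sum_distrib_left[symmetric] A_def using M0 h S by (intro mult_left_mono sum_powr_le_pmass Q2) auto
    also have "\<dots> = l" using M0 A l by (simp add: h_def)
    finally have hi: "cmod (coord (V (restr S g)) n) \<le> l" for n
      using norm_coord_contraction_restr[OF V M S, of g n] by linarith
    have split: "V g = V (restr S g) + V (restr (- S) g)"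
    proof -
      have "g = restr S g + restr (- S) g" by (rule ell2_eqI) (simp add: coord_simps coord_restr)
      then show ?thesis using V unfolding clinear_contraction_def by metis
    qed
    have "(\<Sum>n<L. l\<^sup>2 * indicator {..v n / 2} l) \<le> (\<Sum>n<L. (cmod (coord (V (restr (- S) g)) n))\<^sup>2)"
    proof (intro sum_mono)
      fix n
      show "l\<^sup>2 * indicator {..v n / 2} l \<le> (cmod (coord (V (restr (- S) g)) n))\<^sup>2"
      proof (cases "l \<le> v n / 2")
        case True
        have "v n \<le> l + cmod (coord (V (restr (- S) g)) n)"
          unfolding v_def split coord_simps
          using norm_triangle_ineq[of "coord (V (restr S g)) n" "coord (V (restr (- S) g)) n"] hi[of n] by linarith
        then have "l \<le> cmod (coord (V (restr (- S) g)) n)" using True by linarith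
        then show ?thesis using l True by (simp add: power_mono)
      qed simp
    qed
    also have "\<dots> \<le> (norm (V (restr (- S) g)))\<^sup>2" by (rule sum_coord_sq_le)
    also have "\<dots> \<le> (norm (restr (- S) g))\<^sup>2" using V by (intro power_mono) (auto simp: clinear_contraction_def)
    also have "\<dots> = (\<Sum>m. (cmod (coord g m))\<^sup>2 * indicator {m. cmod (coord z m) \<le> h} m)"
      unfolding norm_ell2_sq by (intro suminf_cong) (auto simp: coord_restr S_def)
    finally show "(\<Sum>n<L. l\<^sup>2 * indicator {..v n / 2} l) \<le> (\<Sum>m. (cmod (coord g m))\<^sup>2 * indicator {m. cmod (coord z m) \<le> M * A / l} m)"
      by (simp add: h_def)
    show "summable (\<lambda>m. (cmod (coord g m))\<^sup>2 * indicator {m. cmod (coord z m) \<le> M * A / l} m)"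
      by (rule summable_comparison_test'[OF summable_coord_sq[of g]]) (auto simp: indicator_def)
  qed
  \<comment> \<open>The level inequality is multiplied by \<open>l powr (Q - 3)\<close> and
    integrated in \<open>l\<close>. On the left this is the layer-cake formula; on the right
    coordinate \<open>m\<close> contributes for \<open>l \<le> lm m\<close>, and the power is
    integrable at 0 because \<open>Q > 2\<close>.\<close>
  have main: "(\<Sum>n<L. (v n / 2) powr Q / Q) \<le> (M * A) powr (Q - 2) / (Q - 2) * A" for L
  proof -
    have pointwise: "(\<Sum>n<L. ennreal (l powr (Q - 1)) * indicator {0..v n / 2} l)
        \<le> (\<Sum>m. ennreal ((cmod (coord g m))\<^sup>2) * (ennreal (l powr (Q - 3)) * indicator {0..lm m} l))" for l :: real
    proof (cases "0 < l")
      case False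
      then have "ennreal (l powr (Q - 1)) * indicator {0..v n / 2} l = 0" for n
        by (cases "l = 0") auto
      then have "(\<Sum>n<L. ennreal (l powr (Q - 1)) * indicator {0..v n / 2} l) = 0" by (intro sum.neutral ballI)
      then show ?thesis by (simp only: zero_le)
    next
      case True
      have "(\<Sum>n<L. ennreal (l powr (Q - 1)) * indicator {0..v n / 2} l)
          = (\<Sum>n<L. ennreal (l powr (Q - 3) * (l\<^sup>2 * indicator {..v n / 2} l)))"
        using True powr_add[of l "Q - 3" 2] by (intro sum.cong) (auto simp: indicator_def)
      also have "\<dots> = ennreal (l powr (Q - 3) * (\<Sum>n<L. l\<^sup>2 * indicator {..v n / 2} l))"
        unfolding sum_distrib_left by (rule sum_ennreal) simp
      also have "\<dots> \<le> ennreal (l powr (Q - 3) * (\<Sum>m. (cmod (coord g m))\<^sup>2 * indicator {m. cmod (coord z m) \<le> M * A / l} m))"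
        by (intro ennreal_leI mult_left_mono level True) simp
      also have "\<dots> = ennreal (\<Sum>m. l powr (Q - 3) * ((cmod (coord g m))\<^sup>2 * indicator {m. cmod (coord z m) \<le> M * A / l} m))"
        by (simp add: suminf_mult[OF level_sm[OF True]])
      also have "\<dots> = (\<Sum>m. ennreal (l powr (Q - 3) * ((cmod (coord g m))\<^sup>2 * indicator {m. cmod (coord z m) \<le> M * A / l} m)))"
        by (intro suminf_ennreal2[symmetric] summable_mult level_sm True) auto
      also have "\<dots> \<le> (\<Sum>m. ennreal ((cmod (coord g m))\<^sup>2) * (ennreal (l powr (Q - 3)) * indicator {0..lm m} l))"
      proof (intro suminf_le)
        fix m
        show "ennreal (l powr (Q - 3) * ((cmod (coord g m))\<^sup>2 * indicator {m. cmod (coord z m) \<le> M * A / l} m))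
            \<le> ennreal ((cmod (coord g m))\<^sup>2) * (ennreal (l powr (Q - 3)) * indicator {0..lm m} l)"
        proof (cases "coord z m = 0")
          case True then show ?thesis by (simp add: g)
        next
          case False
          then have "cmod (coord z m) \<le> M * A / l \<longleftrightarrow> l \<le> lm m"
            using \<open>0 < l\<close> by (simp add: lm_def field_simps)
          then show ?thesis using \<open>0 < l\<close> by (simp add: indicator_def ennreal_mult[symmetric] mult.commute)
        qed
      qed auto
      finally show ?thesis .
    qed
    have "ennreal (\<Sum>n<L. (v n / 2) powr Q / Q) = (\<Sum>n<L. ennreal ((v n / 2) powr Q / Q))"
      using Q by (simp add: sum_ennreal)
    also have "\<dots> = (\<Sum>n<L. \<integral>\<^sup>+l. ennreal (l powr (Q - 1)) * indicator {0..v n / 2} l \<partial>lborel)"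
    proof (intro sum.cong refl)
      fix n
      have "((\<lambda>l. l powr (Q - 1)) has_integral ((v n / 2) powr Q / Q)) {0..v n / 2}"
        using has_integral_powr_from_0[of "Q - 1" "v n / 2"] Q by (simp add: v_def)
      then show "ennreal ((v n / 2) powr Q / Q) = (\<integral>\<^sup>+l. ennreal (l powr (Q - 1)) * indicator {0..v n / 2} l \<partial>lborel)"
        by (intro nn_integral_has_integral_lebesgue'[symmetric]) auto
    qed
    also have "\<dots> = (\<integral>\<^sup>+l. (\<Sum>n<L. ennreal (l powr (Q - 1)) * indicator {0..v n / 2} l) \<partial>lborel)"
      by (rule nn_integral_sum[symmetric]) measurable
    also have "\<dots> \<le> (\<integral>\<^sup>+l. (\<Sum>m. ennreal ((cmod (coord g m))\<^sup>2) * (ennreal (l powr (Q - 3)) * indicator {0..lm m} l)) \<partial>lborel)"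
      by (intro nn_integral_mono pointwise)
    also have "\<dots> = (\<Sum>m. \<integral>\<^sup>+l. ennreal ((cmod (coord g m))\<^sup>2) * (ennreal (l powr (Q - 3)) * indicator {0..lm m} l) \<partial>lborel)"
      by (rule nn_integral_suminf) measurable
    also have "\<dots> = (\<Sum>m. ennreal ((M * A) powr (Q - 2) / (Q - 2) * cmod (coord z m) powr Q))"
    proof (intro suminf_cong)
      fix m
      have "((\<lambda>l. l powr (Q - 3)) has_integral (lm m powr (Q - 2) / (Q - 2))) {0..lm m}"
        using has_integral_powr_from_0[of "Q - 3" "lm m"] Q M0 A by (simp add: lm_def)
      then have "(\<integral>\<^sup>+l. ennreal (l powr (Q - 3)) * indicator {0..lm m} l \<partial>lborel) = ennreal (lm m powr (Q - 2) / (Q - 2))"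
        by (intro nn_integral_has_integral_lebesgue') auto
      moreover have "ennreal ((cmod (coord g m))\<^sup>2) * ennreal (lm m powr (Q - 2) / (Q - 2))
          = ennreal ((cmod (coord g m))\<^sup>2 * (lm m powr (Q - 2) / (Q - 2)))"
        using Q by (intro ennreal_mult[symmetric]) auto
      moreover have "(\<integral>\<^sup>+l. ennreal ((cmod (coord g m))\<^sup>2) * (ennreal (l powr (Q - 3)) * indicator {0..lm m} l) \<partial>lborel)
          = ennreal ((cmod (coord g m))\<^sup>2) * (\<integral>\<^sup>+l. ennreal (l powr (Q - 3)) * indicator {0..lm m} l \<partial>lborel)"
        by (rule nn_integral_cmult) measurable
      ultimately have "(\<integral>\<^sup>+l. ennreal ((cmod (coord g m))\<^sup>2) * (ennreal (l powr (Q - 3)) * indicator {0..lm m} l) \<partial>lborel)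
          = ennreal ((cmod (coord g m))\<^sup>2 * (lm m powr (Q - 2) / (Q - 2)))"
        by (simp only:)
      also have "(cmod (coord g m))\<^sup>2 * (lm m powr (Q - 2) / (Q - 2)) = (M * A) powr (Q - 2) / (Q - 2) * cmod (coord z m) powr Q"
      proof (cases "coord z m = 0")
        case True then show ?thesis by (simp add: g)
      next
        case False
        have "(cmod (coord g m))\<^sup>2 = cmod (coord z m) powr Q * cmod (coord z m) powr (Q - 2)"
          unfolding g power2_eq_square powr_add[symmetric] by (simp add: algebra_simps)
        moreover have "lm m powr (Q - 2) = (M * A) powr (Q - 2) / cmod (coord z m) powr (Q - 2)"
          unfolding lm_def by (rule powr_divide)
        ultimately show ?thesis using False by simp
      qed
      finally show "(\<integral>\<^sup>+l. ennreal ((cmod (coord g m))\<^sup>2) * (ennreal (l powr (Q - 3)) * indicator {0..lm m} l) \<partial>lborel)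
          = ennreal ((M * A) powr (Q - 2) / (Q - 2) * cmod (coord z m) powr Q)" .
    qed
    also have "\<dots> = ennreal (\<Sum>m. (M * A) powr (Q - 2) / (Q - 2) * cmod (coord z m) powr Q)"
      using Q by (intro suminf_ennreal2 summable_mult summable_pmass) auto
    also have "(\<Sum>m. (M * A) powr (Q - 2) / (Q - 2) * cmod (coord z m) powr Q) = (M * A) powr (Q - 2) / (Q - 2) * A"
      unfolding A_def pmass_def by (rule suminf_mult[OF summable_pmass[OF Q2]])
    finally show ?thesis
      using Q A by (subst (asm) ennreal_le_iff) auto
  qed
  show ?thesis
  proof (rule pmass_leI[OF Q2])
    fix L
    have "(\<Sum>n<L. cmod (coord (V (power_nl (Q - 1) z)) n) powr Q) = 2 powr Q * Q * (\<Sum>n<L. (v n / 2) powr Q / Q)"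
      using Q by (simp add: sum_distrib_left v_def g_def powr_divide)
    also have "\<dots> \<le> 2 powr Q * Q * ((M * A) powr (Q - 2) / (Q - 2) * A)"
      using Q by (intro mult_left_mono main) auto
    also have "\<dots> = 2 powr Q * (Q / (Q - 2)) * M powr (Q - 2) * (A powr (Q - 2) * A powr 1)"
      using A M0 by (simp add: powr_mult)
    also have "A powr (Q - 2) * A powr 1 = A powr (Q - 1)" unfolding powr_add[symmetric] by simp
    finally show "(\<Sum>n<L. cmod (coord (V (power_nl (Q - 1) z)) n) powr Q)
        \<le> 2 powr Q * (Q / (Q - 2)) * M powr (Q - 2) * pmass Q z powr (Q - 1)" by (simp add: A_def)
  qed
qed

text \<open>Choosing the constant as a function of \<open>Q\<close> makes it visibly the same for
  all groups sharing that exponent; the uniform smallness threshold rests on this.\<close>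

definition hls_const :: "real \<Rightarrow> real" where
  "hls_const Q = (SOME c. 0 < c \<and> (\<forall>G. G \<in> borel_measurable borel \<longrightarrow> (\<forall>s. 0 \<le> G s) \<longrightarrow>
     (\<integral>\<^sup>+s. ennreal (G s powr (Q / (Q - 1))) \<partial>lborel) \<le> 1 \<longrightarrow> (\<forall>t. frac_int Q G t < \<infinity>) \<longrightarrow>
     (\<integral>\<^sup>+t. ennreal (enn2real (frac_int Q G t) powr Q) \<partial>lborel) \<le> ennreal c))"

lemma hls_const:
  assumes "2 < Q"
  shows "0 < hls_const Q \<and> (\<forall>G. G \<in> borel_measurable borel \<longrightarrow> (\<forall>s. 0 \<le> G s) \<longrightarrow>
     (\<integral>\<^sup>+s. ennreal (G s powr (Q / (Q - 1))) \<partial>lborel) \<le> 1 \<longrightarrow> (\<forall>t. frac_int Q G t < \<infinity>) \<longrightarrow>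
     (\<integral>\<^sup>+t. ennreal (enn2real (frac_int Q G t) powr Q) \<partial>lborel) \<le> ennreal (hls_const Q))"
  unfolding hls_const_def by (rule someI_ex) (rule hls_normalized[OF assms])

lemma hls_const_pos: "2 < Q \<Longrightarrow> 0 < hls_const Q"
  by (rule conjunct1[OF hls_const])

lemma frac_int_cmult:
  assumes [measurable]: "G \<in> borel_measurable borel" and c: "0 \<le> c"
  shows "frac_int Q (\<lambda>s. c * G s) t = ennreal c * frac_int Q G t"
proof -
  have "frac_int Q (\<lambda>s. c * G s) t = (\<integral>\<^sup>+s. ennreal c * ennreal (\<bar>t - s\<bar> powr (- (2 / Q)) * G s) \<partial>lborel)"
    unfolding frac_int_def ennreal_mult'[OF c, symmetric] by (simp only: mult.left_commute)
  also have "\<dots> = ennreal c * frac_int Q G t" unfolding frac_int_def by (rule nn_integral_cmult) measurable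
  finally show ?thesis .
qed

text \<open>Close to \<open>t\<close> the bound on \<open>G\<close> meets an integrable kernel; away
  from it Young's inequality separates an integrable power of the distance from the mass of
  \<open>G\<close>. Finiteness must be secured first, because \<open>enn2real\<close> would turn an
  infinite value into 0.\<close>

lemma frac_int_finite:
  assumes Q: "2 < Q" and Gm [measurable]: "G \<in> borel_measurable borel" and G0: "\<And>s. 0 \<le> G s" and B: "\<And>s. G s \<le> B"
    and fin: "(\<integral>\<^sup>+s. ennreal (G s powr (Q / (Q - 1))) \<partial>lborel) < \<infinity>"
  shows "frac_int Q G t < \<infinity>"
proof -
  have B0: "0 \<le> B" using G0[of 0] B[of 0] by linarith
  let ?n = "\<lambda>r. ennreal (\<bar>r\<bar> powr (- (2 / Q))) * indicator {r. \<bar>r\<bar> \<le> 1} r"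
  let ?f = "\<lambda>r. ennreal (\<bar>r\<bar> powr (- 2)) * indicator {r. 1 < \<bar>r\<bar>} r"
  have "frac_int Q G t \<le> (\<integral>\<^sup>+s. (ennreal B * ?n (t - s) + ?f (t - s)) + ennreal (G s powr (Q / (Q - 1))) \<partial>lborel)"
    unfolding frac_int_def
  proof (intro nn_integral_mono)
    fix s
    show "ennreal (\<bar>t - s\<bar> powr (- (2 / Q)) * G s)
        \<le> (ennreal B * ?n (t - s) + ?f (t - s)) + ennreal (G s powr (Q / (Q - 1)))"
    proof (cases "\<bar>t - s\<bar> \<le> 1")
      case True
      have "\<bar>t - s\<bar> powr (- (2 / Q)) * G s \<le> B * \<bar>t - s\<bar> powr (- (2 / Q))"
        unfolding mult.commute[of B] by (intro mult_left_mono B) simp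
      then have "ennreal (\<bar>t - s\<bar> powr (- (2 / Q)) * G s) \<le> ennreal B * ennreal (\<bar>t - s\<bar> powr (- (2 / Q)))"
        unfolding ennreal_mult'[OF B0, symmetric] by (rule ennreal_leI)
      then show ?thesis using True by (simp add: add_increasing2)
    next
      case False
      have "\<bar>t - s\<bar> powr (- (2 / Q)) * G s \<le> (\<bar>t - s\<bar> powr (- (2 / Q))) powr Q + G s powr (Q / (Q - 1))"
        using Q G0 by (intro mult_le_powr_sum) auto
      also have "(\<bar>t - s\<bar> powr (- (2 / Q))) powr Q = \<bar>t - s\<bar> powr (- 2)" using Q by (simp add: powr_powr)
      finally show ?thesis using False by (simp add: ennreal_leI ennreal_plus[symmetric] del: ennreal_plus)
    qed
  qed
  also have "\<dots> = (ennreal B * (\<integral>\<^sup>+s. ?n (t - s) \<partial>lborel) + (\<integral>\<^sup>+s. ?f (t - s) \<partial>lborel))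
      + (\<integral>\<^sup>+s. ennreal (G s powr (Q / (Q - 1))) \<partial>lborel)"
    by (simp add: nn_integral_add nn_integral_cmult)
  also have "(\<integral>\<^sup>+s. ?n (t - s) \<partial>lborel) = (\<integral>\<^sup>+r. ?n r \<partial>lborel)"
    by (rule nn_integral_translate'[of ?n]) measurable
  also have "(\<integral>\<^sup>+s. ?f (t - s) \<partial>lborel) = (\<integral>\<^sup>+r. ?f r \<partial>lborel)"
    by (rule nn_integral_translate'[of ?f]) measurable
  finally have *: "frac_int Q G t \<le> (ennreal B * (\<integral>\<^sup>+r. ?n r \<partial>lborel) + (\<integral>\<^sup>+r. ?f r \<partial>lborel))
      + (\<integral>\<^sup>+s. ennreal (G s powr (Q / (Q - 1))) \<partial>lborel)" .
  have "(\<integral>\<^sup>+r. ?n r \<partial>lborel) < \<infinity>"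
    by (rule le_less_trans[OF nn_integral_powr_near]) (use Q in auto)
  moreover have "(\<integral>\<^sup>+r. ?f r \<partial>lborel) < \<infinity>"
    by (rule le_less_trans[OF nn_integral_powr_far]) auto
  ultimately show ?thesis
    using fin by (intro le_less_trans[OF *]) (simp add: ennreal_mult_less_top)
qed

text \<open>Division by \<open>a\<close>, the power of \<open>A\<close> that scales like the
  conjugate norm, reduces to mass at most 1. The bilinear bound then follows from Young's inequality
  for the normalised function. The parameter \<open>A\<close> need only dominate the mass, and being
  positive it can be divided by.\<close>

lemma hls:
  assumes Q: "2 < Q" and Gm [measurable]: "G \<in> borel_measurable borel" and G0: "\<And>s. 0 \<le> G s" and B: "\<And>s. G s \<le> B"
    and A: "0 < A" and mass: "(\<integral>\<^sup>+s. ennreal (G s powr (Q / (Q - 1))) \<partial>lborel) \<le> ennreal A"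
  shows "frac_int Q G t < \<infinity>"
    and "(\<integral>\<^sup>+t. ennreal (enn2real (frac_int Q G t) powr Q) \<partial>lborel) \<le> ennreal (hls_const Q * A powr (Q - 1))"
    and "(\<integral>\<^sup>+t. ennreal (G t) * frac_int Q G t \<partial>lborel) \<le> ennreal ((1 + hls_const Q) * (A powr ((Q - 1) / Q))\<^sup>2)"
proof -
  have fin: "frac_int Q G t < \<infinity>" for t
    by (rule frac_int_finite[OF Q Gm G0 B le_less_trans[OF mass]]) simp
  then show "frac_int Q G t < \<infinity>" .
  define a where "a = A powr ((Q - 1) / Q)"
  have a: "0 < a" using A by (simp add: a_def)
  have aq: "a powr (Q / (Q - 1)) = A" and aQ: "a powr Q = A powr (Q - 1)"
    using A Q by (auto simp: a_def powr_powr)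
  define H where "H s = (1 / a) * G s" for s
  have Hm [measurable]: "H \<in> borel_measurable borel" unfolding H_def[abs_def] by measurable
  have H0: "0 \<le> H s" for s using a G0[of s] by (simp add: H_def)
  have GH: "G = (\<lambda>s. a * H s)" using a by (auto simp: H_def)
  have Hq: "H s powr (Q / (Q - 1)) = (1 / A) * G s powr (Q / (Q - 1))" for s
    by (simp add: H_def powr_divide aq)
  have "(\<integral>\<^sup>+s. ennreal (H s powr (Q / (Q - 1))) \<partial>lborel) = (\<integral>\<^sup>+s. ennreal (1 / A) * ennreal (G s powr (Q / (Q - 1))) \<partial>lborel)"
    unfolding Hq using A by (intro nn_integral_cong ennreal_mult') simp
  also have "\<dots> = ennreal (1 / A) * (\<integral>\<^sup>+s. ennreal (G s powr (Q / (Q - 1))) \<partial>lborel)"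
    by (rule nn_integral_cmult) measurable
  also have "\<dots> \<le> ennreal (1 / A) * ennreal A" by (intro mult_left_mono mass) simp
  also have "\<dots> = 1" using A by (simp add: ennreal_mult[symmetric])
  finally have massH: "(\<integral>\<^sup>+s. ennreal (H s powr (Q / (Q - 1))) \<partial>lborel) \<le> 1" .
  have finH: "frac_int Q H t < \<infinity>" for t
    unfolding H_def[abs_def] using a fin[of t]
    by (subst frac_int_cmult) (auto simp: ennreal_mult_less_top)
  have hH: "(\<integral>\<^sup>+t. ennreal (enn2real (frac_int Q H t) powr Q) \<partial>lborel) \<le> ennreal (hls_const Q)"
    using conjunct2[OF hls_const[OF Q]] Hm H0 massH finH by simp
  have fG: "frac_int Q G t = ennreal a * frac_int Q H t" for t
    unfolding GH using a by (intro frac_int_cmult) auto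
  have "(\<integral>\<^sup>+t. ennreal (enn2real (frac_int Q G t) powr Q) \<partial>lborel)
      = (\<integral>\<^sup>+t. ennreal (A powr (Q - 1)) * ennreal (enn2real (frac_int Q H t) powr Q) \<partial>lborel)"
    unfolding fG using a by (intro nn_integral_cong) (simp add: enn2real_mult powr_mult aQ ennreal_mult)
  also have "\<dots> = ennreal (A powr (Q - 1)) * (\<integral>\<^sup>+t. ennreal (enn2real (frac_int Q H t) powr Q) \<partial>lborel)"
    by (rule nn_integral_cmult) measurable
  also have "\<dots> \<le> ennreal (A powr (Q - 1)) * ennreal (hls_const Q)" by (intro mult_left_mono hH) simp
  also have "\<dots> = ennreal (hls_const Q * A powr (Q - 1))"
    using hls_const_pos[OF Q] by (simp add: ennreal_mult[symmetric] mult.commute)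
  finally show "(\<integral>\<^sup>+t. ennreal (enn2real (frac_int Q G t) powr Q) \<partial>lborel) \<le> ennreal (hls_const Q * A powr (Q - 1))" .
  have "(\<integral>\<^sup>+t. ennreal (G t) * frac_int Q G t \<partial>lborel)
      \<le> (\<integral>\<^sup>+t. ennreal (a\<^sup>2) * (ennreal (H t powr (Q / (Q - 1))) + ennreal (enn2real (frac_int Q H t) powr Q)) \<partial>lborel)"
  proof (intro nn_integral_mono)
    fix t
    define y where "y = enn2real (frac_int Q H t)"
    have y: "0 \<le> y" "frac_int Q H t = ennreal y" using finH[of t] by (simp_all add: y_def)
    have "G t = a * H t" using a by (simp add: H_def)
    then have "ennreal (G t) * frac_int Q G t = ennreal (a * H t) * (ennreal a * ennreal y)"
      unfolding fG y(2) by (simp only:)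
    also have "\<dots> = ennreal ((a * H t) * (a * y))"
      using a H0[of t] y(1) by (simp add: ennreal_mult)
    also have "(a * H t) * (a * y) = a\<^sup>2 * (y * H t)" by (simp add: power2_eq_square)
    also have "ennreal (a\<^sup>2 * (y * H t)) = ennreal (a\<^sup>2) * ennreal (enn2real (frac_int Q H t) * H t)"
      unfolding y_def[symmetric] by (rule ennreal_mult') simp
    also have "\<dots> \<le> ennreal (a\<^sup>2) * ennreal (enn2real (frac_int Q H t) powr Q + H t powr (Q / (Q - 1)))"
      using Q H0 by (intro mult_left_mono ennreal_leI mult_le_powr_sum) auto
    finally show "ennreal (G t) * frac_int Q G t
        \<le> ennreal (a\<^sup>2) * (ennreal (H t powr (Q / (Q - 1))) + ennreal (enn2real (frac_int Q H t) powr Q))"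
      by (simp add: add.commute)
  qed
  also have "\<dots> = ennreal (a\<^sup>2) * ((\<integral>\<^sup>+t. ennreal (H t powr (Q / (Q - 1))) \<partial>lborel)
      + (\<integral>\<^sup>+t. ennreal (enn2real (frac_int Q H t) powr Q) \<partial>lborel))"
    by (simp add: nn_integral_add nn_integral_cmult)
  also have "\<dots> \<le> ennreal (a\<^sup>2) * (ennreal 1 + ennreal (hls_const Q))"
    using massH hH by (intro mult_left_mono add_mono) auto
  also have "\<dots> = ennreal ((1 + hls_const Q) * a\<^sup>2)"
    using hls_const_pos[OF Q] by (simp add: ennreal_mult[symmetric] ennreal_plus[symmetric] mult.commute del: ennreal_plus ennreal_1)
  finally show "(\<integral>\<^sup>+t. ennreal (G t) * frac_int Q G t \<partial>lborel) \<le> ennreal ((1 + hls_const Q) * (A powr ((Q - 1) / Q))\<^sup>2)"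
    by (simp add: a_def)
qed

section \<open>Oriented integrals and Fatou's lemma\<close>

lemma interval_integrable_continuous:
  fixes f :: "real \<Rightarrow> 'a::{banach, second_countable_topology}"
  assumes "continuous_on UNIV f"
  shows "interval_lebesgue_integrable lborel (ereal a) (ereal b) f"
  by (rule interval_integrable_isCont) (use assms in \<open>simp add: continuous_on_eq_continuous_at\<close>)

lemma interval_integral_bounded_linear:
  fixes f :: "real \<Rightarrow> 'a::{banach, second_countable_topology}" and T :: "'a \<Rightarrow> 'b::{banach, second_countable_topology}"
  assumes T: "bounded_linear T" and f: "interval_lebesgue_integrable lborel a b f"
  shows "(LBINT s=a..b. T (f s)) = T (LBINT s=a..b. f s)"
proof -
  have *: "(LBINT s:S. T (f s)) = T (LBINT s:S. f s)" if "set_integrable lborel S f" for S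
    using integral_bounded_linear[OF T that[unfolded set_integrable_def]] linear_scale[OF bounded_linear.linear[OF T]]
    unfolding set_lebesgue_integral_def by simp
  show ?thesis
    using f linear_neg[OF bounded_linear.linear[OF T]]
    by (simp add: interval_lebesgue_integral_def interval_lebesgue_integrable_def * split: if_splits)
qed

lemma norm_interval_integral_le:
  fixes f :: "real \<Rightarrow> 'a::{banach, second_countable_topology}"
  assumes "interval_lebesgue_integrable lborel (ereal a) (ereal b) f"
  shows "ennreal (norm (LBINT s=ereal a..ereal b. f s)) \<le> (\<integral>\<^sup>+s. ennreal (norm (f s)) * indicator {min a b..max a b} s \<partial>lborel)"
proof -
  have *: "ennreal (norm (LBINT s:{c<..<d}. f s)) \<le> (\<integral>\<^sup>+s. ennreal (norm (f s)) * indicator {c..d} s \<partial>lborel)"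
    if "set_integrable lborel {c<..<d} f" for c d
  proof -
    have "ennreal (norm (LBINT s:{c<..<d}. f s)) \<le> (\<integral>\<^sup>+s. ennreal (norm (indicator {c<..<d} s *\<^sub>R f s)) \<partial>lborel)"
      unfolding set_lebesgue_integral_def using that unfolding set_integrable_def by (rule integral_norm_bound_ennreal)
    also have "\<dots> \<le> (\<integral>\<^sup>+s. ennreal (norm (f s)) * indicator {c..d} s \<partial>lborel)"
      by (intro nn_integral_mono) (auto simp: indicator_def)
    finally show ?thesis .
  qed
  show ?thesis
    using assms *[of a b] *[of b a]
    by (cases "a \<le> b") (auto simp: interval_lebesgue_integral_def interval_lebesgue_integrable_def)
qed

lemma nn_integral_le_of_tendsto:
  fixes h :: "nat \<Rightarrow> real \<Rightarrow> ennreal"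
  assumes [measurable]: "\<And>k. h k \<in> borel_measurable lborel" and lim: "\<And>t. (\<lambda>k. h k t) \<longlonglongrightarrow> g t"
    and B: "\<And>k. (\<integral>\<^sup>+t. h k t \<partial>lborel) \<le> B"
  shows "(\<integral>\<^sup>+t. g t \<partial>lborel) \<le> B"
proof -
  have "(\<integral>\<^sup>+t. g t \<partial>lborel) = (\<integral>\<^sup>+t. liminf (\<lambda>k. h k t) \<partial>lborel)"
    by (intro nn_integral_cong lim_imp_Liminf[symmetric] lim) simp
  also have "\<dots> \<le> liminf (\<lambda>k. \<integral>\<^sup>+t. h k t \<partial>lborel)" by (rule nn_integral_liminf) measurable
  also have "\<dots> \<le> limsup (\<lambda>k. \<integral>\<^sup>+t. h k t \<partial>lborel)" by (rule Liminf_le_Limsup) simp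
  also have "\<dots> \<le> B" by (rule Limsup_bounded) (simp add: B)
  finally show ?thesis .
qed

definition energy :: "real \<Rightarrow> real set \<Rightarrow> (real \<Rightarrow> ell2) \<Rightarrow> ennreal" where
  "energy Q S u = (\<integral>\<^sup>+t. ennreal (pmass Q (u t)) * indicator S t \<partial>lborel)"

section \<open>Lipschitz bounds for the nonlinearity\<close>

lemma abs_powr_diff_le:
  fixes x y r :: real
  assumes "0 \<le> y" "y \<le> x" "1 \<le> r"
  shows "x powr r - y powr r \<le> r * x powr (r - 1) * (x - y)"
proof -
  consider "y = 0" | "y = x" | "0 < y" "y < x" using assms by linarith
  then show ?thesis
  proof cases
    case 1
    have "x powr r \<le> r * (x powr (r - 1) * x powr 1)" unfolding powr_add[symmetric] using assms by (simp add: mult_le_cancel_right1)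
    then show ?thesis using 1 assms by (simp add: mult.assoc)
  next
    case 3
    have "\<exists>z>y. z < x \<and> x powr r - y powr r = (x - y) * (r * z powr (r - 1))"
      by (rule MVT2[OF 3(2)]) (use 3(1) in \<open>auto intro: has_real_derivative_powr\<close>)
    then obtain z where z: "y < z" "z < x" "x powr r - y powr r = (x - y) * (r * z powr (r - 1))" by blast
    have "(x - y) * (r * z powr (r - 1)) \<le> (x - y) * (r * x powr (r - 1))"
      using z 3 assms by (intro mult_left_mono powr_mono2) auto
    then show ?thesis using z(3) by (simp add: mult_ac)
  qed simp
qed

text \<open>With \<open>a\<close> the number of larger modulus, the difference is
  \<open>|a|^r (a - b)\<close> plus \<open>(|a|^r - |b|^r) b\<close>; the second part is controlled
  by the mean value theorem and by \<open>|b| \<le> |a|\<close>.\<close>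

lemma norm_powr_mult_diff_le:
  fixes a b :: complex
  assumes a: "cmod a \<le> R" and b: "cmod b \<le> R" and r: "1 \<le> r"
  shows "cmod (complex_of_real (cmod a powr r) * a - complex_of_real (cmod b powr r) * b) \<le> (r + 1) * R powr r * cmod (a - b)"
proof -
  have main: "cmod (complex_of_real (cmod a powr r) * a - complex_of_real (cmod b powr r) * b) \<le> (r + 1) * R powr r * cmod (a - b)"
    if a: "cmod a \<le> R" and ba: "cmod b \<le> cmod a" for a b
  proof -
    have "complex_of_real (cmod a powr r) * a - complex_of_real (cmod b powr r) * b
        = complex_of_real (cmod a powr r) * (a - b) + complex_of_real (cmod a powr r - cmod b powr r) * b"
      by (simp add: algebra_simps)
    then have "cmod (complex_of_real (cmod a powr r) * a - complex_of_real (cmod b powr r) * b)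
        \<le> cmod a powr r * cmod (a - b) + \<bar>cmod a powr r - cmod b powr r\<bar> * cmod b"
      by (metis norm_triangle_ineq norm_mult norm_of_real abs_of_nonneg powr_ge_zero)
    also have "\<bar>cmod a powr r - cmod b powr r\<bar> * cmod b \<le> r * cmod a powr r * cmod (a - b)"
    proof -
      have "\<bar>cmod a powr r - cmod b powr r\<bar> = cmod a powr r - cmod b powr r"
        using ba r by (simp add: powr_mono2)
      also have "\<dots> \<le> r * cmod a powr (r - 1) * (cmod a - cmod b)" using ba r by (intro abs_powr_diff_le) auto
      also have "\<dots> \<le> r * cmod a powr (r - 1) * cmod (a - b)"
        using r by (intro mult_left_mono norm_triangle_ineq2) auto
      finally have "\<bar>cmod a powr r - cmod b powr r\<bar> * cmod b \<le> (r * cmod a powr (r - 1) * cmod (a - b)) * cmod a"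
        using r ba by (intro mult_mono) auto
      also have "\<dots> = r * (cmod a powr (r - 1) * cmod a powr 1) * cmod (a - b)" by simp
      also have "cmod a powr (r - 1) * cmod a powr 1 = cmod a powr r" unfolding powr_add[symmetric] by simp
      finally show ?thesis .
    qed
    also have "cmod a powr r * cmod (a - b) + r * cmod a powr r * cmod (a - b) = (r + 1) * cmod a powr r * cmod (a - b)"
      by (simp add: algebra_simps)
    also have "\<dots> \<le> (r + 1) * R powr r * cmod (a - b)"
      using r a by (intro mult_right_mono mult_left_mono powr_mono2) auto
    finally show ?thesis by simp
  qed
  show ?thesis
  proof (cases "cmod b \<le> cmod a")
    case False
    then show ?thesis using main[OF b, of a] by (simp add: norm_minus_commute)
  qed (use main a in blast)
qed

text \<open>The norm of \<open>ell2\<close> dominates every coordinate, so one scalar Lipschitz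
  constant on the disc of radius \<open>R\<close> serves all components at once.\<close>

lemma norm_nl_diff_le:
  assumes Q: "3 \<le> Q" and x: "norm x \<le> R" and y: "norm y \<le> R"
  shows "norm (power_nl (Q - 1) x - power_nl (Q - 1) y) \<le> (Q - 1) * R powr (Q - 2) * norm (x - y)" (is "_ \<le> ?c * _")
proof (rule power2_le_imp_le)
  have c: "0 \<le> ?c" using Q by simp
  have le: "(cmod (coord (power_nl (Q - 1) x - power_nl (Q - 1) y) n))\<^sup>2 \<le> ?c\<^sup>2 * (cmod (coord (x - y) n))\<^sup>2" for n
  proof -
    have "cmod (coord (power_nl (Q - 1) x - power_nl (Q - 1) y) n) \<le> ?c * cmod (coord (x - y) n)"
      using norm_powr_mult_diff_le[of "coord x n" R "coord y n" "Q - 2"] Q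
        order_trans[OF norm_coord_le x] order_trans[OF norm_coord_le y]
      by (simp add: coord_nl coord_simps)
    from power_mono[OF this norm_ge_zero, of 2] show ?thesis by (simp add: power_mult_distrib)
  qed
  have "(norm (power_nl (Q - 1) x - power_nl (Q - 1) y))\<^sup>2 \<le> (\<Sum>n. ?c\<^sup>2 * (cmod (coord (x - y) n))\<^sup>2)"
    unfolding norm_ell2_sq[of "power_nl (Q - 1) x - power_nl (Q - 1) y"]
    by (intro suminf_le le summable_coord_sq summable_mult)
  also have "\<dots> = (?c * norm (x - y))\<^sup>2"
    unfolding power_mult_distrib norm_ell2_sq by (rule suminf_mult[OF summable_coord_sq])
  finally show "(norm (power_nl (Q - 1) x - power_nl (Q - 1) y))\<^sup>2 \<le> (?c * norm (x - y))\<^sup>2" .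
  show "0 \<le> ?c * norm (x - y)" by (rule mult_nonneg_nonneg[OF c norm_ge_zero])
qed

lemma continuous_on_nl:
  assumes Q: "3 \<le> Q" and u: "continuous_on S u"
  shows "continuous_on S (\<lambda>t. power_nl (Q - 1) (u t))"
proof -
  have "isCont (power_nl (Q - 1)) x" for x
  proof -
    have "\<forall>\<^sub>F y in at x. norm y < norm x + 1"
      using tendsto_norm[OF tendsto_ident_at[of x UNIV]] by (rule order_tendstoD) simp
    then have "\<forall>\<^sub>F y in at x. norm (power_nl (Q - 1) y - power_nl (Q - 1) x) \<le> (Q - 1) * (norm x + 1) powr (Q - 2) * norm (y - x)"
      by eventually_elim (use Q in \<open>intro norm_nl_diff_le, auto\<close>)
    moreover have "((\<lambda>y. (Q - 1) * (norm x + 1) powr (Q - 2) * norm (y - x)) \<longlongrightarrow> (Q - 1) * (norm x + 1) powr (Q - 2) * norm (x - x)) (at x)"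
      by (intro tendsto_intros)
    then have "((\<lambda>y. (Q - 1) * (norm x + 1) powr (Q - 2) * norm (y - x)) \<longlongrightarrow> 0) (at x)"
      by (simp only: diff_self norm_zero mult_zero_right)
    ultimately have "((\<lambda>y. power_nl (Q - 1) y - power_nl (Q - 1) x) \<longlongrightarrow> 0) (at x)"
      by (rule Lim_null_comparison)
    then show ?thesis unfolding isCont_def by (rule LIM_zero_cancel)
  qed
  then have "continuous_on UNIV (power_nl (Q - 1))" by (simp add: continuous_on_eq_continuous_at)
  from continuous_on_compose2[OF this u] show ?thesis by simp
qed

subsection \<open>Strichartz estimates\<close>

text \<open>The decay rate is written through \<open>Q\<close> so that a single parameter fixes both
  the exponents and the constants; \<open>Q \<ge> 4\<close> corresponds to a rate at most 1. Leaving
  the group abstract allows its time reversal to be treated by the same locale.\<close>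

locale dispersive_group =
  fixes U :: "real \<Rightarrow> ell2 \<Rightarrow> ell2" and Q :: real
  assumes group: "unitary_group U" and Q4: "4 \<le> Q"
    and decay: "t \<noteq> 0 \<Longrightarrow> cmod (coord (U t (basis m)) n) \<le> \<bar>t\<bar> powr (- (2 / (Q - 2)))"
begin

lemma Q_bounds: "2 < Q" "2 \<le> Q" "3 \<le> Q"
  using Q4 by auto

abbreviation nl :: "ell2 \<Rightarrow> ell2" where "nl \<equiv> power_nl (Q - 1)"

lemma contraction: "clinear_contraction (U t)"
  using group by (auto simp: unitary_group_def intro: unitary_op_contraction)

lemma bounded_linear_U: "bounded_linear (U t)"
  by (rule bounded_linear_contraction[OF contraction])

lemma U_comp: "U s (U t x) = U (s + t) x"
  using group by (simp add: unitary_group_def)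

lemma U_zero_time [simp]: "U 0 x = x"
  using group by (simp add: unitary_group_def)

lemma norm_U [simp]: "norm (U t x) = norm x"
  using group by (simp add: unitary_group_def unitary_op_def)

lemma U_scaleC: "U t (c *\<^sub>C x) = c *\<^sub>C U t x"
  using contraction by (simp add: clinear_contraction_def)

lemmas U_add = linear_add[OF bounded_linear.linear[OF bounded_linear_U]]
lemmas U_diff = linear_diff[OF bounded_linear.linear[OF bounded_linear_U]]

lemma inner_U: "inner (U (- t) x) y = inner x (U t y)"
proof -
  have "inner (U t a) (U t b) = inner a b" for a b
  proof -
    have "(norm (U t a + U t b))\<^sup>2 = (norm (a + b))\<^sup>2" unfolding U_add[symmetric] by simp
    moreover have "(norm (U t a))\<^sup>2 = (norm a)\<^sup>2" "(norm (U t b))\<^sup>2 = (norm b)\<^sup>2" by simp_all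
    ultimately show ?thesis
      unfolding power2_norm_eq_inner inner_add_left inner_add_right by (simp add: inner_commute)
  qed
  from this[of "U (- t) x" y] show ?thesis by (simp add: U_comp)
qed

text \<open>Strong continuity handles the moving time for a fixed vector, and isometry handles the
  moving vector uniformly in time.\<close>

lemma continuous_on_U:
  assumes f: "continuous_on S f" and r: "continuous_on S r"
  shows "continuous_on S (\<lambda>t. U (r t) (f t))"
proof (unfold continuous_on_def, intro ballI)
  fix a assume a: "a \<in> S"
  have cont: "continuous_on UNIV (\<lambda>t. U t (f a))" using group by (simp add: unitary_group_def)
  have 1: "((\<lambda>t. U (r t) (f a)) \<longlongrightarrow> U (r a) (f a)) (at a within S)"
    using continuous_on_compose2[OF cont r] a by (simp add: continuous_on_def)
  have "((\<lambda>t. f t - f a) \<longlongrightarrow> 0) (at a within S)"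
    using f a by (intro LIM_zero) (simp add: continuous_on_def)
  then have "((\<lambda>t. norm (f t - f a)) \<longlongrightarrow> 0) (at a within S)" by (rule tendsto_norm_zero)
  moreover have "\<forall>\<^sub>F t in at a within S. norm (U (r t) (f t) - U (r t) (f a)) \<le> norm (f t - f a)"
    unfolding U_diff[symmetric] by simp
  ultimately have 2: "((\<lambda>t. U (r t) (f t) - U (r t) (f a)) \<longlongrightarrow> 0) (at a within S)" by (rule Lim_null_comparison[rotated])
  from tendsto_add[OF 1 2] show "((\<lambda>t. U (r t) (f t)) \<longlongrightarrow> U (r a) (f a)) (at a within S)" by simp
qed

definition disp_const :: real where
  "disp_const = 2 * (2 powr Q * (Q / (Q - 2))) powr (1 / Q)"

lemma disp_const_pos: "0 < disp_const"
  using Q4 by (simp add: disp_const_def)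

text \<open>The rate \<open>2 / (Q - 2)\<close> enters the mass estimate to the power
  \<open>Q - 2\<close> and gives exponent 2; the \<open>Q\<close>-th root turns this into
  \<open>2 / Q\<close>, the exponent of \<open>frac_int\<close>.\<close>

lemma kernel_bound:
  assumes t: "t \<noteq> 0"
  shows "\<bar>inner (nl x) (U t (nl z))\<bar>
    \<le> disp_const * \<bar>t\<bar> powr (- (2 / Q)) * pmass Q x powr ((Q - 1) / Q) * pmass Q z powr ((Q - 1) / Q)"
proof -
  let ?M = "\<bar>t\<bar> powr (- (2 / (Q - 2)))"
  have "pmass Q (U t (nl z)) \<le> 2 powr Q * (Q / (Q - 2)) * ?M powr (Q - 2) * pmass Q z powr (Q - 1)"
    by (rule pmass_contraction[OF Q_bounds(1) contraction decay[OF t]]) (use t in simp)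
  also have "?M powr (Q - 2) = \<bar>t\<bar> powr (- (2 / (Q - 2)) * (Q - 2))" by (rule powr_powr)
  also have "- (2 / (Q - 2)) * (Q - 2) = - 2" using Q4 by (simp add: field_simps)
  finally have "pmass Q (U t (nl z)) powr (1 / Q)
      \<le> (2 powr Q * (Q / (Q - 2)) * \<bar>t\<bar> powr (- 2) * pmass Q z powr (Q - 1)) powr (1 / Q)"
    using Q_bounds by (intro powr_mono2) auto
  also have "\<dots> = (2 powr Q * (Q / (Q - 2))) powr (1 / Q) * \<bar>t\<bar> powr (- (2 / Q)) * pmass Q z powr ((Q - 1) / Q)"
    by (simp only: powr_mult powr_powr times_divide_eq_right mult_1_right minus_divide_left)
  finally have *: "pmass Q (U t (nl z)) powr (1 / Q)
      \<le> (2 powr Q * (Q / (Q - 2))) powr (1 / Q) * \<bar>t\<bar> powr (- (2 / Q)) * pmass Q z powr ((Q - 1) / Q)" .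
  have "\<bar>inner (nl x) (U t (nl z))\<bar> \<le> 2 * pmass Q x powr ((Q - 1) / Q) * pmass Q (U t (nl z)) powr (1 / Q)"
    by (rule abs_inner_nl_le[OF Q_bounds(2)])
  also have "\<dots> \<le> 2 * pmass Q x powr ((Q - 1) / Q) * ((2 powr Q * (Q / (Q - 2))) powr (1 / Q) * \<bar>t\<bar> powr (- (2 / Q)) * pmass Q z powr ((Q - 1) / Q))"
    by (intro mult_left_mono *) simp
  finally show ?thesis by (simp only: disp_const_def mult_ac)
qed

text \<open>The power \<open>(Q - 1) / Q\<close> of the mass of \<open>w t\<close> is the conjugate
  norm of \<open>nl (w t)\<close>, cut off to the time set \<open>S\<close>.\<close>

definition profile :: "real set \<Rightarrow> (real \<Rightarrow> ell2) \<Rightarrow> real \<Rightarrow> real" where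
  "profile S w t = indicator S t * pmass Q (w t) powr ((Q - 1) / Q)"

lemma measurable_of_continuous: "continuous_on UNIV w \<Longrightarrow> w \<in> borel_measurable borel" for w :: "real \<Rightarrow> ell2"
  by (rule borel_measurable_continuous_onI)

lemma profile_measurable:
  assumes "continuous_on UNIV w" and [measurable]: "S \<in> sets borel"
  shows "profile S w \<in> borel_measurable borel"
proof -
  have [measurable]: "w \<in> borel_measurable borel" by (rule measurable_of_continuous) fact
  show ?thesis unfolding profile_def[abs_def] by measurable
qed

lemma profile_nonneg: "0 \<le> profile S w t"
  by (simp add: profile_def)

lemma profile_le:
  assumes "\<And>t. t \<in> S \<Longrightarrow> norm (w t) \<le> R"
  shows "profile S w t \<le> (R powr Q) powr ((Q - 1) / Q)"
proof (cases "t \<in> S")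
  case True
  have "pmass Q (w t) \<le> norm (w t) powr Q" by (rule pmass_le[OF Q_bounds(2)])
  also have "\<dots> \<le> R powr Q" using assms[OF True] Q4 by (intro powr_mono2) auto
  finally show ?thesis using True Q4 by (simp add: profile_def powr_mono2)
qed (simp add: profile_def)

lemma nn_integral_profile: "(\<integral>\<^sup>+t. ennreal (profile S w t powr (Q / (Q - 1))) \<partial>lborel) = energy Q S w"
  unfolding energy_def
proof (intro nn_integral_cong)
  fix t
  show "ennreal (profile S w t powr (Q / (Q - 1))) = ennreal (pmass Q (w t)) * indicator S t"
    using Q4 by (auto simp: profile_def indicator_def powr_powr)
qed

abbreviation phase :: "(real \<Rightarrow> ell2) \<Rightarrow> real \<Rightarrow> ell2" where
  "phase w s \<equiv> U (- s) (nl (w s))"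

lemma continuous_phase: "continuous_on UNIV w \<Longrightarrow> continuous_on UNIV (phase w)"
  by (intro continuous_on_U continuous_on_nl Q_bounds continuous_intros)

lemma phase_integrable:
  "continuous_on UNIV w \<Longrightarrow> interval_lebesgue_integrable lborel (ereal a) (ereal b) (phase w)"
  by (intro interval_integrable_continuous continuous_phase)

text \<open>Moving the group to one side leaves it at time \<open>t - s\<close>, where the kernel
  bound produces the Riesz kernel. The exceptional time \<open>s = t\<close> is removed as a null
  set.\<close>

lemma inner_phase_integral_le:
  assumes z: "continuous_on UNIV z" and x: "S = {min a b..max a b}"
  shows "ennreal \<bar>inner (U (- t) (nl x)) (LBINT s=ereal a..ereal b. phase z s)\<bar>
    \<le> ennreal (disp_const * pmass Q x powr ((Q - 1) / Q)) * frac_int Q (profile S z) t"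
proof -
  let ?c = "disp_const * pmass Q x powr ((Q - 1) / Q)"
  have [measurable]: "profile S z \<in> borel_measurable borel" using x by (intro profile_measurable z) simp
  have c: "0 \<le> ?c" using disp_const_pos by simp
  have bl: "bounded_linear (inner (U (- t) (nl x)))" by (rule bounded_linear_inner_right)
  have ii: "interval_lebesgue_integrable lborel (ereal a) (ereal b) (\<lambda>s. inner (U (- t) (nl x)) (phase z s))"
    by (intro interval_integrable_continuous continuous_intros continuous_phase z)
  have "ennreal \<bar>inner (U (- t) (nl x)) (LBINT s=ereal a..ereal b. phase z s)\<bar>
      = ennreal (norm (LBINT s=ereal a..ereal b. inner (U (- t) (nl x)) (phase z s)))"
    unfolding interval_integral_bounded_linear[OF bl phase_integrable[OF z]] by simp
  also have "\<dots> \<le> (\<integral>\<^sup>+s. ennreal (norm (inner (U (- t) (nl x)) (phase z s))) * indicator S s \<partial>lborel)"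
    unfolding x by (rule norm_interval_integral_le[OF ii])
  also have "\<dots> \<le> (\<integral>\<^sup>+s. ennreal ?c * ennreal (\<bar>t - s\<bar> powr (- (2 / Q)) * profile S z s) \<partial>lborel)"
  proof (rule nn_integral_mono_AE, rule eventually_mono[OF AE_lborel_singleton[of t]])
    fix s assume s: "s \<noteq> t"
    show "ennreal (norm (inner (U (- t) (nl x)) (phase z s))) * indicator S s
        \<le> ennreal ?c * ennreal (\<bar>t - s\<bar> powr (- (2 / Q)) * profile S z s)"
    proof (cases "s \<in> S")
      case True
      have "\<bar>inner (U (- t) (nl x)) (phase z s)\<bar> = \<bar>inner (nl x) (U (t - s) (nl (z s)))\<bar>"
        unfolding inner_U U_comp by simp
      also have "\<dots> \<le> disp_const * \<bar>t - s\<bar> powr (- (2 / Q)) * pmass Q x powr ((Q - 1) / Q) * pmass Q (z s) powr ((Q - 1) / Q)"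
        by (rule kernel_bound) (use s in simp)
      also have "\<dots> = ?c * (\<bar>t - s\<bar> powr (- (2 / Q)) * profile S z s)" using True by (simp add: profile_def)
      finally show ?thesis
        using True unfolding ennreal_mult'[OF c, symmetric] by (simp add: ennreal_leI)
    qed simp
  qed
  also have "\<dots> = ennreal ?c * frac_int Q (profile S z) t"
    unfolding frac_int_def by (rule nn_integral_cmult) measurable
  finally show ?thesis .
qed

definition dual_const :: real where
  "dual_const = sqrt (disp_const * (1 + hls_const Q))"

lemma dual_const_pos: "0 < dual_const"
  using disp_const_pos hls_const_pos[OF Q_bounds(1)] by (simp add: dual_const_def)

text \<open>The squared norm of the integral \<open>Y\<close> is a double integral over pairs of
  times, and the kernel bound dominates it by the bilinear form of \<open>hls\<close>. The supremum
  of \<open>w\<close> on the interval serves only to make the fractional integral finite.\<close>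

lemma dual_strichartz:
  assumes w: "continuous_on UNIV w" and ab: "a \<le> b" and A: "0 < A" "energy Q {a..b} w \<le> ennreal A"
  shows "norm (LBINT s=ereal a..ereal b. phase w s) \<le> dual_const * A powr ((Q - 1) / Q)"
proof -
  define Y where "Y = (LBINT s=ereal a..ereal b. phase w s)"
  define G where "G = profile {a..b} w"
  have S: "{a..b} = {min a b..max a b}" using ab by (simp add: min_def max_def)
  have [measurable]: "G \<in> borel_measurable borel" unfolding G_def by (intro profile_measurable w) simp
  have cnorm: "continuous_on {a..b} (\<lambda>t. norm (w t))"
    by (intro continuous_intros continuous_on_subset[OF w]) simp
  obtain R where "\<forall>x\<in>(\<lambda>t. norm (w t)) ` {a..b}. norm x \<le> R"
    using compact_imp_bounded[OF compact_continuous_image[OF cnorm compact_Icc]]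
    unfolding bounded_iff by (elim exE)
  then have R: "norm (w t) \<le> R" if "t \<in> {a..b}" for t using that by simp
  have bl: "bounded_linear (inner Y)" by (rule bounded_linear_inner_right)
  have ii: "interval_lebesgue_integrable lborel (ereal a) (ereal b) (\<lambda>s. inner Y (phase w s))"
    by (intro interval_integrable_continuous continuous_intros continuous_phase w)
  have "ennreal ((norm Y)\<^sup>2) = ennreal (norm (inner Y Y))" by (simp add: power2_norm_eq_inner)
  also have "inner Y Y = (LBINT s=ereal a..ereal b. inner Y (phase w s))"
    unfolding interval_integral_bounded_linear[OF bl phase_integrable[OF w]] by (simp add: Y_def)
  also have "ennreal (norm \<dots>) \<le> (\<integral>\<^sup>+t. ennreal (norm (inner Y (phase w t))) * indicator {a..b} t \<partial>lborel)"
    unfolding S by (rule norm_interval_integral_le[OF ii])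
  also have "\<dots> \<le> (\<integral>\<^sup>+t. ennreal disp_const * (ennreal (G t) * frac_int Q G t) \<partial>lborel)"
  proof (intro nn_integral_mono)
    fix t
    show "ennreal (norm (inner Y (phase w t))) * indicator {a..b} t \<le> ennreal disp_const * (ennreal (G t) * frac_int Q G t)"
    proof (cases "t \<in> {a..b}")
      case True
      then have "disp_const * pmass Q (w t) powr ((Q - 1) / Q) = disp_const * G t" by (simp add: G_def profile_def)
      then have "ennreal \<bar>inner (phase w t) Y\<bar> \<le> ennreal (disp_const * G t) * frac_int Q G t"
        using inner_phase_integral_le[OF w S, of t "w t"] unfolding Y_def G_def by (simp only:)
      then show ?thesis
        using True disp_const_pos by (simp add: inner_commute[of Y] ennreal_mult' mult.assoc)
    qed simp
  qed
  also have "\<dots> = ennreal disp_const * (\<integral>\<^sup>+t. ennreal (G t) * frac_int Q G t \<partial>lborel)"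
    by (rule nn_integral_cmult) measurable
  also have "\<dots> \<le> ennreal disp_const * ennreal ((1 + hls_const Q) * (A powr ((Q - 1) / Q))\<^sup>2)"
  proof (intro mult_left_mono)
    show "(\<integral>\<^sup>+t. ennreal (G t) * frac_int Q G t \<partial>lborel) \<le> ennreal ((1 + hls_const Q) * (A powr ((Q - 1) / Q))\<^sup>2)"
    proof (rule hls(3)[OF Q_bounds(1)])
      show "G t \<le> (R powr Q) powr ((Q - 1) / Q)" for t unfolding G_def by (rule profile_le[OF R])
      show "(\<integral>\<^sup>+t. ennreal (G t powr (Q / (Q - 1))) \<partial>lborel) \<le> ennreal A"
        unfolding G_def nn_integral_profile by (rule A)
    qed (use A in \<open>auto simp: G_def profile_nonneg intro: profile_measurable w\<close>)
  qed simp
  also have "\<dots> = ennreal ((dual_const * A powr ((Q - 1) / Q))\<^sup>2)"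
    using disp_const_pos hls_const_pos[OF Q_bounds(1)]
    by (simp add: dual_const_def power_mult_distrib ennreal_mult[symmetric] mult.assoc)
  finally have "(norm Y)\<^sup>2 \<le> (dual_const * A powr ((Q - 1) / Q))\<^sup>2" by simp
  then have "norm Y \<le> dual_const * A powr ((Q - 1) / Q)"
    by (rule power2_le_imp_le) (use dual_const_pos in simp)
  then show ?thesis by (simp add: Y_def)
qed

lemma energy_measurable:
  fixes w :: "real \<Rightarrow> ell2"
  assumes "continuous_on UNIV w" "S \<in> sets borel"
  shows "(\<lambda>t. ennreal (pmass Q (w t)) * indicator S t) \<in> borel_measurable lborel"
proof -
  have [measurable]: "w \<in> borel_measurable borel" "S \<in> sets borel" by (rule measurable_of_continuous[OF assms(1)], rule assms(2))
  show ?thesis by measurable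
qed

lemma bounded_linear_trunc: "bounded_linear (trunc L)"
  by (rule bounded_linear_intro[of _ 1])
     (auto simp: norm_trunc_le intro!: ell2_eqI simp: coord_trunc coord_simps)

lemma pmass_trunc_tendsto: "(\<lambda>L. pmass Q (trunc L x)) \<longlonglongrightarrow> pmass Q x"
proof -
  have "0 < Q" using Q4 by simp
  show ?thesis
    unfolding pmass_trunc[OF \<open>0 < Q\<close>] unfolding pmass_def
    by (rule summable_LIMSEQ[OF summable_pmass[OF Q_bounds(2)]])
qed

text \<open>Restricted to finitely many coordinates and to a bounded interval, the mass
  \<open>X\<close> is finite and equals the inner product of a dual integral with \<open>f\<close>.
  Hence \<open>X\<close> is at most \<open>dual_const * norm f\<close> times
  \<open>X powr ((Q - 1) / Q)\<close>, and division bounds it. Fatou's lemma removes both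
  restrictions.\<close>

lemma homogeneous_strichartz: "energy Q UNIV (\<lambda>t. U t f) \<le> ennreal ((dual_const * norm f) powr Q)"
proof -
  have cU: "continuous_on UNIV (\<lambda>t. U t f)" by (intro continuous_on_U continuous_intros)
  have cT: "continuous_on UNIV (\<lambda>t. trunc L (U t f))" for L
    by (intro bounded_linear.continuous_on[OF bounded_linear_trunc] cU)
  have loc: "energy Q {- real k..real k} (\<lambda>t. trunc k (U t f)) \<le> ennreal ((dual_const * norm f) powr Q)" for k
  proof -
    define w where "w t = trunc k (U t f)" for t
    have w: "continuous_on UNIV w" unfolding w_def by (rule cT)
    have "pmass Q (w t) = inner (phase w t) f" for t
      unfolding inner_U w_def by (rule inner_nl_trunc[OF Q_bounds(2), symmetric])
    then have pm: "(\<lambda>t. pmass Q (w t)) = (\<lambda>t. inner (phase w t) f)" by (rule ext)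
    have cp: "continuous_on UNIV (\<lambda>t. pmass Q (w t))"
      unfolding pm by (intro continuous_intros continuous_phase w)
    define X where "X = (LBINT t:{- real k..real k}. pmass Q (w t))"
    have sint: "set_integrable lborel {- real k..real k} (\<lambda>t. pmass Q (w t))"
      by (intro borel_integrable_atLeastAtMost' continuous_on_subset[OF cp]) simp
    have X0: "0 \<le> X" unfolding X_def set_lebesgue_integral_def using Q_bounds by (intro integral_nonneg_AE) auto
    have eX: "energy Q {- real k..real k} w = ennreal X"
    proof -
      have "energy Q {- real k..real k} w = (\<integral>\<^sup>+t. ennreal (indicator {- real k..real k} t *\<^sub>R pmass Q (w t)) \<partial>lborel)"
        unfolding energy_def by (intro nn_integral_cong) (auto simp: indicator_def)
      also have "\<dots> = ennreal X"
        unfolding X_def set_lebesgue_integral_def using sint Q_bounds unfolding set_integrable_def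
        by (intro nn_integral_eq_integral) auto
      finally show ?thesis .
    qed
    show ?thesis
    proof (cases "X = 0")
      case True
      then show ?thesis using eX by (simp add: w_def[abs_def])
    next
      case False
      then have X: "0 < X" using X0 by simp
      have bl: "bounded_linear (\<lambda>x. inner x f)" by (rule bounded_linear_inner_left)
      have "X = (LBINT t=ereal (- real k)..ereal (real k). inner (phase w t) f)"
        unfolding X_def pm by (rule interval_integral_Icc[symmetric]) simp
      also have "\<dots> = inner (LBINT t=ereal (- real k)..ereal (real k). phase w t) f"
        by (rule interval_integral_bounded_linear[OF bl phase_integrable[OF w]])
      also have "\<dots> \<le> norm (LBINT t=ereal (- real k)..ereal (real k). phase w t) * norm f"
        by (rule norm_cauchy_schwarz)
      also have "\<dots> \<le> dual_const * X powr ((Q - 1) / Q) * norm f"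
        by (intro mult_right_mono dual_strichartz w X) (auto simp: eX)
      finally have le: "X \<le> dual_const * norm f * X powr ((Q - 1) / Q)" by (simp add: mult_ac)
      have eq: "X = X powr (1 / Q) * X powr ((Q - 1) / Q)"
        unfolding powr_add[symmetric] using X Q4 by (simp add: add_divide_distrib[symmetric])
      have "X powr (1 / Q) \<le> dual_const * norm f"
        by (rule mult_right_le_imp_le[OF ord_eq_le_trans[OF eq[symmetric] le]]) (use X in simp)
      then have "(X powr (1 / Q)) powr Q \<le> (dual_const * norm f) powr Q" using Q4 by (intro powr_mono2) auto
      moreover have "(X powr (1 / Q)) powr Q = X" using X Q4 by (simp add: powr_powr)
      ultimately have "ennreal X \<le> ennreal ((dual_const * norm f) powr Q)" by (intro ennreal_leI) simp
      then show ?thesis using eX by (simp add: w_def[abs_def])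
    qed
  qed
  show ?thesis
    unfolding energy_def
  proof (rule nn_integral_le_of_tendsto)
    show "(\<lambda>t. ennreal (pmass Q (trunc k (U t f))) * indicator {- real k..real k} t) \<in> borel_measurable lborel" for k
      by (intro energy_measurable cT) simp
    show "(\<integral>\<^sup>+t. ennreal (pmass Q (trunc k (U t f))) * indicator {- real k..real k} t \<partial>lborel)
        \<le> ennreal ((dual_const * norm f) powr Q)" for k
      using loc[of k] by (simp only: energy_def)
    fix t :: real
    obtain k0 :: nat where k0: "\<bar>t\<bar> \<le> real k0" using real_arch_simple by blast
    have "(\<lambda>k. ennreal (pmass Q (trunc k (U t f)))) \<longlonglongrightarrow> ennreal (pmass Q (U t f))"
      by (intro tendsto_ennrealI pmass_trunc_tendsto)
    moreover have "\<forall>\<^sub>F k in sequentially. ennreal (pmass Q (trunc k (U t f))) = ennreal (pmass Q (trunc k (U t f))) * indicator {- real k..real k} t"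
      by (rule eventually_sequentiallyI[of k0]) (use k0 in \<open>auto simp: indicator_def\<close>)
    ultimately have "(\<lambda>k. ennreal (pmass Q (trunc k (U t f))) * indicator {- real k..real k} t) \<longlonglongrightarrow> ennreal (pmass Q (U t f))"
      by (rule Lim_transform_eventually)
    then show "(\<lambda>k. ennreal (pmass Q (trunc k (U t f))) * indicator {- real k..real k} t) \<longlonglongrightarrow> ennreal (pmass Q (U t f)) * indicator UNIV t"
      by simp
  qed
qed

text \<open>The Duhamel integral seen in the moving frame, with the outer group left off. Its
  increments are integrals over time intervals, so the dual estimate yields both bounds and
  convergence.\<close>

definition duhamel :: "(real \<Rightarrow> ell2) \<Rightarrow> real \<Rightarrow> ell2" where
  "duhamel z t = (LBINT s=ereal 0..ereal t. phase z s)"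

definition ret_const :: real where
  "ret_const = disp_const powr Q * hls_const Q"

lemma ret_const_pos: "0 < ret_const"
  using disp_const_pos hls_const_pos[OF Q_bounds(1)] by (simp add: ret_const_def)

lemma profile_mono: "S \<subseteq> T \<Longrightarrow> profile S w t \<le> profile T w t"
  unfolding profile_def by (intro mult_right_mono) (auto simp: indicator_def)

text \<open>The estimate is pointwise in time before it is integrated: by duality, the mass at time
  \<open>t\<close> is controlled by the fractional integral of the profile there. That kernel is
  positive, so the restriction to times between 0 and \<open>t\<close> is simply given up.\<close>

lemma retarded_strichartz:
  assumes z: "continuous_on UNIV z" and R: "\<And>t. norm (z t) \<le> R" and A: "0 < A" "energy Q UNIV z \<le> ennreal A"
  shows "energy Q UNIV (\<lambda>t. U t (duhamel z t)) \<le> ennreal (ret_const * A powr (Q - 1))"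
proof -
  define G where "G = profile UNIV z"
  have Gm [measurable]: "G \<in> borel_measurable borel" unfolding G_def by (intro profile_measurable z) simp
  note H = hls[OF Q_bounds(1) Gm, of "(R powr Q) powr ((Q - 1) / Q)" A]
  have G0: "0 \<le> G s" and GB: "G s \<le> (R powr Q) powr ((Q - 1) / Q)" for s
    unfolding G_def by (rule profile_nonneg, rule profile_le[OF R])
  have Gmass: "(\<integral>\<^sup>+t. ennreal (G t powr (Q / (Q - 1))) \<partial>lborel) \<le> ennreal A"
    unfolding G_def nn_integral_profile by (rule A)
  define F where "F t = enn2real (frac_int Q G t)" for t
  have fin: "frac_int Q G t = ennreal (F t)" for t using H(1)[OF G0 GB A(1) Gmass, of t] by (simp add: F_def)
  have F0: "0 \<le> F t" for t by (simp add: F_def)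
  have bound: "pmass Q (U t (duhamel z t)) \<le> (disp_const * F t) powr Q" for t
  proof (rule LIMSEQ_le_const2[OF pmass_trunc_tendsto], intro exI allI impI)
    fix L :: nat
    define x where "x = trunc L (U t (duhamel z t))"
    define P where "P = pmass Q x"
    have P0: "0 \<le> P" using Q_bounds by (simp add: P_def)
    have "P \<le> (disp_const * F t) powr Q"
    proof (cases "P = 0")
      case False
      then have P: "0 < P" using P0 by simp
      have "P = inner (nl x) (U t (duhamel z t))" unfolding P_def x_def by (rule inner_nl_trunc[OF Q_bounds(2), symmetric])
      also have "\<dots> = inner (U (- t) (nl x)) (duhamel z t)" by (rule inner_U[symmetric])
      finally have PI: "P = inner (U (- t) (nl x)) (duhamel z t)" .
      have "ennreal P \<le> ennreal \<bar>inner (U (- t) (nl x)) (duhamel z t)\<bar>" unfolding PI by (intro ennreal_leI) simp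
      also have "\<dots> \<le> ennreal (disp_const * P powr ((Q - 1) / Q)) * frac_int Q (profile {min 0 t..max 0 t} z) t"
        unfolding duhamel_def P_def by (rule inner_phase_integral_le[OF z refl])
      \<comment> \<open>The profile on the interval between 0 and \<open>t\<close> is replaced by
        the profile on all times, which only increases the integral.\<close>
      also have "\<dots> \<le> ennreal (disp_const * P powr ((Q - 1) / Q)) * frac_int Q G t"
        unfolding frac_int_def G_def by (intro mult_left_mono nn_integral_mono ennreal_leI profile_mono) auto
      also have "\<dots> = ennreal (disp_const * F t * P powr ((Q - 1) / Q))"
        unfolding fin using disp_const_pos F0[of t] by (simp add: ennreal_mult[symmetric] mult_ac)
      finally have le: "P \<le> disp_const * F t * P powr ((Q - 1) / Q)"
        using disp_const_pos F0[of t] by (subst (asm) ennreal_le_iff) auto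
      have eq: "P = P powr (1 / Q) * P powr ((Q - 1) / Q)"
        unfolding powr_add[symmetric] using P Q4 by (simp add: add_divide_distrib[symmetric])
      have "P powr (1 / Q) \<le> disp_const * F t"
        by (rule mult_right_le_imp_le[OF ord_eq_le_trans[OF eq[symmetric] le]]) (use P in simp)
      then have "(P powr (1 / Q)) powr Q \<le> (disp_const * F t) powr Q" using Q4 by (intro powr_mono2) auto
      moreover have "(P powr (1 / Q)) powr Q = P" using P Q4 by (simp add: powr_powr)
      ultimately show ?thesis by simp
    qed simp
    then show "pmass Q (trunc L (U t (duhamel z t))) \<le> (disp_const * F t) powr Q" by (simp add: P_def x_def)
  qed
  have "energy Q UNIV (\<lambda>t. U t (duhamel z t)) \<le> (\<integral>\<^sup>+t. ennreal (disp_const powr Q) * ennreal (F t powr Q) \<partial>lborel)"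
    unfolding energy_def
  proof (intro nn_integral_mono)
    fix t
    show "ennreal (pmass Q (U t (duhamel z t))) * indicator UNIV t \<le> ennreal (disp_const powr Q) * ennreal (F t powr Q)"
      using ennreal_leI[OF bound[of t]] by (simp add: powr_mult ennreal_mult)
  qed
  also have "\<dots> = ennreal (disp_const powr Q) * (\<integral>\<^sup>+t. ennreal (F t powr Q) \<partial>lborel)"
    unfolding F_def by (rule nn_integral_cmult) measurable
  also have "\<dots> \<le> ennreal (disp_const powr Q) * ennreal (hls_const Q * A powr (Q - 1))"
    unfolding F_def by (intro mult_left_mono H(2) G0 GB A Gmass) simp
  also have "\<dots> = ennreal (ret_const * A powr (Q - 1))"
    using hls_const_pos[OF Q_bounds(1)] by (simp add: ennreal_mult[symmetric] ret_const_def mult.assoc)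
  finally show ?thesis .
qed

end

subsection \<open>The nonlinear equation\<close>

text \<open>The factor \<open>1 / K\<close> is the gain that makes the solution map contract in the
  exponentially weighted norm.\<close>

lemma nn_integral_exp_abs_le:
  assumes K: "0 < K"
  shows "(\<integral>\<^sup>+s. ennreal (exp (K * \<bar>s\<bar>)) * indicator {min 0 t..max 0 t} s \<partial>lborel) \<le> ennreal (2 * exp (K * \<bar>t\<bar>) / K)"
proof -
  let ?f = "\<lambda>r. ennreal (exp (K * r)) * indicator {..\<bar>t\<bar>} r"
  have "(\<integral>\<^sup>+s. ennreal (exp (K * \<bar>s\<bar>)) * indicator {min 0 t..max 0 t} s \<partial>lborel) \<le> (\<integral>\<^sup>+s. ?f \<bar>s\<bar> \<partial>lborel)"
    by (intro nn_integral_mono) (auto simp: indicator_def min_def max_def split: if_splits)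
  also have "\<dots> \<le> 2 * (\<integral>\<^sup>+r. ?f r * indicator {0..} r \<partial>lborel)" by (rule nn_integral_abs_le) measurable
  also have "(\<integral>\<^sup>+r. ?f r * indicator {0..} r \<partial>lborel) = (\<integral>\<^sup>+r. ennreal (exp (K * r)) * indicator {0..\<bar>t\<bar>} r \<partial>lborel)"
    by (intro nn_integral_cong) (auto simp: indicator_def)
  also have "\<dots> = ennreal (exp (K * \<bar>t\<bar>) / K - exp (K * 0) / K)"
    by (rule nn_integral_FTC_Icc) (use K in \<open>auto intro!: derivative_eq_intros\<close>)
  also have "2 * \<dots> = ennreal (2 * (exp (K * \<bar>t\<bar>) / K - exp (K * 0) / K))"
    by (subst ennreal_mult') auto
  also have "\<dots> \<le> ennreal (2 * exp (K * \<bar>t\<bar>) / K)" using K by (intro ennreal_leI) (simp add: field_simps)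
  finally show ?thesis .
qed

lemma convergent_at_top:
  fixes J :: "real \<Rightarrow> 'a::banach"
  assumes C: "\<And>e. 0 < e \<Longrightarrow> \<exists>S. \<forall>s t. S \<le> s \<longrightarrow> s \<le> t \<longrightarrow> norm (J t - J s) \<le> e"
  shows "\<exists>l. (J \<longlongrightarrow> l) at_top"
proof -
  have "Cauchy (\<lambda>n. J (real n))"
  proof (rule CauchyI)
    fix e :: real assume "0 < e"
    then obtain S where S: "\<forall>s t. S \<le> s \<longrightarrow> s \<le> t \<longrightarrow> norm (J t - J s) \<le> e / 2" using C[of "e / 2"] by auto
    obtain N :: nat where N: "S \<le> real N" using real_arch_simple by blast
    have "norm (J (real m) - J (real n)) < e" if "N \<le> m" "N \<le> n" for m n
    proof -
      have "norm (J (real m) - J (real n)) \<le> e / 2"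
      proof (cases "m \<le> n")
        case True
        then show ?thesis using S[rule_format, of "real m" "real n"] N that by (simp add: norm_minus_commute)
      next
        case False
        then show ?thesis using S[rule_format, of "real n" "real m"] N that by simp
      qed
      then show ?thesis using \<open>0 < e\<close> by linarith
    qed
    then show "\<exists>M. \<forall>m\<ge>M. \<forall>n\<ge>M. norm (J (real m) - J (real n)) < e" by blast
  qed
  then obtain l where l: "(\<lambda>n. J (real n)) \<longlonglongrightarrow> l" by (auto simp: Cauchy_convergent_iff convergent_def)
  have "(J \<longlongrightarrow> l) at_top"
  proof (rule tendstoI)
    fix e :: real assume "0 < e"
    then obtain S where S: "\<forall>s t. S \<le> s \<longrightarrow> s \<le> t \<longrightarrow> norm (J t - J s) \<le> e / 2" using C[of "e / 2"] by auto
    have "dist (J s) l < e" if "S \<le> s" for s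
    proof -
      obtain N :: nat where N: "s \<le> real N" using real_arch_simple by blast
      have "norm (l - J s) \<le> e / 2"
      proof (rule LIMSEQ_le_const2)
        show "(\<lambda>n. norm (J (real n) - J s)) \<longlonglongrightarrow> norm (l - J s)" by (intro tendsto_intros l)
        have "norm (J (real n) - J s) \<le> e / 2" if "N \<le> n" for n
          using S[rule_format, OF \<open>S \<le> s\<close>, of "real n"] N that by simp
        then show "\<exists>N. \<forall>n\<ge>N. norm (J (real n) - J s) \<le> e / 2" by blast
      qed
      then show ?thesis using \<open>0 < e\<close> by (simp add: dist_norm norm_minus_commute)
    qed
    then show "\<forall>\<^sub>F s in at_top. dist (J s) l < e" by (rule eventually_at_top_linorderI)
  qed
  then show ?thesis ..
qed

lemma pmass_scaleC:
  assumes "2 \<le> Q" shows "pmass Q (c *\<^sub>C x) = cmod c powr Q * pmass Q x"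
  unfolding pmass_def coord_simps norm_mult powr_mult by (rule suminf_mult[OF summable_pmass[OF assms]])

lemma pmass_add_le:
  assumes Q: "2 \<le> Q" shows "pmass Q (x + y) \<le> 2 powr Q * (pmass Q x + pmass Q y)"
proof -
  have le: "cmod (coord (x + y) n) powr Q \<le> 2 powr Q * (cmod (coord x n) powr Q + cmod (coord y n) powr Q)" for n
  proof -
    let ?m = "max (cmod (coord x n)) (cmod (coord y n))"
    have "cmod (coord (x + y) n) \<le> 2 * ?m"
      using norm_triangle_ineq[of "coord x n" "coord y n"] by (simp add: coord_simps)
    then have "cmod (coord (x + y) n) powr Q \<le> (2 * ?m) powr Q" using Q by (intro powr_mono2) auto
    also have "\<dots> = 2 powr Q * ?m powr Q" by (rule powr_mult)
    also have "\<dots> \<le> 2 powr Q * (cmod (coord x n) powr Q + cmod (coord y n) powr Q)"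
      by (intro mult_left_mono) (auto simp: max_def)
    finally show ?thesis .
  qed
  have "pmass Q (x + y) \<le> (\<Sum>n. 2 powr Q * (cmod (coord x n) powr Q + cmod (coord y n) powr Q))"
    unfolding pmass_def[of Q "x + y"] by (intro suminf_le le summable_pmass Q summable_mult summable_add)
  also have "\<dots> = 2 powr Q * (\<Sum>n. cmod (coord x n) powr Q + cmod (coord y n) powr Q)"
    by (intro suminf_mult summable_add summable_pmass Q)
  also have "\<dots> = 2 powr Q * (pmass Q x + pmass Q y)"
    unfolding pmass_def by (simp add: suminf_add summable_pmass[OF Q])
  finally show ?thesis .
qed

lemma energy_mono: "S \<subseteq> T \<Longrightarrow> energy Q S u \<le> energy Q T u"
  unfolding energy_def by (intro nn_integral_mono mult_left_mono) (auto simp: indicator_def)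

context dispersive_group
begin

lemma duhamel_diff:
  assumes z: "continuous_on UNIV z"
  shows "duhamel z t - duhamel z s = (LBINT r=ereal s..ereal t. phase z r)"
proof -
  have "(LBINT r=ereal 0..ereal s. phase z r) + (LBINT r=ereal s..ereal t. phase z r) = (LBINT r=ereal 0..ereal t. phase z r)"
    by (rule interval_integral_sum) (simp only: ereal_min[symmetric] ereal_max[symmetric] phase_integrable[OF z])
  then show ?thesis unfolding duhamel_def by (simp add: algebra_simps)
qed

lemma bounded_on_Icc:
  fixes w :: "real \<Rightarrow> ell2"
  assumes "continuous_on UNIV w"
  shows "\<exists>R\<ge>0. \<forall>t. a \<le> t \<longrightarrow> t \<le> b \<longrightarrow> norm (w t) \<le> R"
proof -
  have cnorm: "continuous_on {a..b} (\<lambda>t. norm (w t))"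
    by (intro continuous_intros continuous_on_subset[OF assms]) simp
  obtain R where "\<forall>x\<in>(\<lambda>t. norm (w t)) ` {a..b}. norm x \<le> R"
    using compact_imp_bounded[OF compact_continuous_image[OF cnorm compact_Icc]]
    unfolding bounded_iff by (elim exE)
  then have "norm (w t) \<le> max R 0" if "a \<le> t" "t \<le> b" for t using that by (simp add: le_max_iff_disj)
  then show ?thesis by (intro exI[of _ "max R 0"]) auto
qed

lemma continuous_duhamel:
  assumes z: "continuous_on UNIV z" shows "continuous_on UNIV (duhamel z)"
proof -
  have "isCont (duhamel z) t" for t
  proof -
    obtain B where B: "0 \<le> B" "\<forall>s. t - 1 \<le> s \<longrightarrow> s \<le> t + 1 \<longrightarrow> norm (phase z s) \<le> B"
      using bounded_on_Icc[OF continuous_phase[OF z], of "t - 1" "t + 1"] by (elim exE conjE)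
    have "norm (duhamel z s - duhamel z t) \<le> B * norm (s - t)" if s: "\<bar>s - t\<bar> < 1" for s
    proof -
      have "ennreal (norm (duhamel z s - duhamel z t)) \<le> (\<integral>\<^sup>+r. ennreal (norm (phase z r)) * indicator {min t s..max t s} r \<partial>lborel)"
        unfolding duhamel_diff[OF z] by (rule norm_interval_integral_le[OF phase_integrable[OF z]])
      also have "\<dots> \<le> (\<integral>\<^sup>+r. ennreal B * indicator {min t s..max t s} r \<partial>lborel)"
      proof (intro nn_integral_mono)
        fix r
        show "ennreal (norm (phase z r)) * indicator {min t s..max t s} r \<le> ennreal B * indicator {min t s..max t s} r"
        proof (cases "r \<in> {min t s..max t s}")
          case True
          then have "norm (phase z r) \<le> B" using s by (intro B(2)[rule_format]) (auto simp: min_def max_def split: if_splits)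
          then show ?thesis using True by (simp add: ennreal_leI)
        qed simp
      qed
      also have "\<dots> = ennreal B * ennreal (max t s - min t s)"
        by (simp add: nn_integral_cmult_indicator)
      also have "\<dots> = ennreal (B * norm (s - t))"
        using B(1) by (simp add: ennreal_mult'[symmetric] max_def min_def abs_if)
      finally show ?thesis using B(1) by (subst (asm) ennreal_le_iff) auto
    qed
    then have "\<forall>\<^sub>F s in at t. norm (duhamel z s - duhamel z t) \<le> B * norm (s - t)"
      unfolding eventually_at by (intro exI[of _ 1]) (simp add: dist_norm)
    moreover have "((\<lambda>s. B * norm (s - t)) \<longlongrightarrow> B * norm (t - t)) (at t)" by (intro tendsto_intros)
    then have "((\<lambda>s. B * norm (s - t)) \<longlongrightarrow> 0) (at t)" by (simp only: diff_self norm_zero mult_zero_right)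
    ultimately have "((\<lambda>s. duhamel z s - duhamel z t) \<longlongrightarrow> 0) (at t)" by (rule Lim_null_comparison)
    then show ?thesis unfolding isCont_def by (rule LIM_zero_cancel)
  qed
  then show ?thesis by (simp add: continuous_on_eq_continuous_at)
qed

section \<open>The solution map and its fixed points\<close>

definition solution_map :: "real \<Rightarrow> ell2 \<Rightarrow> (real \<Rightarrow> ell2) \<Rightarrow> real \<Rightarrow> ell2" where
  "solution_map \<mu> u0 u t = U t (u0 - (\<i> * complex_of_real \<mu>) *\<^sub>C duhamel u t)"

lemma continuous_solution_map:
  "continuous_on UNIV u \<Longrightarrow> continuous_on UNIV (solution_map \<mu> u0 u)"
  unfolding solution_map_def[abs_def]
  by (intro continuous_on_U continuous_intros bounded_linear.continuous_on[OF bounded_linear_scaleC] continuous_duhamel)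

text \<open>The map is Lipschitz on balls of \<open>ell2\<close>, and integrating the weight gains
  \<open>2 / K\<close>; the factor 4 in the condition on \<open>K\<close> absorbs this 2 and leaves
  one half. All assumptions concern times up to \<open>|t|\<close>, so bounds on compact intervals
  are enough to apply it.\<close>

lemma solution_map_diff_le:
  assumes u: "continuous_on UNIV u" and v: "continuous_on UNIV v" and K: "0 < K" "4 * \<bar>\<mu>\<bar> * ((Q - 1) * R powr (Q - 2)) \<le> K"
    and bd: "\<And>s. \<bar>s\<bar> \<le> \<bar>t\<bar> \<Longrightarrow> norm (u s) \<le> R" "\<And>s. \<bar>s\<bar> \<le> \<bar>t\<bar> \<Longrightarrow> norm (v s) \<le> R"
    and M: "0 \<le> M" "\<And>s. \<bar>s\<bar> \<le> \<bar>t\<bar> \<Longrightarrow> norm (u s - v s) \<le> M * exp (K * \<bar>s\<bar>)"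
  shows "norm (solution_map \<mu> u0 u t - solution_map \<mu> u0 v t) \<le> M / 2 * exp (K * \<bar>t\<bar>)"
proof -
  define D where "D = (Q - 1) * R powr (Q - 2)"
  have D: "0 \<le> D" using Q4 by (simp add: D_def)
  have "duhamel u t - duhamel v t = (LBINT s=ereal 0..ereal t. phase u s - phase v s)"
    unfolding duhamel_def by (rule interval_lebesgue_integral_diff(2)[symmetric]; rule phase_integrable; fact)
  then have "ennreal (norm (duhamel u t - duhamel v t)) = ennreal (norm (LBINT s=ereal 0..ereal t. phase u s - phase v s))"
    by (simp only:)
  also have "\<dots> \<le> (\<integral>\<^sup>+s. ennreal (norm (phase u s - phase v s)) * indicator {min 0 t..max 0 t} s \<partial>lborel)"
    by (intro norm_interval_integral_le interval_integrable_continuous continuous_intros continuous_phase u v)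
  also have "\<dots> \<le> (\<integral>\<^sup>+s. ennreal (D * M) * (ennreal (exp (K * \<bar>s\<bar>)) * indicator {min 0 t..max 0 t} s) \<partial>lborel)"
  proof (intro nn_integral_mono)
    fix s
    show "ennreal (norm (phase u s - phase v s)) * indicator {min 0 t..max 0 t} s
        \<le> ennreal (D * M) * (ennreal (exp (K * \<bar>s\<bar>)) * indicator {min 0 t..max 0 t} s)"
    proof (cases "s \<in> {min 0 t..max 0 t}")
      case True
      then have s: "\<bar>s\<bar> \<le> \<bar>t\<bar>" by (auto simp: min_def max_def split: if_splits)
      have "norm (phase u s - phase v s) = norm (nl (u s) - nl (v s))" unfolding U_diff[symmetric] by simp
      also have "\<dots> \<le> D * norm (u s - v s)" unfolding D_def by (intro norm_nl_diff_le Q_bounds bd s)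
      also have "\<dots> \<le> D * (M * exp (K * \<bar>s\<bar>))" by (intro mult_left_mono M(2) s D)
      also have "\<dots> = (D * M) * exp (K * \<bar>s\<bar>)" by simp
      finally have "ennreal (norm (phase u s - phase v s)) \<le> ennreal ((D * M) * exp (K * \<bar>s\<bar>))" by (rule ennreal_leI)
      also have "\<dots> = ennreal (D * M) * ennreal (exp (K * \<bar>s\<bar>))" using D M(1) by (intro ennreal_mult') simp
      finally show ?thesis using True by simp
    qed simp
  qed
  also have "\<dots> = ennreal (D * M) * (\<integral>\<^sup>+s. ennreal (exp (K * \<bar>s\<bar>)) * indicator {min 0 t..max 0 t} s \<partial>lborel)"
    by (rule nn_integral_cmult) measurable
  also have "\<dots> \<le> ennreal (D * M) * ennreal (2 * exp (K * \<bar>t\<bar>) / K)"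
    by (intro mult_left_mono nn_integral_exp_abs_le K) simp
  also have "\<dots> = ennreal (D * M * (2 * exp (K * \<bar>t\<bar>) / K))" using D M(1) by (intro ennreal_mult'[symmetric]) simp
  finally have d: "norm (duhamel u t - duhamel v t) \<le> D * M * (2 * exp (K * \<bar>t\<bar>) / K)"
    using D M(1) K(1) by (subst (asm) ennreal_le_iff) auto
  have "solution_map \<mu> u0 u t - solution_map \<mu> u0 v t = U t ((\<i> * complex_of_real \<mu>) *\<^sub>C (duhamel v t - duhamel u t))"
    unfolding solution_map_def U_diff[symmetric] by (rule arg_cong[where f = "U t"]) (rule ell2_eqI, simp add: coord_simps algebra_simps)
  then have "norm (solution_map \<mu> u0 u t - solution_map \<mu> u0 v t) = \<bar>\<mu>\<bar> * norm (duhamel u t - duhamel v t)"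
    by (simp add: norm_scaleC norm_mult norm_minus_commute)
  also have "\<dots> \<le> \<bar>\<mu>\<bar> * (D * M * (2 * exp (K * \<bar>t\<bar>) / K))" by (intro mult_left_mono d) simp
  also have "\<dots> = (4 * \<bar>\<mu>\<bar> * D) * (M * exp (K * \<bar>t\<bar>) / (2 * K))" by simp
  also have "\<dots> \<le> K * (M * exp (K * \<bar>t\<bar>) / (2 * K))" using K M(1) by (intro mult_right_mono) (auto simp: D_def)
  also have "\<dots> = M / 2 * exp (K * \<bar>t\<bar>)" using K by simp
  finally show ?thesis .
qed

text \<open>On the interval up to \<open>|t|\<close> both solutions are bounded by continuity, and
  the weighted contraction is iterated: the difference is at most \<open>R / 2 ^ k\<close> times the
  weight for every \<open>k\<close>.\<close>

lemma solution_map_unique: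
  assumes u: "continuous_on UNIV u" "\<And>t. u t = solution_map \<mu> u0 u t"
    and v: "continuous_on UNIV v" "\<And>t. v t = solution_map \<mu> u0 v t"
  shows "u = v"
proof (rule ext)
  fix t
  obtain R1 where R1: "0 \<le> R1" "\<forall>s. - \<bar>t\<bar> \<le> s \<longrightarrow> s \<le> \<bar>t\<bar> \<longrightarrow> norm (u s) \<le> R1"
    using bounded_on_Icc[OF u(1), of "- \<bar>t\<bar>" "\<bar>t\<bar>"] by (elim exE conjE)
  obtain R2 where R2: "0 \<le> R2" "\<forall>s. - \<bar>t\<bar> \<le> s \<longrightarrow> s \<le> \<bar>t\<bar> \<longrightarrow> norm (v s) \<le> R2"
    using bounded_on_Icc[OF v(1), of "- \<bar>t\<bar>" "\<bar>t\<bar>"] by (elim exE conjE)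
  define R where "R = R1 + R2"
  have R: "norm (u s) \<le> R" "norm (v s) \<le> R" "norm (u s - v s) \<le> R" if "\<bar>s\<bar> \<le> \<bar>t\<bar>" for s
    using R1(2)[rule_format, of s] R2(2)[rule_format, of s] R1(1) R2(1) norm_triangle_ineq4[of "u s" "v s"] that unfolding R_def by linarith+
  define K where "K = 4 * \<bar>\<mu>\<bar> * ((Q - 1) * R powr (Q - 2)) + 1"
  have K: "0 < K" "4 * \<bar>\<mu>\<bar> * ((Q - 1) * R powr (Q - 2)) \<le> K" using Q4 by (auto simp: K_def intro!: add_nonneg_pos)
  have it: "\<forall>s. \<bar>s\<bar> \<le> \<bar>t\<bar> \<longrightarrow> norm (u s - v s) \<le> R / 2 ^ k * exp (K * \<bar>s\<bar>)" for k
  proof (induction k)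
    case 0
    show ?case
    proof (intro allI impI)
      fix s assume s: "\<bar>s\<bar> \<le> \<bar>t\<bar>"
      have "R * 1 \<le> R * exp (K * \<bar>s\<bar>)" using K R1(1) R2(1) by (intro mult_left_mono) (auto simp: R_def)
      then show "norm (u s - v s) \<le> R / 2 ^ 0 * exp (K * \<bar>s\<bar>)" using R(3)[OF s] by simp
    qed
  next
    case (Suc k)
    show ?case
    proof (intro allI impI)
      fix s assume s: "\<bar>s\<bar> \<le> \<bar>t\<bar>"
      have "norm (solution_map \<mu> u0 u s - solution_map \<mu> u0 v s) \<le> (R / 2 ^ k) / 2 * exp (K * \<bar>s\<bar>)"
      proof (rule solution_map_diff_le[OF u(1) v(1) K])
        fix r assume "\<bar>r\<bar> \<le> \<bar>s\<bar>"
        then have r: "\<bar>r\<bar> \<le> \<bar>t\<bar>" using s by linarith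
        show "norm (u r) \<le> R" "norm (v r) \<le> R" by (rule R[OF r])+
        show "norm (u r - v r) \<le> R / 2 ^ k * exp (K * \<bar>r\<bar>)" using Suc.IH r by blast
      qed (use R1(1) R2(1) in \<open>simp add: R_def\<close>)
      then show "norm (u s - v s) \<le> R / 2 ^ Suc k * exp (K * \<bar>s\<bar>)"
        unfolding u(2)[of s, symmetric] v(2)[of s, symmetric] by (simp add: mult.commute)
    qed
  qed
  have "(\<lambda>k. R * exp (K * \<bar>t\<bar>) * (1 / 2) ^ k) \<longlonglongrightarrow> R * exp (K * \<bar>t\<bar>) * 0" by (intro tendsto_intros LIMSEQ_power_zero) simp
  moreover have "norm (u t - v t) \<le> R * exp (K * \<bar>t\<bar>) * (1 / 2) ^ k" for k
  proof -
    have "R / 2 ^ k * exp (K * \<bar>t\<bar>) = R * exp (K * \<bar>t\<bar>) * (1 / 2) ^ k" by (simp add: power_one_over)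
    moreover have "norm (u t - v t) \<le> R / 2 ^ k * exp (K * \<bar>t\<bar>)" by (rule it[rule_format]) simp
    ultimately show ?thesis by (simp only:)
  qed
  then have "\<exists>N. \<forall>k\<ge>N. norm (u t - v t) \<le> R * exp (K * \<bar>t\<bar>) * (1 / 2) ^ k" by (intro exI allI impI)
  ultimately have "norm (u t - v t) \<le> R * exp (K * \<bar>t\<bar>) * 0" by (rule LIMSEQ_le_const)
  then show "u t = v t" by simp
qed

lemma norm_duhamel_le:
  assumes z: "continuous_on UNIV z" and A: "0 < A" "energy Q UNIV z \<le> ennreal A"
  shows "norm (duhamel z t) \<le> dual_const * A powr ((Q - 1) / Q)"
proof (cases "0 \<le> t")
  case True
  show ?thesis unfolding duhamel_def
    by (rule dual_strichartz[OF z True A(1) order_trans[OF energy_mono A(2)]]) simp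
next
  case False
  have "norm (duhamel z t) = norm (LBINT s=ereal t..ereal 0. phase z s)"
    unfolding duhamel_def by (subst interval_integral_endpoints_reverse) simp
  also have "\<dots> \<le> dual_const * A powr ((Q - 1) / Q)"
    by (rule dual_strichartz[OF z _ A(1) order_trans[OF energy_mono A(2)]]) (use False in auto)
  finally show ?thesis .
qed

lemma norm_solution_map_le:
  assumes z: "continuous_on UNIV z" and A: "0 < A" "energy Q UNIV z \<le> ennreal A"
  shows "norm (solution_map \<mu> u0 z t) \<le> norm u0 + \<bar>\<mu>\<bar> * (dual_const * A powr ((Q - 1) / Q))"
proof -
  have "norm (solution_map \<mu> u0 z t) \<le> norm u0 + \<bar>\<mu>\<bar> * norm (duhamel z t)"
    using norm_triangle_ineq4[of u0 "(\<i> * complex_of_real \<mu>) *\<^sub>C duhamel z t"]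
    by (simp add: solution_map_def norm_scaleC norm_mult)
  also have "\<dots> \<le> norm u0 + \<bar>\<mu>\<bar> * (dual_const * A powr ((Q - 1) / Q))"
    by (intro add_left_mono mult_left_mono norm_duhamel_le[OF z A]) simp
  finally show ?thesis .
qed

lemma energy_solution_map_le:
  assumes z: "continuous_on UNIV z" and R: "\<And>t. norm (z t) \<le> R" and A: "0 < A" "energy Q UNIV z \<le> ennreal A"
  shows "energy Q UNIV (solution_map \<mu> u0 z)
    \<le> ennreal (2 powr Q * ((dual_const * norm u0) powr Q + \<bar>\<mu>\<bar> powr Q * (ret_const * A powr (Q - 1))))"
proof -
  let ?c = "- (\<i> * complex_of_real \<mu>)"
  have cU: "continuous_on UNIV (\<lambda>t. U t u0)" and cD: "continuous_on UNIV (\<lambda>t. U t (duhamel z t))"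
    by (intro continuous_on_U continuous_intros continuous_duhamel z)+
  have [measurable]: "(\<lambda>t. U t u0) \<in> borel_measurable borel" "(\<lambda>t. U t (duhamel z t)) \<in> borel_measurable borel"
    by (rule measurable_of_continuous, fact)+
  have eq: "solution_map \<mu> u0 z t = U t u0 + ?c *\<^sub>C U t (duhamel z t)" for t
  proof -
    have "u0 - (\<i> * complex_of_real \<mu>) *\<^sub>C duhamel z t = u0 + ?c *\<^sub>C duhamel z t"
      by (rule ell2_eqI) (simp add: coord_simps)
    then show ?thesis unfolding solution_map_def by (simp only: U_add U_scaleC)
  qed
  have "energy Q UNIV (solution_map \<mu> u0 z)
      \<le> (\<integral>\<^sup>+t. ennreal (2 powr Q) * (ennreal (pmass Q (U t u0)) + ennreal (\<bar>\<mu>\<bar> powr Q) * ennreal (pmass Q (U t (duhamel z t)))) \<partial>lborel)"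
    unfolding energy_def
  proof (intro nn_integral_mono)
    fix t
    have "pmass Q (solution_map \<mu> u0 z t) \<le> 2 powr Q * (pmass Q (U t u0) + pmass Q (?c *\<^sub>C U t (duhamel z t)))"
      unfolding eq by (rule pmass_add_le[OF Q_bounds(2)])
    also have "pmass Q (?c *\<^sub>C U t (duhamel z t)) = \<bar>\<mu>\<bar> powr Q * pmass Q (U t (duhamel z t))"
      unfolding pmass_scaleC[OF Q_bounds(2)] by (simp add: norm_mult)
    finally have "ennreal (pmass Q (solution_map \<mu> u0 z t))
        \<le> ennreal (2 powr Q * (pmass Q (U t u0) + \<bar>\<mu>\<bar> powr Q * pmass Q (U t (duhamel z t))))" by (rule ennreal_leI)
    then show "ennreal (pmass Q (solution_map \<mu> u0 z t)) * indicator UNIV t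
        \<le> ennreal (2 powr Q) * (ennreal (pmass Q (U t u0)) + ennreal (\<bar>\<mu>\<bar> powr Q) * ennreal (pmass Q (U t (duhamel z t))))"
      using Q_bounds by (simp add: ennreal_mult)
  qed
  also have "\<dots> = ennreal (2 powr Q) * (energy Q UNIV (\<lambda>t. U t u0) + ennreal (\<bar>\<mu>\<bar> powr Q) * energy Q UNIV (\<lambda>t. U t (duhamel z t)))"
    unfolding energy_def by (simp add: nn_integral_add nn_integral_cmult)
  also have "\<dots> \<le> ennreal (2 powr Q) * (ennreal ((dual_const * norm u0) powr Q) + ennreal (\<bar>\<mu>\<bar> powr Q) * ennreal (ret_const * A powr (Q - 1)))"
    by (intro mult_left_mono add_mono homogeneous_strichartz retarded_strichartz[OF z R A]) simp_all
  also have "\<dots> = ennreal (2 powr Q * ((dual_const * norm u0) powr Q + \<bar>\<mu>\<bar> powr Q * (ret_const * A powr (Q - 1))))"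
    using ret_const_pos by (simp add: ennreal_mult)
  finally show ?thesis .
qed

primrec picard :: "real \<Rightarrow> ell2 \<Rightarrow> nat \<Rightarrow> real \<Rightarrow> ell2" where
  "picard \<mu> u0 0 = (\<lambda>t. 0)"
| "picard \<mu> u0 (Suc k) = solution_map \<mu> u0 (picard \<mu> u0 k)"

lemma continuous_picard: "continuous_on UNIV (picard \<mu> u0 k)"
  by (induction k) (auto intro: continuous_solution_map)

text \<open>Convergence in \<open>ell2\<close> passes to each finite partial sum of the mass.
  Fatou's lemma is therefore used twice, first in the sequence with finitely many coordinates, then
  in the number of coordinates.\<close>

lemma energy_le_of_tendsto:
  assumes cont: "\<And>k. continuous_on UNIV (v k)" and lim: "\<And>t. (\<lambda>k. v k t) \<longlonglongrightarrow> u t"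
    and A: "\<And>k. energy Q UNIV (v k) \<le> A"
  shows "energy Q UNIV u \<le> A"
proof -
  have [measurable]: "v k \<in> borel_measurable borel" for k by (rule measurable_of_continuous[OF cont])
  have [measurable]: "u \<in> borel_measurable borel"
    by (rule borel_measurable_LIMSEQ_metric[OF _ lim]) measurable
  have Q0: "0 < Q" using Q4 by simp
  have L: "(\<integral>\<^sup>+t. ennreal (pmass Q (trunc L (u t))) \<partial>lborel) \<le> A" for L
  proof (rule nn_integral_le_of_tendsto)
    show "(\<lambda>t. ennreal (pmass Q (trunc L (v k t)))) \<in> borel_measurable lborel" for k
      unfolding pmass_trunc[OF Q0] by measurable
    show "(\<lambda>k. ennreal (pmass Q (trunc L (v k t)))) \<longlonglongrightarrow> ennreal (pmass Q (trunc L (u t)))" for t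
    proof -
      have "(\<lambda>k. cmod (coord (v k t) n) powr Q) \<longlonglongrightarrow> cmod (coord (u t) n) powr Q" for n
        using Q0 by (intro tendsto_powr' tendsto_const tendsto_norm bounded_linear.tendsto[OF bounded_linear_coord lim]) simp
      then show ?thesis unfolding pmass_trunc[OF Q0] by (intro tendsto_ennrealI tendsto_sum)
    qed
    show "(\<integral>\<^sup>+t. ennreal (pmass Q (trunc L (v k t))) \<partial>lborel) \<le> A" for k
    proof -
      have "(\<integral>\<^sup>+t. ennreal (pmass Q (trunc L (v k t))) \<partial>lborel) \<le> energy Q UNIV (v k)"
        unfolding energy_def pmass_trunc[OF Q0]
        by (intro nn_integral_mono) (simp add: ennreal_leI sum_powr_le_pmass[OF Q_bounds(2)])
      then show ?thesis using A[of k] by (rule order_trans)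
    qed
  qed
  have "(\<integral>\<^sup>+t. ennreal (pmass Q (u t)) \<partial>lborel) \<le> A"
  proof (rule nn_integral_le_of_tendsto[OF _ _ L])
    show "(\<lambda>t. ennreal (pmass Q (trunc L (u t)))) \<in> borel_measurable lborel" for L
      unfolding pmass_trunc[OF Q0] by measurable
    show "(\<lambda>L. ennreal (pmass Q (trunc L (u t)))) \<longlonglongrightarrow> ennreal (pmass Q (u t))" for t
      by (intro tendsto_ennrealI pmass_trunc_tendsto)
  qed
  then show ?thesis by (simp add: energy_def)
qed

text \<open>The condition on \<open>A\<close> keeps the space-time mass of the iterates below
  \<open>A\<close>, and the dual estimate then keeps their \<open>ell2\<close> norm below
  \<open>R\<close> at all times. With this uniform bound the weighted contraction applies with a
  single \<open>K\<close>, and the limit inherits both bounds.\<close>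

lemma solution_exists:
  assumes A: "0 < A" "2 powr Q * ((dual_const * norm u0) powr Q + \<bar>\<mu>\<bar> powr Q * (ret_const * A powr (Q - 1))) \<le> A"
  shows "\<exists>u. continuous_on UNIV u \<and> energy Q UNIV u \<le> ennreal A \<and> (\<forall>t. u t = solution_map \<mu> u0 u t)"
proof -
  let ?u = "picard \<mu> u0"
  define R where "R = norm u0 + \<bar>\<mu>\<bar> * (dual_const * A powr ((Q - 1) / Q))"
  have R0: "0 \<le> R" using dual_const_pos by (simp add: R_def)
  have inv: "(\<forall>t. norm (?u k t) \<le> R) \<and> energy Q UNIV (?u k) \<le> ennreal A" for k
  proof (induction k)
    case 0
    have "pmass Q 0 = 0" by (simp add: pmass_def coord_simps)
    then show ?case using R0 by (simp add: energy_def)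
  next
    case (Suc k)
    have "energy Q UNIV (?u (Suc k)) \<le> ennreal (2 powr Q * ((dual_const * norm u0) powr Q + \<bar>\<mu>\<bar> powr Q * (ret_const * A powr (Q - 1))))"
      using Suc.IH A(1) by (simp only: picard.simps) (intro energy_solution_map_le[of _ R] continuous_picard, auto)
    also have "\<dots> \<le> ennreal A" by (rule ennreal_leI[OF A(2)])
    finally have "energy Q UNIV (?u (Suc k)) \<le> ennreal A" .
    moreover have "norm (?u (Suc k) t) \<le> R" for t
      unfolding picard.simps R_def using Suc.IH A(1) by (intro norm_solution_map_le continuous_picard) auto
    ultimately show ?case by blast
  qed
  have bR: "norm (?u k t) \<le> R" for k t by (rule spec[OF conjunct1[OF inv]])
  define K where "K = 4 * \<bar>\<mu>\<bar> * ((Q - 1) * R powr (Q - 2)) + 1"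
  have K: "0 < K" "4 * \<bar>\<mu>\<bar> * ((Q - 1) * R powr (Q - 2)) \<le> K" using Q4 by (auto simp: K_def intro!: add_nonneg_pos)
  have step: "\<forall>t. norm (?u (Suc k) t - ?u k t) \<le> R / 2 ^ k * exp (K * \<bar>t\<bar>)" for k
  proof (induction k)
    case 0
    show ?case
    proof
      fix t
      have "R * 1 \<le> R * exp (K * \<bar>t\<bar>)" using K R0 by (intro mult_left_mono) auto
      then show "norm (?u (Suc 0) t - ?u 0 t) \<le> R / 2 ^ 0 * exp (K * \<bar>t\<bar>)" using bR[of "Suc 0" t] by simp
    qed
  next
    case (Suc k)
    show ?case
    proof
      fix t
      have "norm (solution_map \<mu> u0 (?u (Suc k)) t - solution_map \<mu> u0 (?u k) t) \<le> (R / 2 ^ k) / 2 * exp (K * \<bar>t\<bar>)"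
        by (rule solution_map_diff_le[OF continuous_picard continuous_picard K bR bR _ spec[OF Suc.IH]]) (use R0 in simp)
      then show "norm (?u (Suc (Suc k)) t - ?u (Suc k) t) \<le> R / 2 ^ Suc k * exp (K * \<bar>t\<bar>)"
        by (simp only: picard.simps(2) power_Suc2 divide_divide_eq_left)
    qed
  qed
  \<comment> \<open>The sum of the geometric series of steps; it bounds the distance of the
    \<open>k\<close>-th iterate from the limit after division by \<open>2 ^ k\<close>.\<close>
  define B where "B t = 2 * R * exp (K * \<bar>t\<bar>)" for t
  have B0: "0 \<le> B t" for t using R0 by (simp add: B_def)
  have far: "norm (?u (k + j) t - ?u k t) \<le> B t / 2 ^ k - B t / 2 ^ (k + j)" for k j t
  proof (induction j)
    case (Suc j)
    have "norm (?u (k + Suc j) t - ?u k t) \<le> norm (?u (Suc (k + j)) t - ?u (k + j) t) + norm (?u (k + j) t - ?u k t)"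
      using norm_triangle_ineq[of "?u (Suc (k + j)) t - ?u (k + j) t" "?u (k + j) t - ?u k t"] by simp
    also have "\<dots> \<le> R / 2 ^ (k + j) * exp (K * \<bar>t\<bar>) + (B t / 2 ^ k - B t / 2 ^ (k + j))"
      by (rule add_mono[OF spec[OF step] Suc.IH])
    also have "\<dots> = B t / 2 ^ k - B t / 2 ^ (k + Suc j)" by (simp add: B_def field_simps)
    finally show ?case .
  qed simp
  have far': "norm (?u m t - ?u k t) \<le> B t / 2 ^ k" if "k \<le> m" for k m t
  proof -
    have "norm (?u m t - ?u k t) \<le> B t / 2 ^ k - B t / 2 ^ m" using far[of k "m - k" t] that by simp
    moreover have "0 \<le> B t / 2 ^ m" using B0[of t] by simp
    ultimately show ?thesis by linarith
  qed
  have B_lim: "(\<lambda>k. B t / 2 ^ k) \<longlonglongrightarrow> 0" for t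
  proof -
    have "(\<lambda>k. B t * (1 / 2) ^ k) \<longlonglongrightarrow> B t * 0" by (intro tendsto_intros LIMSEQ_power_zero) simp
    then show ?thesis by (simp add: power_one_over)
  qed
  have "\<exists>l. (\<lambda>k. ?u k t) \<longlonglongrightarrow> l" for t
  proof -
    have "Cauchy (\<lambda>k. ?u k t)"
    proof (rule CauchyI)
      fix e :: real assume e: "0 < e"
      obtain N where N: "B t / 2 ^ N < e / 2"
        using order_tendstoD(2)[OF B_lim[of t], of "e / 2"] e unfolding eventually_sequentially by auto
      have "norm (?u m t - ?u n t) < e" if "N \<le> m" "N \<le> n" for m n
      proof -
        have "norm (?u m t - ?u n t) \<le> norm (?u m t - ?u N t) + norm (?u n t - ?u N t)"
          using norm_triangle_ineq4[of "?u m t - ?u N t" "?u n t - ?u N t"] by simp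
        then show ?thesis using far'[OF that(1), of t] far'[OF that(2), of t] N by linarith
      qed
      then show "\<exists>M. \<forall>m\<ge>M. \<forall>n\<ge>M. norm (?u m t - ?u n t) < e" by blast
    qed
    then show ?thesis by (simp add: Cauchy_convergent_iff convergent_def)
  qed
  then have "\<exists>u. \<forall>t. (\<lambda>k. ?u k t) \<longlonglongrightarrow> u t" by (intro choice allI)
  then obtain u where u: "\<And>t. (\<lambda>k. ?u k t) \<longlonglongrightarrow> u t" by blast
  have uk: "norm (u t - ?u k t) \<le> B t / 2 ^ k" for k t
  proof (rule LIMSEQ_le_const2)
    show "(\<lambda>m. norm (?u m t - ?u k t)) \<longlonglongrightarrow> norm (u t - ?u k t)" by (intro tendsto_intros u)
    show "\<exists>N. \<forall>m\<ge>N. norm (?u m t - ?u k t) \<le> B t / 2 ^ k" using far' by blast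
  qed
  have uR: "norm (u t) \<le> R" for t
    by (rule LIMSEQ_le_const2[OF tendsto_norm[OF u]]) (use bR in blast)
  have cu: "continuous_on UNIV u"
  proof -
    \<comment> \<open>The weight grows with time, so convergence is uniform on bounded intervals
      only; open ones suffice for continuity at each point.\<close>
    have "continuous_on {- T<..<T} u" for T
    proof (rule uniform_limit_theorem)
      show "\<forall>\<^sub>F k in sequentially. continuous_on {- T<..<T} (?u k)"
        by (intro always_eventually allI continuous_on_subset[OF continuous_picard]) simp
      show "uniform_limit {- T<..<T} ?u u sequentially"
      proof (rule uniform_limitI)
        fix e :: real assume "0 < e"
        have "\<forall>\<^sub>F k in sequentially. B T / 2 ^ k < e" by (rule order_tendstoD(2)[OF B_lim]) fact
        then show "\<forall>\<^sub>F k in sequentially. \<forall>t\<in>{- T<..<T}. dist (?u k t) (u t) < e"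
        proof eventually_elim
          case (elim k)
          show ?case
          proof
            fix t assume "t \<in> {- T<..<T}"
            then have "B t \<le> B T" unfolding B_def using R0 K by (intro mult_left_mono) auto
            then have "B t / 2 ^ k \<le> B T / 2 ^ k" by (rule divide_right_mono) simp
            with uk[of t k] elim show "dist (?u k t) (u t) < e" by (simp add: dist_norm norm_minus_commute)
          qed
        qed
      qed
    qed simp
    then have "isCont u t" for t
    proof -
      have "t \<in> {- (\<bar>t\<bar> + 1)<..<\<bar>t\<bar> + 1}" by auto
      with \<open>\<And>T. continuous_on {- T<..<T} u\<close>[of "\<bar>t\<bar> + 1"] show ?thesis
        by (simp add: continuous_on_eq_continuous_at)
    qed
    then show ?thesis by (simp add: continuous_on_eq_continuous_at)
  qed
  have "u t = solution_map \<mu> u0 u t" for t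
  proof -
    have "norm (?u (Suc k) t - solution_map \<mu> u0 u t) \<le> B t / 2 ^ k" for k
    proof -
      have "norm (solution_map \<mu> u0 (?u k) t - solution_map \<mu> u0 u t) \<le> (2 * R / 2 ^ k) / 2 * exp (K * \<bar>t\<bar>)"
      proof (rule solution_map_diff_le[OF continuous_picard cu K bR uR])
        show "norm (?u k s - u s) \<le> 2 * R / 2 ^ k * exp (K * \<bar>s\<bar>)" for s
          using uk[of s k] by (simp add: B_def norm_minus_commute)
      qed (use R0 in simp)
      also have "\<dots> \<le> B t / 2 ^ k" using R0 by (simp add: B_def divide_right_mono mult_right_mono)
      finally show ?thesis by simp
    qed
    then have "(\<lambda>k. ?u (Suc k) t - solution_map \<mu> u0 u t) \<longlonglongrightarrow> 0"
      by (intro Lim_null_comparison[OF always_eventually B_lim[of t]] allI)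
    then have "(\<lambda>k. ?u (Suc k) t) \<longlonglongrightarrow> solution_map \<mu> u0 u t" by (rule LIM_zero_cancel)
    moreover have "(\<lambda>k. ?u (Suc k) t) \<longlonglongrightarrow> u t" by (rule LIMSEQ_Suc[OF u])
    ultimately show ?thesis by (rule LIMSEQ_unique[rotated])
  qed
  moreover have "energy Q UNIV u \<le> ennreal A"
    by (rule energy_le_of_tendsto[OF continuous_picard u conjunct2[OF inv]])
  ultimately show ?thesis using cu by blast
qed

section \<open>Scattering\<close>

lemma energy_tail:
  assumes u: "continuous_on UNIV u" and fin: "energy Q UNIV u < \<infinity>" and A: "0 < A"
  shows "\<exists>S. \<forall>a b. S \<le> a \<longrightarrow> energy Q {a..b} u \<le> ennreal A"
proof -
  have [measurable]: "u \<in> borel_measurable borel" by (rule measurable_of_continuous[OF u])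
  have int: "integrable lborel (\<lambda>t. pmass Q (u t))"
    using fin Q_bounds by (intro integrableI_nonneg) (auto simp: energy_def)
  let ?F = "\<lambda>y. \<integral>t. indicator {..y} t *\<^sub>R pmass Q (u t) \<partial>lborel"
  let ?I = "\<integral>t. pmass Q (u t) \<partial>lborel"
  have "(?F \<longlongrightarrow> ?I) at_top" by (rule tendsto_integral_at_top[OF sets_lborel int])
  then have "\<forall>\<^sub>F y in at_top. ?I - A < ?F y" by (rule order_tendstoD(1)) (use A in simp)
  then obtain S where S: "?I - A < ?F S" unfolding eventually_at_top_linorder by blast
  have int1: "integrable lborel (\<lambda>t. indicator {..S} t *\<^sub>R pmass Q (u t))"
    by (rule integrable_mult_indicator[OF _ int]) simp
  have "energy Q {a..b} u \<le> ennreal A" if a: "S \<le> a" for a b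
  proof -
    have "energy Q {a..b} u \<le> (\<integral>\<^sup>+t. ennreal (pmass Q (u t) - indicator {..S} t *\<^sub>R pmass Q (u t)) \<partial>lborel)"
      unfolding energy_def
    proof (rule nn_integral_mono_AE, rule eventually_mono[OF AE_lborel_singleton[of S]])
      fix t assume "t \<noteq> S"
      then show "ennreal (pmass Q (u t)) * indicator {a..b} t \<le> ennreal (pmass Q (u t) - indicator {..S} t *\<^sub>R pmass Q (u t))"
        using a by (auto simp: indicator_def)
    qed
    also have "\<dots> = ennreal (\<integral>t. pmass Q (u t) - indicator {..S} t *\<^sub>R pmass Q (u t) \<partial>lborel)"
      using Q_bounds by (intro nn_integral_eq_integral Bochner_Integration.integrable_diff int int1) (auto simp: indicator_def)
    also have "(\<integral>t. pmass Q (u t) - indicator {..S} t *\<^sub>R pmass Q (u t) \<partial>lborel) = ?I - ?F S"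
      by (rule Bochner_Integration.integral_diff[OF int int1])
    also have "ennreal (?I - ?F S) \<le> ennreal A" using S by (intro ennreal_leI) simp
    finally show ?thesis .
  qed
  then show ?thesis by blast
qed

lemma scattering_at_top:
  assumes u: "continuous_on UNIV u" "\<And>t. u t = solution_map \<mu> u0 u t" and fin: "energy Q UNIV u < \<infinity>"
  shows "\<exists>u_plus. ((\<lambda>t. norm (u t - U t u_plus)) \<longlongrightarrow> 0) at_top"
proof -
  have "\<exists>l. (duhamel u \<longlongrightarrow> l) at_top"
  proof (rule convergent_at_top)
    fix e :: real assume e: "0 < e"
    \<comment> \<open>The inverse of the dual estimate: mass at most \<open>A\<close> on an interval
      forces the Duhamel increment over it to be at most \<open>e\<close>.\<close>
    define A where "A = (e / dual_const) powr (Q / (Q - 1))"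
    have A: "0 < A" using e dual_const_pos by (simp add: A_def)
    have Ae: "dual_const * A powr ((Q - 1) / Q) = e"
      using e dual_const_pos Q4 by (simp add: A_def powr_powr)
    obtain S where S: "\<forall>a b. S \<le> a \<longrightarrow> energy Q {a..b} u \<le> ennreal A" using energy_tail[OF u(1) fin A] by blast
    have "norm (duhamel u t - duhamel u s) \<le> e" if "S \<le> s" "s \<le> t" for s t
      unfolding duhamel_diff[OF u(1)] Ae[symmetric]
      by (rule dual_strichartz[OF u(1) that(2) A S[rule_format, OF that(1)]])
    then show "\<exists>S. \<forall>s t. S \<le> s \<longrightarrow> s \<le> t \<longrightarrow> norm (duhamel u t - duhamel u s) \<le> e" by blast
  qed
  then obtain l where l: "(duhamel u \<longlongrightarrow> l) at_top" by blast
  let ?c = "\<i> * complex_of_real \<mu>"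
  have eq: "norm (u t - U t (u0 - ?c *\<^sub>C l)) = \<bar>\<mu>\<bar> * norm (duhamel u t - l)" for t
  proof -
    have "u t - U t (u0 - ?c *\<^sub>C l) = U t (?c *\<^sub>C (l - duhamel u t))"
      unfolding u(2)[of t] solution_map_def U_diff[symmetric]
      by (rule arg_cong[where f = "U t"]) (rule ell2_eqI, simp add: coord_simps algebra_simps)
    then show ?thesis by (simp add: norm_scaleC norm_mult norm_minus_commute)
  qed
  have "((\<lambda>t. \<bar>\<mu>\<bar> * norm (duhamel u t - l)) \<longlongrightarrow> \<bar>\<mu>\<bar> * norm (l - l)) at_top" by (intro tendsto_intros l)
  then have "((\<lambda>t. norm (u t - U t (u0 - ?c *\<^sub>C l))) \<longlongrightarrow> 0) at_top" unfolding eq by simp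
  then show ?thesis by blast
qed

lemma reflected: "dispersive_group (\<lambda>t. U (- t)) Q"
proof
  have "continuous_on UNIV (\<lambda>t. U (- t) x)" for x by (intro continuous_on_U continuous_intros)
  moreover have "unitary_op (U t)" for t using group by (simp add: unitary_group_def)
  ultimately show "unitary_group (\<lambda>t. U (- t))" by (simp add: unitary_group_def U_comp)
  show "cmod (coord (U (- t) (basis m)) n) \<le> \<bar>t\<bar> powr - (2 / (Q - 2))" if "t \<noteq> 0" for t m n
    using decay[of "- t" m n] that by simp
qed (rule Q4)

text \<open>Time reversal: \<open>u (- t)\<close> solves the equation for the reversed group with
  coefficient \<open>- \<mu>\<close>, so its behaviour at plus infinity is the behaviour of
  \<open>u\<close> at minus infinity.\<close>

lemma scattering_at_bot:
  assumes u: "continuous_on UNIV u" "\<And>t. u t = solution_map \<mu> u0 u t" and fin: "energy Q UNIV u < \<infinity>"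
  shows "\<exists>u_minus. ((\<lambda>t. norm (u t - U t u_minus)) \<longlongrightarrow> 0) at_bot"
proof -
  interpret refl: dispersive_group "\<lambda>t. U (- t)" Q by (rule reflected)
  define v where "v t = u (- t)" for t
  have v: "continuous_on UNIV v"
    unfolding v_def by (intro continuous_on_compose2[OF u(1)] continuous_intros) simp
  have d: "refl.duhamel v t = - duhamel u (- t)" for t
  proof -
    have "duhamel u (- t) = (LBINT s=- ereal (- t)..- ereal 0. phase u (- s))"
      unfolding duhamel_def by (rule interval_integral_reflect)
    also have "\<dots> = - (LBINT s=ereal 0..ereal t. phase u (- s))"
      by (subst interval_integral_endpoints_reverse) (simp add: zero_ereal_def[symmetric])
    finally show ?thesis unfolding refl.duhamel_def by (simp add: v_def)
  qed
  have "v t = refl.solution_map (- \<mu>) u0 v t" for t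
  proof -
    have "u0 - (\<i> * complex_of_real \<mu>) *\<^sub>C duhamel u (- t) = u0 - (\<i> * complex_of_real (- \<mu>)) *\<^sub>C refl.duhamel v t"
      unfolding d by (rule ell2_eqI) (simp add: coord_simps)
    then show ?thesis unfolding v_def u(2)[of "- t"] solution_map_def refl.solution_map_def by (simp only: v_def[symmetric])
  qed
  moreover have "energy Q UNIV v < \<infinity>"
  proof -
    have [measurable]: "u \<in> borel_measurable borel" by (rule measurable_of_continuous[OF u(1)])
    have "energy Q UNIV v = energy Q UNIV u"
      using nn_integral_real_affine[of "\<lambda>t. ennreal (pmass Q (u t))" "- 1" 0] by (simp add: energy_def v_def)
    then show ?thesis using fin by simp
  qed
  ultimately obtain w where "((\<lambda>t. norm (v t - U (- t) w)) \<longlongrightarrow> 0) at_top"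
    using refl.scattering_at_top[OF v] by blast
  then have "((\<lambda>t. norm (u t - U t w)) \<longlongrightarrow> 0) at_bot"
    unfolding filterlim_at_bot_mirror v_def .
  then show ?thesis by blast
qed

text \<open>The threshold is chosen before the group \<open>V\<close>, although the statement lives
  inside the locale of one group. This is possible because the bodies of \<open>dual_const\<close>
  and \<open>ret_const\<close> mention \<open>Q\<close> only, so the constants agree for every group
  with that exponent.\<close>

lemma small_data_solution:
  assumes \<mu>0: "0 \<le> \<mu>0"
  shows "\<exists>\<epsilon>>0. \<forall>V \<mu> u0. dispersive_group V Q \<longrightarrow> \<bar>\<mu>\<bar> \<le> \<mu>0 \<longrightarrow> norm u0 \<le> \<epsilon> \<longrightarrow>
    (\<exists>u. continuous_on UNIV u \<and> energy Q UNIV u < \<infinity> \<and> (\<forall>t. u t = dispersive_group.solution_map V Q \<mu> u0 u t))"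
proof -
  \<comment> \<open>The added 1 keeps \<open>b\<close> positive when the bound on the coefficient is
    0.\<close>
  define b where "b = 2 powr Q * ((\<mu>0 powr Q + 1) * ret_const)"
  have b: "0 < b" using ret_const_pos by (simp add: b_def add_nonneg_pos)
  \<comment> \<open>Solves \<open>b A^(Q-2) = 1/2\<close>, so that the nonlinear part of the energy
    bound uses half of \<open>A\<close>.\<close>
  define A where "A = (1 / (2 * b)) powr (1 / (Q - 2))"
  have A: "0 < A" using b by (simp add: A_def)
  have "A powr (Q - 2) = 1 / (2 * b)" using b Q4 by (simp add: A_def powr_powr)
  then have AQ: "A powr (Q - 1) = A / (2 * b)" using A powr_add[of A 1 "Q - 2"] by simp
  \<comment> \<open>Gives the linear part of the energy bound the other half of
    \<open>A\<close>.\<close>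
  define \<epsilon> where "\<epsilon> = (A / (2 * 2 powr Q)) powr (1 / Q) / dual_const"
  have \<epsilon>: "0 < \<epsilon>" using A dual_const_pos by (simp add: \<epsilon>_def)
  have \<epsilon>Q: "(dual_const * \<epsilon>) powr Q = A / (2 * 2 powr Q)"
    using A dual_const_pos Q4 by (simp add: \<epsilon>_def powr_powr)
  show ?thesis
  proof (intro exI[of _ \<epsilon>] conjI allI impI \<epsilon>)
    fix V \<mu> and u0 :: ell2
    assume V: "dispersive_group V Q" and \<mu>: "\<bar>\<mu>\<bar> \<le> \<mu>0" and u0: "norm u0 \<le> \<epsilon>"
    interpret V: dispersive_group V Q by (rule V)
    have "2 powr Q * ((dual_const * norm u0) powr Q + \<bar>\<mu>\<bar> powr Q * (ret_const * A powr (Q - 1)))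
        \<le> 2 powr Q * (A / (2 * 2 powr Q) + (\<mu>0 powr Q + 1) * (ret_const * A powr (Q - 1)))"
    proof (intro mult_left_mono add_mono mult_right_mono)
      have "dual_const * norm u0 \<le> dual_const * \<epsilon>" using dual_const_pos u0 by (intro mult_left_mono) auto
      then have "(dual_const * norm u0) powr Q \<le> (dual_const * \<epsilon>) powr Q"
        using dual_const_pos Q4 by (intro powr_mono2) auto
      then show "(dual_const * norm u0) powr Q \<le> A / (2 * 2 powr Q)" unfolding \<epsilon>Q .
      have "\<bar>\<mu>\<bar> powr Q \<le> \<mu>0 powr Q" using \<mu> Q4 by (intro powr_mono2) auto
      then show "\<bar>\<mu>\<bar> powr Q \<le> \<mu>0 powr Q + 1" by simp
    qed (use ret_const_pos in auto)
    also have "\<dots> = A / 2 + b * A powr (Q - 1)" by (simp add: b_def distrib_left)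
    also have "\<dots> = A" unfolding AQ using b by simp
    finally have "\<exists>u. continuous_on UNIV u \<and> energy Q UNIV u \<le> ennreal A \<and> (\<forall>t. u t = V.solution_map \<mu> u0 u t)"
      by (intro V.solution_exists A)
    then show "\<exists>u. continuous_on UNIV u \<and> energy Q UNIV u < \<infinity> \<and> (\<forall>t. u t = V.solution_map \<mu> u0 u t)"
      by (elim exE conjE) (intro exI conjI, assumption, erule le_less_trans, simp, assumption)
  qed
qed

lemma LqLr_iff:
  assumes u: "continuous_on UNIV u"
  shows "(\<lambda>t. coord (u t)) \<in> LqLr Q Q \<longleftrightarrow> energy Q UNIV u < \<infinity>"
proof -
  have [measurable]: "u \<in> borel_measurable borel" by (rule measurable_of_continuous[OF u])
  have "lr_norm Q (coord (u t)) powr Q = pmass Q (u t)" for t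
    using Q4 pmass_nonneg[OF Q_bounds(2), of "u t"] by (simp add: lr_norm_def pmass_def[symmetric] powr_powr)
  moreover have "integrable lborel (\<lambda>t. pmass Q (u t)) \<longleftrightarrow> energy Q UNIV u < \<infinity>"
    using Q_bounds by (simp add: integrable_iff_bounded energy_def)
  moreover have "(\<lambda>t. coord (u t) n) \<in> borel_measurable lborel" for n by measurable
  ultimately show ?thesis by (simp add: LqLr_def summable_pmass[OF Q_bounds(2)])
qed

lemma U_duhamel:
  assumes u: "continuous_on UNIV u"
  shows "interval_lebesgue_integrable lborel (ereal 0) (ereal t) (\<lambda>s. U (t - s) (nl (u s)))"
    and "(LBINT s=ereal 0..ereal t. U (t - s) (nl (u s))) = U t (duhamel u t)"
proof -
  show "interval_lebesgue_integrable lborel (ereal 0) (ereal t) (\<lambda>s. U (t - s) (nl (u s)))"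
    by (intro interval_integrable_continuous continuous_on_U continuous_on_nl Q_bounds continuous_intros u)
  have "(LBINT s=ereal 0..ereal t. U t (phase u s)) = U t (duhamel u t)"
    unfolding duhamel_def by (rule interval_integral_bounded_linear[OF bounded_linear_U phase_integrable[OF u]])
  then show "(LBINT s=ereal 0..ereal t. U (t - s) (nl (u s))) = U t (duhamel u t)" by (simp add: U_comp)
qed

end

section \<open>The Laguerre group\<close>

lemma laguerre_decay:
  assumes "-1 < \<alpha>"
  shows "unitary_group (laguerre_group \<alpha>)"
    "t \<noteq> 0 \<Longrightarrow> cmod (coord (laguerre_group \<alpha> t (basis m)) n) \<le> \<bar>t\<bar> powr (- sigma \<alpha>)"
  using laguerre_group_kernel[OF assms] lag_kernel_dispersive[OF assms] by auto

lemma dispersive_laguerre: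
  assumes "-1 < \<alpha>" shows "dispersive_group (laguerre_group \<alpha>) (Q_crit \<alpha>)"
proof
  have s: "0 < sigma \<alpha>" "sigma \<alpha> \<le> 1" using assms by (auto simp: sigma_def)
  show "unitary_group (laguerre_group \<alpha>)" by (rule laguerre_decay[OF assms])
  have "2 \<le> 2 / sigma \<alpha>" using s by (simp add: pos_le_divide_eq)
  then show "4 \<le> Q_crit \<alpha>" by (simp add: Q_crit_def p_crit_def)
  have "2 / (Q_crit \<alpha> - 2) = sigma \<alpha>" using s by (simp add: Q_crit_def p_crit_def)
  then show "cmod (coord (laguerre_group \<alpha> t (basis m)) n) \<le> \<bar>t\<bar> powr (- (2 / (Q_crit \<alpha> - 2)))" if "t \<noteq> 0" for t m n
    using laguerre_decay(2)[OF assms that, of m n] by (simp only:)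
qed

lemma global_solution_iff:
  assumes "-1 < \<alpha>"
  shows "global_solution \<alpha> \<mu> u0 u \<longleftrightarrow> continuous_on UNIV u \<and> energy (Q_crit \<alpha>) UNIV u < \<infinity> \<and>
    (\<forall>t. u t = dispersive_group.solution_map (laguerre_group \<alpha>) (Q_crit \<alpha>) \<mu> u0 u t)"
proof -
  interpret dispersive_group "laguerre_group \<alpha>" "Q_crit \<alpha>" by (rule dispersive_laguerre[OF assms])
  have p: "p_crit \<alpha> = Q_crit \<alpha> - 1" by (simp add: Q_crit_def)
  have "mild_solution \<alpha> \<mu> (p_crit \<alpha>) u0 u \<longleftrightarrow> (\<forall>t. u t = solution_map \<mu> u0 u t)" if u: "continuous_on UNIV u"
    unfolding mild_solution_def p solution_map_def U_diff U_scaleC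
    by (simp only: U_duhamel[OF u] simp_thms)
  then show ?thesis unfolding global_solution_def using LqLr_iff by blast
qed

text \<open>The parameter enters the constants only through \<open>sigma\<close>, hence through
  \<open>Q\<close>. Allowing every \<beta> with the same \<open>sigma\<close> lets one statement
  yield both halves of the theorem.\<close>

lemma small_data_scattering:
  assumes \<alpha>: "-1 < \<alpha>" and \<mu>0: "0 \<le> \<mu>0"
  shows "\<exists>\<epsilon>>0. \<forall>\<beta>>-1. sigma \<beta> = sigma \<alpha> \<longrightarrow> (\<forall>\<mu> u0. \<bar>\<mu>\<bar> \<le> \<mu>0 \<longrightarrow> norm u0 \<le> \<epsilon> \<longrightarrow>
    (\<exists>!u. global_solution \<beta> \<mu> u0 u) \<and> (\<forall>u. global_solution \<beta> \<mu> u0 u \<longrightarrow> scatters \<beta> u))"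
proof -
  obtain \<epsilon> where \<epsilon>: "0 < \<epsilon>" and ex: "\<forall>V \<mu> u0. dispersive_group V (Q_crit \<alpha>) \<longrightarrow> \<bar>\<mu>\<bar> \<le> \<mu>0 \<longrightarrow> norm u0 \<le> \<epsilon> \<longrightarrow>
    (\<exists>u. continuous_on UNIV u \<and> energy (Q_crit \<alpha>) UNIV u < \<infinity> \<and> (\<forall>t. u t = dispersive_group.solution_map V (Q_crit \<alpha>) \<mu> u0 u t))"
    using dispersive_group.small_data_solution[OF dispersive_laguerre[OF \<alpha>] \<mu>0] by (elim exE conjE)
  show ?thesis
  proof (rule exI[of _ \<epsilon>], rule conjI[OF \<epsilon>], intro allI impI)
    fix \<beta> \<mu> :: real and u0 :: ell2
    assume \<beta>: "-1 < \<beta>" and s: "sigma \<beta> = sigma \<alpha>" and \<mu>: "\<bar>\<mu>\<bar> \<le> \<mu>0" and u0: "norm u0 \<le> \<epsilon>"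
    have Q: "Q_crit \<beta> = Q_crit \<alpha>" by (simp add: Q_crit_def p_crit_def s)
    interpret dispersive_group "laguerre_group \<beta>" "Q_crit \<beta>" by (rule dispersive_laguerre[OF \<beta>])
    have "\<exists>u. global_solution \<beta> \<mu> u0 u"
      unfolding global_solution_iff[OF \<beta>]
      using ex[rule_format, OF dispersive_laguerre[OF \<beta>, unfolded Q] \<mu> u0] unfolding Q .
    moreover have "u = v" if "global_solution \<beta> \<mu> u0 u" "global_solution \<beta> \<mu> u0 v" for u v
      using that unfolding global_solution_iff[OF \<beta>] by (elim conjE) (rule solution_map_unique[of u \<mu> u0 v]; simp)
    moreover have "scatters \<beta> u" if "global_solution \<beta> \<mu> u0 u" for u
    proof -
      from that have u: "continuous_on UNIV u" "\<And>t. u t = solution_map \<mu> u0 u t" "energy (Q_crit \<beta>) UNIV u < \<infinity>"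
        unfolding global_solution_iff[OF \<beta>] by blast+
      show ?thesis
        unfolding scatters_def using scattering_at_top[OF u] scattering_at_bot[OF u] by blast
    qed
    ultimately show "(\<exists>!u. global_solution \<beta> \<mu> u0 u) \<and> (\<forall>u. global_solution \<beta> \<mu> u0 u \<longrightarrow> scatters \<beta> u)" by blast
  qed
qed

theorem corollary12p2:
  shows "(\<forall>\<alpha> > -1. \<forall>\<mu>. \<exists>\<epsilon> > 0. \<forall>u0. norm u0 \<le> \<epsilon> \<longrightarrow>
            (\<exists>!u. global_solution \<alpha> \<mu> u0 u) \<and>
            (\<forall>u. global_solution \<alpha> \<mu> u0 u \<longrightarrow> scatters \<alpha> u))
       \<and> (\<forall>\<mu>0 \<ge> 0. \<exists>\<epsilon> > 0. \<forall>\<alpha> \<ge> 0. \<forall>\<mu>. \<bar>\<mu>\<bar> \<le> \<mu>0 \<longrightarrow> (\<forall>u0. norm u0 \<le> \<epsilon> \<longrightarrow>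
            (\<exists>!u. global_solution \<alpha> \<mu> u0 u) \<and>
            (\<forall>u. global_solution \<alpha> \<mu> u0 u \<longrightarrow> scatters \<alpha> u)))"
proof (intro conjI allI impI)
  fix \<alpha> \<mu> :: real assume \<alpha>: "-1 < \<alpha>"
  show "\<exists>\<epsilon> > 0. \<forall>u0. norm u0 \<le> \<epsilon> \<longrightarrow>
      (\<exists>!u. global_solution \<alpha> \<mu> u0 u) \<and> (\<forall>u. global_solution \<alpha> \<mu> u0 u \<longrightarrow> scatters \<alpha> u)"
    using small_data_scattering[OF \<alpha> abs_ge_zero[of \<mu>]] \<alpha> by (elim exE conjE) (rule exI, rule conjI, assumption, blast)
next
  fix \<mu>0 :: real assume \<mu>0: "0 \<le> \<mu>0"
  \<comment> \<open>Every nonnegative parameter has the same \<open>sigma\<close> as 0, so the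
    threshold found at 0 serves all of them.\<close>
  obtain \<epsilon> where \<epsilon>: "0 < \<epsilon>" and *: "\<forall>\<beta>>-1. sigma \<beta> = sigma 0 \<longrightarrow> (\<forall>\<mu> u0. \<bar>\<mu>\<bar> \<le> \<mu>0 \<longrightarrow> norm u0 \<le> \<epsilon> \<longrightarrow>
      (\<exists>!u. global_solution \<beta> \<mu> u0 u) \<and> (\<forall>u. global_solution \<beta> \<mu> u0 u \<longrightarrow> scatters \<beta> u))"
    using small_data_scattering[of 0, OF _ \<mu>0] by auto
  show "\<exists>\<epsilon> > 0. \<forall>\<alpha> \<ge> 0. \<forall>\<mu>. \<bar>\<mu>\<bar> \<le> \<mu>0 \<longrightarrow> (\<forall>u0. norm u0 \<le> \<epsilon> \<longrightarrow>
      (\<exists>!u. global_solution \<alpha> \<mu> u0 u) \<and> (\<forall>u. global_solution \<alpha> \<mu> u0 u \<longrightarrow> scatters \<alpha> u))"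
  proof (rule exI[of _ \<epsilon>], rule conjI[OF \<epsilon>], intro allI impI)
    fix \<alpha> \<mu> :: real and u0 :: ell2
    assume \<alpha>: "0 \<le> \<alpha>" and \<mu>: "\<bar>\<mu>\<bar> \<le> \<mu>0" and u0: "norm u0 \<le> \<epsilon>"
    have "-1 < \<alpha>" "sigma \<alpha> = sigma 0" using \<alpha> by (simp_all add: sigma_def)
    from *[rule_format, OF this \<mu> u0]
    show "(\<exists>!u. global_solution \<alpha> \<mu> u0 u) \<and> (\<forall>u. global_solution \<alpha> \<mu> u0 u \<longrightarrow> scatters \<alpha> u)" .
  qed
qed

end
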